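(* (Total correctness of $ST$.) Let $S$ be a (well-formed) signature of the calculus $\mathrm{EMF}^\star$ containing the state effect $ST$ with state type $s$, and let $e$ be a closed term with $S;\cdot\vdash e:ST\,t\,wp$. Then for all $p$ and $s_0$ such that $S;\cdot\vdash s_0:s$, $S;\cdot\vdash p:t\times s\to\mathsf{Type}_0$ and $S;\cdot\models wp\,s_0\,p$, there is a value $v$ such that $S\vdash\mathsf{run}\,((\mathsf{reify}\,e)\,s_0)\longrightarrow^{*}v$ and $S;\cdot\models p\,v$.
   Context: **The state effect.** The effect $ST$ in $S$ has $wp\_type=\lambda a.\,s\to(a\times s\to\mathsf{Type}_0)\to\mathsf{Type}_0$ and $repr=\lambda a\,w.\,(s_0{:}s\to\mathsf{Pure}\,(a\times s)\,(w\,s_0))$, with the usual state-passing $\underline{return}$, $\underline{bind}$, and actions get and put, and $return^\star=\lambda a\,x\,s_0\,p.\,p\,(x,s_0)$, $bind^\star=\lambda a\,b\,f\,g\,s_0\,p.\,f\,s_0\,(\lambda (x,s_1).\,g\,x\,s_1\,p)$, get: WP $\lambda s_0\,p.\,p\,(s_0,s_0)$, put $x$: WP $\lambda s_0\,p.\,p\,((),x)$. **Syntax of $\mathrm{EMF}^\star$.** Expressions $e$, types $t$, predicate transformers $wp$ and formulas $\phi$ are all terms: $e,t,wp,\phi ::= x \mid T \mid x{:}t\{\phi\}$ (refinement type) $\mid \lambda x{:}t.e \mid x{:}t\to c$ (dependent product) $\mid e_1\,e_2 \mid \mathsf{case}_t(e\ \mathsf{as}\ y)\,x.e_1\,x.e_2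 \mid \mathsf{run}\,e\mid \mathsf{reify}\,e\mid\mathsf{reflect}\,e\mid M.\mathsf{lift}_{M'}\,t\,wp\,e\mid F.\mathsf{act}\,\bar e\mid M.\mathsf{return}\,t\,e\mid M.\mathsf{bind}\,t_1\,t_2\,wp_1\,e_1\,wp_2\,x.e_2$. Constants $T$ include universes $\mathsf{Type}_i$ ($i\in\mathbb N$, predicative, non-cumulative), unit, non-dependent pairs ($\times$, pairing, $\mathsf{fst},\mathsf{snd}$) and disjoint sums ($+,\mathsf{inl},\mathsf{inr}$). Computation types: $c::=\mathsf{Tot}\,t\mid M\,t\,wp$. Throughout, $M$ (and $M'$) ranges over $\mathsf{Pure}$ and the user-defined effects $F$. $t\to t'$ abbreviates $t\to\mathsf{Tot}\,t'$, and $e:t$ abbreviates $e:\mathsf{Tot}\,t$. Values $v$ are fully evaluated (irreducible) terms. **Signatures.** $S$ is a list of effect definitions $D$ and lifts $L$. A definition $D$ of an effect $F$ is a record with fields $repr$ (the type of an $F$ computation reified as a pure term), $wp\_type$, $\underline{return}$, $return^\star$, $\underline{bind}$, $bind^\star$, and for each action $\underline{act}_j$ and its type $act_j^\star=\overline{x_j{:}t_j}\to c_j$. A lift is a pair of a term $\underline{M.lift}_{M'}$ and a predicate-transformer map $M.lift^\star_{M'}$. $S.F.field$ denotes lookup. $S$ always contains, for $\mathsf{Pure}$: $wp\_type=\lambda a{:}\mathsf{Type}_0.(a\to\mathsf{Type}_0)\to\mathsf{Type}_0$, $return^\star=\lambda a.\lambda x{:}a.\lambda p.\,p\,x$, $bind^\star=\lambda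 a\,b\,w_1\,w_2\,p.\,w_1(\lambda x.(w_2\,x)\,p)$ (no other fields, since $\mathsf{Pure}$ is handled primitively). $S$ is well formed if the fields of its definitions and its lifts are well typed as per their corresponding WPs, where each effect definition may use previously defined effects. For a user-defined effect this means: $\underline{return}: a{:}\mathsf{Type}_0\to x{:}a\to repr\,a\,(return^\star\,a\,x)$; $\underline{bind}: a\to b\to w_1{:}wp\_type\,a\to repr\,a\,w_1\to w_2{:}(a\to wp\_type\,b)\to(x{:}a\to repr\,b\,(w_2\,x))\to repr\,b\,(bind^\star\,a\,b\,w_1\,w_2)$; $\underline{act}_j:\overline{x_j{:}t_j}\to repr\,t\,wp$ when $c_j=F\,t\,wp$. A lift term $\underline{M.lift}_{M'}$ takes a type $a$, a $w{:}S.M.wp\_type\,a$ and the representation of an $M$ computation with result type $a$ and specification $w$ to the representation of an $M'$ computation with result type $a$ and specification $M.lift^\star_{M'}\,w$ (type argument of $lift^\star$ implicit). **Typing $S;\Gamma\vdash e:c$** ($\Gamma$ a list of bindings $x{:}t$; $\cdot$ is the empty list). Standard rules for variables, constants, universes ($\mathsf{Type}_i:\mathsf{Type}_{i+1}$), products (with universe the maximum), abstraction ($\lambda x{:}t.e:x{:}t\to c$ if $\Gamma,x{:}t\vdash e:c$), application ($e_1e_2:c[e_2/x]$ if $e_1:x{:}t\to c$ and $e_2:t$), pairs, sums, and dependent case analysis; case analysis whose branches are $M\,t\,wp_1$ and $M\,t\,wp_2$ computations (non-dependent $t$) has type $M\,t\,(\mathsf{case}(e)\,x.wp_1\,x.wp_2)$.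 Also: - T-Return: $e:\mathsf{Tot}\,t$ gives $M.\mathsf{return}\,t\,e:M\,t\,(S.M.return^\star\,t\,e)$. - T-Bind: $t_2:\mathsf{Type}_0$, $wp_2:x{:}t_1\to S.M.wp\_type\,t_2$, $e_1:M\,t_1\,wp_1$ and $\Gamma,x{:}t_1\vdash e_2:M\,t_2\,(wp_2\,x)$ give $M.\mathsf{bind}\,t_1\,t_2\,wp_1\,e_1\,wp_2\,x.e_2:M\,t_2\,(S.M.bind^\star\,t_1\,t_2\,wp_1\,wp_2)$. - T-Lift: $e:M\,t\,wp$ gives $M.\mathsf{lift}_{M'}\,t\,wp\,e:M'\,t\,(S.M.lift^\star_{M'}\,wp)$. - T-Act: if $S.F.act^\star=\overline{x{:}t}\to c$ and each $e_i:t_i$, then $F.\mathsf{act}\,\bar e:c[\bar e/\bar x]$. - T-Reify: $e:F\,t\,wp$ gives $\mathsf{reify}\,e:\mathsf{Tot}(S.F.repr\,t\,wp)$. T-Reflect: the converse, $e:\mathsf{Tot}(S.F.repr\,t\,wp)$ gives $\mathsf{reflect}\,e:F\,t\,wp$. - T-Run: $e:\mathsf{Pure}\,t\,wp$ and $S;\Gamma\models\exists p.\,wp\,p$ give $\mathsf{run}\,e:\mathsf{Tot}\,t$. - T-Refine: $t:\mathsf{Type}_i$ and $\Gamma,x{:}t\vdash\phi:\mathsf{Type}_j$ give $x{:}t\{\phi\}:\mathsf{Type}_i$. - C-Pure: $t:\mathsf{Type}_0$, $wp:(t\to\mathsf{Type}_0)\to\mathsf{Type}_0$ give $\mathsf{Pure}\,t\,wp:\mathsf{Type}_0$.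 C-F: $S.F.repr\,t\,wp:\mathsf{Type}_0$ gives $F\,t\,wp:\mathsf{Type}_0$. - T-Sub: $e:c'$ and $c'<:c$ give $e:c$. **Subtyping $S;\Gamma\vdash c'<:c$ and $t'<:t$** (a preorder): $\mathsf{Tot}\,t'<:\mathsf{Tot}\,t$ if $t'<:t$; $\mathsf{Pure}\,t'\,wp'<:\mathsf{Pure}\,t\,wp$ if $t'<:t$ and $S;\Gamma\models\forall p.\,wp\,p\Rightarrow wp'\,p$; $F\,t'\,wp'<:F\,t\,wp$ if $S.F.repr\,t'\,wp'<:S.F.repr\,t\,wp$; $x{:}t'\to c'<:x{:}t\to c$ if $t<:t'$ and $\Gamma,x{:}t\vdash c'<:c$; $x{:}t\{\phi\}<:t$; $t<:x{:}t\{\phi\}$ if $\Gamma,x{:}t\models\phi$; $t'<:t$ if $t'\longrightarrow^*t$ or $t\longrightarrow^*t'$. **Validity $S;\Gamma\models\phi$** is entailment of a proof-irrelevant classical higher-order logic, with squashed connectives (e.g. $p\wedge q$ is $x{:}\mathsf{unit}\{p\times q\}$, $p\Rightarrow q$ is $x{:}\mathsf{unit}\{p\to q\}$, in $\mathsf{Type}_0$): usual rules for hypotheses from $\Gamma$, the connectives and quantifiers, equality (reflexive, substitutive, containing reduction, extensional on functions), and case analysis on sums. **Reduction $S\vdash e\longrightarrow e'$** is the closure under evaluation contexts $E::=\bullet\mid\lambda x{:}t.E\mid E\,e\mid e\,E\mid\mathsf{run}\,E\mid\mathsf{reify}\,E\mid\mathsf{reflect}\,E\mid M.\mathsf{bind}\,t_1\,t_2\,wp_1\,E\,wp_2\,x.e_2\mid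 M.\mathsf{return}\,t\,E\mid M.\mathsf{lift}_{M'}\,t\,wp\,E\mid F.\mathsf{act}\,\bar e\,E\,\bar e'$ and case with $E$ in the scrutinee or either branch, of: $(\lambda x{:}t.e)\,e'\to e[e'/x]$; the usual rules for $\mathsf{fst},\mathsf{snd}$, case; $\mathsf{run}(\mathsf{Pure}.\mathsf{return}\,t\,e)\to e$; $\mathsf{Pure}.\mathsf{bind}\,t_1\,t_2\,wp_1\,(\mathsf{Pure}.\mathsf{return}\,t\,e_1)\,wp_2\,x.e_2\to e_2[e_1/x]$; $\mathsf{reify}(\mathsf{reflect}\,e)\to e$; $\mathsf{reify}(F.\mathsf{return}\,t\,e)\to S.F.\underline{return}\,t\,e$; $\mathsf{reify}(F.\mathsf{bind}\,t_1\,t_2\,wp_1\,e_1\,wp_2\,x.e_2)\to S.F.\underline{bind}\,t_1\,t_2\,wp_1\,(\mathsf{reify}\,e_1)\,wp_2\,(\lambda x{:}t_1.\mathsf{reify}\,e_2)$; $\mathsf{reify}(F.\mathsf{act}\,\bar e)\to S.F.\underline{act}\,\bar e$; $\mathsf{reify}(M.\mathsf{lift}_{M'}\,t\,wp\,e)\to S.\underline{M.lift}_{M'}\,t\,wp\,(\mathsf{reify}\,e)$. **Standing assumption.** Strong normalization of $\mathrm{EMF}^\star$ is relative to strong normalization of the Calculus of Inductive Constructions, which is assumed.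
   Formalization: Typing/subtyping rules (e.g. T-Sub, transitivity, T-Reflect) also require the types involved to be well formed; lifts into Pure are excluded, a lift from Pure receives a thunk instead of reify e, and actions of F have type F t wp. *)

theory Defs
  imports Main
begin

section \<open>Terms of EMF*\<close>

text \<open>
  Terms are in de Bruijn form. The binders are the second argument of \<open>Refine\<close> (the formula),
  \<open>Lam\<close> and \<open>Pi\<close>, the last argument of \<open>Bind\<close>, and the first (motive), third and fourth
  (branches) argument of \<open>Case\<close>; each binds one variable. Constants are applied with \<open>App\<close>;
  pairing, projections and injections take their type arguments explicitly. The constants
  \<open>FalsityC\<close>, \<open>ExistsC\<close> and \<open>EqualC\<close> are the logical symbols that are not obtained by squashing
  (there are no dependent pairs to squash for the existential).
\<close>

type_synonym ename = string
type_synonym aname = string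

datatype eff = Pure | Usr ename

datatype const =
    Univ nat
  | UnitC | StarC
  | ProdC | PairC | FstC | SndC
  | SumC | InlC | InrC
  | FalsityC | ExistsC | EqualC

datatype tm =
    Var nat
  | Con const
  | Refine tm tm
  | Lam tm tm
  | Pi tm comp
  | App tm tm  (infixl "\<cdot>" 100)
  | Case tm tm tm tm
  | Run tm
  | Reify tm
  | Reflect tm
  | Lift eff eff tm tm tm
  | Act ename aname "tm list"
  | Return eff tm tm
  | Bind eff tm tm tm tm tm tm
and comp =
    Tot tm
  | Comp eff tm tm

text \<open>Capture-avoiding renaming and parallel substitution.\<close>

definition upr :: "(nat \<Rightarrow> nat) \<Rightarrow> nat \<Rightarrow> nat" where
  "upr r = case_nat 0 (\<lambda>n. Suc (r n))"

primrec ren :: "(nat \<Rightarrow> nat) \<Rightarrow> tm \<Rightarrow> tm"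
  and renc :: "(nat \<Rightarrow> nat) \<Rightarrow> comp \<Rightarrow> comp" where
  "ren r (Var n) = Var (r n)"
| "ren r (Con k) = Con k"
| "ren r (Refine t \<phi>) = Refine (ren r t) (ren (upr r) \<phi>)"
| "ren r (Lam t e) = Lam (ren r t) (ren (upr r) e)"
| "ren r (Pi t c) = Pi (ren r t) (renc (upr r) c)"
| "ren r (App e1 e2) = App (ren r e1) (ren r e2)"
| "ren r (Case t e e1 e2) = Case (ren (upr r) t) (ren r e) (ren (upr r) e1) (ren (upr r) e2)"
| "ren r (Run e) = Run (ren r e)"
| "ren r (Reify e) = Reify (ren r e)"
| "ren r (Reflect e) = Reflect (ren r e)"
| "ren r (Lift M M' t wp e) = Lift M M' (ren r t) (ren r wp) (ren r e)"
| "ren r (Act F a es) = Act F a (map (ren r) es)"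
| "ren r (Return M t e) = Return M (ren r t) (ren r e)"
| "ren r (Bind M t1 t2 wp1 e1 wp2 e2) =
     Bind M (ren r t1) (ren r t2) (ren r wp1) (ren r e1) (ren r wp2) (ren (upr r) e2)"
| "renc r (Tot t) = Tot (ren r t)"
| "renc r (Comp M t wp) = Comp M (ren r t) (ren r wp)"

abbreviation sh :: "tm \<Rightarrow> tm" where
  "sh \<equiv> ren Suc"

definition scons :: "tm \<Rightarrow> (nat \<Rightarrow> tm) \<Rightarrow> nat \<Rightarrow> tm" where
  "scons e \<sigma> = case_nat e \<sigma>"

definition ups :: "(nat \<Rightarrow> tm) \<Rightarrow> nat \<Rightarrow> tm" where
  "ups \<sigma> = scons (Var 0) (\<lambda>n. sh (\<sigma> n))"

primrec sub :: "(nat \<Rightarrow> tm) \<Rightarrow> tm \<Rightarrow> tm"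
  and subc :: "(nat \<Rightarrow> tm) \<Rightarrow> comp \<Rightarrow> comp" where
  "sub \<sigma> (Var n) = \<sigma> n"
| "sub \<sigma> (Con k) = Con k"
| "sub \<sigma> (Refine t \<phi>) = Refine (sub \<sigma> t) (sub (ups \<sigma>) \<phi>)"
| "sub \<sigma> (Lam t e) = Lam (sub \<sigma> t) (sub (ups \<sigma>) e)"
| "sub \<sigma> (Pi t c) = Pi (sub \<sigma> t) (subc (ups \<sigma>) c)"
| "sub \<sigma> (App e1 e2) = App (sub \<sigma> e1) (sub \<sigma> e2)"
| "sub \<sigma> (Case t e e1 e2) =
     Case (sub (ups \<sigma>) t) (sub \<sigma> e) (sub (ups \<sigma>) e1) (sub (ups \<sigma>) e2)"
| "sub \<sigma> (Run e) = Run (sub \<sigma> e)"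
| "sub \<sigma> (Reify e) = Reify (sub \<sigma> e)"
| "sub \<sigma> (Reflect e) = Reflect (sub \<sigma> e)"
| "sub \<sigma> (Lift M M' t wp e) = Lift M M' (sub \<sigma> t) (sub \<sigma> wp) (sub \<sigma> e)"
| "sub \<sigma> (Act F a es) = Act F a (map (sub \<sigma>) es)"
| "sub \<sigma> (Return M t e) = Return M (sub \<sigma> t) (sub \<sigma> e)"
| "sub \<sigma> (Bind M t1 t2 wp1 e1 wp2 e2) =
     Bind M (sub \<sigma> t1) (sub \<sigma> t2) (sub \<sigma> wp1) (sub \<sigma> e1) (sub \<sigma> wp2) (sub (ups \<sigma>) e2)"
| "subc \<sigma> (Tot t) = Tot (sub \<sigma> t)"
| "subc \<sigma> (Comp M t wp) = Comp M (sub \<sigma> t) (sub \<sigma> wp)"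

definition inst :: "tm \<Rightarrow> tm \<Rightarrow> tm" where
  "inst b e = sub (scons e Var) b"

definition instc :: "comp \<Rightarrow> tm \<Rightarrow> comp" where
  "instc c e = subc (scons e Var) c"

text \<open>
  \<open>args es\<close> substitutes the arguments of an action for its telescope of parameters: the last
  argument replaces index 0.
\<close>

definition args :: "tm list \<Rightarrow> nat \<Rightarrow> tm" where
  "args es n = (if n < length es then rev es ! n else Var (n - length es))"

abbreviation apps :: "tm \<Rightarrow> tm list \<Rightarrow> tm" where
  "apps f es \<equiv> foldl App f es"

abbreviation Ty :: "nat \<Rightarrow> tm" where "Ty i \<equiv> Con (Univ i)"
abbreviation tunit :: tm where "tunit \<equiv> Con UnitC"
abbreviation tt :: tm where "tt \<equiv> Con StarC"
abbreviation arr :: "tm \<Rightarrow> tm \<Rightarrow> tm" where "arr t t' \<equiv> Pi t (Tot (sh t'))"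
abbreviation tprod :: "tm \<Rightarrow> tm \<Rightarrow> tm" where "tprod a b \<equiv> Con ProdC \<cdot> a \<cdot> b"
abbreviation tsum :: "tm \<Rightarrow> tm \<Rightarrow> tm" where "tsum a b \<equiv> Con SumC \<cdot> a \<cdot> b"
abbreviation tpair :: "tm \<Rightarrow> tm \<Rightarrow> tm \<Rightarrow> tm \<Rightarrow> tm" where
  "tpair a b x y \<equiv> Con PairC \<cdot> a \<cdot> b \<cdot> x \<cdot> y"
abbreviation tfst :: "tm \<Rightarrow> tm \<Rightarrow> tm \<Rightarrow> tm" where "tfst a b x \<equiv> Con FstC \<cdot> a \<cdot> b \<cdot> x"
abbreviation tsnd :: "tm \<Rightarrow> tm \<Rightarrow> tm \<Rightarrow> tm" where "tsnd a b x \<equiv> Con SndC \<cdot> a \<cdot> b \<cdot> x"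
abbreviation tinl :: "tm \<Rightarrow> tm \<Rightarrow> tm \<Rightarrow> tm" where "tinl a b x \<equiv> Con InlC \<cdot> a \<cdot> b \<cdot> x"
abbreviation tinr :: "tm \<Rightarrow> tm \<Rightarrow> tm \<Rightarrow> tm" where "tinr a b x \<equiv> Con InrC \<cdot> a \<cdot> b \<cdot> x"

text \<open>
  Formulas. A squashed type \<open>x:unit{\<phi>}\<close> lives in \<open>Type_0\<close> whatever the universe of \<open>\<phi>\<close>.
  \<open>FAll t \<phi>\<close> and \<open>FEx t \<phi>\<close> bind a variable in \<open>\<phi>\<close>.
\<close>

definition squash :: "tm \<Rightarrow> tm" where "squash \<phi> = Refine tunit (sh \<phi>)"
definition FConj :: "tm \<Rightarrow> tm \<Rightarrow> tm" where "FConj p q = squash (tprod p q)"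
definition FDisj :: "tm \<Rightarrow> tm \<Rightarrow> tm" where "FDisj p q = squash (tsum p q)"
definition FImp :: "tm \<Rightarrow> tm \<Rightarrow> tm" where "FImp p q = squash (arr p q)"
definition FAll :: "tm \<Rightarrow> tm \<Rightarrow> tm" where "FAll t \<phi> = squash (Pi t (Tot \<phi>))"
definition FEx :: "tm \<Rightarrow> tm \<Rightarrow> tm" where "FEx t \<phi> = Con ExistsC \<cdot> t \<cdot> Lam t \<phi>"
definition FEq :: "tm \<Rightarrow> tm \<Rightarrow> tm \<Rightarrow> tm" where "FEq t a b = Con EqualC \<cdot> t \<cdot> a \<cdot> b"
definition FNot :: "tm \<Rightarrow> tm" where "FNot p = FImp p (Con FalsityC)"


section \<open>Signatures\<close>

record action =
  act_params :: "tm list"  \<comment> \<open>telescope; each type may mention the preceding parameters\<close>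
  act_comp :: comp         \<comment> \<open>in the scope of the telescope\<close>
  act_impl :: tm

record effdef =
  wp_type :: tm
  repr :: tm
  ret :: tm
  ret_star :: tm
  bnd :: tm
  bnd_star :: tm
  acts :: "(aname \<times> action) list"

text \<open>
  The most recent item of a signature is at its head. A lift carries its term and its
  predicate-transformer map; the latter takes its type argument explicitly.
\<close>

datatype item =
    EffDef ename effdef
  | LiftDef eff eff tm tm

type_synonym signature = "item list"

fun eff_of :: "signature \<Rightarrow> ename \<Rightarrow> effdef option" where
  "eff_of [] F = None"
| "eff_of (EffDef G D # S) F = (if F = G then Some D else eff_of S F)"
| "eff_of (LiftDef _ _ _ _ # S) F = eff_of S F"

fun lift_of :: "signature \<Rightarrow> eff \<Rightarrow> eff \<Rightarrow> (tm \<times> tm) option" where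
  "lift_of [] M M' = None"
| "lift_of (EffDef _ _ # S) M M' = lift_of S M M'"
| "lift_of (LiftDef N N' l l_star # S) M M' =
     (if M = N \<and> M' = N' then Some (l, l_star) else lift_of S M M')"

definition act_of :: "signature \<Rightarrow> ename \<Rightarrow> aname \<Rightarrow> action option" where
  "act_of S F a = (case eff_of S F of None \<Rightarrow> None | Some D \<Rightarrow> map_of (acts D) a)"

definition pure_wp_type :: tm where
  "pure_wp_type = Lam (Ty 0) (arr (arr (Var 0) (Ty 0)) (Ty 0))"

definition pure_ret_star :: tm where
  "pure_ret_star =
     Lam (Ty 0) (Lam (Var 0) (Lam (arr (Var 1) (Ty 0)) (Var 0 \<cdot> Var 1)))"

definition pure_bnd_star :: tm where
  "pure_bnd_star =
     Lam (Ty 0) (Lam (Ty 0)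
       (Lam (pure_wp_type \<cdot> Var 1)
         (Lam (arr (Var 2) (pure_wp_type \<cdot> Var 1))
           (Lam (arr (Var 2) (Ty 0))
             (Var 2 \<cdot> Lam (Var 4) (Var 2 \<cdot> Var 0 \<cdot> Var 1))))))"

fun wp_type_of :: "signature \<Rightarrow> eff \<Rightarrow> tm option" where
  "wp_type_of S Pure = Some pure_wp_type"
| "wp_type_of S (Usr F) = map_option wp_type (eff_of S F)"

fun ret_star_of :: "signature \<Rightarrow> eff \<Rightarrow> tm option" where
  "ret_star_of S Pure = Some pure_ret_star"
| "ret_star_of S (Usr F) = map_option ret_star (eff_of S F)"

fun bnd_star_of :: "signature \<Rightarrow> eff \<Rightarrow> tm option" where
  "bnd_star_of S Pure = Some pure_bnd_star"
| "bnd_star_of S (Usr F) = map_option bnd_star (eff_of S F)"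

text \<open>
  What a lift takes as its computation argument. A computation of a user-defined effect is
  represented by its reification. \<open>Pure\<close> has no \<open>repr\<close> field and \<open>reify\<close> does not apply to it,
  so a pure computation is represented by a thunk, the only way to pass a computation
  to a function. \<open>rep_type S M t wp\<close> is the type of such a representation.
\<close>

fun rep :: "eff \<Rightarrow> tm \<Rightarrow> tm" where
  "rep Pure e = Lam tunit (sh e)"
| "rep (Usr F) e = Reify e"

fun rep_type :: "signature \<Rightarrow> eff \<Rightarrow> tm \<Rightarrow> tm \<Rightarrow> tm option" where
  "rep_type S Pure t wp = Some (Pi tunit (Comp Pure (sh t) (sh wp)))"
| "rep_type S (Usr F) t wp = map_option (\<lambda>D. repr D \<cdot> t \<cdot> wp) (eff_of S F)"


section \<open>Reduction\<close>

inductive red :: "signature \<Rightarrow> tm \<Rightarrow> tm \<Rightarrow> bool" for S :: signature where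
  R_Beta: "red S (Lam t e \<cdot> e') (inst e e')"
| R_Fst: "red S (tfst a b (tpair a' b' x y)) x"
| R_Snd: "red S (tsnd a b (tpair a' b' x y)) y"
| R_CaseInl: "red S (Case t (tinl a b v) e1 e2) (inst e1 v)"
| R_CaseInr: "red S (Case t (tinr a b v) e1 e2) (inst e2 v)"
| R_RunReturn: "red S (Run (Return Pure t e)) e"
| R_BindReturn: "red S (Bind Pure t1 t2 wp1 (Return Pure t e1) wp2 e2) (inst e2 e1)"
| R_ReifyReflect: "red S (Reify (Reflect e)) e"
| R_ReifyReturn: "eff_of S F = Some D \<Longrightarrow> red S (Reify (Return (Usr F) t e)) (apps (ret D) [t, e])"
| R_ReifyBind: "eff_of S F = Some D \<Longrightarrow>
    red S (Reify (Bind (Usr F) t1 t2 wp1 e1 wp2 e2))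
      (apps (bnd D) [t1, t2, wp1, Reify e1, wp2, Lam t1 (Reify e2)])"
| R_ReifyAct: "act_of S F a = Some A \<Longrightarrow> red S (Reify (Act F a es)) (apps (act_impl A) es)"
| R_ReifyLift: "lift_of S M M' = Some (l, l_star) \<Longrightarrow>
    red S (Reify (Lift M M' t wp e)) (apps l [t, wp, rep M e])"
| E_Lam: "red S e e' \<Longrightarrow> red S (Lam t e) (Lam t e')"
| E_AppL: "red S e e' \<Longrightarrow> red S (e \<cdot> d) (e' \<cdot> d)"
| E_AppR: "red S e e' \<Longrightarrow> red S (d \<cdot> e) (d \<cdot> e')"
| E_Run: "red S e e' \<Longrightarrow> red S (Run e) (Run e')"
| E_Reify: "red S e e' \<Longrightarrow> red S (Reify e) (Reify e')"
| E_Reflect: "red S e e' \<Longrightarrow> red S (Reflect e) (Reflect e')"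
| E_Bind: "red S e e' \<Longrightarrow> red S (Bind M t1 t2 wp1 e wp2 e2) (Bind M t1 t2 wp1 e' wp2 e2)"
| E_Return: "red S e e' \<Longrightarrow> red S (Return M t e) (Return M t e')"
| E_Lift: "red S e e' \<Longrightarrow> red S (Lift M M' t wp e) (Lift M M' t wp e')"
| E_Act: "red S e e' \<Longrightarrow> red S (Act F a (es @ e # es')) (Act F a (es @ e' # es'))"
| E_Case: "red S e e' \<Longrightarrow> red S (Case t e e1 e2) (Case t e' e1 e2)"
| E_CaseL: "red S e e' \<Longrightarrow> red S (Case t d e e2) (Case t d e' e2)"
| E_CaseR: "red S e e' \<Longrightarrow> red S (Case t d e1 e) (Case t d e1 e')"

abbreviation reds :: "signature \<Rightarrow> tm \<Rightarrow> tm \<Rightarrow> bool" where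
  "reds S \<equiv> (red S)\<^sup>*\<^sup>*"

definition is_value :: "signature \<Rightarrow> tm \<Rightarrow> bool" where
  "is_value S v \<longleftrightarrow> (\<nexists>v'. red S v v')"


section \<open>Typing, subtyping and validity\<close>

text \<open>
  Constants are bare, so those with type arguments have one type for each choice of universes.
\<close>

inductive const_type :: "const \<Rightarrow> tm \<Rightarrow> bool" where
  "const_type (Univ i) (Ty (Suc i))"
| "const_type UnitC (Ty 0)"
| "const_type StarC tunit"
| "const_type ProdC (arr (Ty i) (arr (Ty j) (Ty (max i j))))"
| "const_type PairC (Pi (Ty i) (Tot (Pi (Ty j) (Tot
     (arr (Var 1) (arr (Var 0) (tprod (Var 1) (Var 0))))))))"
| "const_type FstC (Pi (Ty i) (Tot (Pi (Ty j) (Tot (arr (tprod (Var 1) (Var 0)) (Var 1))))))"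
| "const_type SndC (Pi (Ty i) (Tot (Pi (Ty j) (Tot (arr (tprod (Var 1) (Var 0)) (Var 0))))))"
| "const_type SumC (arr (Ty i) (arr (Ty j) (Ty (max i j))))"
| "const_type InlC (Pi (Ty i) (Tot (Pi (Ty j) (Tot (arr (Var 1) (tsum (Var 1) (Var 0)))))))"
| "const_type InrC (Pi (Ty i) (Tot (Pi (Ty j) (Tot (arr (Var 0) (tsum (Var 1) (Var 0)))))))"
| "const_type FalsityC (Ty 0)"
| "const_type ExistsC (Pi (Ty i) (Tot (arr (arr (Var 0) (Ty 0)) (Ty 0))))"
| "const_type EqualC (Pi (Ty i) (Tot (arr (Var 0) (arr (Var 0) (Ty 0)))))"

text \<open>
  A context is a list of types, the most recent binding first. \<open>has_univ S \<Gamma> c i\<close> says that the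
  computation type \<open>c\<close> is well formed in \<open>Type_i\<close>.

  All judgments are about well-formed types: \<open>S;\<Gamma> \<turnstile> e : c\<close> presupposes \<open>c\<close>, and
  \<open>S;\<Gamma> \<turnstile> c' <: c\<close> presupposes \<open>c'\<close> and \<open>c\<close>. The rules state this where it does not follow from
  their other premises: a term can only be given a well-formed supertype, transitivity
  only goes through well-formed types, \<open>F t wp\<close> has \<open>t : Type_0\<close> and \<open>wp : S.F.wp_type t\<close>
  (which a \<open>repr\<close> accepting more specifications than \<open>wp_type\<close> would not ensure),
  and the result type of a \<open>return\<close> is in \<open>Type_0\<close>, as in the rules for \<open>Pure t wp\<close> and \<open>F t wp\<close>.

  A proposition is an arbitrary type, valid when it is inhabited (\<open>V_Inhab\<close>, which gives the
  hypotheses of the context through \<open>T_Var\<close>); an element of a refinement type satisfies the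
  refinement.
\<close>

inductive typing :: "signature \<Rightarrow> tm list \<Rightarrow> tm \<Rightarrow> comp \<Rightarrow> bool"
  and has_univ :: "signature \<Rightarrow> tm list \<Rightarrow> comp \<Rightarrow> nat \<Rightarrow> bool"
  and subtype :: "signature \<Rightarrow> tm list \<Rightarrow> tm \<Rightarrow> tm \<Rightarrow> bool"
  and subcomp :: "signature \<Rightarrow> tm list \<Rightarrow> comp \<Rightarrow> comp \<Rightarrow> bool"
  and valid :: "signature \<Rightarrow> tm list \<Rightarrow> tm \<Rightarrow> bool"
  for S :: signature
where
  T_Var: "n < length \<Gamma> \<Longrightarrow> typing S \<Gamma> (Var n) (Tot (ren (\<lambda>m. m + Suc n) (\<Gamma> ! n)))"
| T_Con: "const_type k t \<Longrightarrow> typing S \<Gamma> (Con k) (Tot t)"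
| T_Pi: "\<lbrakk>typing S \<Gamma> t (Tot (Ty i)); has_univ S (t # \<Gamma>) c j\<rbrakk>
    \<Longrightarrow> typing S \<Gamma> (Pi t c) (Tot (Ty (max i j)))"
| T_Refine: "\<lbrakk>typing S \<Gamma> t (Tot (Ty i)); typing S (t # \<Gamma>) \<phi> (Tot (Ty j))\<rbrakk>
    \<Longrightarrow> typing S \<Gamma> (Refine t \<phi>) (Tot (Ty i))"
| T_Lam: "\<lbrakk>typing S \<Gamma> t (Tot (Ty i)); typing S (t # \<Gamma>) e c\<rbrakk>
    \<Longrightarrow> typing S \<Gamma> (Lam t e) (Tot (Pi t c))"
| T_App: "\<lbrakk>typing S \<Gamma> e1 (Tot (Pi t c)); typing S \<Gamma> e2 (Tot t)\<rbrakk>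
    \<Longrightarrow> typing S \<Gamma> (e1 \<cdot> e2) (instc c e2)"
| T_CaseTot: "\<lbrakk>typing S \<Gamma> e (Tot (tsum t1 t2)); typing S (tsum t1 t2 # \<Gamma>) t (Tot (Ty k));
    typing S (t1 # \<Gamma>) e1
      (Tot (sub (scons (tinl (sh t1) (sh t2) (Var 0)) (\<lambda>n. Var (Suc n))) t));
    typing S (t2 # \<Gamma>) e2
      (Tot (sub (scons (tinr (sh t1) (sh t2) (Var 0)) (\<lambda>n. Var (Suc n))) t))\<rbrakk>
    \<Longrightarrow> typing S \<Gamma> (Case t e e1 e2) (Tot (inst t e))"
| T_CaseComp: "\<lbrakk>typing S \<Gamma> e (Tot (tsum t1 t2)); typing S \<Gamma> t (Tot (Ty 0));
    wp_type_of S M = Some W;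
    typing S (t1 # \<Gamma>) e1 (Comp M (sh t) wp1); typing S (t2 # \<Gamma>) e2 (Comp M (sh t) wp2)\<rbrakk>
    \<Longrightarrow> typing S \<Gamma> (Case (sh t) e e1 e2) (Comp M t (Case (sh (W \<cdot> t)) e wp1 wp2))"
| T_Return: "\<lbrakk>ret_star_of S M = Some r; typing S \<Gamma> t (Tot (Ty 0)); typing S \<Gamma> e (Tot t)\<rbrakk>
    \<Longrightarrow> typing S \<Gamma> (Return M t e) (Comp M t (r \<cdot> t \<cdot> e))"
| T_Bind: "\<lbrakk>wp_type_of S M = Some W; bnd_star_of S M = Some b;
    typing S \<Gamma> t2 (Tot (Ty 0)); typing S \<Gamma> wp2 (Tot (arr t1 (W \<cdot> t2)));
    typing S \<Gamma> e1 (Comp M t1 wp1);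
    typing S (t1 # \<Gamma>) e2 (Comp M (sh t2) (sh wp2 \<cdot> Var 0))\<rbrakk>
    \<Longrightarrow> typing S \<Gamma> (Bind M t1 t2 wp1 e1 wp2 e2) (Comp M t2 (apps b [t1, t2, wp1, wp2]))"
| T_Lift: "\<lbrakk>lift_of S M M' = Some (l, l_star); typing S \<Gamma> e (Comp M t wp)\<rbrakk>
    \<Longrightarrow> typing S \<Gamma> (Lift M M' t wp e) (Comp M' t (l_star \<cdot> t \<cdot> wp))"
| T_Act: "\<lbrakk>act_of S F a = Some A; length es = length (act_params A);
    \<forall>i < length es. typing S \<Gamma> (es ! i) (Tot (sub (args (take i es)) (act_params A ! i)))\<rbrakk>
    \<Longrightarrow> typing S \<Gamma> (Act F a es) (subc (args es) (act_comp A))"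
| T_Reify: "\<lbrakk>eff_of S F = Some D; typing S \<Gamma> e (Comp (Usr F) t wp)\<rbrakk>
    \<Longrightarrow> typing S \<Gamma> (Reify e) (Tot (repr D \<cdot> t \<cdot> wp))"
| T_Reflect: "\<lbrakk>eff_of S F = Some D; typing S \<Gamma> e (Tot (repr D \<cdot> t \<cdot> wp));
    has_univ S \<Gamma> (Comp (Usr F) t wp) i\<rbrakk>
    \<Longrightarrow> typing S \<Gamma> (Reflect e) (Comp (Usr F) t wp)"
| T_Run: "\<lbrakk>typing S \<Gamma> e (Comp Pure t wp);
    valid S \<Gamma> (FEx (arr t (Ty 0)) (sh wp \<cdot> Var 0))\<rbrakk>
    \<Longrightarrow> typing S \<Gamma> (Run e) (Tot t)"
| T_Sub: "\<lbrakk>typing S \<Gamma> e c'; subcomp S \<Gamma> c' c; has_univ S \<Gamma> c i\<rbrakk> \<Longrightarrow> typing S \<Gamma> e c"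

| C_Tot: "typing S \<Gamma> t (Tot (Ty i)) \<Longrightarrow> has_univ S \<Gamma> (Tot t) i"
| C_Pure: "\<lbrakk>typing S \<Gamma> t (Tot (Ty 0)); typing S \<Gamma> wp (Tot (arr (arr t (Ty 0)) (Ty 0)))\<rbrakk>
    \<Longrightarrow> has_univ S \<Gamma> (Comp Pure t wp) 0"
| C_F: "\<lbrakk>eff_of S F = Some D; typing S \<Gamma> t (Tot (Ty 0)); typing S \<Gamma> wp (Tot (wp_type D \<cdot> t));
    typing S \<Gamma> (repr D \<cdot> t \<cdot> wp) (Tot (Ty 0))\<rbrakk>
    \<Longrightarrow> has_univ S \<Gamma> (Comp (Usr F) t wp) 0"

| S_Refl: "subtype S \<Gamma> t t"
| S_Trans: "\<lbrakk>subtype S \<Gamma> t1 t2; typing S \<Gamma> t2 (Tot (Ty i)); subtype S \<Gamma> t2 t3\<rbrakk>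
    \<Longrightarrow> subtype S \<Gamma> t1 t3"
| S_Pi: "\<lbrakk>subtype S \<Gamma> t t'; subcomp S (t # \<Gamma>) c' c\<rbrakk> \<Longrightarrow> subtype S \<Gamma> (Pi t' c') (Pi t c)"
| S_RefineL: "subtype S \<Gamma> (Refine t \<phi>) t"
| S_RefineR: "valid S (t # \<Gamma>) \<phi> \<Longrightarrow> subtype S \<Gamma> t (Refine t \<phi>)"
| S_Red: "reds S t' t \<Longrightarrow> subtype S \<Gamma> t' t"
| S_Exp: "reds S t t' \<Longrightarrow> subtype S \<Gamma> t' t"

| SC_Refl: "subcomp S \<Gamma> c c"
| SC_Trans: "\<lbrakk>subcomp S \<Gamma> c1 c2; has_univ S \<Gamma> c2 i; subcomp S \<Gamma> c2 c3\<rbrakk> \<Longrightarrow> subcomp S \<Gamma> c1 c3"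
| SC_Tot: "subtype S \<Gamma> t' t \<Longrightarrow> subcomp S \<Gamma> (Tot t') (Tot t)"
| SC_Pure: "\<lbrakk>subtype S \<Gamma> t' t;
    valid S \<Gamma> (FAll (arr t (Ty 0)) (FImp (sh wp \<cdot> Var 0) (sh wp' \<cdot> Var 0)))\<rbrakk>
    \<Longrightarrow> subcomp S \<Gamma> (Comp Pure t' wp') (Comp Pure t wp)"
| SC_F: "\<lbrakk>eff_of S F = Some D; subtype S \<Gamma> (repr D \<cdot> t' \<cdot> wp') (repr D \<cdot> t \<cdot> wp)\<rbrakk>
    \<Longrightarrow> subcomp S \<Gamma> (Comp (Usr F) t' wp') (Comp (Usr F) t wp)"

| V_Inhab: "\<lbrakk>typing S \<Gamma> e (Tot \<phi>); typing S \<Gamma> \<phi> (Tot (Ty i))\<rbrakk> \<Longrightarrow> valid S \<Gamma> \<phi>"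
| V_Refine: "typing S \<Gamma> e (Tot (Refine t \<phi>)) \<Longrightarrow> valid S \<Gamma> (inst \<phi> e)"
| V_SquashI: "\<lbrakk>valid S \<Gamma> \<phi>; typing S \<Gamma> \<phi> (Tot (Ty i))\<rbrakk> \<Longrightarrow> valid S \<Gamma> (squash \<phi>)"
| V_SquashE: "valid S \<Gamma> (squash \<phi>) \<Longrightarrow> valid S \<Gamma> \<phi>"
| V_FalseE: "\<lbrakk>valid S \<Gamma> (Con FalsityC); typing S \<Gamma> \<phi> (Tot (Ty i))\<rbrakk> \<Longrightarrow> valid S \<Gamma> \<phi>"
| V_Classical: "\<lbrakk>typing S \<Gamma> \<phi> (Tot (Ty i)); valid S (FNot \<phi> # \<Gamma>) (Con FalsityC)\<rbrakk> \<Longrightarrow> valid S \<Gamma> \<phi>"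
| V_ImpI: "\<lbrakk>typing S \<Gamma> p (Tot (Ty i)); typing S \<Gamma> q (Tot (Ty j)); valid S (p # \<Gamma>) (sh q)\<rbrakk>
    \<Longrightarrow> valid S \<Gamma> (FImp p q)"
| V_ImpE: "\<lbrakk>valid S \<Gamma> (FImp p q); valid S \<Gamma> p\<rbrakk> \<Longrightarrow> valid S \<Gamma> q"
| V_ConjI: "\<lbrakk>valid S \<Gamma> p; valid S \<Gamma> q; typing S \<Gamma> p (Tot (Ty i)); typing S \<Gamma> q (Tot (Ty j))\<rbrakk>
    \<Longrightarrow> valid S \<Gamma> (FConj p q)"
| V_ConjE1: "valid S \<Gamma> (FConj p q) \<Longrightarrow> valid S \<Gamma> p"
| V_ConjE2: "valid S \<Gamma> (FConj p q) \<Longrightarrow> valid S \<Gamma> q"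
| V_DisjI1: "\<lbrakk>valid S \<Gamma> p; typing S \<Gamma> p (Tot (Ty i)); typing S \<Gamma> q (Tot (Ty j))\<rbrakk>
    \<Longrightarrow> valid S \<Gamma> (FDisj p q)"
| V_DisjI2: "\<lbrakk>valid S \<Gamma> q; typing S \<Gamma> p (Tot (Ty i)); typing S \<Gamma> q (Tot (Ty j))\<rbrakk>
    \<Longrightarrow> valid S \<Gamma> (FDisj p q)"
| V_DisjE: "\<lbrakk>valid S \<Gamma> (FDisj p q); typing S \<Gamma> \<phi> (Tot (Ty i));
    valid S (p # \<Gamma>) (sh \<phi>); valid S (q # \<Gamma>) (sh \<phi>)\<rbrakk> \<Longrightarrow> valid S \<Gamma> \<phi>"
| V_AllI: "\<lbrakk>typing S \<Gamma> t (Tot (Ty i)); typing S (t # \<Gamma>) \<phi> (Tot (Ty j)); valid S (t # \<Gamma>) \<phi>\<rbrakk>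
    \<Longrightarrow> valid S \<Gamma> (FAll t \<phi>)"
| V_AllE: "\<lbrakk>valid S \<Gamma> (FAll t \<phi>); typing S \<Gamma> e (Tot t)\<rbrakk> \<Longrightarrow> valid S \<Gamma> (inst \<phi> e)"
| V_ExI: "\<lbrakk>typing S \<Gamma> t (Tot (Ty i)); typing S (t # \<Gamma>) \<phi> (Tot (Ty 0)); typing S \<Gamma> e (Tot t);
    valid S \<Gamma> (inst \<phi> e)\<rbrakk> \<Longrightarrow> valid S \<Gamma> (FEx t \<phi>)"
| V_ExE: "\<lbrakk>valid S \<Gamma> (FEx t \<phi>); typing S \<Gamma> \<psi> (Tot (Ty i)); valid S (\<phi> # t # \<Gamma>) (sh (sh \<psi>))\<rbrakk>
    \<Longrightarrow> valid S \<Gamma> \<psi>"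
| V_EqRefl: "\<lbrakk>typing S \<Gamma> t (Tot (Ty i)); typing S \<Gamma> e (Tot t)\<rbrakk> \<Longrightarrow> valid S \<Gamma> (FEq t e e)"
| V_EqSubst: "\<lbrakk>valid S \<Gamma> (FEq t e e'); typing S (t # \<Gamma>) \<phi> (Tot (Ty i)); valid S \<Gamma> (inst \<phi> e)\<rbrakk>
    \<Longrightarrow> valid S \<Gamma> (inst \<phi> e')"
| V_EqRed: "\<lbrakk>typing S \<Gamma> t (Tot (Ty i)); typing S \<Gamma> e (Tot t); typing S \<Gamma> e' (Tot t);
    reds S e e'\<rbrakk> \<Longrightarrow> valid S \<Gamma> (FEq t e e')"
| V_EqFun: "\<lbrakk>typing S \<Gamma> f (Tot (Pi t (Tot t'))); typing S \<Gamma> g (Tot (Pi t (Tot t')));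
    typing S \<Gamma> (Pi t (Tot t')) (Tot (Ty i));
    valid S (t # \<Gamma>) (FEq t' (sh f \<cdot> Var 0) (sh g \<cdot> Var 0))\<rbrakk>
    \<Longrightarrow> valid S \<Gamma> (FEq (Pi t (Tot t')) f g)"
| V_Case: "\<lbrakk>typing S \<Gamma> e (Tot (tsum t1 t2)); typing S (tsum t1 t2 # \<Gamma>) \<phi> (Tot (Ty i));
    valid S (t1 # \<Gamma>) (sub (scons (tinl (sh t1) (sh t2) (Var 0)) (\<lambda>n. Var (Suc n))) \<phi>);
    valid S (t2 # \<Gamma>) (sub (scons (tinr (sh t1) (sh t2) (Var 0)) (\<lambda>n. Var (Suc n))) \<phi>)\<rbrakk>
    \<Longrightarrow> valid S \<Gamma> (inst \<phi> e)"


section \<open>Well-formed signatures\<close>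

text \<open>
  The fields of a definition are closed terms, typed in the preceding part of the signature.
  In the types below the parameters are, outermost first, \<open>a x\<close>; \<open>a b w1 e w2 f\<close>; \<open>a w e\<close>.
\<close>

text \<open>\<open>pis ts t\<close> closes \<open>t\<close> under the telescope \<open>ts\<close>.\<close>

definition pis :: "tm list \<Rightarrow> tm \<Rightarrow> tm" where
  "pis ts t = foldr (\<lambda>t u. Pi t (Tot u)) ts t"

definition ret_type :: "effdef \<Rightarrow> tm" where
  "ret_type D = pis
     [Ty 0,
      Var 0]
     (repr D \<cdot> Var 1 \<cdot> (ret_star D \<cdot> Var 1 \<cdot> Var 0))"

definition bnd_type :: "effdef \<Rightarrow> tm" where
  "bnd_type D = pis
     [Ty 0,
      Ty 0,
      wp_type D \<cdot> Var 1,
      repr D \<cdot> Var 2 \<cdot> Var 0,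
      arr (Var 3) (wp_type D \<cdot> Var 2),
      Pi (Var 4) (Tot (repr D \<cdot> Var 4 \<cdot> (Var 1 \<cdot> Var 0)))]
     (repr D \<cdot> Var 4 \<cdot> apps (bnd_star D) [Var 5, Var 4, Var 3, Var 1])"

definition ret_star_type :: "effdef \<Rightarrow> tm" where
  "ret_star_type D = pis [Ty 0, Var 0] (wp_type D \<cdot> Var 1)"

definition bnd_star_type :: "effdef \<Rightarrow> tm" where
  "bnd_star_type D = pis
     [Ty 0,
      Ty 0,
      wp_type D \<cdot> Var 1,
      arr (Var 2) (wp_type D \<cdot> Var 1)]
     (wp_type D \<cdot> Var 2)"

definition wf_action :: "signature \<Rightarrow> ename \<Rightarrow> effdef \<Rightarrow> action \<Rightarrow> bool" where
  "wf_action S F D A \<longleftrightarrow>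
     (\<forall>i < length (act_params A).
        \<exists>j. typing S (rev (take i (act_params A))) (act_params A ! i) (Tot (Ty j))) \<and>
     (\<exists>t wp. act_comp A = Comp (Usr F) t wp \<and>
        typing S (rev (act_params A)) t (Tot (Ty 0)) \<and>
        typing S (rev (act_params A)) wp (Tot (wp_type D \<cdot> t)) \<and>
        typing S [] (act_impl A) (Tot (pis (act_params A) (repr D \<cdot> t \<cdot> wp))))"

definition wf_effdef :: "signature \<Rightarrow> ename \<Rightarrow> effdef \<Rightarrow> bool" where
  "wf_effdef S F D \<longleftrightarrow>
     (\<exists>i. typing S [] (wp_type D) (Tot (arr (Ty 0) (Ty i)))) \<and>
     typing S [] (repr D) (Tot (Pi (Ty 0) (Tot (arr (wp_type D \<cdot> Var 0) (Ty 0))))) \<and>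
     typing S [] (ret_star D) (Tot (ret_star_type D)) \<and>
     typing S [] (bnd_star D) (Tot (bnd_star_type D)) \<and>
     typing S [] (ret D) (Tot (ret_type D)) \<and>
     typing S [] (bnd D) (Tot (bnd_type D)) \<and>
     distinct (map fst (acts D)) \<and>
     (\<forall>(a, A) \<in> set (acts D). wf_action S F D A)"

text \<open>
  The target of a lift is a user-defined effect: lifts are interpreted by \<open>reify\<close>, and
  \<open>run (M.lift_Pure t wp e)\<close> has no reduction.
\<close>

definition wf_lift :: "signature \<Rightarrow> eff \<Rightarrow> eff \<Rightarrow> tm \<Rightarrow> tm \<Rightarrow> bool" where
  "wf_lift S M M' l l_star \<longleftrightarrow> M' \<noteq> Pure \<and>
     (\<exists>W W' R R'.
        wp_type_of S M = Some W \<and> wp_type_of S M' = Some W' \<and>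
        rep_type S M (Var 1) (Var 0) = Some R \<and>
        rep_type S M' (Var 2) (l_star \<cdot> Var 2 \<cdot> Var 1) = Some R' \<and>
        typing S [] l_star (Tot (Pi (Ty 0) (Tot (arr (W \<cdot> Var 0) (W' \<cdot> Var 0))))) \<and>
        typing S [] l (Tot (pis [Ty 0, W \<cdot> Var 0, R] R')))"

inductive wf_sig :: "signature \<Rightarrow> bool" where
  wf_Nil: "wf_sig []"
| wf_EffDef: "\<lbrakk>wf_sig S; eff_of S F = None; wf_effdef S F D\<rbrakk> \<Longrightarrow> wf_sig (EffDef F D # S)"
| wf_LiftDef: "\<lbrakk>wf_sig S; lift_of S M M' = None; wf_lift S M M' l l_star\<rbrakk>
    \<Longrightarrow> wf_sig (LiftDef M M' l l_star # S)"


section \<open>The state effect\<close>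

text \<open>
  The state type \<open>s\<close> is closed (as it occurs in the closed fields of a well-formed signature),
  so it is not shifted under binders.
\<close>

definition st_wp_type :: "tm \<Rightarrow> tm" where
  "st_wp_type s = Lam (Ty 0) (arr s (arr (arr (tprod (Var 0) s) (Ty 0)) (Ty 0)))"

definition st_repr :: "tm \<Rightarrow> tm" where
  "st_repr s = Lam (Ty 0) (Lam (st_wp_type s \<cdot> Var 0)
     (Pi s (Comp Pure (tprod (Var 2) s) (Var 1 \<cdot> Var 0))))"

text \<open>\<open>\<lambda>a x s0 p. p (x, s0)\<close>\<close>

definition st_ret_star :: "tm \<Rightarrow> tm" where
  "st_ret_star s = Lam (Ty 0) (Lam (Var 0) (Lam s (Lam (arr (tprod (Var 2) s) (Ty 0))
     (Var 0 \<cdot> tpair (Var 3) s (Var 2) (Var 1)))))"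

text \<open>\<open>\<lambda>a b f g s0 p. f s0 (\<lambda>z. g (fst z) (snd z) p)\<close>\<close>

definition st_bnd_star :: "tm \<Rightarrow> tm" where
  "st_bnd_star s =
     Lam (Ty 0) (Lam (Ty 0)
       (Lam (st_wp_type s \<cdot> Var 1)
         (Lam (arr (Var 2) (st_wp_type s \<cdot> Var 1))
           (Lam s
             (Lam (arr (tprod (Var 3) s) (Ty 0))
               (Var 3 \<cdot> Var 1 \<cdot>
                 Lam (tprod (Var 5) s)
                   (Var 3 \<cdot> tfst (Var 6) s (Var 0) \<cdot> tsnd (Var 6) s (Var 0) \<cdot> Var 1)))))))"

text \<open>\<open>\<lambda>a x s0. Pure.return (a \<times> s) (x, s0)\<close>\<close>

definition st_ret :: "tm \<Rightarrow> tm" where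
  "st_ret s = Lam (Ty 0) (Lam (Var 0) (Lam s
     (Return Pure (tprod (Var 2) s) (tpair (Var 2) s (Var 1) (Var 0)))))"

text \<open>
  \<open>\<lambda>a b w1 e w2 f s0. Pure.bind (a \<times> s) (b \<times> s) (w1 s0) (e s0)
     (\<lambda>z. w2 (fst z) (snd z)) z.(f (fst z) (snd z))\<close>
\<close>

definition st_bnd :: "tm \<Rightarrow> tm" where
  "st_bnd s =
     Lam (Ty 0) (Lam (Ty 0)
       (Lam (st_wp_type s \<cdot> Var 1)
         (Lam (st_repr s \<cdot> Var 2 \<cdot> Var 0)
           (Lam (arr (Var 3) (st_wp_type s \<cdot> Var 2))
             (Lam (Pi (Var 4) (Tot (st_repr s \<cdot> Var 4 \<cdot> (Var 1 \<cdot> Var 0))))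
               (Lam s
                 (Bind Pure (tprod (Var 6) s) (tprod (Var 5) s)
                   (Var 4 \<cdot> Var 0) (Var 3 \<cdot> Var 0)
                   (Lam (tprod (Var 6) s)
                     (Var 3 \<cdot> tfst (Var 7) s (Var 0) \<cdot> tsnd (Var 7) s (Var 0)))
                   (Var 2 \<cdot> tfst (Var 7) s (Var 0) \<cdot> tsnd (Var 7) s (Var 0)))))))))"

text \<open>\<open>get : ST s (\<lambda>s0 p. p (s0, s0))\<close>, implemented by \<open>\<lambda>s0. Pure.return (s \<times> s) (s0, s0)\<close>\<close>

definition st_get :: "ename \<Rightarrow> tm \<Rightarrow> action" where
  "st_get ST s = \<lparr>
     act_params = [],
     act_comp = Comp (Usr ST) s
       (Lam s (Lam (arr (tprod s s) (Ty 0)) (Var 0 \<cdot> tpair s s (Var 1) (Var 1)))),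
     act_impl = Lam s (Return Pure (tprod s s) (tpair s s (Var 0) (Var 0)))\<rparr>"

text \<open>
  \<open>put : x:s \<rightarrow> ST unit (\<lambda>s0 p. p ((), x))\<close>, implemented by
  \<open>\<lambda>x s0. Pure.return (unit \<times> s) ((), x)\<close>
\<close>

definition st_put :: "ename \<Rightarrow> tm \<Rightarrow> action" where
  "st_put ST s = \<lparr>
     act_params = [s],
     act_comp = Comp (Usr ST) tunit
       (Lam s (Lam (arr (tprod tunit s) (Ty 0)) (Var 0 \<cdot> tpair tunit s tt (Var 2)))),
     act_impl = Lam s (Lam s (Return Pure (tprod tunit s) (tpair tunit s tt (Var 1))))\<rparr>"

definition state_effect :: "ename \<Rightarrow> tm \<Rightarrow> effdef" where
  "state_effect ST s = \<lparr>
     wp_type = st_wp_type s,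
     repr = st_repr s,
     ret = st_ret s,
     ret_star = st_ret_star s,
     bnd = st_bnd s,
     bnd_star = st_bnd_star s,
     acts = [(''get'', st_get ST s), (''put'', st_put ST s)]\<rparr>"


section \<open>The Calculus of Inductive Constructions\<close>

text \<open>
  The part of CIC with predicative, non-cumulative universes, dependent products, and the
  inductive types unit, product and tsum (with dependent, large elimination for sums). Its
  strong normalization is a consequence of that of CIC, so a theorem that assumes
  only the former is at least as strong as one that assumes the latter.
  Here reduction is allowed in every position.
\<close>

datatype cic =
    CVar nat
  | CSort nat
  | CPi cic cic
  | CLam cic cic
  | CApp cic cic
  | CUnit
  | CTt
  | CProd cic cic
  | CPair cic cic cic cic
  | CFst cic
  | CSnd cic
  | CSum cic cic
  | CInl cic cic cic
  | CInr cic cic cic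
  | CCase cic cic cic cic

primrec cren :: "(nat \<Rightarrow> nat) \<Rightarrow> cic \<Rightarrow> cic" where
  "cren r (CVar n) = CVar (r n)"
| "cren r (CSort i) = CSort i"
| "cren r (CPi A B) = CPi (cren r A) (cren (upr r) B)"
| "cren r (CLam A b) = CLam (cren r A) (cren (upr r) b)"
| "cren r (CApp f a) = CApp (cren r f) (cren r a)"
| "cren r CUnit = CUnit"
| "cren r CTt = CTt"
| "cren r (CProd A B) = CProd (cren r A) (cren r B)"
| "cren r (CPair A B a b) = CPair (cren r A) (cren r B) (cren r a) (cren r b)"
| "cren r (CFst p) = CFst (cren r p)"
| "cren r (CSnd p) = CSnd (cren r p)"
| "cren r (CSum A B) = CSum (cren r A) (cren r B)"
| "cren r (CInl A B a) = CInl (cren r A) (cren r B) (cren r a)"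
| "cren r (CInr A B b) = CInr (cren r A) (cren r B) (cren r b)"
| "cren r (CCase P u a b) = CCase (cren (upr r) P) (cren r u) (cren (upr r) a) (cren (upr r) b)"

definition cscons :: "cic \<Rightarrow> (nat \<Rightarrow> cic) \<Rightarrow> nat \<Rightarrow> cic" where
  "cscons a \<sigma> = case_nat a \<sigma>"

definition cups :: "(nat \<Rightarrow> cic) \<Rightarrow> nat \<Rightarrow> cic" where
  "cups \<sigma> = cscons (CVar 0) (\<lambda>n. cren Suc (\<sigma> n))"

primrec csub :: "(nat \<Rightarrow> cic) \<Rightarrow> cic \<Rightarrow> cic" where
  "csub \<sigma> (CVar n) = \<sigma> n"
| "csub \<sigma> (CSort i) = CSort i"
| "csub \<sigma> (CPi A B) = CPi (csub \<sigma> A) (csub (cups \<sigma>) B)"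
| "csub \<sigma> (CLam A b) = CLam (csub \<sigma> A) (csub (cups \<sigma>) b)"
| "csub \<sigma> (CApp f a) = CApp (csub \<sigma> f) (csub \<sigma> a)"
| "csub \<sigma> CUnit = CUnit"
| "csub \<sigma> CTt = CTt"
| "csub \<sigma> (CProd A B) = CProd (csub \<sigma> A) (csub \<sigma> B)"
| "csub \<sigma> (CPair A B a b) = CPair (csub \<sigma> A) (csub \<sigma> B) (csub \<sigma> a) (csub \<sigma> b)"
| "csub \<sigma> (CFst p) = CFst (csub \<sigma> p)"
| "csub \<sigma> (CSnd p) = CSnd (csub \<sigma> p)"
| "csub \<sigma> (CSum A B) = CSum (csub \<sigma> A) (csub \<sigma> B)"
| "csub \<sigma> (CInl A B a) = CInl (csub \<sigma> A) (csub \<sigma> B) (csub \<sigma> a)"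
| "csub \<sigma> (CInr A B b) = CInr (csub \<sigma> A) (csub \<sigma> B) (csub \<sigma> b)"
| "csub \<sigma> (CCase P u a b) =
     CCase (csub (cups \<sigma>) P) (csub \<sigma> u) (csub (cups \<sigma>) a) (csub (cups \<sigma>) b)"

definition cinst :: "cic \<Rightarrow> cic \<Rightarrow> cic" where
  "cinst b a = csub (cscons a CVar) b"

inductive cred :: "cic \<Rightarrow> cic \<Rightarrow> bool" where
  "cred (CApp (CLam A b) a) (cinst b a)"
| "cred (CFst (CPair A B a b)) a"
| "cred (CSnd (CPair A B a b)) b"
| "cred (CCase P (CInl A B u) a b) (cinst a u)"
| "cred (CCase P (CInr A B u) a b) (cinst b u)"
| "cred A A' \<Longrightarrow> cred (CPi A B) (CPi A' B)"
| "cred B B' \<Longrightarrow> cred (CPi A B) (CPi A B')"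
| "cred A A' \<Longrightarrow> cred (CLam A b) (CLam A' b)"
| "cred b b' \<Longrightarrow> cred (CLam A b) (CLam A b')"
| "cred f f' \<Longrightarrow> cred (CApp f a) (CApp f' a)"
| "cred a a' \<Longrightarrow> cred (CApp f a) (CApp f a')"
| "cred A A' \<Longrightarrow> cred (CProd A B) (CProd A' B)"
| "cred B B' \<Longrightarrow> cred (CProd A B) (CProd A B')"
| "cred A A' \<Longrightarrow> cred (CPair A B a b) (CPair A' B a b)"
| "cred B B' \<Longrightarrow> cred (CPair A B a b) (CPair A B' a b)"
| "cred a a' \<Longrightarrow> cred (CPair A B a b) (CPair A B a' b)"
| "cred b b' \<Longrightarrow> cred (CPair A B a b) (CPair A B a b')"
| "cred p p' \<Longrightarrow> cred (CFst p) (CFst p')"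
| "cred p p' \<Longrightarrow> cred (CSnd p) (CSnd p')"
| "cred A A' \<Longrightarrow> cred (CSum A B) (CSum A' B)"
| "cred B B' \<Longrightarrow> cred (CSum A B) (CSum A B')"
| "cred A A' \<Longrightarrow> cred (CInl A B a) (CInl A' B a)"
| "cred B B' \<Longrightarrow> cred (CInl A B a) (CInl A B' a)"
| "cred a a' \<Longrightarrow> cred (CInl A B a) (CInl A B a')"
| "cred A A' \<Longrightarrow> cred (CInr A B b) (CInr A' B b)"
| "cred B B' \<Longrightarrow> cred (CInr A B b) (CInr A B' b)"
| "cred b b' \<Longrightarrow> cred (CInr A B b) (CInr A B b')"
| "cred P P' \<Longrightarrow> cred (CCase P u a b) (CCase P' u a b)"
| "cred u u' \<Longrightarrow> cred (CCase P u a b) (CCase P u' a b)"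
| "cred a a' \<Longrightarrow> cred (CCase P u a b) (CCase P u a' b)"
| "cred b b' \<Longrightarrow> cred (CCase P u a b) (CCase P u a b')"

inductive cic_ctxt :: "cic list \<Rightarrow> bool"
  and cic_typing :: "cic list \<Rightarrow> cic \<Rightarrow> cic \<Rightarrow> bool"
where
  "cic_ctxt []"
| "\<lbrakk>cic_ctxt \<Gamma>; cic_typing \<Gamma> A (CSort i)\<rbrakk> \<Longrightarrow> cic_ctxt (A # \<Gamma>)"
| "\<lbrakk>cic_ctxt \<Gamma>; n < length \<Gamma>\<rbrakk> \<Longrightarrow> cic_typing \<Gamma> (CVar n) (cren (\<lambda>m. m + Suc n) (\<Gamma> ! n))"
| "cic_ctxt \<Gamma> \<Longrightarrow> cic_typing \<Gamma> (CSort i) (CSort (Suc i))"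
| "\<lbrakk>cic_typing \<Gamma> A (CSort i); cic_typing (A # \<Gamma>) B (CSort j)\<rbrakk>
    \<Longrightarrow> cic_typing \<Gamma> (CPi A B) (CSort (max i j))"
| "\<lbrakk>cic_typing (A # \<Gamma>) b B; cic_typing \<Gamma> (CPi A B) (CSort i)\<rbrakk>
    \<Longrightarrow> cic_typing \<Gamma> (CLam A b) (CPi A B)"
| "\<lbrakk>cic_typing \<Gamma> f (CPi A B); cic_typing \<Gamma> a A\<rbrakk> \<Longrightarrow> cic_typing \<Gamma> (CApp f a) (cinst B a)"
| "cic_ctxt \<Gamma> \<Longrightarrow> cic_typing \<Gamma> CUnit (CSort 0)"
| "cic_ctxt \<Gamma> \<Longrightarrow> cic_typing \<Gamma> CTt CUnit"
| "\<lbrakk>cic_typing \<Gamma> A (CSort i); cic_typing \<Gamma> B (CSort j)\<rbrakk>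
    \<Longrightarrow> cic_typing \<Gamma> (CProd A B) (CSort (max i j))"
| "\<lbrakk>cic_typing \<Gamma> (CProd A B) (CSort i); cic_typing \<Gamma> a A; cic_typing \<Gamma> b B\<rbrakk>
    \<Longrightarrow> cic_typing \<Gamma> (CPair A B a b) (CProd A B)"
| "cic_typing \<Gamma> p (CProd A B) \<Longrightarrow> cic_typing \<Gamma> (CFst p) A"
| "cic_typing \<Gamma> p (CProd A B) \<Longrightarrow> cic_typing \<Gamma> (CSnd p) B"
| "\<lbrakk>cic_typing \<Gamma> A (CSort i); cic_typing \<Gamma> B (CSort j)\<rbrakk>
    \<Longrightarrow> cic_typing \<Gamma> (CSum A B) (CSort (max i j))"
| "\<lbrakk>cic_typing \<Gamma> (CSum A B) (CSort i); cic_typing \<Gamma> a A\<rbrakk>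
    \<Longrightarrow> cic_typing \<Gamma> (CInl A B a) (CSum A B)"
| "\<lbrakk>cic_typing \<Gamma> (CSum A B) (CSort i); cic_typing \<Gamma> b B\<rbrakk>
    \<Longrightarrow> cic_typing \<Gamma> (CInr A B b) (CSum A B)"
| "\<lbrakk>cic_typing \<Gamma> u (CSum A B); cic_typing (CSum A B # \<Gamma>) P (CSort i);
    cic_typing (A # \<Gamma>) a
      (csub (cscons (CInl (cren Suc A) (cren Suc B) (CVar 0)) (\<lambda>n. CVar (Suc n))) P);
    cic_typing (B # \<Gamma>) b
      (csub (cscons (CInr (cren Suc A) (cren Suc B) (CVar 0)) (\<lambda>n. CVar (Suc n))) P)\<rbrakk>
    \<Longrightarrow> cic_typing \<Gamma> (CCase P u a b) (cinst P u)"
| "\<lbrakk>cic_typing \<Gamma> a A; cic_typing \<Gamma> B (CSort i); equivclp cred A B\<rbrakk> \<Longrightarrow> cic_typing \<Gamma> a B"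

definition cic_strongly_normalizing :: bool where
  "cic_strongly_normalizing \<longleftrightarrow> (\<forall>\<Gamma> a A. cic_typing \<Gamma> a A \<longrightarrow> Wellfounded.termip cred a)"

end

theory Submission
  imports Defs
begin

text \<open>
  Reduction does not take place below the binders of refinement and product types, so it is not confluent,
  and subject reduction has no direct proof by injectivity of products. It is obtained together with strong
  normalization from a Kripke logical relation. The worlds are typing contexts, and a type denotes
  a partial equivalence relation on strongly normalizing, possibly open terms all of whose reducts have that type; related
  terms are convertible through well-typed terms. Types are interpreted by recursion on their universe.

  The relation also gives the inversion of sum types that is needed to make the presuppositions of a typing derivation
  explicit, so that the fundamental theorem applies to every term typed in a well-formed signature.

  In particular \<open>(reify e) s0 : Pure (t \<times> s) (wp s0)\<close> reduces to a normal form, which is related to itself; being closed it is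
  not stuck, so it is \<open>Pure.return v\<close>. Along the subsumptions in a typing of \<open>Pure.return v : Pure (t \<times> s) w\<close>, the
  specification only gets stronger towards \<open>w\<close>, so the validity of \<open>w p\<close> implies that of \<open>return_star v p\<close>, i.e. of \<open>p v\<close>.
\<close>

section \<open>Substitution\<close>

text \<open>Typed terms normalize even under contradictory hypotheses, because validity has no
  influence on the shape of a type: subtyping moves along reduction and into or out of refinements,
  but never along a provable equality. The relation therefore does not interpret formulas. A
  refinement denotes the part of its base type that is typable at the refinement, and a
  specification matters only through typability.

  The main obstacle is that a substitution instance does not follow a reduction of the substituted
  term, since the variable may occur in a position where reduction does not take place. Such
  instances are compared through beta redexes, whose argument is an evaluation position, and
  assumptions about a contractum are made for all reducts of the argument. Worlds are needed because
  reduction goes under abstractions, so that bodies are open terms. The relation is binary because a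
  dependent result type has to denote the same thing at two related arguments.\<close>

abbreviation lk :: "tm list \<Rightarrow> nat \<Rightarrow> tm" where
  "lk \<Gamma> n \<equiv> ren (\<lambda>m. m + Suc n) (\<Gamma> ! n)"

lemma upr_simps [simp]: "upr r 0 = 0" "upr r (Suc n) = Suc (r n)"
  by (simp_all add: upr_def)

lemma scons_simps [simp]: "scons e \<sigma> 0 = e" "scons e \<sigma> (Suc n) = \<sigma> n"
  by (simp_all add: scons_def)

lemma ups_simps [simp]: "ups \<sigma> 0 = Var 0" "ups \<sigma> (Suc n) = sh (\<sigma> n)"
  by (simp_all add: ups_def)

lemma nat_ext: "f 0 = g 0 \<Longrightarrow> (\<And>n. f (Suc n) = g (Suc n)) \<Longrightarrow> f = g"
  by (rule ext) (metis not0_implies_Suc)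

text \<open>Makes the laws of renaming special cases of those of substitution; the binder cases only
  need that lifting commutes with the embedding of variables.\<close>

lemma ren_eq_sub: "ren r e = sub (\<lambda>n. Var (r n)) e" and renc_eq_subc: "renc r c = subc (\<lambda>n. Var (r n)) c"
proof (induct e and c arbitrary: r and r)
  have *: "(\<lambda>n. Var (upr r n)) = ups (\<lambda>n. Var (r n))" for r :: "nat \<Rightarrow> nat"
    by (rule nat_ext) simp_all
  { case (Refine x1 x2) then show ?case by (simp add: *) }
  { case (Lam x1 x2) then show ?case by (simp add: *) }
  { case (Pi x1 x2) then show ?case by (simp add: *) }
  { case (Case x1 x2 x3 x4) then show ?case by (simp add: *) }
  { case (Bind x1 x2 x3 x4 x5 x6 x7) then show ?case by (simp add: *) }
qed simp_all

text \<open>The order of the composition laws is forced by lifting under a binder: a lifted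
  composition shifts a term and then substitutes, so \<open>sub_sub\<close> rests on
  \<open>sub_ren\<close> and \<open>ren_sub\<close>, and the latter on the composition of
  renamings.\<close>

lemma sub_ren: "sub \<sigma> (ren r e) = sub (\<lambda>n. \<sigma> (r n)) e"
  and subc_renc: "subc \<sigma> (renc r c) = subc (\<lambda>n. \<sigma> (r n)) c"
proof (induct e and c arbitrary: r \<sigma> and r \<sigma>)
  have *: "(\<lambda>n. ups \<sigma> (upr r n)) = ups (\<lambda>n. \<sigma> (r n))" for r \<sigma>
    by (rule nat_ext) simp_all
  { case (Refine x1 x2) then show ?case by (simp add: *) }
  { case (Lam x1 x2) then show ?case by (simp add: *) }
  { case (Pi x1 x2) then show ?case by (simp add: *) }
  { case (Case x1 x2 x3 x4) then show ?case by (simp add: *) }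
  { case (Bind x1 x2 x3 x4 x5 x6 x7) then show ?case by (simp add: *) }
qed simp_all

lemma ren_ren: "ren r (ren q e) = ren (\<lambda>n. r (q n)) e"
  and renc_renc: "renc r (renc q c) = renc (\<lambda>n. r (q n)) c"
  by (simp_all only: ren_eq_sub[of r] renc_eq_subc[of r] sub_ren subc_renc ren_eq_sub[of "\<lambda>n. r (q n)"] renc_eq_subc[of "\<lambda>n. r (q n)"])

lemma ren_sub: "ren r (sub \<sigma> e) = sub (\<lambda>n. ren r (\<sigma> n)) e"
  and renc_subc: "renc r (subc \<sigma> c) = subc (\<lambda>n. ren r (\<sigma> n)) c"
proof (induct e and c arbitrary: r \<sigma> and r \<sigma>)
  have *: "(\<lambda>n. ren (upr r) (ups \<sigma> n)) = ups (\<lambda>n. ren r (\<sigma> n))" for r \<sigma>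
    by (rule nat_ext) (simp_all add: ren_ren)
  { case (Refine x1 x2) then show ?case by (simp add: *) }
  { case (Lam x1 x2) then show ?case by (simp add: *) }
  { case (Pi x1 x2) then show ?case by (simp add: *) }
  { case (Case x1 x2 x3 x4) then show ?case by (simp add: *) }
  { case (Bind x1 x2 x3 x4 x5 x6 x7) then show ?case by (simp add: *) }
qed simp_all

lemma sub_sub: "sub \<tau> (sub \<sigma> e) = sub (\<lambda>n. sub \<tau> (\<sigma> n)) e"
  and subc_subc: "subc \<tau> (subc \<sigma> c) = subc (\<lambda>n. sub \<tau> (\<sigma> n)) c"
proof (induct e and c arbitrary: \<tau> \<sigma> and \<tau> \<sigma>)
  have *: "(\<lambda>n. sub (ups \<tau>) (ups \<sigma> n)) = ups (\<lambda>n. sub \<tau> (\<sigma> n))" for \<tau> \<sigma>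
    by (rule nat_ext) (simp_all add: sub_ren ren_sub)
  { case (Refine x1 x2) then show ?case by (simp add: *) }
  { case (Lam x1 x2) then show ?case by (simp add: *) }
  { case (Pi x1 x2) then show ?case by (simp add: *) }
  { case (Case x1 x2 x3 x4) then show ?case by (simp add: *) }
  { case (Bind x1 x2 x3 x4 x5 x6 x7) then show ?case by (simp add: *) }
qed simp_all

lemma ups_Var [simp]: "ups Var = Var"
  by (rule nat_ext) simp_all

lemma sub_Var [simp]: "sub Var e = e" and subc_Var [simp]: "subc Var c = c"
  by (induct e and c) (simp_all add: map_idI)

lemma ren_id [simp]: "ren (\<lambda>n. n) e = e" and renc_id [simp]: "renc (\<lambda>n. n) c = c"
  by (simp_all add: ren_eq_sub renc_eq_subc)

lemma comp_scons: "(\<lambda>n. sub \<tau> (scons a \<sigma> n)) = scons (sub \<tau> a) (\<lambda>n. sub \<tau> (\<sigma> n))"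
  "(\<lambda>n. ren r (scons a \<sigma> n)) = scons (ren r a) (\<lambda>n. ren r (\<sigma> n))"
  by (rule nat_ext; simp)+

lemma scons_ups: "(\<lambda>n. sub (scons a \<tau>) (ups \<sigma> n)) = scons a (\<lambda>n. sub \<tau> (\<sigma> n))"
  by (rule nat_ext) (simp_all add: sub_ren)

lemma scons_upr: "(\<lambda>n. scons a \<sigma> (upr r n)) = scons a (\<lambda>n. \<sigma> (r n))"
  by (rule nat_ext) simp_all

lemma scons_eta [simp]: "scons (\<sigma> 0) (\<lambda>n. \<sigma> (Suc n)) = \<sigma>"
  by (rule nat_ext) simp_all

lemma ren_upr_Suc: "ren (upr r) (sh e) = sh (ren r e)"
  by (simp add: ren_ren)

lemma sub_ups_sh: "sub (ups \<sigma>) (sh e) = sh (sub \<sigma> e)" and subc_ups_sh: "subc (ups \<sigma>) (renc Suc c) = renc Suc (subc \<sigma> c)"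
  by (simp_all add: sub_ren ren_sub subc_renc renc_subc)

text \<open>Normalises every renaming, instantiation and composition to one parallel substitution.\<close>

lemmas subst_simps = sub_sub subc_subc sub_ren subc_renc ren_sub renc_subc ren_ren renc_renc
  comp_scons scons_ups scons_upr inst_def instc_def

lemma inst_sh [simp]: "inst (sh b) e = b" and instc_sh [simp]: "instc (renc Suc c) e = c"
  by (simp_all add: subst_simps)

lemma sub_inst: "sub \<sigma> (inst b e) = inst (sub (ups \<sigma>) b) (sub \<sigma> e)"
  and subc_instc: "subc \<sigma> (instc c e) = instc (subc (ups \<sigma>) c) (sub \<sigma> e)"
  by (simp_all add: subst_simps)

lemma ren_inst: "ren r (inst b e) = inst (ren (upr r) b) (ren r e)"
  by (simp add: subst_simps)

lemma inst_ups: "inst (sub (ups \<sigma>) b) a = sub (scons a \<sigma>) b"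
  and instc_ups: "instc (subc (ups \<sigma>) c) a = subc (scons a \<sigma>) c"
  by (simp_all add: subst_simps)

lemma instc_simps [simp]: "instc (Tot t) e = Tot (inst t e)"
  "instc (Comp M t wp) e = Comp M (inst t e) (inst wp e)"
  by (simp_all add: instc_def inst_def)

lemma inst_simps [simp]:
  "inst (a \<cdot> b) e = inst a e \<cdot> inst b e" "inst (Con k) e = Con k" "inst (Var 0) e = e" "inst (Var (Suc n)) e = Var n"
  by (simp_all add: inst_def)

text \<open>Scoping is defined by its use: the term cannot distinguish substitutions that agree
  below \<open>n\<close>. No separate notion of free variable has to be related to substitution, and
  closed terms are fixed by every substitution at once.\<close>

definition scoped :: "nat \<Rightarrow> tm \<Rightarrow> bool" where
  "scoped n e \<longleftrightarrow> (\<forall>\<sigma> \<tau>. (\<forall>m<n. \<sigma> m = \<tau> m) \<longrightarrow> sub \<sigma> e = sub \<tau> e)"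
definition scopedc :: "nat \<Rightarrow> comp \<Rightarrow> bool" where
  "scopedc n c \<longleftrightarrow> (\<forall>\<sigma> \<tau>. (\<forall>m<n. \<sigma> m = \<tau> m) \<longrightarrow> subc \<sigma> c = subc \<tau> c)"

abbreviation closed :: "tm \<Rightarrow> bool" where "closed \<equiv> scoped 0"

lemma closed_sub: "closed e \<Longrightarrow> sub \<sigma> e = e"
  by (metis scoped_def not_less_zero sub_Var)
lemma closed_ren: "closed e \<Longrightarrow> ren r e = e"
  by (simp add: ren_eq_sub closed_sub)

lemma ups_agree: "(\<forall>m<n. \<sigma> m = \<tau> m) \<Longrightarrow> (\<forall>m<Suc n. ups \<sigma> m = ups \<tau> m)"
  by (auto simp: less_Suc_eq_0_disj)

lemma scoped_simps [simp]:
  "scoped n (Con k)" "scoped n (Var m) \<longleftrightarrow> m < n"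
  "scoped n (a \<cdot> b) \<longleftrightarrow> scoped n a \<and> scoped n b"
  "scopedc n (Tot t) \<longleftrightarrow> scoped n t"
  "scopedc n (Comp M t wp) \<longleftrightarrow> scoped n t \<and> scoped n wp"
proof -
  show "scoped n (Con k)" by (simp add: scoped_def)
  show "scoped n (Var m) \<longleftrightarrow> m < n"
  proof
    assume *: "scoped n (Var m)"
    \<comment> \<open>A substitution that agrees with the identity below \<open>n\<close> and puts a
      constant everywhere else; it can fix \<open>Var m\<close> only if
      \<open>m < n\<close>.\<close>
    have "sub Var (Var m) = sub (\<lambda>k. if k < n then Var k else tt) (Var m)"
      by (rule *[unfolded scoped_def, rule_format]) simp
    then show "m < n" by (simp split: if_splits)
  qed (simp add: scoped_def)
qed (auto simp: scoped_def scopedc_def)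

lemma scopedI: "(\<And>\<sigma> \<tau>. \<forall>m<n. \<sigma> m = \<tau> m \<Longrightarrow> sub \<sigma> e = sub \<tau> e) \<Longrightarrow> scoped n e"
  by (simp add: scoped_def)
lemma scopedD: "scoped n e \<Longrightarrow> \<forall>m<n. \<sigma> m = \<tau> m \<Longrightarrow> sub \<sigma> e = sub \<tau> e"
  "scopedc n c \<Longrightarrow> \<forall>m<n. \<sigma> m = \<tau> m \<Longrightarrow> subc \<sigma> c = subc \<tau> c"
  by (simp_all add: scoped_def scopedc_def)
lemma scopedD_ups: "scoped (Suc n) e \<Longrightarrow> \<forall>m<n. \<sigma> m = \<tau> m \<Longrightarrow> sub (ups \<sigma>) e = sub (ups \<tau>) e"
  "scopedc (Suc n) c \<Longrightarrow> \<forall>m<n. \<sigma> m = \<tau> m \<Longrightarrow> subc (ups \<sigma>) c = subc (ups \<tau>) c"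
  by (meson scopedD ups_agree)+

lemma scoped_binders:
  "scoped n t \<Longrightarrow> scoped (Suc n) b \<Longrightarrow> scoped n (Lam t b)"
  "scoped n t \<Longrightarrow> scoped (Suc n) b \<Longrightarrow> scoped n (Refine t b)"
  "scoped n t \<Longrightarrow> scopedc (Suc n) c \<Longrightarrow> scoped n (Pi t c)"
  "scoped (Suc n) t \<Longrightarrow> scoped n e \<Longrightarrow> scoped (Suc n) e1 \<Longrightarrow> scoped (Suc n) e2 \<Longrightarrow> scoped n (Case t e e1 e2)"
  "scoped n t1 \<Longrightarrow> scoped n t2 \<Longrightarrow> scoped n wp1 \<Longrightarrow> scoped n e1 \<Longrightarrow> scoped n wp2 \<Longrightarrow> scoped (Suc n) e2
    \<Longrightarrow> scoped n (Bind M t1 t2 wp1 e1 wp2 e2)"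
  "scoped n e \<Longrightarrow> scoped n (Run e)" "scoped n e \<Longrightarrow> scoped n (Reify e)" "scoped n e \<Longrightarrow> scoped n (Reflect e)"
  "scoped n t \<Longrightarrow> scoped n wp \<Longrightarrow> scoped n e \<Longrightarrow> scoped n (Lift M M' t wp e)"
  "scoped n t \<Longrightarrow> scoped n e \<Longrightarrow> scoped n (Return M t e)"
  "\<forall>e\<in>set es. scoped n e \<Longrightarrow> scoped n (Act F a es)"
  by (rule scopedI; simp; (intro conjI)?; (erule (1) scopedD scopedD_ups)?; blast intro: scopedD)+

lemma sub_apps: "sub \<sigma> (apps f es) = apps (sub \<sigma> f) (map (sub \<sigma>) es)"
  by (induct es arbitrary: f) simp_all
lemma ren_apps: "ren r (apps f es) = apps (ren r f) (map (ren r) es)"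
  by (induct es arbitrary: f) simp_all

lemma closed_pure: "closed pure_wp_type" "closed pure_ret_star" "closed pure_bnd_star"
  by (simp_all add: scoped_def pure_wp_type_def pure_ret_star_def pure_bnd_star_def numeral_eq_Suc)

text \<open>Reifying an operation inserts fields of the signature into the term, so reduction
  commutes with substitution only when these fields are closed. The types of an action are scoped by
  its telescope instead.\<close>

definition closed_sig :: "signature \<Rightarrow> bool" where
  "closed_sig S \<longleftrightarrow>
    (\<forall>F D. eff_of S F = Some D \<longrightarrow> closed (wp_type D) \<and> closed (repr D) \<and> closed (ret D) \<and> closed (ret_star D)
       \<and> closed (bnd D) \<and> closed (bnd_star D)) \<and>
    (\<forall>M M' l l'. lift_of S M M' = Some (l, l') \<longrightarrow> closed l \<and> closed l') \<and>
    (\<forall>F a A. act_of S F a = Some A \<longrightarrow> closed (act_impl A) \<and> (\<forall>i<length (act_params A). scoped i (act_params A ! i))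
       \<and> scopedc (length (act_params A)) (act_comp A))"

lemma closed_sigD:
  assumes "closed_sig S"
  shows "eff_of S F = Some D \<Longrightarrow> closed (wp_type D)" "eff_of S F = Some D \<Longrightarrow> closed (repr D)"
    "eff_of S F = Some D \<Longrightarrow> closed (ret D)" "eff_of S F = Some D \<Longrightarrow> closed (ret_star D)"
    "eff_of S F = Some D \<Longrightarrow> closed (bnd D)" "eff_of S F = Some D \<Longrightarrow> closed (bnd_star D)"
    "lift_of S M M' = Some (l, l') \<Longrightarrow> closed l" "lift_of S M M' = Some (l, l') \<Longrightarrow> closed l'"
    "act_of S F a = Some A \<Longrightarrow> closed (act_impl A)"
    "act_of S F a = Some A \<Longrightarrow> i < length (act_params A) \<Longrightarrow> scoped i (act_params A ! i)"
    "act_of S F a = Some A \<Longrightarrow> scopedc (length (act_params A)) (act_comp A)"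
    "wp_type_of S M = Some W \<Longrightarrow> closed W" "ret_star_of S M = Some r \<Longrightarrow> closed r" "bnd_star_of S M = Some b \<Longrightarrow> closed b"
  using assms unfolding closed_sig_def
  by (blast+, (cases M; auto simp: closed_pure)+)

text \<open>Beyond its arguments \<open>args\<close> lowers the index to an ordinary variable, which
  a subsequent \<open>\<sigma>\<close> would replace. Scoping excludes these indices, so that only
  the arguments are affected.\<close>

lemma sub_args: "scoped (length es) e \<Longrightarrow> sub \<sigma> (sub (args es) e) = sub (args (map (sub \<sigma>) es)) e"
  and subc_args: "scopedc (length es) c \<Longrightarrow> subc \<sigma> (subc (args es) c) = subc (args (map (sub \<sigma>) es)) c"
  unfolding scoped_def scopedc_def by (simp_all add: sub_sub subc_subc args_def rev_map)

lemma sub_rep: "sub \<sigma> (rep M e) = rep M (sub \<sigma> e)"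
  by (cases M) (simp_all add: sub_ups_sh)

lemma ren_rep: "ren r (rep M e) = rep M (ren r e)"
  by (simp add: ren_eq_sub sub_rep)

text \<open>Closedness of the fields is what the logical relation and its fundamental theorem use of
  the signature; the typing of unfolded operations is carried by the derivations of
  \<open>ty\<close> themselves.\<close>

locale sigc =
  fixes S :: signature
  assumes csig: "closed_sig S"
begin

lemmas csD = closed_sigD[OF csig]

lemma red_sub: "red S e e' \<Longrightarrow> red S (sub \<sigma> e) (sub \<sigma> e')"
proof (induct arbitrary: \<sigma> rule: red.induct)
  case (R_ReifyAct F a A es)
  then show ?case using csD(9)[OF R_ReifyAct] by (simp add: sub_apps closed_sub red.R_ReifyAct)
next
  case (R_ReifyLift M M' l l' t wp e)
  then show ?case using csD(7)[OF R_ReifyLift] red.R_ReifyLift[OF R_ReifyLift, of "sub \<sigma> t" "sub \<sigma> wp" "sub \<sigma> e"]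
    by (simp add: sub_rep closed_sub)
next
  case (R_ReifyBind F D t1 t2 wp1 e1 wp2 e2)
  show ?case using csD(5)[OF R_ReifyBind] red.R_ReifyBind[OF R_ReifyBind, of "sub \<sigma> t1" "sub \<sigma> t2" "sub \<sigma> wp1" "sub \<sigma> e1" "sub \<sigma> wp2" "sub (ups \<sigma>) e2"]
    by (simp add: closed_sub)
next
  case (R_ReifyReturn F D t e)
  show ?case using csD(3)[OF R_ReifyReturn] red.R_ReifyReturn[OF R_ReifyReturn, of "sub \<sigma> t" "sub \<sigma> e"]
    by (simp add: closed_sub)
qed (auto simp: sub_inst intro: red.intros)

lemma red_ren: "red S e e' \<Longrightarrow> red S (ren r e) (ren r e')"
  by (simp add: ren_eq_sub red_sub)

lemma reds_sub: "reds S e e' \<Longrightarrow> reds S (sub \<sigma> e) (sub \<sigma> e')"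
  by (induct rule: rtranclp_induct) (auto intro: red_sub rtranclp.rtrancl_into_rtrancl)

lemma reds_ren: "reds S e e' \<Longrightarrow> reds S (ren r e) (ren r e')"
  by (simp add: ren_eq_sub reds_sub)

end

lemma ren_inv:
  "(Con k = ren r e) = (e = Con k)"
  "(Lam t b = ren r e) = (\<exists>t' b'. e = Lam t' b' \<and> t = ren r t' \<and> b = ren (upr r) b')"
  "(f \<cdot> g = ren r e) = (\<exists>f' g'. e = f' \<cdot> g' \<and> f = ren r f' \<and> g = ren r g')"
  "(Case t d d1 d2 = ren r e) = (\<exists>t' d' d1' d2'. e = Case t' d' d1' d2' \<and> t = ren (upr r) t' \<and> d = ren r d' \<and> d1 = ren (upr r) d1' \<and> d2 = ren (upr r) d2')"
  "(Run d = ren r e) = (\<exists>d'. e = Run d' \<and> d = ren r d')"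
  "(Reify d = ren r e) = (\<exists>d'. e = Reify d' \<and> d = ren r d')"
  "(Reflect d = ren r e) = (\<exists>d'. e = Reflect d' \<and> d = ren r d')"
  "(Lift M M' t wp d = ren r e) = (\<exists>t' wp' d'. e = Lift M M' t' wp' d' \<and> t = ren r t' \<and> wp = ren r wp' \<and> d = ren r d')"
  "(Act F a es = ren r e) = (\<exists>es'. e = Act F a es' \<and> es = map (ren r) es')"
  "(Return M t d = ren r e) = (\<exists>t' d'. e = Return M t' d' \<and> t = ren r t' \<and> d = ren r d')"
  "(Bind M t1 t2 w1 d1 w2 d2 = ren r e) = (\<exists>t1' t2' w1' d1' w2' d2'. e = Bind M t1' t2' w1' d1' w2' d2' \<and> t1 = ren r t1'
     \<and> t2 = ren r t2' \<and> w1 = ren r w1' \<and> d1 = ren r d1' \<and> w2 = ren r w2' \<and> d2 = ren (upr r) d2')"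
  "(Pi t c = ren r e) = (\<exists>t' c'. e = Pi t' c' \<and> t = ren r t' \<and> c = renc (upr r) c')"
  "(Refine t b = ren r e) = (\<exists>t' b'. e = Refine t' b' \<and> t = ren r t' \<and> b = ren (upr r) b')"
  by (cases e; auto)+

context sigc begin

text \<open>A renaming keeps every constructor in place and turns variables only into variables, so
  it creates no redex. Reducts and normal forms of a renamed term can hence be pulled back, which is
  what moves strong normalization between worlds.\<close>

lemma red_ren_inv: "red S u x \<Longrightarrow> u = ren r e \<Longrightarrow> \<exists>e'. red S e e' \<and> x = ren r e'"
proof (induct arbitrary: r e rule: red.induct)
  case (R_Beta t b e')
  then show ?case by (auto simp: ren_inv ren_inst[symmetric] intro: red.R_Beta)
next
  case (R_CaseInl t a b v e1 e2)
  then show ?case by (auto simp: ren_inv ren_inst[symmetric] intro: red.R_CaseInl)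
next
  case (R_CaseInr t a b v e1 e2)
  then show ?case by (auto simp: ren_inv ren_inst[symmetric] intro: red.R_CaseInr)
next
  case (R_BindReturn t1 t2 wp1 t e1 wp2 e2)
  then show ?case by (auto simp: ren_inv ren_inst[symmetric] intro: red.R_BindReturn)
next
  case (R_ReifyReturn F D t e')
  then obtain t' d where "e = Reify (Return (Usr F) t' d)" "t = ren r t'" "e' = ren r d"
    by (auto simp: ren_inv)
  then show ?case using csD(3)[OF R_ReifyReturn(1)] red.R_ReifyReturn[OF R_ReifyReturn(1), of t' d]
    by (intro exI[of _ "apps (ret D) [t', d]"]) (simp add: closed_ren)
next
  case (R_ReifyBind F D t1 t2 wp1 e1 wp2 e2)
  then obtain t1' t2' wp1' e1' wp2' e2' where "e = Reify (Bind (Usr F) t1' t2' wp1' e1' wp2' e2')" 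
    "t1 = ren r t1'" "t2 = ren r t2'" "wp1 = ren r wp1'" "e1 = ren r e1'" "wp2 = ren r wp2'" "e2 = ren (upr r) e2'"
    by (auto simp: ren_inv)
  then show ?case using csD(5)[OF R_ReifyBind(1)] red.R_ReifyBind[OF R_ReifyBind(1), of t1' t2' wp1' e1' wp2' e2']
    by (intro exI[of _ "apps (bnd D) [t1', t2', wp1', Reify e1', wp2', Lam t1' (Reify e2')]"]) (simp add: closed_ren)
next
  case (R_ReifyAct F a A es)
  then obtain es' where "e = Reify (Act F a es')" "es = map (ren r) es'" by (auto simp: ren_inv)
  then show ?case using csD(9)[OF R_ReifyAct(1)] red.R_ReifyAct[OF R_ReifyAct(1), of es']
    by (intro exI[of _ "apps (act_impl A) es'"]) (simp add: closed_ren ren_apps)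
next
  case (R_ReifyLift M M' l l' t wp d)
  then obtain t' wp' d' where "e = Reify (Lift M M' t' wp' d')" "t = ren r t'" "wp = ren r wp'" "d = ren r d'" by (auto simp: ren_inv)
  then show ?case using csD(7)[OF R_ReifyLift(1)] red.R_ReifyLift[OF R_ReifyLift(1), of t' wp' d']
    by (intro exI[of _ "apps l [t', wp', rep M d']"]) (simp add: closed_ren ren_rep)
next
  case (E_Lam d d' t)
  then show ?case by (fastforce simp: ren_inv intro: red.E_Lam)
next
  case (E_Act d d' F a es es')
  from E_Act.prems obtain es0 e0 es0' where e: "e = Act F a (es0 @ e0 # es0')" "es = map (ren r) es0" "d = ren r e0" "es' = map (ren r) es0'"
    by (auto simp: ren_inv map_eq_append_conv append_eq_map_conv Cons_eq_map_conv)
  then show ?case using E_Act.hyps(2)[OF e(3)] by (force intro: red.E_Act)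
next
  case (E_CaseL e e' t d e2) then show ?case by (fastforce simp: ren_inv intro: red.E_CaseL)
next
  case (E_CaseR e e' t d e1) then show ?case by (fastforce simp: ren_inv intro: red.E_CaseR)
qed (fastforce simp: ren_inv intro: red.intros)+

lemma reds_ren_inv: assumes "reds S (ren r e) x" shows "\<exists>e'. reds S e e' \<and> x = ren r e'"
  using assms
proof (induct rule: rtranclp_induct)
  case (step y z)
  then show ?case using red_ren_inv[of y z r] by (metis rtranclp.rtrancl_into_rtrancl)
qed auto

end

section \<open>Substitution in the typing judgments\<close>

lemma const_type_closed: "const_type k t \<Longrightarrow> closed t"
  by (erule const_type.cases) (simp_all add: scoped_def numeral_eq_Suc)

lemma sub_branch: "sub (ups \<sigma>) (sub (scons a (\<lambda>n. Var (Suc n))) t) = sub (scons (sub (ups \<sigma>) a) (\<lambda>n. Var (Suc n))) (sub (ups \<sigma>) t)"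
proof -
  have "(\<lambda>n. sub (ups \<sigma>) (scons a (\<lambda>n. Var (Suc n)) n)) = (\<lambda>n. sub (scons (sub (ups \<sigma>) a) (\<lambda>n. Var (Suc n))) (ups \<sigma> n))"
    by (rule nat_ext) (simp_all add: sub_ren, simp add: ren_eq_sub)
  then show ?thesis by (simp add: sub_sub)
qed

lemma sub_ups_upr: "sub (ups (ups \<sigma>)) (ren (upr Suc) e) = ren (upr Suc) (sub (ups \<sigma>) e)"
  and subc_ups_upr: "subc (ups (ups \<sigma>)) (renc (upr Suc) c) = renc (upr Suc) (subc (ups \<sigma>) c)"
proof -
  have "(\<lambda>n. ups (ups \<sigma>) (upr Suc n)) = (\<lambda>n. ren (upr Suc) (ups \<sigma> n))"
    by (rule nat_ext) (simp_all add: ren_ren)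
  then show "sub (ups (ups \<sigma>)) (ren (upr Suc) e) = ren (upr Suc) (sub (ups \<sigma>) e)"
    "subc (ups (ups \<sigma>)) (renc (upr Suc) c) = renc (upr Suc) (subc (ups \<sigma>) c)" by (simp_all add: sub_ren ren_sub subc_renc renc_subc)
qed

lemma sub_formulas:
  "sub \<sigma> (squash p) = squash (sub \<sigma> p)" "sub \<sigma> (FImp p q) = FImp (sub \<sigma> p) (sub \<sigma> q)"
  "sub \<sigma> (FConj p q) = FConj (sub \<sigma> p) (sub \<sigma> q)" "sub \<sigma> (FDisj p q) = FDisj (sub \<sigma> p) (sub \<sigma> q)"
  "sub \<sigma> (FNot p) = FNot (sub \<sigma> p)" "sub \<sigma> (FAll t r) = FAll (sub \<sigma> t) (sub (ups \<sigma>) r)"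
  "sub \<sigma> (FEx t r) = FEx (sub \<sigma> t) (sub (ups \<sigma>) r)" "sub \<sigma> (FEq t a b) = FEq (sub \<sigma> t) (sub \<sigma> a) (sub \<sigma> b)"
  by (simp_all add: squash_def FImp_def FConj_def FDisj_def FNot_def FAll_def FEx_def FEq_def sub_ups_sh sub_ups_upr)

lemmas sub_laws = sub_inst subc_instc sub_ups_sh subc_ups_sh sub_branch sub_formulas

context sigc begin

lemmas orig_intros = typing_has_univ_subtype_subcomp_valid.intros

text \<open>The class \<open>P\<close> of admissible substitutions is left open, with typed
  components and closure under lifting as its only requirements. A typed substitution can be lifted
  only once weakening is known, so the lemma is used twice: with renamings and then with
  \<open>sbt\<close>.\<close>

lemma orig_subst:
  assumes P1: "\<And>E \<sigma> \<Gamma> n. P E \<sigma> \<Gamma> \<Longrightarrow> n < length \<Gamma> \<Longrightarrow> typing S E (\<sigma> n) (Tot (sub \<sigma> (lk \<Gamma> n)))"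
    and P2: "\<And>E \<sigma> \<Gamma> t. P E \<sigma> \<Gamma> \<Longrightarrow> P (sub \<sigma> t # E) (ups \<sigma>) (t # \<Gamma>)"
  shows "typing S \<Gamma> e c \<Longrightarrow> P E \<sigma> \<Gamma> \<Longrightarrow> typing S E (sub \<sigma> e) (subc \<sigma> c)"
    and "has_univ S \<Gamma> c i \<Longrightarrow> P E \<sigma> \<Gamma> \<Longrightarrow> has_univ S E (subc \<sigma> c) i"
    and "subtype S \<Gamma> t t' \<Longrightarrow> P E \<sigma> \<Gamma> \<Longrightarrow> subtype S E (sub \<sigma> t) (sub \<sigma> t')"
    and "subcomp S \<Gamma> c c' \<Longrightarrow> P E \<sigma> \<Gamma> \<Longrightarrow> subcomp S E (subc \<sigma> c) (subc \<sigma> c')"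
    and "valid S \<Gamma> \<phi> \<Longrightarrow> P E \<sigma> \<Gamma> \<Longrightarrow> valid S E (sub \<sigma> \<phi>)"
proof (induct arbitrary: E \<sigma> and E \<sigma> and E \<sigma> and E \<sigma> and E \<sigma> rule: typing_has_univ_subtype_subcomp_valid.inducts)
  case (T_Var n \<Gamma>)
  from P1[OF T_Var(2,1)] show ?case by simp
next
  case (T_Con k t \<Gamma>)
  then show ?case by (simp add: orig_intros closed_sub[OF const_type_closed])
next
  case (T_App \<Gamma> e1 t c e2)
  show ?case using T_App(2,4)[OF T_App(5)] by (simp add: sub_laws) (rule orig_intros)
next
  case (T_CaseTot \<Gamma> e t1 t2 t k e1 e2)
  show ?case using T_CaseTot(2)[OF T_CaseTot(9)] T_CaseTot(4,6,8)[OF P2[OF T_CaseTot(9)]]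
    by (simp add: sub_laws) (rule orig_intros)
next
  case (T_CaseComp \<Gamma> e t1 t2 t M W e1 wp1 e2 wp2)
  show ?case using T_CaseComp(2,4)[OF T_CaseComp(10)] T_CaseComp(7,9)[OF P2[OF T_CaseComp(10)]] T_CaseComp(5) csD(12)[OF T_CaseComp(5)]
    orig_intros(8)[of S E "sub \<sigma> e" "sub \<sigma> t1" "sub \<sigma> t2" "sub \<sigma> t" M W "sub (ups \<sigma>) e1" "sub (ups \<sigma>) wp1" "sub (ups \<sigma>) e2" "sub (ups \<sigma>) wp2"]
    by (simp add: sub_laws closed_sub closed_ren)
next
  case (T_Return M r \<Gamma> t e)
  show ?case using T_Return(3,5)[OF T_Return(6)] csD(13)[OF T_Return(1)] T_Return(1)
    by (simp add: closed_sub) (rule orig_intros)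
next
  case (T_Bind M W b \<Gamma> t2 wp2 t1 e1 wp1 e2)
  have "typing S (sub \<sigma> t1 # E) (sub (ups \<sigma>) e2) (Comp M (sh (sub \<sigma> t2)) (sh (sub \<sigma> wp2) \<cdot> Var 0))"
    using T_Bind(10)[OF P2[OF T_Bind(11)]] by (simp add: sub_laws)
  with T_Bind(4,6,8)[OF T_Bind(11)] csD(12)[OF T_Bind(1)] csD(14)[OF T_Bind(2)] T_Bind(1,2)
    orig_intros(10)[of S M W b E "sub \<sigma> t2" "sub \<sigma> wp2" "sub \<sigma> t1" "sub \<sigma> e1" "sub \<sigma> wp1" "sub (ups \<sigma>) e2"]
  show ?case by (simp add: closed_sub sub_laws closed_ren)
next
  case (T_Lift M M' l l' \<Gamma> e t wp)
  show ?case using T_Lift(3)[OF T_Lift(4)] csD(8)[OF T_Lift(1)] T_Lift(1)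
    by (simp add: closed_sub) (rule orig_intros)
next
  case (T_Act F a A es \<Gamma>)
  have "typing S E (Act F a (map (sub \<sigma>) es)) (subc (args (map (sub \<sigma>) es)) (act_comp A))"
  proof (rule orig_intros(12)[OF T_Act(1)])
    show "\<forall>i<length (map (sub \<sigma>) es). typing S E (map (sub \<sigma>) es ! i) (Tot (sub (args (take i (map (sub \<sigma>) es))) (act_params A ! i)))"
    proof (intro allI impI)
      fix i assume i: "i < length (map (sub \<sigma>) es)"
      then have "scoped (length (take i es)) (act_params A ! i)" using csD(10)[OF T_Act(1)] T_Act(2) by simp
      from sub_args[OF this, of \<sigma>] have "sub (args (take i (map (sub \<sigma>) es))) (act_params A ! i) = sub \<sigma> (sub (args (take i es)) (act_params A ! i))"
        by (simp only: take_map)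
      moreover have "typing S E (sub \<sigma> (es ! i)) (subc \<sigma> (Tot (sub (args (take i es)) (act_params A ! i))))"
        using T_Act(3) i T_Act(4) by simp
      ultimately show "typing S E (map (sub \<sigma>) es ! i) (Tot (sub (args (take i (map (sub \<sigma>) es))) (act_params A ! i)))"
        using i by simp
    qed
  qed (simp add: T_Act(2))
  then show ?case using subc_args[of es "act_comp A" \<sigma>] csD(11)[OF T_Act(1)] T_Act(2) by simp
next
  case (T_Reify F D \<Gamma> e t wp)
  show ?case using T_Reify(3)[OF T_Reify(4)] csD(2)[OF T_Reify(1)] T_Reify(1)
    by (simp add: closed_sub orig_intros)
next
  case (T_Reflect F D \<Gamma> e t wp i)
  show ?case using T_Reflect(3,5)[OF T_Reflect(6)] csD(2)[OF T_Reflect(1)] T_Reflect(1)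
    by (simp add: closed_sub) (rule orig_intros)
next
  case (T_Run \<Gamma> e t wp)
  show ?case using T_Run(2,4)[OF T_Run(5)] orig_intros(15)[of S E "sub \<sigma> e" "sub \<sigma> t" "sub \<sigma> wp"] by (simp add: sub_laws)
next
  case (C_F F D \<Gamma> t wp)
  show ?case using C_F(3,5,7)[OF C_F(8)] csD(1,2)[OF C_F(1)] C_F(1)
    by (simp add: closed_sub) (rule orig_intros)
next
  case (S_Red t' t \<Gamma>)
  then show ?case by (simp add: orig_intros reds_sub)
next
  case (S_Exp t t' \<Gamma>)
  then show ?case by (simp add: orig_intros reds_sub)
next
  case (S_Trans \<Gamma> t1 t2 i t3)
  then show ?case using orig_intros(21) by fastforce
next
  case (SC_Trans \<Gamma> t1 t2 i t3)
  then show ?case using orig_intros(28) by fastforce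
next
  case (SC_Pure \<Gamma> t' t wp wp')
  show ?case using SC_Pure(2,4)[OF SC_Pure(5)] orig_intros(30)[of S E "sub \<sigma> t'" "sub \<sigma> t" "sub \<sigma> wp" "sub \<sigma> wp'"] by (simp add: sub_laws)
next
  case (SC_F F D \<Gamma> t' wp' t wp)
  show ?case using SC_F(3)[OF SC_F(4)] csD(2)[OF SC_F(1)] SC_F(1)
    by (simp add: closed_sub) (rule orig_intros)
next
  case (V_EqFun \<Gamma> f t t' g i)
  show ?case using V_EqFun(2,4,6)[OF V_EqFun(9)] V_EqFun(8)[OF P2[OF V_EqFun(9)]] by (simp add: sub_laws) (rule orig_intros)
next
  case (V_Inhab \<Gamma> e \<phi> i) then show ?case using orig_intros(32) by fastforce
next
  case (V_FalseE \<Gamma> \<phi> i) then show ?case using orig_intros(36) by fastforce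
next
  case (V_SquashE \<Gamma> \<phi>) then show ?case using orig_intros(35) by (fastforce simp: sub_laws)
next
  case (V_ImpE \<Gamma> \<phi>) then show ?case using orig_intros(39) by (fastforce simp: sub_laws)
next
  case (V_ConjE1 \<Gamma> \<phi>) then show ?case using orig_intros(41) by (fastforce simp: sub_laws)
next
  case (V_ConjE2 \<Gamma> \<phi>) then show ?case using orig_intros(42) by (fastforce simp: sub_laws)
next
  case (V_Refine \<Gamma> e t \<phi>) then show ?case using orig_intros(33) by (fastforce simp: sub_laws)
next
  case (V_AllE \<Gamma> t \<phi> e) 
  show ?case using V_AllE(2,4)[OF V_AllE(5)] by (simp add: sub_laws) (rule orig_intros)
next
  case (V_EqSubst \<Gamma> t e e' \<phi> i) 
  show ?case using V_EqSubst(2,6)[OF V_EqSubst(7)] V_EqSubst(4)[OF P2[OF V_EqSubst(7)]] by (simp add: sub_laws) (rule orig_intros)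
next
  case (V_Case \<Gamma> e t1 t2 \<phi> i)
  show ?case using V_Case(2)[OF V_Case(9)] V_Case(4,6,8)[OF P2[OF V_Case(9)]] by (simp add: sub_laws) (rule orig_intros)
next
  case (V_ExE \<Gamma> t \<phi> \<psi> i)
  show ?case using V_ExE(2,4)[OF V_ExE(7)] V_ExE(6)[OF P2[OF P2[OF V_ExE(7)]]] by (simp add: sub_laws) (rule orig_intros)
next
  case (V_DisjE \<Gamma> p q \<phi> i)
  show ?case using V_DisjE(2,4)[OF V_DisjE(9)] V_DisjE(6,8)[OF P2[OF V_DisjE(9)]] by (simp add: sub_laws) (rule orig_intros)
next
  case (V_Classical \<Gamma> \<phi> i)
  show ?case using V_Classical(2)[OF V_Classical(5)] V_Classical(4)[OF P2[OF V_Classical(5)]] by (simp add: sub_laws) (rule orig_intros)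
next
  case (V_EqRed \<Gamma> t i e e')
  show ?case using V_EqRed(2,4,6)[OF V_EqRed(8)] reds_sub[OF V_EqRed(7)] by (simp add: sub_laws) (rule orig_intros)
next
  case (V_ExI \<Gamma> t i \<phi> e)
  show ?case using V_ExI(2,6,8)[OF V_ExI(9)] V_ExI(4)[OF P2[OF V_ExI(9)]] by (simp add: sub_laws) (rule orig_intros)
next
  case (V_ImpI \<Gamma> p i q j)
  show ?case using V_ImpI(2,4)[OF V_ImpI(7)] V_ImpI(6)[OF P2[OF V_ImpI(7)]] by (simp add: sub_laws) (rule orig_intros)
next
  case (V_SquashI \<Gamma> \<phi> i)
  then show ?case by (simp add: sub_laws) (rule orig_intros)
next
  case (V_ConjI \<Gamma> p q i j)
  then show ?case by (simp add: sub_laws) (rule orig_intros)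
next
  case (V_DisjI1 \<Gamma> p i q j)
  then show ?case by (simp add: sub_laws) (rule orig_intros)
next
  case (V_DisjI2 \<Gamma> q p i j)
  then show ?case by (simp add: sub_laws) (rule orig_intros(44))
next
  case (V_AllI \<Gamma> t i \<phi> j)
  show ?case using V_AllI(2)[OF V_AllI(7)] V_AllI(4,6)[OF P2[OF V_AllI(7)]] by (simp add: sub_laws) (rule orig_intros)
next
  case (V_EqRefl \<Gamma> t i e)
  then show ?case by (simp add: sub_laws) (rule orig_intros)
next
  case (T_Sub \<Gamma> e c' c i)
  then show ?case using orig_intros(16) by fastforce
next
  case (T_Pi \<Gamma> t i c j)
  show ?case using T_Pi(2)[OF T_Pi(5)] T_Pi(4)[OF P2[OF T_Pi(5)]] by (simp add: sub_laws) (rule orig_intros)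
next
  case (T_Refine \<Gamma> t i c j)
  show ?case using T_Refine(2)[OF T_Refine(5)] T_Refine(4)[OF P2[OF T_Refine(5)]] by (simp add: sub_laws) (rule orig_intros)
next
  case (T_Lam \<Gamma> t i e c)
  show ?case using T_Lam(2)[OF T_Lam(5)] T_Lam(4)[OF P2[OF T_Lam(5)]] by (simp add: sub_laws) (rule orig_intros)
next
  case (S_Pi \<Gamma> t t' c' c)
  show ?case using S_Pi(2)[OF S_Pi(5)] S_Pi(4)[OF P2[OF S_Pi(5)]] by (simp add: sub_laws) (rule orig_intros)
next
  case (S_RefineR t \<Gamma> \<phi>)
  show ?case using S_RefineR(2)[OF P2[OF S_RefineR(3)]] by (simp add: sub_laws) (rule orig_intros)
qed (auto intro: orig_intros)

text \<open>Neither injectivity nor an order is required of \<open>r\<close>; it suffices that each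
  variable is sent to one of the renamed type. These maps are the extensions of worlds.\<close>

definition wk :: "tm list \<Rightarrow> (nat \<Rightarrow> nat) \<Rightarrow> tm list \<Rightarrow> bool" where
  "wk \<Gamma> r E \<longleftrightarrow> (\<forall>n<length \<Gamma>. r n < length E \<and> lk E (r n) = ren r (lk \<Gamma> n))"

lemma wk_up: "wk \<Gamma> r E \<Longrightarrow> wk (t # \<Gamma>) (upr r) (ren r t # E)"
  unfolding wk_def
proof (intro allI impI)
  fix n assume *: "\<forall>n<length \<Gamma>. r n < length E \<and> lk E (r n) = ren r (lk \<Gamma> n)"
    and n: "n < length (t # \<Gamma>)"
  show "upr r n < length (ren r t # E) \<and> ren (\<lambda>m. m + Suc (upr r n)) ((ren r t # E) ! upr r n) = ren (upr r) (lk (t # \<Gamma>) n)"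
  proof (cases n)
    case (Suc k)
    then have "ren Suc (lk E (r k)) = ren Suc (ren r (lk \<Gamma> k))" "r k < length E" using * n by auto
    then show ?thesis using Suc by (simp add: ren_ren)
  qed (simp add: ren_ren)
qed

lemma wk_id: "wk \<Gamma> (\<lambda>n. n) \<Gamma>"
  by (simp add: wk_def)

lemma wk_Suc: "wk \<Gamma> Suc (t # \<Gamma>)"
  by (simp add: wk_def ren_ren)

lemma wk_comp: "wk \<Gamma> r E \<Longrightarrow> wk E q \<Theta> \<Longrightarrow> wk \<Gamma> (\<lambda>n. q (r n)) \<Theta>"
  unfolding wk_def
proof (intro allI impI)
  fix n assume 1: "\<forall>n<length \<Gamma>. r n < length E \<and> lk E (r n) = ren r (lk \<Gamma> n)"
    and 2: "\<forall>n<length E. q n < length \<Theta> \<and> lk \<Theta> (q n) = ren q (lk E n)"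
    and n: "n < length \<Gamma>"
  from 1 n have r: "r n < length E" and e: "lk E (r n) = ren r (lk \<Gamma> n)" by blast+
  from 2 r have "q (r n) < length \<Theta>" "ren (\<lambda>m. m + Suc (q (r n))) (\<Theta> ! q (r n)) = ren q (ren r (lk \<Gamma> n))"
    unfolding e[symmetric] by blast+
  then show "q (r n) < length \<Theta> \<and> ren (\<lambda>m. m + Suc (q (r n))) (\<Theta> ! q (r n)) = ren (\<lambda>n. q (r n)) (lk \<Gamma> n)"
    by (simp add: ren_ren)
qed

lemma Var_upr: "(\<lambda>n. Var (upr r n)) = ups (\<lambda>n. Var (r n))"
  by (rule nat_ext) simp_all

definition rsb :: "tm list \<Rightarrow> (nat \<Rightarrow> tm) \<Rightarrow> tm list \<Rightarrow> bool" where
  "rsb E \<sigma> \<Gamma> \<longleftrightarrow> (\<exists>r. \<sigma> = (\<lambda>n. Var (r n)) \<and> wk \<Gamma> r E)"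

lemma rsb:
  "rsb E \<sigma> \<Gamma> \<Longrightarrow> n < length \<Gamma> \<Longrightarrow> \<exists>m<length E. \<sigma> n = Var m \<and> sub \<sigma> (lk \<Gamma> n) = lk E m"
  "rsb E \<sigma> \<Gamma> \<Longrightarrow> rsb (sub \<sigma> t # E) (ups \<sigma>) (t # \<Gamma>)"
  "wk \<Gamma> r E \<Longrightarrow> rsb E (\<lambda>n. Var (r n)) \<Gamma>"
proof -
  show "rsb E \<sigma> \<Gamma> \<Longrightarrow> n < length \<Gamma> \<Longrightarrow> \<exists>m<length E. \<sigma> n = Var m \<and> sub \<sigma> (lk \<Gamma> n) = lk E m"
    unfolding rsb_def wk_def by (metis ren_eq_sub)
  show "rsb E \<sigma> \<Gamma> \<Longrightarrow> rsb (sub \<sigma> t # E) (ups \<sigma>) (t # \<Gamma>)"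
    unfolding rsb_def by (metis Var_upr wk_up ren_eq_sub)
qed (auto simp: rsb_def)

lemma orig_ren:
  assumes "wk \<Gamma> r E"
  shows "typing S \<Gamma> e c \<Longrightarrow> typing S E (ren r e) (renc r c)"
    and "has_univ S \<Gamma> c i \<Longrightarrow> has_univ S E (renc r c) i"
    and "subtype S \<Gamma> t t' \<Longrightarrow> subtype S E (ren r t) (ren r t')"
    and "subcomp S \<Gamma> c c' \<Longrightarrow> subcomp S E (renc r c) (renc r c')"
    and "valid S \<Gamma> \<phi> \<Longrightarrow> valid S E (ren r \<phi>)"
  unfolding ren_eq_sub[of r] renc_eq_subc[of r]
  by (rule orig_subst[of rsb, OF _ rsb(2) _ rsb(3)[OF assms]], metis rsb(1) T_Var, assumption+)+

definition sbt :: "tm list \<Rightarrow> (nat \<Rightarrow> tm) \<Rightarrow> tm list \<Rightarrow> bool" where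
  "sbt E \<sigma> \<Gamma> \<longleftrightarrow> (\<forall>n<length \<Gamma>. typing S E (\<sigma> n) (Tot (sub \<sigma> (lk \<Gamma> n))))"

lemma sbt_up: assumes "sbt E \<sigma> \<Gamma>" shows "sbt (sub \<sigma> t # E) (ups \<sigma>) (t # \<Gamma>)"
  unfolding sbt_def
proof (intro allI impI)
  fix n assume n: "n < length (t # \<Gamma>)"
  show "typing S (sub \<sigma> t # E) (ups \<sigma> n) (Tot (sub (ups \<sigma>) (lk (t # \<Gamma>) n)))"
  proof (cases n)
    case 0
    then show ?thesis using orig_intros(1)[of 0 "sub \<sigma> t # E" S] by (simp add: sub_ren ren_sub)
  next
    case (Suc k)
    then show ?thesis using orig_ren(1)[OF wk_Suc, of E "\<sigma> k"] assms n by (fastforce simp: sbt_def sub_ren ren_sub)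
  qed
qed

lemma sbtD: "sbt E \<sigma> \<Gamma> \<Longrightarrow> n < length \<Gamma> \<Longrightarrow> typing S E (\<sigma> n) (Tot (sub \<sigma> (lk \<Gamma> n)))"
  unfolding sbt_def by blast

lemma valid_sub: assumes "sbt E \<sigma> \<Gamma>" "valid S \<Gamma> \<phi>" shows "valid S E (sub \<sigma> \<phi>)"
  by (rule orig_subst(5)[where P = sbt, OF _ _ assms(2,1)], erule (1) sbtD, erule sbt_up)

end

section \<open>Typing with explicit presuppositions\<close>

text \<open>
  The rules of \<open>typing\<close>, with the well-formedness of the types involved as further premises and, for the
  constructs that \<open>reify\<close> unfolds, the typing of their unfolding. This makes the fundamental theorem an
  induction on derivations. Validity remains that of the original system.
\<close>

inductive ty :: "signature \<Rightarrow> tm list \<Rightarrow> tm \<Rightarrow> comp \<Rightarrow> bool"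
  and hu :: "signature \<Rightarrow> tm list \<Rightarrow> comp \<Rightarrow> nat \<Rightarrow> bool"
  and st :: "signature \<Rightarrow> tm list \<Rightarrow> tm \<Rightarrow> tm \<Rightarrow> bool"
  and sc :: "signature \<Rightarrow> tm list \<Rightarrow> comp \<Rightarrow> comp \<Rightarrow> bool"
  for S :: signature
where
  Y_Var: "n < length \<Gamma> \<Longrightarrow> ty S \<Gamma> (Var n) (Tot (lk \<Gamma> n))"
| Y_Univ: "ty S \<Gamma> (Ty i) (Tot (Ty (Suc i)))"
| Y_Con: "\<lbrakk>const_type k t; \<forall>i. k \<noteq> Univ i; ty S \<Gamma> t (Tot (Ty i))\<rbrakk> \<Longrightarrow> ty S \<Gamma> (Con k) (Tot t)"
| Y_Pi: "\<lbrakk>ty S \<Gamma> t (Tot (Ty i)); hu S (t # \<Gamma>) c j\<rbrakk> \<Longrightarrow> ty S \<Gamma> (Pi t c) (Tot (Ty (max i j)))"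
| Y_Refine: "\<lbrakk>ty S \<Gamma> t (Tot (Ty i)); ty S (t # \<Gamma>) \<phi> (Tot (Ty j))\<rbrakk> \<Longrightarrow> ty S \<Gamma> (Refine t \<phi>) (Tot (Ty i))"
| Y_Lam: "\<lbrakk>ty S \<Gamma> t (Tot (Ty i)); hu S (t # \<Gamma>) c j; ty S (t # \<Gamma>) e c\<rbrakk> \<Longrightarrow> ty S \<Gamma> (Lam t e) (Tot (Pi t c))"
| Y_App: "\<lbrakk>ty S \<Gamma> e1 (Tot (Pi t c)); ty S \<Gamma> e2 (Tot t); ty S \<Gamma> t (Tot (Ty i)); hu S (t # \<Gamma>) c j\<rbrakk>
    \<Longrightarrow> ty S \<Gamma> (e1 \<cdot> e2) (instc c e2)"
| Y_CaseTot: "\<lbrakk>ty S \<Gamma> e (Tot (tsum t1 t2)); ty S \<Gamma> t1 (Tot (Ty i)); ty S \<Gamma> t2 (Tot (Ty j)); ty S \<Gamma> (tsum t1 t2) (Tot (Ty l));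
    ty S (tsum t1 t2 # \<Gamma>) t (Tot (Ty k));
    ty S (t1 # \<Gamma>) e1 (Tot (sub (scons (tinl (sh t1) (sh t2) (Var 0)) (\<lambda>n. Var (Suc n))) t));
    ty S (t2 # \<Gamma>) e2 (Tot (sub (scons (tinr (sh t1) (sh t2) (Var 0)) (\<lambda>n. Var (Suc n))) t))\<rbrakk>
    \<Longrightarrow> ty S \<Gamma> (Case t e e1 e2) (Tot (inst t e))"
| Y_CaseComp: "\<lbrakk>ty S \<Gamma> e (Tot (tsum t1 t2)); ty S \<Gamma> t1 (Tot (Ty i)); ty S \<Gamma> t2 (Tot (Ty j)); ty S \<Gamma> (tsum t1 t2) (Tot (Ty l));
    ty S \<Gamma> t (Tot (Ty 0)); wp_type_of S M = Some W; ty S \<Gamma> (W \<cdot> t) (Tot (Ty k));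
    ty S (t1 # \<Gamma>) e1 (Comp M (sh t) wp1); ty S (t2 # \<Gamma>) e2 (Comp M (sh t) wp2);
    ty S (t1 # \<Gamma>) wp1 (Tot (sh (W \<cdot> t))); ty S (t2 # \<Gamma>) wp2 (Tot (sh (W \<cdot> t)));
    hu S (t1 # \<Gamma>) (Comp M (sh t) wp1) 0; hu S (t2 # \<Gamma>) (Comp M (sh t) wp2) 0;
    hu S \<Gamma> (Comp M t (Case (sh (W \<cdot> t)) e wp1 wp2)) 0\<rbrakk>
    \<Longrightarrow> ty S \<Gamma> (Case (sh t) e e1 e2) (Comp M t (Case (sh (W \<cdot> t)) e wp1 wp2))"
| Y_ReturnP: "\<lbrakk>ty S \<Gamma> t (Tot (Ty 0)); ty S \<Gamma> e (Tot t); hu S \<Gamma> (Comp Pure t (pure_ret_star \<cdot> t \<cdot> e)) 0\<rbrakk>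
    \<Longrightarrow> ty S \<Gamma> (Return Pure t e) (Comp Pure t (pure_ret_star \<cdot> t \<cdot> e))"
| Y_ReturnF: "\<lbrakk>eff_of S F = Some D; ty S \<Gamma> t (Tot (Ty 0)); ty S \<Gamma> e (Tot t); hu S \<Gamma> (Comp (Usr F) t (ret_star D \<cdot> t \<cdot> e)) 0;
    ty S \<Gamma> (apps (ret D) [t, e]) (Tot (repr D \<cdot> t \<cdot> (ret_star D \<cdot> t \<cdot> e)))\<rbrakk>
    \<Longrightarrow> ty S \<Gamma> (Return (Usr F) t e) (Comp (Usr F) t (ret_star D \<cdot> t \<cdot> e))"
| Y_BindP: "\<lbrakk>ty S \<Gamma> t1 (Tot (Ty 0)); ty S \<Gamma> t2 (Tot (Ty 0)); ty S \<Gamma> wp2 (Tot (arr t1 (pure_wp_type \<cdot> t2)));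
    ty S \<Gamma> e1 (Comp Pure t1 wp1); ty S (t1 # \<Gamma>) e2 (Comp Pure (sh t2) (sh wp2 \<cdot> Var 0));
    hu S \<Gamma> (Comp Pure t1 wp1) 0; hu S (t1 # \<Gamma>) (Comp Pure (sh t2) (sh wp2 \<cdot> Var 0)) 0;
    hu S \<Gamma> (Comp Pure t2 (apps pure_bnd_star [t1, t2, wp1, wp2])) 0\<rbrakk>
    \<Longrightarrow> ty S \<Gamma> (Bind Pure t1 t2 wp1 e1 wp2 e2) (Comp Pure t2 (apps pure_bnd_star [t1, t2, wp1, wp2]))"
| Y_BindF: "\<lbrakk>eff_of S F = Some D; ty S \<Gamma> t1 (Tot (Ty 0)); ty S \<Gamma> t2 (Tot (Ty 0)); ty S \<Gamma> wp2 (Tot (arr t1 (wp_type D \<cdot> t2)));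
    ty S \<Gamma> e1 (Comp (Usr F) t1 wp1); ty S (t1 # \<Gamma>) e2 (Comp (Usr F) (sh t2) (sh wp2 \<cdot> Var 0));
    hu S \<Gamma> (Comp (Usr F) t1 wp1) 0; hu S (t1 # \<Gamma>) (Comp (Usr F) (sh t2) (sh wp2 \<cdot> Var 0)) 0;
    hu S \<Gamma> (Comp (Usr F) t2 (apps (bnd_star D) [t1, t2, wp1, wp2])) 0;
    ty S \<Gamma> (apps (bnd D) [t1, t2, wp1, Reify e1, wp2, Lam t1 (Reify e2)]) (Tot (repr D \<cdot> t2 \<cdot> apps (bnd_star D) [t1, t2, wp1, wp2]))\<rbrakk>
    \<Longrightarrow> ty S \<Gamma> (Bind (Usr F) t1 t2 wp1 e1 wp2 e2) (Comp (Usr F) t2 (apps (bnd_star D) [t1, t2, wp1, wp2]))"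
| Y_Lift: "\<lbrakk>lift_of S M (Usr F) = Some (l, l_star); eff_of S F = Some D; ty S \<Gamma> e (Comp M t wp); hu S \<Gamma> (Comp M t wp) 0;
    hu S \<Gamma> (Comp (Usr F) t (l_star \<cdot> t \<cdot> wp)) 0;
    ty S \<Gamma> (apps l [t, wp, rep M e]) (Tot (repr D \<cdot> t \<cdot> (l_star \<cdot> t \<cdot> wp)))\<rbrakk>
    \<Longrightarrow> ty S \<Gamma> (Lift M (Usr F) t wp e) (Comp (Usr F) t (l_star \<cdot> t \<cdot> wp))"
| Y_Act: "\<lbrakk>act_of S F a = Some A; eff_of S F = Some D; length es = length (act_params A);
    \<forall>i<length es. ty S \<Gamma> (es ! i) (Tot (sub (args (take i es)) (act_params A ! i)));
    \<forall>i<length es. \<exists>j. ty S (rev (take i (act_params A))) (act_params A ! i) (Tot (Ty j));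
    act_comp A = Comp (Usr F) t wp; hu S (rev (act_params A)) (act_comp A) 0;
    hu S \<Gamma> (Comp (Usr F) (sub (args es) t) (sub (args es) wp)) 0;
    ty S \<Gamma> (apps (act_impl A) es) (Tot (repr D \<cdot> sub (args es) t \<cdot> sub (args es) wp))\<rbrakk>
    \<Longrightarrow> ty S \<Gamma> (Act F a es) (Comp (Usr F) (sub (args es) t) (sub (args es) wp))"
| Y_Reify: "\<lbrakk>eff_of S F = Some D; ty S \<Gamma> e (Comp (Usr F) t wp); hu S \<Gamma> (Comp (Usr F) t wp) 0\<rbrakk>
    \<Longrightarrow> ty S \<Gamma> (Reify e) (Tot (repr D \<cdot> t \<cdot> wp))"
| Y_Reflect: "\<lbrakk>eff_of S F = Some D; ty S \<Gamma> e (Tot (repr D \<cdot> t \<cdot> wp)); hu S \<Gamma> (Comp (Usr F) t wp) 0\<rbrakk>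
    \<Longrightarrow> ty S \<Gamma> (Reflect e) (Comp (Usr F) t wp)"
| Y_Run: "\<lbrakk>ty S \<Gamma> e (Comp Pure t wp); valid S \<Gamma> (FEx (arr t (Ty 0)) (sh wp \<cdot> Var 0)); ty S \<Gamma> t (Tot (Ty 0))\<rbrakk>
    \<Longrightarrow> ty S \<Gamma> (Run e) (Tot t)"
| Y_Sub: "\<lbrakk>ty S \<Gamma> e c'; sc S \<Gamma> c' c; hu S \<Gamma> c' j; hu S \<Gamma> c i\<rbrakk> \<Longrightarrow> ty S \<Gamma> e c"

| H_Tot: "ty S \<Gamma> t (Tot (Ty i)) \<Longrightarrow> hu S \<Gamma> (Tot t) i"
| H_Pure: "\<lbrakk>ty S \<Gamma> t (Tot (Ty 0)); ty S \<Gamma> wp (Tot (arr (arr t (Ty 0)) (Ty 0)))\<rbrakk> \<Longrightarrow> hu S \<Gamma> (Comp Pure t wp) 0"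
| H_F: "\<lbrakk>eff_of S F = Some D; ty S \<Gamma> t (Tot (Ty 0)); ty S \<Gamma> wp (Tot (wp_type D \<cdot> t));
    ty S \<Gamma> (repr D \<cdot> t \<cdot> wp) (Tot (Ty 0))\<rbrakk> \<Longrightarrow> hu S \<Gamma> (Comp (Usr F) t wp) 0"

| ST_Refl: "st S \<Gamma> t t"
| ST_Trans: "\<lbrakk>st S \<Gamma> t1 t2; ty S \<Gamma> t2 (Tot (Ty i)); st S \<Gamma> t2 t3\<rbrakk> \<Longrightarrow> st S \<Gamma> t1 t3"
| ST_Pi: "\<lbrakk>ty S \<Gamma> t (Tot (Ty i)); st S \<Gamma> t t'; sc S (t # \<Gamma>) c' c\<rbrakk> \<Longrightarrow> st S \<Gamma> (Pi t' c') (Pi t c)"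
| ST_RefineL: "st S \<Gamma> (Refine t \<phi>) t"
| ST_RefineR: "valid S (t # \<Gamma>) \<phi> \<Longrightarrow> st S \<Gamma> t (Refine t \<phi>)"
| ST_Red: "reds S t' t \<Longrightarrow> st S \<Gamma> t' t"
| ST_Exp: "reds S t t' \<Longrightarrow> st S \<Gamma> t' t"

| SB_Refl: "sc S \<Gamma> c c"
| SB_Trans: "\<lbrakk>sc S \<Gamma> c1 c2; hu S \<Gamma> c2 i; sc S \<Gamma> c2 c3\<rbrakk> \<Longrightarrow> sc S \<Gamma> c1 c3"
| SB_Tot: "st S \<Gamma> t' t \<Longrightarrow> sc S \<Gamma> (Tot t') (Tot t)"
| SB_Pure: "\<lbrakk>st S \<Gamma> t' t; valid S \<Gamma> (FAll (arr t (Ty 0)) (FImp (sh wp \<cdot> Var 0) (sh wp' \<cdot> Var 0)))\<rbrakk>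
    \<Longrightarrow> sc S \<Gamma> (Comp Pure t' wp') (Comp Pure t wp)"
| SB_F: "\<lbrakk>eff_of S F = Some D; st S \<Gamma> (repr D \<cdot> t' \<cdot> wp') (repr D \<cdot> t \<cdot> wp)\<rbrakk>
    \<Longrightarrow> sc S \<Gamma> (Comp (Usr F) t' wp') (Comp (Usr F) t wp)"

lemmas ty_intros = ty_hu_st_sc.intros

lemma ty_orig:
  "ty S \<Gamma> e c \<Longrightarrow> typing S \<Gamma> e c"
  "hu S \<Gamma> c i \<Longrightarrow> has_univ S \<Gamma> c i"
  "st S \<Gamma> t t' \<Longrightarrow> subtype S \<Gamma> t t'"
  "sc S \<Gamma> c c' \<Longrightarrow> subcomp S \<Gamma> c c'"
proof (induct rule: ty_hu_st_sc.inducts)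
  case (Y_Univ \<Gamma> i) then show ?case by (intro typing_has_univ_subtype_subcomp_valid.intros const_type.intros)
next
  case (Y_CaseTot \<Gamma> e t1 t2 i j l t k e1 e2) then show ?case by - (rule T_CaseTot)
next
  case (Y_CaseComp \<Gamma> e t1 t2 i j l t M W k e1 wp1 e2 wp2) then show ?case by - (rule T_CaseComp)
next
  case (Y_ReturnP) then show ?case by (simp add: T_Return)
next
  case (Y_ReturnF) then show ?case by (simp add: T_Return)
next
  case (Y_BindP \<Gamma> t1 t2 wp2 e1 wp1 e2) then show ?case by - (rule T_Bind, simp_all)
next
  case (Y_BindF F D \<Gamma> t1 t2 wp2 e1 wp1 e2) then show ?case by - (rule T_Bind, simp_all)
next
  case (Y_Act F a A D es \<Gamma> t wp)
  then show ?case using T_Act[of S F a A es \<Gamma>] by simp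
qed (blast intro: typing_has_univ_subtype_subcomp_valid.intros)+

lemma ty_scoped:
  "ty S \<Gamma> e c \<Longrightarrow> scoped (length \<Gamma>) e"
  "hu S \<Gamma> c i \<Longrightarrow> scopedc (length \<Gamma>) c"
  "st S \<Gamma> t t' \<Longrightarrow> True"
  "sc S \<Gamma> c c' \<Longrightarrow> True"
proof (induct rule: ty_hu_st_sc.inducts)
  case (Y_Act F a A D es \<Gamma> t wp)
  then show ?case by (intro scoped_binders) (auto simp: in_set_conv_nth)
qed (auto intro: scoped_binders)

context sigc begin

abbreviation tyt :: "tm list \<Rightarrow> tm \<Rightarrow> tm \<Rightarrow> bool" where
  "tyt \<Gamma> e t \<equiv> ty S \<Gamma> e (Tot t)"
abbreviation isty :: "tm list \<Rightarrow> tm \<Rightarrow> nat \<Rightarrow> bool" where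
  "isty \<Gamma> t i \<equiv> ty S \<Gamma> t (Tot (Ty i))"

lemma ty_subst:
  assumes P1: "\<And>E \<sigma> \<Gamma> n. P E \<sigma> \<Gamma> \<Longrightarrow> n < length \<Gamma> \<Longrightarrow> tyt E (\<sigma> n) (sub \<sigma> (lk \<Gamma> n))"
    and P2: "\<And>E \<sigma> \<Gamma> t. P E \<sigma> \<Gamma> \<Longrightarrow> P (sub \<sigma> t # E) (ups \<sigma>) (t # \<Gamma>)"
  shows "ty S \<Gamma> e c \<Longrightarrow> P E \<sigma> \<Gamma> \<Longrightarrow> ty S E (sub \<sigma> e) (subc \<sigma> c)"
    and "hu S \<Gamma> c i \<Longrightarrow> P E \<sigma> \<Gamma> \<Longrightarrow> hu S E (subc \<sigma> c) i"
    and "st S \<Gamma> t t' \<Longrightarrow> P E \<sigma> \<Gamma> \<Longrightarrow> st S E (sub \<sigma> t) (sub \<sigma> t')"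
    and "sc S \<Gamma> c c' \<Longrightarrow> P E \<sigma> \<Gamma> \<Longrightarrow> sc S E (subc \<sigma> c) (subc \<sigma> c')"
proof -
  \<comment> \<open>Validity stays a judgment of the original system, so its instances are obtained
    there, after viewing the components of \<open>\<sigma>\<close> as terms of that system.\<close>
  have vs: "valid S E (sub \<sigma> \<phi>)" if "P E \<sigma> \<Gamma>" "valid S \<Gamma> \<phi>" for E \<sigma> \<Gamma> \<phi>
    by (rule valid_sub[OF _ that(2)]) (auto simp: sbt_def intro: ty_orig(1) P1[OF that(1)] simp del: add_Suc_right)
  show "ty S \<Gamma> e c \<Longrightarrow> P E \<sigma> \<Gamma> \<Longrightarrow> ty S E (sub \<sigma> e) (subc \<sigma> c)"
    and "hu S \<Gamma> c i \<Longrightarrow> P E \<sigma> \<Gamma> \<Longrightarrow> hu S E (subc \<sigma> c) i"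
    and "st S \<Gamma> t t' \<Longrightarrow> P E \<sigma> \<Gamma> \<Longrightarrow> st S E (sub \<sigma> t) (sub \<sigma> t')"
    and "sc S \<Gamma> c c' \<Longrightarrow> P E \<sigma> \<Gamma> \<Longrightarrow> sc S E (subc \<sigma> c) (subc \<sigma> c')"
  proof (induct arbitrary: E \<sigma> and E \<sigma> and E \<sigma> and E \<sigma> rule: ty_hu_st_sc.inducts)
    case (Y_Var n \<Gamma>)
    from P1[OF Y_Var(2,1)] show ?case by simp
  next
    case (Y_Univ \<Gamma> i)
    then show ?case by (simp add: ty_intros)
  next
    case (Y_Con k t \<Gamma> i)
    show ?case using Y_Con(4)[OF Y_Con(5)] by (simp add: closed_sub[OF const_type_closed[OF Y_Con(1)]]) (rule ty_hu_st_sc.Y_Con[OF Y_Con(1,2)])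
  next
    case (Y_Pi \<Gamma> t i c j)
    show ?case using Y_Pi(2)[OF Y_Pi(5)] Y_Pi(4)[OF P2[OF Y_Pi(5)]] by simp (rule ty_intros)
  next
    case (Y_Refine \<Gamma> t i \<phi> j)
    show ?case using Y_Refine(2)[OF Y_Refine(5)] Y_Refine(4)[OF P2[OF Y_Refine(5)]] by simp (rule ty_intros)
  next
    case (Y_Lam \<Gamma> t i c j e)
    show ?case using Y_Lam(2)[OF Y_Lam(7)] Y_Lam(4,6)[OF P2[OF Y_Lam(7)]] by simp (rule ty_intros)
  next
    case (Y_App \<Gamma> e1 t c e2 i j)
    show ?case using Y_App(2,4,6)[OF Y_App(9)] Y_App(8)[OF P2[OF Y_App(9)]] by (simp add: sub_laws) (rule ty_intros)
  next
    case (Y_CaseTot \<Gamma> e t1 t2 i j l t k e1 e2)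
    show ?case using Y_CaseTot(2,4,6,8)[OF Y_CaseTot(15)] Y_CaseTot(10,12,14)[OF P2[OF Y_CaseTot(15)]] by (simp add: sub_laws) (rule ty_intros)
  next
    case (Y_CaseComp \<Gamma> e t1 t2 i j l t M W k e1 wp1 e2 wp2)
    note I = Y_CaseComp(28) and H = Y_CaseComp
    show ?case using H(2,4,6,8,10,13,27)[OF I] H(15,17,19,21,23,25)[OF P2[OF I]] H(11) csD(12)[OF H(11)]
      ty_hu_st_sc.Y_CaseComp[of S E "sub \<sigma> e" "sub \<sigma> t1" "sub \<sigma> t2" i j l "sub \<sigma> t" M W k "sub (ups \<sigma>) e1" "sub (ups \<sigma>) wp1" "sub (ups \<sigma>) e2" "sub (ups \<sigma>) wp2"]
      by (simp add: sub_laws closed_sub closed_ren)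
  next
    case (Y_ReturnP \<Gamma> t e)
    show ?case using Y_ReturnP(2,4,6)[OF Y_ReturnP(7)] by (simp add: closed_sub closed_pure) (rule ty_intros)
  next
    case (Y_ReturnF F D \<Gamma> t e)
    show ?case using Y_ReturnF(3,5,7,9)[OF Y_ReturnF(10)] csD(1-6)[OF Y_ReturnF(1)] ty_hu_st_sc.Y_ReturnF[OF Y_ReturnF(1), of E "sub \<sigma> t" "sub \<sigma> e"]
      by (simp add: closed_sub)
  next
    case (Y_BindP \<Gamma> t1 t2 wp2 e1 wp1 e2)
    note I = Y_BindP(17) and H = Y_BindP
    show ?case using H(2,4,6,8,12,16)[OF I] H(10,14)[OF P2[OF I]]
      ty_hu_st_sc.Y_BindP[of S E "sub \<sigma> t1" "sub \<sigma> t2" "sub \<sigma> wp2" "sub \<sigma> e1" "sub \<sigma> wp1" "sub (ups \<sigma>) e2"]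
      by (simp add: sub_laws closed_sub closed_ren closed_pure)
  next
    case (Y_BindF F D \<Gamma> t1 t2 wp2 e1 wp1 e2)
    note I = Y_BindF(20) and H = Y_BindF
    show ?case using H(3,5,7,9,13,17,19)[OF I] H(11,15)[OF P2[OF I]] csD(1-6)[OF H(1)]
      ty_hu_st_sc.Y_BindF[OF H(1), of E "sub \<sigma> t1" "sub \<sigma> t2" "sub \<sigma> wp2" "sub \<sigma> e1" "sub \<sigma> wp1" "sub (ups \<sigma>) e2"]
      by (simp add: sub_laws closed_sub closed_ren closed_pure)
  next
    case (Y_Lift M F l l_star D \<Gamma> e t wp)
    note I = Y_Lift(11) and H = Y_Lift
    show ?case using H(4,6,8,10)[OF I] csD(1-6)[OF H(2)] csD(7,8)[OF H(1)]
      ty_hu_st_sc.Y_Lift[OF H(1,2), of E "sub \<sigma> e" "sub \<sigma> t" "sub \<sigma> wp"]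
      by (simp add: sub_laws closed_sub closed_ren sub_rep)
  next
    case (Y_Act F a A D es \<Gamma> t wp)
    note H = Y_Act
    from csD(11)[OF H(1)] H(3,6) have s: "scoped (length es) t" "scoped (length es) wp" by auto
    have "ty S E (Act F a (map (sub \<sigma>) es)) (Comp (Usr F) (sub (args (map (sub \<sigma>) es)) t) (sub (args (map (sub \<sigma>) es)) wp))"
    proof (rule ty_hu_st_sc.Y_Act[OF H(1,2) _ _ _ H(6)])
      show "\<forall>i<length (map (sub \<sigma>) es). tyt E (map (sub \<sigma>) es ! i) (sub (args (take i (map (sub \<sigma>) es))) (act_params A ! i))"
      proof (intro allI impI)
        fix i assume i: "i < length (map (sub \<sigma>) es)"
        then have "scoped (length (take i es)) (act_params A ! i)" using csD(10)[OF H(1)] H(3) by simp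
        from sub_args[OF this, of \<sigma>] have "sub (args (take i (map (sub \<sigma>) es))) (act_params A ! i) = sub \<sigma> (sub (args (take i es)) (act_params A ! i))"
          by (simp only: take_map)
        moreover have "ty S E (sub \<sigma> (es ! i)) (subc \<sigma> (Tot (sub (args (take i es)) (act_params A ! i))))"
          using H(4) i H(13) by simp
        ultimately show "tyt E (map (sub \<sigma>) es ! i) (sub (args (take i (map (sub \<sigma>) es))) (act_params A ! i))"
          using i by simp
      qed
    next
      show "\<forall>i<length (map (sub \<sigma>) es). \<exists>j. isty (rev (take i (act_params A))) (act_params A ! i) j" using H(5) by auto
    qed (use H(3,7) H(10,12)[OF H(13)] csD(9)[OF H(1)] csD(2)[OF H(2)] s in \<open>simp_all add: sub_args sub_apps closed_sub\<close>)
    then show ?case using s by (simp add: sub_args)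
  next
    case (Y_Reify F D \<Gamma> e t wp)
    show ?case using Y_Reify(3,5)[OF Y_Reify(6)] csD(1-6)[OF Y_Reify(1)] ty_hu_st_sc.Y_Reify[OF Y_Reify(1), of E "sub \<sigma> e"] by (simp add: closed_sub)
  next
    case (Y_Reflect F D \<Gamma> e t wp)
    show ?case using Y_Reflect(3,5)[OF Y_Reflect(6)] csD(1-6)[OF Y_Reflect(1)] ty_hu_st_sc.Y_Reflect[OF Y_Reflect(1), of E "sub \<sigma> e"] by (simp add: closed_sub)
  next
    case (Y_Run \<Gamma> e t wp)
    show ?case using Y_Run(2,5)[OF Y_Run(6)] vs[OF Y_Run(6,3)] ty_hu_st_sc.Y_Run[of S E "sub \<sigma> e" "sub \<sigma> t" "sub \<sigma> wp"] by (simp add: sub_laws)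
  next
    case (Y_Sub \<Gamma> e c' c j i)
    then show ?case using ty_hu_st_sc.Y_Sub by fastforce
  next
    case (H_F F D \<Gamma> t wp)
    show ?case using H_F(3,5,7)[OF H_F(8)] csD(1-6)[OF H_F(1)] ty_hu_st_sc.H_F[OF H_F(1)] by (simp add: closed_sub)
  next
    case (ST_Trans \<Gamma> t1 t2 i t3)
    then show ?case using ty_hu_st_sc.ST_Trans by fastforce
  next
    case (ST_Pi \<Gamma> t i t' c' c)
    show ?case using ST_Pi(2,4)[OF ST_Pi(7)] ST_Pi(6)[OF P2[OF ST_Pi(7)]] by simp (rule ty_intros)
  next
    case (ST_RefineR t \<Gamma> \<phi>)
    show ?case using vs[OF P2[OF ST_RefineR(2)] ST_RefineR(1)] by simp (rule ty_intros)
  next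
    case (ST_Red t' t \<Gamma>)
    then show ?case by (simp add: ty_intros reds_sub)
  next
    case (ST_Exp t' t \<Gamma>)
    then show ?case by (simp add: ty_intros reds_sub)
  next
    case (SB_Trans \<Gamma> t1 t2 i t3)
    then show ?case using ty_hu_st_sc.SB_Trans by fastforce
  next
    case (SB_Pure \<Gamma> t' t wp wp')
    show ?case using SB_Pure(2)[OF SB_Pure(4)] vs[OF SB_Pure(4,3)] ty_hu_st_sc.SB_Pure[of S E "sub \<sigma> t'" "sub \<sigma> t" "sub \<sigma> wp" "sub \<sigma> wp'"] by (simp add: sub_laws)
  next
    case (SB_F F D \<Gamma> t' wp' t wp)
    show ?case using SB_F(3)[OF SB_F(4)] csD(1-6)[OF SB_F(1)] ty_hu_st_sc.SB_F[OF SB_F(1)] by (simp add: closed_sub)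
  qed (auto intro: ty_intros)
qed

lemma ty_ren:
  assumes "wk \<Gamma> r E"
  shows "ty S \<Gamma> e c \<Longrightarrow> ty S E (ren r e) (renc r c)"
    and "hu S \<Gamma> c i \<Longrightarrow> hu S E (renc r c) i"
    and "st S \<Gamma> t t' \<Longrightarrow> st S E (ren r t) (ren r t')"
    and "sc S \<Gamma> c c' \<Longrightarrow> sc S E (renc r c) (renc r c')"
  unfolding ren_eq_sub[of r] renc_eq_subc[of r]
  by (rule ty_subst[of rsb, OF _ rsb(2) _ rsb(3)[OF assms]], metis rsb(1) Y_Var, assumption+)+

definition tsb :: "tm list \<Rightarrow> (nat \<Rightarrow> tm) \<Rightarrow> tm list \<Rightarrow> bool" where
  "tsb E \<sigma> \<Gamma> \<longleftrightarrow> (\<forall>n<length \<Gamma>. tyt E (\<sigma> n) (sub \<sigma> (lk \<Gamma> n)))"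

lemma tsbD: "tsb E \<sigma> \<Gamma> \<Longrightarrow> n < length \<Gamma> \<Longrightarrow> tyt E (\<sigma> n) (sub \<sigma> (lk \<Gamma> n))"
  unfolding tsb_def by blast

lemma sub_scons_drop: "sub (scons a \<sigma>) (ren (\<lambda>m. m + Suc (Suc n)) t) = sub \<sigma> (ren (\<lambda>m. m + Suc n) t)"
  "sub (scons a \<sigma>) (ren (\<lambda>m. m + Suc 0) t) = sub \<sigma> t"
  by (simp_all add: sub_ren)

lemma tsb_cons: "tsb E \<sigma> \<Gamma> \<Longrightarrow> tyt E a (sub \<sigma> t) \<Longrightarrow> tsb E (scons a \<sigma>) (t # \<Gamma>)"
  unfolding tsb_def
proof (intro allI impI)
  fix n assume 1: "\<forall>n<length \<Gamma>. tyt E (\<sigma> n) (sub \<sigma> (lk \<Gamma> n))" "tyt E a (sub \<sigma> t)" "n < length (t # \<Gamma>)"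
  show "tyt E (scons a \<sigma> n) (sub (scons a \<sigma>) (lk (t # \<Gamma>) n))"
  proof (cases n)
    case 0 then show ?thesis using 1(2) by (simp only: sub_scons_drop scons_simps nth_Cons_0)
  next
    case (Suc k) then show ?thesis using 1 by (simp only: sub_scons_drop scons_simps nth_Cons_Suc length_Cons Suc_less_eq)
  qed
qed

lemma tsb_Var: "tsb \<Gamma> Var \<Gamma>"
  unfolding tsb_def using Y_Var by simp

lemma tsb_ren: "tsb E \<sigma> \<Gamma> \<Longrightarrow> wk E r \<Theta> \<Longrightarrow> tsb \<Theta> (\<lambda>n. ren r (\<sigma> n)) \<Gamma>"
  unfolding tsb_def
proof (intro allI impI)
  fix n assume 1: "\<forall>n<length \<Gamma>. tyt E (\<sigma> n) (sub \<sigma> (lk \<Gamma> n))" "wk E r \<Theta>" "n < length \<Gamma>"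
  show "tyt \<Theta> (ren r (\<sigma> n)) (sub (\<lambda>n. ren r (\<sigma> n)) (lk \<Gamma> n))"
    using ty_ren(1)[OF 1(2) 1(1)[rule_format, OF 1(3)]] by (simp only: renc.simps ren_sub)
qed

lemma tsb_up: assumes "tsb E \<sigma> \<Gamma>" shows "tsb (sub \<sigma> t # E) (ups \<sigma>) (t # \<Gamma>)"
proof -
  have "ups \<sigma> = scons (Var 0) (\<lambda>n. ren Suc (\<sigma> n))" by (rule nat_ext) simp_all
  then show ?thesis using tsb_cons[OF tsb_ren[OF assms wk_Suc], of "sub \<sigma> t" "Var 0" t] Y_Var[of 0 "sub \<sigma> t # E" S] by (simp add: ren_sub)
qed

lemma ty_sub:
  assumes "tsb E \<sigma> \<Gamma>"
  shows "ty S \<Gamma> e c \<Longrightarrow> ty S E (sub \<sigma> e) (subc \<sigma> c)"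
    and "hu S \<Gamma> c i \<Longrightarrow> hu S E (subc \<sigma> c) i"
    and "st S \<Gamma> t t' \<Longrightarrow> st S E (sub \<sigma> t) (sub \<sigma> t')"
    and "sc S \<Gamma> c c' \<Longrightarrow> sc S E (subc \<sigma> c) (subc \<sigma> c')"
  by (rule ty_subst[where P = tsb, OF _ _ _ assms], erule (1) tsbD, erule tsb_up, assumption)+

end

section \<open>Conversion\<close>

context sigc begin

lemma hu_inv:
  "hu S \<Gamma> (Tot X) i \<Longrightarrow> isty \<Gamma> X i"
  "hu S \<Gamma> (Comp Pure t wp) i \<Longrightarrow> i = 0 \<and> isty \<Gamma> t 0 \<and> tyt \<Gamma> wp (arr (arr t (Ty 0)) (Ty 0))"
  "hu S \<Gamma> (Comp (Usr F) t wp) i \<Longrightarrow> i = 0 \<and> isty \<Gamma> t 0 \<and>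
     (\<exists>D. eff_of S F = Some D \<and> tyt \<Gamma> wp (wp_type D \<cdot> t) \<and> isty \<Gamma> (repr D \<cdot> t \<cdot> wp) 0)"
  by (erule hu.cases; auto)+

lemma hu_t: "hu S \<Gamma> (Comp M t wp) i \<Longrightarrow> isty \<Gamma> t 0" "hu S \<Gamma> (Comp M t wp) i \<Longrightarrow> i = 0"
  by (cases M; auto dest: hu_inv)+

lemma pi_inv_aux:
  "ty S \<Gamma> e C \<Longrightarrow> e = Pi t c \<Longrightarrow> \<exists>i j. isty \<Gamma> t i \<and> hu S (t # \<Gamma>) c j"
  "hu S \<Gamma> C k \<Longrightarrow> True" "st S \<Gamma> x y \<Longrightarrow> True" "sc S \<Gamma> C C' \<Longrightarrow> True"
  by (induct rule: ty_hu_st_sc.inducts) auto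

lemma pi_inv: "ty S \<Gamma> (Pi t c) C \<Longrightarrow> \<exists>i j. isty \<Gamma> t i \<and> hu S (t # \<Gamma>) c j"
  using pi_inv_aux(1) by blast

lemma hu_Ty: "hu S \<Gamma> (Tot (Ty i)) (Suc i)"
  by (intro ty_intros)

lemma tsb_single: "tyt E a F \<Longrightarrow> tsb E (scons a Var) (F # E)"
  using tsb_cons[OF tsb_Var, of E a F] by simp

lemma ty_inst: "ty S (F # E) e c \<Longrightarrow> tyt E a F \<Longrightarrow> ty S E (inst e a) (instc c a)"
  and hu_inst: "hu S (F # E) c i \<Longrightarrow> tyt E a F \<Longrightarrow> hu S E (instc c a) i"
  using ty_sub(1,2)[OF tsb_single] by (auto simp: inst_def instc_def)

lemma ty_st: "tyt \<Gamma> e X \<Longrightarrow> st S \<Gamma> X Y \<Longrightarrow> isty \<Gamma> X i \<Longrightarrow> isty \<Gamma> Y j \<Longrightarrow> tyt \<Gamma> e Y"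
  by (meson SB_Tot Y_Sub H_Tot)

lemma ty_arr: "isty \<Gamma> a i \<Longrightarrow> isty \<Gamma> b j \<Longrightarrow> isty \<Gamma> (arr a b) (max i j)"
  using ty_ren(1)[OF wk_Suc, of \<Gamma> b "Tot (Ty j)"] by (auto intro: ty_intros)

lemma ty_unit: "isty \<Gamma> tunit 0"
  by (rule Y_Con[OF const_type.intros(2) _ Y_Univ]) simp

lemma ty_squash: "isty \<Gamma> p j \<Longrightarrow> isty \<Gamma> (squash p) 0"
  unfolding squash_def using ty_ren(1)[OF wk_Suc, of \<Gamma> p "Tot (Ty j)" tunit] Y_Refine[OF ty_unit] by simp

abbreviation edge :: "tm list \<Rightarrow> comp \<Rightarrow> tm \<Rightarrow> tm \<Rightarrow> bool" where
  "edge E c x y \<equiv> ty S E x c \<and> ty S E y c \<and> (reds S x y \<or> reds S y x)"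

text \<open>Conversion through well-typed vertices; the reductions along an edge need not preserve typing.\<close>

definition cv :: "tm list \<Rightarrow> comp \<Rightarrow> tm \<Rightarrow> tm \<Rightarrow> bool" where
  "cv E c x y \<longleftrightarrow> ty S E x c \<and> (edge E c)\<^sup>*\<^sup>* x y"

lemma cv_refl: "ty S E x c \<Longrightarrow> cv E c x x"
  by (simp add: cv_def)
lemma cv_ty1: "cv E c x y \<Longrightarrow> ty S E x c"
  by (simp add: cv_def)
lemma cv_ty2: assumes "cv E c x y" shows "ty S E y c"
proof -
  have "(edge E c)\<^sup>*\<^sup>* x y" "ty S E x c" using assms by (auto simp: cv_def)
  then show ?thesis by (induct rule: rtranclp_induct) auto
qed
lemma cv_trans: "cv E c x y \<Longrightarrow> cv E c y z \<Longrightarrow> cv E c x z"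
  unfolding cv_def by auto
lemma cv_red: "ty S E x c \<Longrightarrow> ty S E y c \<Longrightarrow> reds S x y \<Longrightarrow> cv E c x y"
  unfolding cv_def by (auto intro!: r_into_rtranclp)
lemma cv_exp: "ty S E x c \<Longrightarrow> ty S E y c \<Longrightarrow> reds S y x \<Longrightarrow> cv E c x y"
  unfolding cv_def by (auto intro!: r_into_rtranclp)
lemma cv_sym: assumes "cv E c x y" shows "cv E c y x"
proof -
  have "(edge E c)\<^sup>*\<^sup>* x y" "ty S E x c" using assms by (auto simp: cv_def)
  then show ?thesis by (induct rule: rtranclp_induct) (auto intro: cv_refl cv_red cv_exp cv_trans)
qed

text \<open>An edge asks only for a reduction between its ends and for typability of the ends, so a
  context that preserves reduction maps a chain to a chain as soon as the images of the vertices are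
  typed. Each vertex is known to be convertible to \<open>a\<close>, on which this typing may
  depend.\<close>

lemma cv_map:
  assumes cv: "cv E c a b" and r: "\<And>x y. reds S x y \<Longrightarrow> reds S (f x) (f y)" and t: "\<And>x. cv E c a x \<Longrightarrow> ty S E' (f x) c'"
  shows "cv E' c' (f a) (f b)"
proof -
  have *: "(edge E c)\<^sup>*\<^sup>* a b" and a: "ty S E a c" using cv by (auto simp: cv_def)
  from * have "cv E c a b \<and> cv E' c' (f a) (f b)"
  proof (induct rule: rtranclp_induct)
    case base
    then show ?case using a t[OF cv_refl] by (auto intro: cv_refl)
  next
    case (step y z)
    then have z: "cv E c a z" by (auto intro: cv_trans cv_red cv_exp)
    then have "edge E' c' (f y) (f z)" using step t r by blast
    then show ?case using step(3) z by (auto intro: cv_trans cv_red cv_exp)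
  qed
  then show ?thesis by simp
qed

lemma cv_ren: "wk E r E' \<Longrightarrow> cv E c x y \<Longrightarrow> cv E' (renc r c) (ren r x) (ren r y)"
  by (erule cv_map) (auto intro: reds_ren dest: cv_ty2 ty_ren(1))

lemma cv_sc: "cv E c x y \<Longrightarrow> sc S E c c' \<Longrightarrow> hu S E c i \<Longrightarrow> hu S E c' j \<Longrightarrow> cv E c' x y"
  using cv_map[of E c x y "\<lambda>x. x" E c'] cv_ty2 Y_Sub by blast

text \<open>Transitivity of subtyping passes only through well-formed types, and the vertices of a
  conversion at a universe are such types.\<close>

lemma cv_st: assumes "cv E (Tot (Ty i)) X Y" shows "st S E X Y"
proof -
  have *: "(edge E (Tot (Ty i)))\<^sup>*\<^sup>* X Y" using assms by (auto simp: cv_def)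
  then show ?thesis by (induct rule: rtranclp_induct) (auto intro: ST_Refl ST_Trans ST_Red ST_Exp)
qed

lemma cv_conv: "cv E (Tot X) x y \<Longrightarrow> cv E (Tot (Ty i)) X Y \<Longrightarrow> cv E (Tot Y) x y"
  by (rule cv_sc[OF _ SB_Tot[OF cv_st] H_Tot[OF cv_ty1] H_Tot[OF cv_ty2]])

lemma ty_conv: "tyt E x X \<Longrightarrow> cv E (Tot (Ty i)) X Y \<Longrightarrow> tyt E x Y"
  by (metis cv_conv cv_refl cv_ty1)

lemma reds_AppL: "reds S x y \<Longrightarrow> reds S (x \<cdot> a) (y \<cdot> a)"
  by (induct rule: rtranclp_induct) (auto intro: E_AppL rtranclp.rtrancl_into_rtrancl)
lemma reds_AppR: "reds S x y \<Longrightarrow> reds S (a \<cdot> x) (a \<cdot> y)"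
  by (induct rule: rtranclp_induct) (auto intro: E_AppR rtranclp.rtrancl_into_rtrancl)
lemma reds_App: "reds S x y \<Longrightarrow> reds S a b \<Longrightarrow> reds S (x \<cdot> a) (y \<cdot> b)"
  by (meson reds_AppL reds_AppR rtranclp_trans)
lemma reds_Lam: "reds S x y \<Longrightarrow> reds S (Lam t x) (Lam t y)"
  by (induct rule: rtranclp_induct) (auto intro: E_Lam rtranclp.rtrancl_into_rtrancl)
lemma reds_Reify: "reds S x y \<Longrightarrow> reds S (Reify x) (Reify y)"
  by (induct rule: rtranclp_induct) (auto intro: E_Reify rtranclp.rtrancl_into_rtrancl)
lemma reds_Run: "reds S x y \<Longrightarrow> reds S (Run x) (Run y)"
  by (induct rule: rtranclp_induct) (auto intro: E_Run rtranclp.rtrancl_into_rtrancl)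
lemma reds_Case: "reds S x y \<Longrightarrow> reds S (Case t x a b) (Case t y a b)"
  by (induct rule: rtranclp_induct) (auto intro: E_Case rtranclp.rtrancl_into_rtrancl)

text \<open>The instances at \<open>a\<close> and at one of its reducts need not be linked by
  reduction, since the variable may sit in a type annotation or in a product. Both are contracta of
  \<open>Lam F e\<close> applied to the argument, and there the argument does reduce.
  \<open>H\<close> brings the types of the vertices back to the one at \<open>a\<close>. For types
  it is trivial, as their classifier is a universe, and the case of types then supplies
  \<open>H\<close> for terms.\<close>

lemma cv_inst_term:
  assumes F: "isty E F k" and c: "hu S (F # E) c i" and e: "ty S (F # E) e c"
    and ab: "cv E (Tot F) a b" and H: "\<And>x. cv E (Tot F) a x \<Longrightarrow> sc S E (instc c x) (instc c a)"
  shows "cv E (instc c a) (inst e a) (inst e b)"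
proof -
  have t: "ty S E (Lam F e \<cdot> x) (instc c a)" "ty S E (inst e x) (instc c a)" if x: "cv E (Tot F) a x" for x
    using Y_App[OF Y_Lam[OF F c e] cv_ty2[OF x] F c] ty_inst[OF e cv_ty2[OF x]] H[OF x] hu_inst[OF c cv_ty2[OF x]] hu_inst[OF c cv_ty1[OF x]]
    by (blast intro: Y_Sub)+
  have b: "reds S (Lam F e \<cdot> x) (inst e x)" for x by (blast intro: R_Beta)
  have "cv E (instc c a) (Lam F e \<cdot> a) (Lam F e \<cdot> b)"
    by (rule cv_map[OF ab reds_AppR]) (auto intro: t)
  then show ?thesis using t[OF ab] t[OF cv_refl[OF cv_ty1[OF ab]]] b
    by (meson cv_exp cv_red cv_trans)
qed

lemma cv_inst_type: "isty E F k \<Longrightarrow> isty (F # E) X i \<Longrightarrow> cv E (Tot F) a b \<Longrightarrow>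
   cv E (Tot (Ty i)) (inst X a) (inst X b)"
  using cv_inst_term[of E F k "Tot (Ty i)" "Suc i" X a b] hu_Ty by (auto intro: SB_Refl)

text \<open>With a generic postcondition and a proof of \<open>w\<close> at it in the context, the
  variable for this proof also has the convertible type given by \<open>w'\<close>, and an inhabited
  formula is valid.\<close>

lemma valid_cv:
  assumes t: "isty E t 0" and cv: "cv E (Tot (arr (arr t (Ty 0)) (Ty 0))) w w'"
  shows "valid S E (FAll (arr t (Ty 0)) (FImp (sh w \<cdot> Var 0) (sh w' \<cdot> Var 0)))"
proof -
  let ?P = "arr t (Ty 0)" let ?A = "sh w \<cdot> Var 0" and ?B = "sh w' \<cdot> Var 0"
  have P: "isty E ?P (Suc 0)" using ty_arr[OF t Y_Univ, of 0] by simp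
  have P': "isty (?P # E) (sh ?P) (Suc 0)" using ty_ren(1)[OF wk_Suc P] by simp
  have cv': "cv (?P # E) (Tot (arr (sh ?P) (Ty 0))) (sh w) (sh w')" using cv_ren[OF wk_Suc[of _ ?P] cv] by simp
  have h: "hu S (sh ?P # ?P # E) (Tot (Ty 0)) (Suc 0)" by (intro ty_intros)
  have v: "tyt (?P # E) (Var 0) (sh ?P)" using Y_Var[of 0 "?P # E" S] by simp
  have AB: "cv (?P # E) (Tot (Ty 0)) ?A ?B"
    by (rule cv_map[OF cv' reds_AppL]) (use Y_App[OF cv_ty2 v P', where c = "Tot (Ty 0)"] h in auto)
  have A: "isty (?P # E) ?A 0" and B: "isty (?P # E) ?B 0" using AB by (auto dest: cv_ty1 cv_ty2)
  have "cv (?A # ?P # E) (Tot (Ty 0)) (sh ?A) (sh ?B)" using cv_ren[OF wk_Suc[of _ ?A] AB] by simp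
  moreover have "tyt (?A # ?P # E) (Var 0) (sh ?A)" using Y_Var[of 0 "?A # ?P # E" S] by simp
  ultimately have "tyt (?A # ?P # E) (Var 0) (sh ?B)" "isty (?A # ?P # E) (sh ?B) 0" by (auto dest: ty_conv cv_ty2)
  then have "valid S (?A # ?P # E) (sh ?B)" by (meson V_Inhab ty_orig(1))
  then have "valid S (?P # E) (FImp ?A ?B)" using A B by (meson V_ImpI ty_orig(1))
  moreover have "isty (?P # E) (FImp ?A ?B) 0" unfolding FImp_def by (rule ty_squash[OF ty_arr[OF A B]])
  ultimately show ?thesis using P by (meson V_AllI ty_orig(1))
qed

lemma cv_wp_type: assumes "cv E (Tot (Ty 0)) t t'" 
  shows "cv E (Tot (Ty (Suc 0))) (arr (arr t (Ty 0)) (Ty 0)) (arr (arr t' (Ty 0)) (Ty 0))"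
proof -
  have v: "isty (Ty 0 # E) (Var 0) 0" using Y_Var[of 0 "Ty 0 # E" S] by simp
  have "isty (Ty 0 # E) (arr (arr (Var 0) (Ty 0)) (Ty 0)) (Suc 0)"
    using ty_arr[OF ty_arr[OF v Y_Univ] Y_Univ, of 0 0] by simp
  from cv_inst_type[OF Y_Univ this assms] show ?thesis by (simp add: inst_def)
qed

lemma sc_pure:
  assumes "cv E (Tot (Ty 0)) t t'" "cv E (Tot (arr (arr t (Ty 0)) (Ty 0))) w w'"
  shows "sc S E (Comp Pure t w) (Comp Pure t' w')"
  by (rule SB_Pure[OF cv_st[OF assms(1)]], rule valid_cv[OF cv_ty2[OF assms(1)]], rule cv_sym, rule cv_conv[OF assms(2) cv_wp_type[OF assms(1)]])

text \<open>Passes from conversion of types and terms to subtyping of computation types, whatever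
  the source of the conversion: a single argument in \<open>sc_inst\<close>, a whole context in
  \<open>cvsub_sc\<close>.\<close>

lemma sc_sub:
  assumes H: "\<And>X i. isty \<Gamma> X i \<Longrightarrow> cv E (Tot (Ty i)) (sub \<sigma> X) (sub \<tau> X)"
    and H': "\<And>e X i. tyt \<Gamma> e X \<Longrightarrow> isty \<Gamma> X i \<Longrightarrow> cv E (Tot (sub \<sigma> X)) (sub \<sigma> e) (sub \<tau> e)"
    and c: "hu S \<Gamma> c i"
  shows "sc S E (subc \<sigma> c) (subc \<tau> c)"
proof (cases c)
  case (Tot X)
  then show ?thesis using cv_st[OF H[OF hu_inv(1)]] c by (simp add: SB_Tot)
next
  case (Comp M t w)
  show ?thesis
  proof (cases M)
    case Pure
    with hu_inv(2) c Comp have t: "isty \<Gamma> t 0" and w: "tyt \<Gamma> w (arr (arr t (Ty 0)) (Ty 0))" by blast+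
    have "isty \<Gamma> (arr (arr t (Ty 0)) (Ty 0)) (Suc 0)" using ty_arr[OF ty_arr[OF t Y_Univ] Y_Univ, of 0 0] by simp
    from H'[OF w this] H[OF t] show ?thesis unfolding Comp Pure by (simp add: sc_pure sub_laws)
  next
    case (Usr F)
    then obtain D where D: "eff_of S F = Some D" "isty \<Gamma> (repr D \<cdot> t \<cdot> w) 0" using hu_inv(3) c Comp by blast
    from cv_st[OF H[OF D(2)]] csD(2)[OF D(1)] show ?thesis unfolding Comp Usr by (simp add: closed_sub SB_F[OF D(1)])
  qed
qed

lemma sc_inst:
  assumes F: "isty E F k" and c: "hu S (F # E) c i" and ab: "cv E (Tot F) a b"
  shows "sc S E (instc c a) (instc c b)"
  unfolding instc_def
proof (rule sc_sub[OF _ _ c])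
  fix X i assume "isty (F # E) X i"
  then show "cv E (Tot (Ty i)) (sub (scons a Var) X) (sub (scons b Var) X)"
    using cv_inst_type[OF F _ ab, of X i] by (simp add: inst_def)
next
  fix e X i assume e: "tyt (F # E) e X" and X: "isty (F # E) X i"
  have "cv E (instc (Tot X) a) (inst e a) (inst e b)"
    by (rule cv_inst_term[OF F H_Tot[OF X] e ab], unfold instc_simps) (rule SB_Tot[OF cv_st[OF cv_sym[OF cv_inst_type[OF F X]]]])
  then show "cv E (Tot (sub (scons a Var) X)) (sub (scons a Var) e) (sub (scons b Var) e)" by (simp add: inst_def)
qed

lemma cv_app:
  assumes f: "cv E (Tot (Pi F c)) f g" and a: "cv E (Tot F) a b" and F: "isty E F k" and c: "hu S (F # E) c j"
  shows "cv E (instc c a) (f \<cdot> a) (g \<cdot> b)"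
proof -
  have "cv E (instc c a) (f \<cdot> a) (g \<cdot> a)"
    by (rule cv_map[OF f reds_AppL]) (use Y_App cv_ty1[OF a] cv_ty2 F c in blast)+
  moreover have "cv E (instc c a) (g \<cdot> a) (g \<cdot> b)"
  proof (rule cv_map[OF a reds_AppR])
    fix x assume x: "cv E (Tot F) a x"
    then show "ty S E (g \<cdot> x) (instc c a)"
      using Y_App[OF cv_ty2[OF f] cv_ty2[OF x] F c] sc_inst[OF F c cv_sym[OF x]] hu_inst[OF c cv_ty2[OF x]] hu_inst[OF c cv_ty1[OF x]] Y_Sub by blast
  qed
  ultimately show ?thesis by (rule cv_trans)
qed

text \<open>Applied to \<open>\<sigma>\<close>, the abstraction of \<open>e\<close> over its context reduces to \<open>sub \<sigma>' e\<close> for every reduct \<open>\<sigma>'\<close> of \<open>\<sigma>\<close>,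
  even where \<open>e\<close> has variables in positions in which reduction does not take place.\<close>

primrec clo :: "tm list \<Rightarrow> (nat \<Rightarrow> tm) \<Rightarrow> tm \<Rightarrow> tm" where
  "clo [] \<sigma> e = sub \<sigma> e"
| "clo (t # \<Gamma>) \<sigma> e = clo \<Gamma> (\<lambda>n. \<sigma> (Suc n)) (Lam t e) \<cdot> \<sigma> 0"

primrec wfc :: "tm list \<Rightarrow> bool" where
  "wfc [] = True"
| "wfc (t # \<Gamma>) = (wfc \<Gamma> \<and> (\<exists>i. isty \<Gamma> t i))"

lemma sub_tl: "sub \<sigma> (ren (\<lambda>m. m + Suc (Suc n)) t) = sub (\<lambda>n. \<sigma> (Suc n)) (ren (\<lambda>m. m + Suc n) t)"
  "sub \<sigma> (ren (\<lambda>m. m + Suc 0) t) = sub (\<lambda>n. \<sigma> (Suc n)) t"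
  by (simp_all add: sub_ren)

lemma tsb_tl: assumes "tsb E \<sigma> (t # \<Gamma>)" shows "tsb E (\<lambda>n. \<sigma> (Suc n)) \<Gamma>"
  unfolding tsb_def
proof (intro allI impI)
  fix n assume "n < length \<Gamma>"
  then show "tyt E (\<sigma> (Suc n)) (sub (\<lambda>n. \<sigma> (Suc n)) (lk \<Gamma> n))"
    using tsbD[OF assms, of "Suc n"] by (simp only: sub_tl nth_Cons_Suc length_Cons Suc_less_eq)
qed

definition scv :: "tm list \<Rightarrow> tm list \<Rightarrow> (nat \<Rightarrow> tm) \<Rightarrow> (nat \<Rightarrow> tm) \<Rightarrow> bool" where
  "scv E \<Gamma> \<sigma> \<tau> \<longleftrightarrow> tsb E \<sigma> \<Gamma> \<and> tsb E \<tau> \<Gamma> \<and> (\<forall>n<length \<Gamma>. cv E (Tot (sub \<sigma> (lk \<Gamma> n))) (\<sigma> n) (\<tau> n))"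

lemma scv_tl: "scv E (t # \<Gamma>) \<sigma> \<tau> \<Longrightarrow> scv E \<Gamma> (\<lambda>n. \<sigma> (Suc n)) (\<lambda>n. \<tau> (Suc n))"
  unfolding scv_def
proof (intro conjI allI impI; (elim conjE)?)
  fix n assume *: "\<forall>n<length (t # \<Gamma>). cv E (Tot (sub \<sigma> (lk (t # \<Gamma>) n))) (\<sigma> n) (\<tau> n)" and "n < length \<Gamma>"
  then show "cv E (Tot (sub (\<lambda>n. \<sigma> (Suc n)) (lk \<Gamma> n))) (\<sigma> (Suc n)) (\<tau> (Suc n))"
    using *[rule_format, of "Suc n"] by (simp only: sub_tl nth_Cons_Suc length_Cons Suc_less_eq)
qed (auto intro: tsb_tl)

lemma scv_hd: "scv E (t # \<Gamma>) \<sigma> \<tau> \<Longrightarrow> cv E (Tot (sub (\<lambda>n. \<sigma> (Suc n)) t)) (\<sigma> 0) (\<tau> 0)"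
  unfolding scv_def by (elim conjE, drule spec[of _ 0], simp only: sub_tl nth_Cons_0 length_Cons zero_less_Suc simp_thms)

lemma clo_reds: "reds S (clo \<Gamma> \<sigma> e) (sub \<sigma> e)"
proof (induct \<Gamma> arbitrary: \<sigma> e)
  case (Cons t \<Gamma>)
  let ?s = "\<lambda>n. \<sigma> (Suc n)"
  have "reds S (clo \<Gamma> ?s (Lam t e) \<cdot> \<sigma> 0) (Lam (sub ?s t) (sub (ups ?s) e) \<cdot> \<sigma> 0)"
    using reds_AppL[OF Cons[of ?s "Lam t e"]] by simp
  moreover have "red S (Lam (sub ?s t) (sub (ups ?s) e) \<cdot> \<sigma> 0) (sub \<sigma> e)"
    using R_Beta[of S "sub ?s t" "sub (ups ?s) e" "\<sigma> 0"] by (simp add: inst_ups)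
  ultimately show ?case by simp
qed simp

text \<open>Abstracting the last variable leaves a term over a shorter context, to which the
  induction hypothesis applies; congruence of application then handles the last component.\<close>

lemma clo_cv: "wfc \<Gamma> \<Longrightarrow> scv E \<Gamma> \<sigma> \<tau> \<Longrightarrow> ty S \<Gamma> e c \<Longrightarrow> hu S \<Gamma> c j \<Longrightarrow> cv E (subc \<sigma> c) (clo \<Gamma> \<sigma> e) (clo \<Gamma> \<tau> e)"
proof (induct \<Gamma> arbitrary: \<sigma> \<tau> e c j)
  case Nil
  then have "sub \<sigma> e = sub \<tau> e" using ty_scoped(1) closed_sub by fastforce
  then show ?case using Nil cv_refl[OF ty_sub(1)[of E \<sigma> "[]" e c]] by (simp add: scv_def)
next
  case (Cons t \<Gamma>)
  then obtain i where t: "isty \<Gamma> t i" and w: "wfc \<Gamma>" by auto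
  let ?s = "\<lambda>n. \<sigma> (Suc n)" and ?t = "\<lambda>n. \<tau> (Suc n)"
  have s: "tsb E ?s \<Gamma>" using scv_tl[OF Cons.prems(2)] by (simp add: scv_def)
  have "cv E (subc ?s (Tot (Pi t c))) (clo \<Gamma> ?s (Lam t e)) (clo \<Gamma> ?t (Lam t e))"
    by (rule Cons.hyps[OF w scv_tl[OF Cons.prems(2)] Y_Lam[OF t Cons.prems(4,3)] H_Tot[OF Y_Pi[OF t Cons.prems(4)]]])
  from cv_app[OF this[simplified] scv_hd[OF Cons.prems(2)]] ty_sub(1)[OF s t] ty_sub(2)[OF tsb_up[OF s] Cons.prems(4)]
  show ?case by (simp add: instc_ups)
qed

text \<open>Types come before terms: the classifier \<open>Ty i\<close> is the same at
  \<open>\<sigma>\<close> and \<open>\<tau>\<close>, so both instances are typed at it without any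
  conversion. For terms the type at \<open>\<tau>\<close> has to be converted first.\<close>

lemma cvsub_type:
  assumes "wfc \<Gamma>" "scv E \<Gamma> \<sigma> \<tau>" "isty \<Gamma> X i"
  shows "cv E (Tot (Ty i)) (sub \<sigma> X) (sub \<tau> X)"
proof -
  have s: "tsb E \<sigma> \<Gamma>" "tsb E \<tau> \<Gamma>" using assms(2) by (auto simp: scv_def)
  have "cv E (Tot (Ty i)) (clo \<Gamma> \<sigma> X) (clo \<Gamma> \<tau> X)" using clo_cv[OF assms hu_Ty] by simp
  moreover have "isty E (sub \<sigma> X) i" "isty E (sub \<tau> X) i" using ty_sub(1)[OF s(1) assms(3)] ty_sub(1)[OF s(2) assms(3)] by simp_all
  ultimately show ?thesis by (meson clo_reds cv_exp cv_red cv_trans cv_ty1 cv_ty2)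
qed

lemma cvsub_tot:
  assumes "wfc \<Gamma>" "scv E \<Gamma> \<sigma> \<tau>" "tyt \<Gamma> e X" "isty \<Gamma> X i"
  shows "cv E (Tot (sub \<sigma> X)) (sub \<sigma> e) (sub \<tau> e)"
proof -
  have s: "tsb E \<sigma> \<Gamma>" "tsb E \<tau> \<Gamma>" using assms(2) by (auto simp: scv_def)
  have "cv E (Tot (sub \<sigma> X)) (clo \<Gamma> \<sigma> e) (clo \<Gamma> \<tau> e)" using clo_cv[OF assms(1-3) H_Tot[OF assms(4)]] by simp
  moreover have "tyt E (sub \<sigma> e) (sub \<sigma> X)" "tyt E (sub \<tau> e) (sub \<sigma> X)"
    using ty_sub(1)[OF s(1) assms(3)] ty_conv[OF _ cv_sym[OF cvsub_type[OF assms(1,2,4)]]] ty_sub(1)[OF s(2) assms(3)] by simp_all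
  ultimately show ?thesis by (meson clo_reds cv_exp cv_red cv_trans cv_ty1 cv_ty2)
qed

lemma cvsub_sc: "wfc \<Gamma> \<Longrightarrow> scv E \<Gamma> \<sigma> \<tau> \<Longrightarrow> hu S \<Gamma> c i \<Longrightarrow> sc S E (subc \<sigma> c) (subc \<tau> c)"
  by (rule sc_sub) (auto intro: cvsub_type cvsub_tot)

end

section \<open>The logical relation\<close>

definition is_Lam :: "tm \<Rightarrow> bool" where "is_Lam e \<longleftrightarrow> (\<exists>t b. e = Lam t b)"
definition proj2 :: "tm \<Rightarrow> bool" where "proj2 e \<longleftrightarrow> (\<exists>a b. e = Con FstC \<cdot> a \<cdot> b \<or> e = Con SndC \<cdot> a \<cdot> b)"

lemma is_Lam_simps [simp]: "is_Lam (Lam t b)" "\<not> is_Lam (Con k)" "\<not> is_Lam (f \<cdot> a)"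
  by (simp_all add: is_Lam_def)
lemma proj2_simps [simp]: "\<not> proj2 (Con k)" "\<not> proj2 (Con k \<cdot> a)" "proj2 (Con k \<cdot> a \<cdot> b) = (k = FstC \<or> k = SndC)"
  "\<not> proj2 (f \<cdot> a \<cdot> b \<cdot> d)" "\<not> proj2 (Lam t e)"
  by (auto simp: proj2_def)

text \<open>Terms that are not introduction forms: putting them into an elimination does not create a redex.\<close>

fun nt :: "tm \<Rightarrow> bool" where
  "nt (Var n) = True"
| "nt (f \<cdot> a) = (nt f \<or> is_Lam f \<or> proj2 f)"
| "nt (Case t e a b) = True"
| "nt (Run e) = True"
| "nt (Reify e) = True"
| "nt (Bind M t1 t2 w1 e1 w2 e2) = (M = Pure)"
| "nt _ = False"

text \<open>Neutral terms: evaluation is blocked by a variable in head position. In contrast to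
  \<open>nt\<close>, which admits redexes, this class is stable under reduction and contains no
  closed term.\<close>

inductive stuck :: "tm \<Rightarrow> bool" where
  "stuck (Var n)"
| "stuck f \<Longrightarrow> stuck (f \<cdot> a)"
| "stuck e \<Longrightarrow> stuck (Case t e a b)"
| "stuck e \<Longrightarrow> stuck (Run e)"
| "stuck e \<Longrightarrow> stuck (Reify e)"
| "stuck e \<Longrightarrow> stuck (Bind Pure t1 t2 w1 e w2 e2)"
| "stuck e \<Longrightarrow> stuck (tfst a b e)"
| "stuck e \<Longrightarrow> stuck (tsnd a b e)"

text \<open>The introduction forms of the types whose elements are compared by their values:
  products, sums and pure computations.\<close>

definition valform :: "tm \<Rightarrow> bool" where
  "valform w \<longleftrightarrow> (\<exists>a b x y. w = tpair a b x y) \<or> (\<exists>a b x. w = tinl a b x) \<or> (\<exists>a b x. w = tinr a b x) \<or> (\<exists>t x. w = Return Pure t x)"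

text \<open>The type formers that have an interpretation of their own. Every other normal type, such
  as unit, falsity, an equality or a stuck term, denotes its whole base relation
  \<open>BR\<close>.\<close>

definition canon :: "tm \<Rightarrow> bool" where
  "canon w \<longleftrightarrow> (\<exists>t c. w = Pi t c) \<or> (\<exists>t p. w = Refine t p) \<or> (\<exists>j. w = Ty j) \<or> (\<exists>a b. w = tprod a b) \<or> (\<exists>a b. w = tsum a b)"

lemma stuck_nt: "stuck e \<Longrightarrow> nt e"
  by (induct rule: stuck.induct) (auto simp: proj2_def)

lemma nt_not: "nt e \<Longrightarrow> \<not> valform e" "nt e \<Longrightarrow> \<not> canon e" "nt e \<Longrightarrow> \<not> is_Lam e" "nt e \<Longrightarrow> \<not> proj2 e"
  by (auto simp: valform_def canon_def is_Lam_def proj2_def)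

lemma nt_ren [simp]: "nt (ren r e) = nt e"
proof (induct e arbitrary: r)
  case (App f a)
  have "is_Lam (ren r f) = is_Lam f" by (cases f) (auto simp: is_Lam_def)
  moreover have "proj2 (ren r f) = proj2 f"
    unfolding proj2_def by (auto simp: ren_inv eq_commute[of "ren r f"])
  ultimately show ?case using App by simp
qed (auto intro: comp.induct)

lemma stuck_ren: "stuck e \<Longrightarrow> stuck (ren r e)"
  by (induct arbitrary: r rule: stuck.induct) (auto intro: stuck.intros)

lemma stuck_not_closed: "stuck e \<Longrightarrow> \<not> scoped 0 e"
  by (induct rule: stuck.induct) (auto simp: scoped_def)

inductive_cases red_AppE: "red S (f \<cdot> a) x"
inductive_cases red_ReifyE: "red S (Reify e) x"
inductive_cases red_LamE: "red S (Lam t b) x"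
inductive_cases red_VarE: "red S (Var n) x"
inductive_cases red_ConE: "red S (Con k) x"
inductive_cases red_PiE: "red S (Pi t c) x"
inductive_cases red_RefineE: "red S (Refine t c) x"
inductive_cases red_ReturnE: "red S (Return M t e) x"
inductive_cases red_ReflectE: "red S (Reflect e) x"
inductive_cases red_BindE: "red S (Bind M t1 t2 wp1 e wp2 e2) x"
inductive_cases red_LiftE: "red S (Lift M M' t wp e) x"
inductive_cases red_ActE: "red S (Act F a es) x"
inductive_cases red_RunE: "red S (Run e) x"
inductive_cases red_CaseE: "red S (Case t e e1 e2) x"

lemma red_app_nt: "nt f \<Longrightarrow> red S (f \<cdot> a) x \<Longrightarrow> (\<exists>f'. red S f f' \<and> x = f' \<cdot> a) \<or> (\<exists>a'. red S a a' \<and> x = f \<cdot> a')"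
  by (erule red_AppE) auto

lemma red_Reify_nt: "nt e \<Longrightarrow> red S (Reify e) x \<Longrightarrow> \<exists>e'. red S e e' \<and> x = Reify e'"
  by (erule red_ReifyE) auto

lemma red_Con1: "red S (Con k \<cdot> a) x \<Longrightarrow> \<exists>a'. red S a a' \<and> x = Con k \<cdot> a'"
  by (erule red_AppE) (auto elim: red_ConE)
lemma red_Con2: "red S (Con k \<cdot> a \<cdot> b) x \<Longrightarrow> (\<exists>a'. red S a a' \<and> x = Con k \<cdot> a' \<cdot> b) \<or> (\<exists>b'. red S b b' \<and> x = Con k \<cdot> a \<cdot> b')"
  by (erule red_AppE) (auto dest: red_Con1)

lemma stuck_red: "stuck e \<Longrightarrow> red S e x \<Longrightarrow> stuck x"
proof (induct arbitrary: x rule: stuck.induct)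
  case (2 f a)
  then show ?case using red_app_nt[OF stuck_nt] stuck.intros(2) by blast
next
  case (3 e t a b)
  from 3(3) show ?case by (rule red_CaseE) (use 3 in \<open>auto intro: stuck.intros dest: stuck_nt\<close>)
next
  case (4 e)
  from 4(3) show ?case by (rule red_RunE) (use 4 in \<open>auto intro: stuck.intros dest: stuck_nt\<close>)
next
  case (5 e)
  then show ?case using red_Reify_nt[OF stuck_nt] stuck.intros(5) by blast
next
  case (6 e)
  from 6(3) show ?case by (rule red_BindE) (use 6 in \<open>auto intro: stuck.intros dest: stuck_nt\<close>)
next
  case (7 e a b)
  from 7(3) show ?case 
  proof (rule red_AppE)
    fix e' assume "x = e' \<cdot> e" "red S (Con FstC \<cdot> a \<cdot> b) e'"
    then show ?thesis using 7 stuck.intros(7) by (auto dest: red_Con2)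
  qed (use 7 in \<open>auto intro: stuck.intros dest: stuck_nt\<close>)
next
  case (8 e a b)
  from 8(3) show ?case 
  proof (rule red_AppE)
    fix e' assume "x = e' \<cdot> e" "red S (Con SndC \<cdot> a \<cdot> b) e'"
    then show ?thesis using 8 stuck.intros(8) by (auto dest: red_Con2)
  qed (use 8 in \<open>auto intro: stuck.intros dest: stuck_nt\<close>)
qed (auto elim: red_VarE)

lemma stuck_reds: "reds S e e' \<Longrightarrow> stuck e \<Longrightarrow> stuck e'"
  by (induct rule: rtranclp_induct) (auto intro: stuck_red)

type_synonym trel = "(tm \<times> tm) set"

definition Qprod :: "trel \<Rightarrow> trel \<Rightarrow> tm \<Rightarrow> tm \<Rightarrow> bool" where
  "Qprod Ra Rb w w' \<longleftrightarrow> (\<exists>a b x y a' b' x' y'. w = tpair a b x y \<and> w' = tpair a' b' x' y' \<and> (x, x') \<in> Ra \<and> (y, y') \<in> Rb)"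

definition Qpure :: "trel \<Rightarrow> tm \<Rightarrow> tm \<Rightarrow> bool" where
  "Qpure R w w' \<longleftrightarrow> (\<exists>t x t' x'. w = Return Pure t x \<and> w' = Return Pure t' x' \<and> (x, x') \<in> R)"

section \<open>Normalization, the base relation and the interpretation of types\<close>

context sigc begin

inductive SN :: "tm \<Rightarrow> bool" where
  SN_I: "(\<And>e'. red S e e' \<Longrightarrow> SN e') \<Longrightarrow> SN e"

lemma SN_red: "SN e \<Longrightarrow> red S e e' \<Longrightarrow> SN e'"
  by (erule SN.cases) blast
lemma SN_reds: "reds S e e' \<Longrightarrow> SN e \<Longrightarrow> SN e'"
  by (induct rule: rtranclp_induct) (auto intro: SN_red)

lemma SN_nf: "SN e \<Longrightarrow> \<exists>w. reds S e w \<and> is_value S w"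
proof (induct rule: SN.induct)
  case (SN_I e)
  show ?case
  proof (cases "is_value S e")
    case False
    then obtain e' where e': "red S e e'" by (auto simp: is_value_def)
    then obtain w where "reds S e' w" "is_value S w" using SN_I by blast
    then show ?thesis using converse_rtranclp_into_rtranclp[of "red S", OF e'] by blast
  qed blast
qed

lemma SN_ren: "SN e \<Longrightarrow> SN (ren r e)"
proof (induct rule: SN.induct)
  case (SN_I e)
  then show ?case using red_ren_inv[OF _ refl, of r e] by (metis SN.SN_I)
qed

definition BB :: "tm list \<Rightarrow> comp \<Rightarrow> tm \<Rightarrow> bool" where
  "BB E c e \<longleftrightarrow> SN e \<and> (\<forall>e'. reds S e e' \<longrightarrow> ty S E e' c)"

definition BR :: "tm list \<Rightarrow> comp \<Rightarrow> trel" where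
  "BR E c = {(e, e'). BB E c e \<and> BB E c e' \<and> cv E c e e'}"

lemma BB_D: "BB E c e \<Longrightarrow> SN e" "BB E c e \<Longrightarrow> ty S E e c" "BB E c e \<Longrightarrow> reds S e e' \<Longrightarrow> ty S E e' c"
  unfolding BB_def by blast+

lemma BB_reds: "BB E c e \<Longrightarrow> reds S e e' \<Longrightarrow> BB E c e'"
  unfolding BB_def by (meson SN_reds rtranclp_trans)

lemma BB_sc: "BB E c e \<Longrightarrow> sc S E c c' \<Longrightarrow> hu S E c i \<Longrightarrow> hu S E c' j \<Longrightarrow> BB E c' e"
  unfolding BB_def by (meson Y_Sub)

lemma BB_ren: "wk E r E' \<Longrightarrow> BB E c e \<Longrightarrow> BB E' (renc r c) (ren r e)"
  unfolding BB_def using SN_ren reds_ren_inv ty_ren(1) by blast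

lemma BR_D: "(e, e') \<in> BR E c \<Longrightarrow> BB E c e" "(e, e') \<in> BR E c \<Longrightarrow> BB E c e'" "(e, e') \<in> BR E c \<Longrightarrow> cv E c e e'"
  unfolding BR_def by blast+

lemma BR_I: "BB E c e \<Longrightarrow> BB E c e' \<Longrightarrow> cv E c e e' \<Longrightarrow> (e, e') \<in> BR E c"
  unfolding BR_def by blast

lemma BR_sym: "(e, e') \<in> BR E c \<Longrightarrow> (e', e) \<in> BR E c"
  unfolding BR_def using cv_sym by blast
lemma BR_trans: "(e, e') \<in> BR E c \<Longrightarrow> (e', e'') \<in> BR E c \<Longrightarrow> (e, e'') \<in> BR E c"
  unfolding BR_def using cv_trans by blast

lemma BR_reds: "(e, e') \<in> BR E c \<Longrightarrow> reds S e x \<Longrightarrow> (x, e') \<in> BR E c"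
  by (meson BB_D(2,3) BB_reds BR_D BR_I cv_exp cv_trans)

lemma BR_sc: "(e, e') \<in> BR E c \<Longrightarrow> sc S E c c' \<Longrightarrow> hu S E c i \<Longrightarrow> hu S E c' j \<Longrightarrow> (e, e') \<in> BR E c'"
  unfolding BR_def using BB_sc cv_sc by blast

lemma BR_ren: "wk E r E' \<Longrightarrow> (e, e') \<in> BR E c \<Longrightarrow> (ren r e, ren r e') \<in> BR E' (renc r c)"
  unfolding BR_def using BB_ren cv_ren by blast

lemma BR_st: "(e, e') \<in> BR E (Tot X) \<Longrightarrow> st S E X Y \<Longrightarrow> isty E X i \<Longrightarrow> isty E Y j \<Longrightarrow> (e, e') \<in> BR E (Tot Y)"
  by (rule BR_sc[OF _ SB_Tot H_Tot H_Tot])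

lemma BR_conv: "cv E (Tot (Ty i)) X Y \<Longrightarrow> BR E (Tot X) = BR E (Tot Y)"
  using BR_st cv_st cv_sym cv_ty1 cv_ty2 by (intro equalityI subsetI; clarify; meson)

lemma BB_cv: "BB E c e \<Longrightarrow> reds S e x \<Longrightarrow> cv E c e x"
  using BB_D cv_red by blast

text \<open>The points at which a term or a type is inspected. Introduction forms and canonical
  types count even when they still reduce inside: an elimination may fire on them at once, and a
  canonical type should reveal its interpretation without being normalized.\<close>

definition "fin w \<longleftrightarrow> valform w \<or> is_value S w"
definition "tfin w \<longleftrightarrow> canon w \<or> is_value S w"

text \<open>All pairs of inspected reducts are constrained rather than one chosen pair, because
  different reductions of the same term need not meet again.\<close>

definition posR :: "(tm \<Rightarrow> tm \<Rightarrow> bool) \<Rightarrow> tm list \<Rightarrow> comp \<Rightarrow> trel" where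
  "posR Q E c = {(e, e'). (e, e') \<in> BR E c \<and>
     (\<forall>w w'. reds S e w \<longrightarrow> reds S e' w' \<longrightarrow> fin w \<longrightarrow> fin w' \<longrightarrow> (stuck w \<and> stuck w') \<or> Q w w')}"

text \<open>The second component of an injection determines its type arguments only up to conversion.\<close>

definition Qsum :: "tm list \<Rightarrow> tm \<Rightarrow> tm \<Rightarrow> trel \<Rightarrow> trel \<Rightarrow> tm \<Rightarrow> tm \<Rightarrow> bool" where
  "Qsum E A B Ra Rb w w' \<longleftrightarrow>
     (\<exists>a b x a' b' x'. w = tinl a b x \<and> w' = tinl a' b' x' \<and> (x, x') \<in> Ra
        \<and> cv E (Tot (tsum A B)) w (tinl A B x) \<and> cv E (Tot (tsum A B)) w' (tinl A B x')) \<or>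
     (\<exists>a b x a' b' x'. w = tinr a b x \<and> w' = tinr a' b' x' \<and> (x, x') \<in> Rb
        \<and> cv E (Tot (tsum A B)) w (tinr A B x) \<and> cv E (Tot (tsum A B)) w' (tinr A B x'))"

definition piR :: "tm list \<Rightarrow> tm \<Rightarrow> comp \<Rightarrow> (tm list \<Rightarrow> (nat \<Rightarrow> nat) \<Rightarrow> trel) \<Rightarrow> (tm list \<Rightarrow> (nat \<Rightarrow> nat) \<Rightarrow> tm \<Rightarrow> trel) \<Rightarrow> trel" where
  "piR E F C RF RC = {(f, f'). (f, f') \<in> BR E (Tot (Pi F C)) \<and>
     (\<forall>E' r a a'. wk E r E' \<longrightarrow> (a, a') \<in> RF E' r \<longrightarrow> (ren r f \<cdot> a, ren r f' \<cdot> a') \<in> RC E' r a)}"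

abbreviation effR :: "tm list \<Rightarrow> comp \<Rightarrow> trel \<Rightarrow> trel" where
  "effR E c R \<equiv> {(e, e'). (e, e') \<in> BR E c \<and> (Reify e, Reify e') \<in> R}"

type_synonym cand = "nat \<Rightarrow> tm list \<Rightarrow> tm \<Rightarrow> trel \<Rightarrow> bool"

abbreviation univR :: "cand \<Rightarrow> nat \<Rightarrow> tm list \<Rightarrow> trel" where
  "univR K j E \<equiv> {(A, A'). (A, A') \<in> BR E (Tot (Ty j)) \<and>
     (\<forall>E' r. wk E r E' \<longrightarrow> (\<exists>R. K j E' (ren r A) R \<and> K j E' (ren r A') R))}"

text \<open>
  \<open>U n K E X R\<close> says that the type \<open>X\<close> in the world \<open>E\<close> denotes \<open>R\<close>, where \<open>K j\<close> interprets the universe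
  \<open>Type_j\<close> for \<open>j < n\<close>; \<open>V\<close> is the same for canonical and for normal types. As reduction is not confluent,
  \<open>U_I\<close> requires all these reducts of \<open>X\<close> to have the same denotation, in all extensions of \<open>E\<close>.
\<close>

inductive U :: "nat \<Rightarrow> cand \<Rightarrow> tm list \<Rightarrow> tm \<Rightarrow> trel \<Rightarrow> bool"
  and V :: "nat \<Rightarrow> cand \<Rightarrow> tm list \<Rightarrow> tm \<Rightarrow> trel \<Rightarrow> bool"
  and UC :: "nat \<Rightarrow> cand \<Rightarrow> tm list \<Rightarrow> comp \<Rightarrow> trel \<Rightarrow> bool"
  for n :: nat and K :: cand
where
  U_I: "\<lbrakk>BB E (Tot (Ty i)) X; \<forall>E' r W. wk E r E' \<longrightarrow> reds S X W \<longrightarrow> tfin W \<longrightarrow> V n K E' (ren r W) (RR E' r)\<rbrakk>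
    \<Longrightarrow> U n K E X (RR E (\<lambda>m. m))"
| V_Pi: "\<lbrakk>isty E (Pi F C) i; \<forall>E' r. wk E r E' \<longrightarrow> U n K E' (ren r F) (RF E' r);
    \<forall>E' r a a'. wk E r E' \<longrightarrow> (a, a') \<in> RF E' r \<longrightarrow>
      UC n K E' (instc (renc (upr r) C) a) (RC E' r a) \<and> UC n K E' (instc (renc (upr r) C) a') (RC E' r a)\<rbrakk>
    \<Longrightarrow> V n K E (Pi F C) (piR E F C RF RC)"
| V_Refine: "\<lbrakk>isty E (Refine t \<phi>) i; U n K E t R\<rbrakk> \<Longrightarrow> V n K E (Refine t \<phi>) (R \<inter> BR E (Tot (Refine t \<phi>)))"
| V_Univ: "j < n \<Longrightarrow> V n K E (Ty j) (univR K j E)"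
| V_Prod: "\<lbrakk>isty E (tprod a b) i; U n K E a Ra; U n K E b Rb\<rbrakk>
    \<Longrightarrow> V n K E (tprod a b) (posR (Qprod Ra Rb) E (Tot (tprod a b)))"
| V_Sum: "\<lbrakk>isty E (tsum a b) i; U n K E a Ra; U n K E b Rb\<rbrakk>
    \<Longrightarrow> V n K E (tsum a b) (posR (Qsum E a b Ra Rb) E (Tot (tsum a b)))"
| V_Inert: "\<lbrakk>isty E W i; is_value S W; \<not> canon W\<rbrakk> \<Longrightarrow> V n K E W (BR E (Tot W))"
| UC_Tot: "U n K E X R \<Longrightarrow> UC n K E (Tot X) R"
| UC_Pure: "\<lbrakk>hu S E (Comp Pure t wp) 0; U n K E t R\<rbrakk>
    \<Longrightarrow> UC n K E (Comp Pure t wp) (posR (Qpure R) E (Comp Pure t wp))"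
| UC_F: "\<lbrakk>eff_of S F = Some D; hu S E (Comp (Usr F) t wp) 0; U n K E (repr D \<cdot> t \<cdot> wp) R\<rbrakk>
    \<Longrightarrow> UC n K E (Comp (Usr F) t wp) (effR E (Comp (Usr F) t wp) R)"

text \<open>Ties the parameter of \<open>U\<close> to \<open>U\<close> itself at smaller levels. The
  members of a universe are the types that have a denotation, and this reference sits inside the
  relation assigned to the universe, where it cannot be a premise of the inductive definition.
  Predicativity makes a recursion on the level possible.\<close>

primrec KK :: "nat \<Rightarrow> cand" where
  "KK 0 = (\<lambda>j E A R. False)"
| "KK (Suc n) = (\<lambda>j. if j = n then U n (KK n) else KK n j)"

lemma KK_eq: "j < n \<Longrightarrow> KK n j = U j (KK j)"
  by (induct n) auto

abbreviation "LU n \<equiv> U n (KK n)"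
abbreviation "LV n \<equiv> V n (KK n)"
abbreviation "LC n \<equiv> UC n (KK n)"

text \<open>Induction with the hypothesis for a type stated in its own world only, which is the
  instance of \<open>U_I\<close> at the identity; the family over all extensions matters just where
  worlds change.\<close>

lemma LR_ind:
  assumes "\<And>E i X R. BB E (Tot (Ty i)) X \<Longrightarrow> \<forall>W. reds S X W \<longrightarrow> tfin W \<longrightarrow> V n K E W R \<and> P2 E W R \<Longrightarrow> P1 E X R"
    and "\<And>E F C i RF RC. isty E (Pi F C) i \<Longrightarrow>
      \<forall>E' r. wk E r E' \<longrightarrow> U n K E' (ren r F) (RF E' r) \<and> P1 E' (ren r F) (RF E' r) \<Longrightarrow>
      \<forall>E' r a a'. wk E r E' \<longrightarrow> (a, a') \<in> RF E' r \<longrightarrow>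
        (UC n K E' (instc (renc (upr r) C) a) (RC E' r a) \<and> P3 E' (instc (renc (upr r) C) a) (RC E' r a)) \<and>
        UC n K E' (instc (renc (upr r) C) a') (RC E' r a) \<and> P3 E' (instc (renc (upr r) C) a') (RC E' r a) \<Longrightarrow>
      P2 E (Pi F C) (piR E F C RF RC)"
    and "\<And>E t \<phi> i R. isty E (Refine t \<phi>) i \<Longrightarrow> U n K E t R \<Longrightarrow> P1 E t R \<Longrightarrow> P2 E (Refine t \<phi>) (R \<inter> BR E (Tot (Refine t \<phi>)))"
    and "\<And>j E. j < n \<Longrightarrow> P2 E (Ty j) (univR K j E)"
    and "\<And>E a b i Ra Rb. isty E (tprod a b) i \<Longrightarrow> U n K E a Ra \<Longrightarrow> P1 E a Ra \<Longrightarrow> U n K E b Rb \<Longrightarrow> P1 E b Rb \<Longrightarrow>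
      P2 E (tprod a b) (posR (Qprod Ra Rb) E (Tot (tprod a b)))"
    and "\<And>E a b i Ra Rb. isty E (tsum a b) i \<Longrightarrow> U n K E a Ra \<Longrightarrow> P1 E a Ra \<Longrightarrow> U n K E b Rb \<Longrightarrow> P1 E b Rb \<Longrightarrow>
      P2 E (tsum a b) (posR (Qsum E a b Ra Rb) E (Tot (tsum a b)))"
    and "\<And>E W i. isty E W i \<Longrightarrow> is_value S W \<Longrightarrow> \<not> canon W \<Longrightarrow> P2 E W (BR E (Tot W))"
    and "\<And>E X R. U n K E X R \<Longrightarrow> P1 E X R \<Longrightarrow> P3 E (Tot X) R"
    and "\<And>E t wp R. hu S E (Comp Pure t wp) 0 \<Longrightarrow> U n K E t R \<Longrightarrow> P1 E t R \<Longrightarrow> P3 E (Comp Pure t wp) (posR (Qpure R) E (Comp Pure t wp))"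
    and "\<And>F D E t wp R. eff_of S F = Some D \<Longrightarrow> hu S E (Comp (Usr F) t wp) 0 \<Longrightarrow> U n K E (repr D \<cdot> t \<cdot> wp) R \<Longrightarrow> P1 E (repr D \<cdot> t \<cdot> wp) R \<Longrightarrow>
      P3 E (Comp (Usr F) t wp) (effR E (Comp (Usr F) t wp) R)"
  shows "U n K E X R \<Longrightarrow> P1 E X R" "V n K E W R \<Longrightarrow> P2 E W R" "UC n K E c R \<Longrightarrow> P3 E c R"
proof (induct rule: U_V_UC.inducts)
  case (U_I E i X RR)
  show ?case using U_I(2)[rule_format, OF wk_id] by (intro assms(1)[OF U_I(1)]) simp
qed (fact assms)+

lemmas LR_induct = LR_ind[rotated 10, consumes 1, case_names U_I V_Pi V_Refine V_Univ V_Prod V_Sum V_Inert UC_Tot UC_Pure UC_F]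

lemma U_inv': "U n K E X R \<Longrightarrow> \<exists>i RR. BB E (Tot (Ty i)) X \<and> R = RR E (\<lambda>m. m) \<and> (\<forall>E' r W. wk E r E' \<longrightarrow> reds S X W \<longrightarrow> tfin W \<longrightarrow> V n K E' (ren r W) (RR E' r))"
  by (erule U.cases) blast

lemma U_inv: "U n K E X R \<Longrightarrow> (\<exists>i. BB E (Tot (Ty i)) X) \<and> (\<forall>W. reds S X W \<longrightarrow> tfin W \<longrightarrow> V n K E W R)"
  by (drule U_inv') (metis ren_id wk_id)

text \<open>\<open>U_I\<close> wants one function that assigns relations to worlds, whereas in
  applications a relation is only known to exist in each extension. Choice assembles the function,
  pinned to \<open>R\<close> in the given world.\<close>

lemma U_intro:
  assumes X: "BB E (Tot (Ty i)) X" and K: "\<And>E' r. wk E r E' \<Longrightarrow> \<exists>R. \<forall>W. reds S X W \<longrightarrow> tfin W \<longrightarrow> V n K E' (ren r W) R"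
    and R: "\<And>W. reds S X W \<Longrightarrow> tfin W \<Longrightarrow> V n K E W R"
  shows "U n K E X R"
proof -
  let ?RR = "\<lambda>E' r. if E' = E \<and> r = (\<lambda>m. m) then R else SOME R. \<forall>W. reds S X W \<longrightarrow> tfin W \<longrightarrow> V n K E' (ren r W) R"
  have "U n K E X (?RR E (\<lambda>m. m))"
  proof (rule U_I[where RR = ?RR, OF X], intro allI impI)
    fix E' r W assume W: "wk E r E'" "reds S X W" "tfin W"
    show "V n K E' (ren r W) (?RR E' r)"
    proof (cases "E' = E \<and> r = (\<lambda>m. m)")
      case True
      then show ?thesis using R[OF W(2,3)] by simp
    next
      case False
      then show ?thesis using someI_ex[OF K[OF W(1)]] W(2,3) by auto
    qed
  qed
  then show ?thesis by simp
qed

lemma U_BB: "U n K E X R \<Longrightarrow> \<exists>i. BB E (Tot (Ty i)) X"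
  using U_inv by blast

lemma U_nf: assumes "U n K E X R" shows "\<exists>W i. reds S X W \<and> is_value S W \<and> V n K E W R \<and> cv E (Tot (Ty i)) X W"
proof -
  from U_inv[OF assms] obtain i where X: "BB E (Tot (Ty i)) X" "\<forall>W. reds S X W \<longrightarrow> tfin W \<longrightarrow> V n K E W R" by blast
  then obtain W where "reds S X W" "is_value S W" using SN_nf BB_D by blast
  then show ?thesis using X BB_cv unfolding tfin_def by blast
qed

lemma canon_ren: "canon (ren r W) = canon W"
proof
  assume "canon (ren r W)"
  then show "canon W" by (auto simp: canon_def ren_inv eq_commute[of "ren r W"])
qed (auto simp: canon_def)

lemma is_value_ren: "is_value S (ren r W) = is_value S W"
  unfolding is_value_def using red_ren red_ren_inv[OF _ refl] by blast

lemma tfin_ren: "tfin (ren r W) = tfin W"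
  by (simp add: tfin_def canon_ren is_value_ren)

lemma U_reds: assumes "U n K E X R" "reds S X X'" shows "U n K E X' R"
proof -
  from U_inv'[OF assms(1)] obtain i RR where *: "BB E (Tot (Ty i)) X" "R = RR E (\<lambda>m. m)"
    "\<forall>E' r W. wk E r E' \<longrightarrow> reds S X W \<longrightarrow> tfin W \<longrightarrow> V n K E' (ren r W) (RR E' r)" by blast
  show ?thesis unfolding *(2)
  proof (rule U_I[where RR = RR, OF BB_reds[OF *(1) assms(2)]], intro allI impI)
    fix E' r W assume "wk E r E'" "reds S X' W" "tfin W"
    then show "V n K E' (ren r W) (RR E' r)" using *(3) rtranclp_trans[OF assms(2), of W] by blast
  qed
qed

text \<open>Reducts of the renamed type are renamings of reducts of the type, so the family of
  relations can be restricted to the extensions of the new world. How the new relation depends on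
  the old one is settled in \<open>LR_ren\<close>.\<close>

lemma U_kripke: assumes "U n K E X R" "wk E r E'" shows "\<exists>R'. U n K E' (ren r X) R'"
proof -
  from U_inv'[OF assms(1)] obtain i RR where *: "BB E (Tot (Ty i)) X" "R = RR E (\<lambda>m. m)"
    "\<forall>E' r W. wk E r E' \<longrightarrow> reds S X W \<longrightarrow> tfin W \<longrightarrow> V n K E' (ren r W) (RR E' r)" by blast
  let ?RR = "\<lambda>E'' q. RR E'' (\<lambda>m. q (r m))"
  have "U n K E' (ren r X) (?RR E' (\<lambda>m. m))"
  proof (rule U_I[where RR = ?RR])
    show "BB E' (Tot (Ty i)) (ren r X)" using BB_ren[OF assms(2) *(1)] by simp
    show "\<forall>E'' q W. wk E' q E'' \<longrightarrow> reds S (ren r X) W \<longrightarrow> tfin W \<longrightarrow> V n K E'' (ren q W) (?RR E'' q)"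
    proof (intro allI impI)
      fix E'' q W assume W: "wk E' q E''" "reds S (ren r X) W" "tfin W"
      then obtain W0 where W0: "reds S X W0" "W = ren r W0" using reds_ren_inv by blast
      with W(3) have "tfin W0" by (simp add: tfin_ren)
      then show "V n K E'' (ren q W) (?RR E'' q)" using *(3) wk_comp[OF assms(2) W(1)] W0 by (auto simp: ren_ren)
    qed
  qed
  then show ?thesis by blast
qed

lemma reds_step: "reds S x y \<Longrightarrow> x = y \<or> (\<exists>z. red S x z \<and> reds S z y)"
  by (erule converse_rtranclpE) auto

lemma BB_step: "ty S E e c \<Longrightarrow> (\<And>x. red S e x \<Longrightarrow> BB E c x) \<Longrightarrow> BB E c e"
proof -
  assume 1: "ty S E e c" and 2: "\<And>x. red S e x \<Longrightarrow> BB E c x"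
  have "ty S E e' c" if "reds S e e'" for e'
    using reds_step[OF that] 1 BB_D(3)[OF 2] by blast
  moreover have "SN e" using BB_D(1)[OF 2] by (rule SN_I)
  ultimately show ?thesis by (simp add: BB_def)
qed

text \<open>A reducible type that is no introduction form is itself never inspected, so each of its
  inspected reducts lies behind a first step, and its denotation is that of its immediate
  reducts.\<close>

lemma U_exp:
  assumes X: "isty E X i" "\<And>x. red S X x \<Longrightarrow> BB E (Tot (Ty i)) x" "nt X" "red S X x0"
    and R: "\<And>x. red S X x \<Longrightarrow> U n K E x R"
    and K: "\<And>E' r. wk E r E' \<Longrightarrow> \<exists>R. \<forall>x. red S X x \<longrightarrow> U n K E' (ren r x) R"
  shows "U n K E X R"
proof -
  have *: "\<exists>z. red S X z \<and> reds S z W" if W: "reds S X W" "tfin W" for W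
  proof -
    have "\<not> tfin X" using X(3,4) nt_not(2) by (auto simp: tfin_def is_value_def)
    then show ?thesis using reds_step W by blast
  qed
  show ?thesis
  proof (rule U_intro[OF BB_step[OF X(1,2)]])
    fix E' r assume "wk E r E'"
    from K[OF this] obtain R where R: "\<And>x. red S X x \<Longrightarrow> U n K E' (ren r x) R" by blast
    have "V n K E' (ren r W) R" if "reds S X W" "tfin W" for W
      using *[OF that] R U_inv reds_ren that(2) tfin_ren by blast
    then show "\<exists>R. \<forall>W. reds S X W \<longrightarrow> tfin W \<longrightarrow> V n K E' (ren r W) R" by blast
  next
    fix W assume "reds S X W" "tfin W"
    then show "V n K E W R" using * R U_inv by blast
  qed
qed

text \<open>All inspected reducts are normal and not canonical here, and their base relations
  coincide because the reducts are convertible to \<open>X\<close>.\<close>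

lemma U_inert:
  assumes X: "BB E (Tot (Ty i)) X" and nc: "\<And>W. reds S X W \<Longrightarrow> \<not> canon W"
  shows "U n K E X (BR E (Tot X))"
proof -
  have *: "V n K E' (ren r W) (BR E' (Tot (ren r X)))" if w: "wk E r E'" and W: "reds S X W" "tfin W" for E' r W
  proof -
    have "is_value S (ren r W)" using nc W by (auto simp: tfin_def is_value_ren)
    moreover have "isty E' (ren r W) i" using ty_ren(1)[OF w BB_D(3)[OF X W(1)]] by simp
    moreover have "BR E' (Tot (ren r X)) = BR E' (Tot (ren r W))" using BR_conv cv_ren[OF w BB_cv[OF X W(1)]] by simp
    ultimately show ?thesis using V_Inert[of E' "ren r W" i n K] nc[OF W(1)] by (simp add: canon_ren)
  qed
  show ?thesis by (rule U_intro[OF X]) (use * *[OF wk_id] in \<open>auto simp: ren_id\<close>)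
qed

lemma U_stuck: "BB E (Tot (Ty i)) X \<Longrightarrow> stuck X \<Longrightarrow> U n K E X (BR E (Tot X))"
  by (rule U_inert) (auto dest: stuck_reds stuck_nt nt_not(2))

lemma V_BR: "V n K E W R \<Longrightarrow> R \<subseteq> BR E (Tot W)"
  by (erule V.cases) (auto simp: piR_def posR_def)

lemma U_BR: "U n K E X R \<Longrightarrow> R \<subseteq> BR E (Tot X)"
  using U_nf V_BR BR_conv by blast

lemma UC_BR: "UC n K E c R \<Longrightarrow> R \<subseteq> BR E c"
  by (erule UC.cases) (auto simp: posR_def dest: U_BR)

lemma UC_hu: "UC n K E c R \<Longrightarrow> \<exists>i. hu S E c i"
  by (erule UC.cases) (use U_BB BB_D(2) H_Tot in blast)+

end

lemma canon_simps [simp]: "canon (Pi t c)" "canon (Refine t p)" "canon (Ty j)" "canon (tprod a b)" "canon (tsum a b)"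
  by (auto simp: canon_def)

section \<open>Inversion, uniqueness and closure properties of denotations\<close>

context sigc begin

inductive_cases V_PiE: "V n K E (Pi F C) R"
inductive_cases V_RefineE: "V n K E (Refine t p) R"
inductive_cases V_UnivE: "V n K E (Ty j) R"
inductive_cases V_ProdE: "V n K E (tprod a b) R"
inductive_cases V_SumE: "V n K E (tsum a b) R"
inductive_cases UC_TotE: "UC n K E (Tot X) R"
inductive_cases UC_PureE: "UC n K E (Comp Pure t wp) R"
inductive_cases UC_FE: "UC n K E (Comp (Usr F) t wp) R"

lemma V_Pi_inv: "V n K E (Pi F C) R \<Longrightarrow> \<exists>RF RC. R = piR E F C RF RC \<and> (\<forall>E' r. wk E r E' \<longrightarrow> U n K E' (ren r F) (RF E' r)) \<and>
    (\<forall>E' r a a'. wk E r E' \<longrightarrow> (a, a') \<in> RF E' r \<longrightarrow>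
      UC n K E' (instc (renc (upr r) C) a) (RC E' r a) \<and> UC n K E' (instc (renc (upr r) C) a') (RC E' r a))"
  by (erule V_PiE) (blast, simp)

lemma LR_inv:
  "V n K E (Refine t p) R \<Longrightarrow> \<exists>R0. R = R0 \<inter> BR E (Tot (Refine t p)) \<and> U n K E t R0"
  "V n K E (Ty j) R \<Longrightarrow> j < n \<and> R = univR K j E"
  "V n K E (tprod a b) R \<Longrightarrow> \<exists>Ra Rb. R = posR (Qprod Ra Rb) E (Tot (tprod a b)) \<and> U n K E a Ra \<and> U n K E b Rb"
  "V n K E (tsum a b) R \<Longrightarrow> \<exists>Ra Rb. R = posR (Qsum E a b Ra Rb) E (Tot (tsum a b)) \<and> U n K E a Ra \<and> U n K E b Rb"
  "UC n K E (Tot X) R \<Longrightarrow> U n K E X R"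
  "UC n K E (Comp Pure t wp) R \<Longrightarrow> \<exists>R0. R = posR (Qpure R0) E (Comp Pure t wp) \<and> U n K E t R0 \<and> hu S E (Comp Pure t wp) 0"
  "UC n K E (Comp (Usr F) t wp) R \<Longrightarrow> eff_of S F = Some D \<Longrightarrow>
     \<exists>R0. R = effR E (Comp (Usr F) t wp) R0 \<and> U n K E (repr D \<cdot> t \<cdot> wp) R0 \<and> hu S E (Comp (Usr F) t wp) 0"
  by (erule V_RefineE, blast, simp) (erule V_UnivE V_ProdE V_SumE UC_TotE UC_PureE UC_FE; (auto; fail) | blast)+

lemma V_inert_inv: "V n K E W R \<Longrightarrow> \<not> canon W \<Longrightarrow> R = BR E (Tot W)"
  by (erule V.cases) auto

lemma piR_cong:
  assumes "\<And>E' r. wk E r E' \<Longrightarrow> RF E' r = RF' E' r"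
    and "\<And>E' r a a'. wk E r E' \<Longrightarrow> (a, a') \<in> RF E' r \<Longrightarrow> RC E' r a = RC' E' r a"
  shows "piR E F C RF RC = piR E F C RF' RC'"
  unfolding piR_def using assms by auto

text \<open>Both derivations must assign their relation to a normal form of the type, which exists
  by strong normalization. For products the families agree only on the worlds and arguments over
  which the relation ranges, hence the restricted premises of \<open>piR_cong\<close>.\<close>

lemma LR_unique:
  "U n K E X R \<Longrightarrow> \<forall>R'. U n K E X R' \<longrightarrow> R = R'"
  "V n K E X R \<Longrightarrow> \<forall>R'. V n K E X R' \<longrightarrow> R = R'"
  "UC n K E c R \<Longrightarrow> \<forall>R'. UC n K E c R' \<longrightarrow> R = R'"
proof (induct rule: LR_induct)
  case (U_I E i X R)
  show ?case
  proof (intro allI impI)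
    fix R' assume R': "U n K E X R'"
    from SN_nf[OF BB_D(1)[OF U_I(1)]] obtain W where W: "reds S X W" "is_value S W" by blast
    then have "tfin W" by (simp add: tfin_def)
    then show "R = R'" using U_I(2) U_inv[OF R'] W by blast
  qed
next
  case (V_Pi E F C i RF RC)
  show ?case
  proof (intro allI impI)
    fix R' assume "V n K E (Pi F C) R'"
    then obtain RF' RC' where R': "R' = piR E F C RF' RC'" "\<forall>E' r. wk E r E' \<longrightarrow> U n K E' (ren r F) (RF' E' r)"
      "\<forall>E' r a a'. wk E r E' \<longrightarrow> (a, a') \<in> RF' E' r \<longrightarrow>
        UC n K E' (instc (renc (upr r) C) a) (RC' E' r a) \<and> UC n K E' (instc (renc (upr r) C) a') (RC' E' r a)"
      using V_Pi_inv by blast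
    have e: "RF E' r = RF' E' r" if "wk E r E'" for E' r using V_Pi(2) R'(2) that by blast
    show "piR E F C RF RC = R'" unfolding R'(1)
    proof (rule piR_cong[OF e])
      fix E' r a a' assume w: "wk E r E'" and a: "(a, a') \<in> RF E' r"
      then have "(a, a') \<in> RF' E' r" using e by blast
      then show "RC E' r a = RC' E' r a" using V_Pi(3) R'(3) w a by blast
    qed
  qed
next
  case (V_Refine E t \<phi> i R)
  then show ?case by (intro allI impI) (drule LR_inv(1), metis)
next
  case (V_Univ j E)
  then show ?case by (intro allI impI) (drule LR_inv(2), simp)
next
  case (V_Prod E a b i Ra Rb)
  then show ?case by (intro allI impI) (drule LR_inv(3), metis)
next
  case (V_Sum E a b i Ra Rb)
  then show ?case by (intro allI impI) (drule LR_inv(4), metis)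
next
  case (V_Inert E W i)
  then show ?case using V_inert_inv by blast
next
  case (UC_Tot E X R)
  then show ?case by (intro allI impI) (drule LR_inv(5), metis)
next
  case (UC_Pure E t wp R)
  then show ?case by (intro allI impI) (drule LR_inv(6), metis)
next
  case (UC_F F D E t wp R)
  show ?case
  proof (intro allI impI)
    fix R' assume "UC n K E (Comp (Usr F) t wp) R'"
    from LR_inv(7)[OF this UC_F(1)] obtain R0 where
      "R' = effR E (Comp (Usr F) t wp) R0" "U n K E (repr D \<cdot> t \<cdot> wp) R0" by blast
    moreover from this(2) UC_F(4) have "R = R0" by blast
    ultimately show "effR E (Comp (Usr F) t wp) R = R'" by simp
  qed
qed

lemmas U_unique = LR_unique(1)[rule_format] and UC_unique = LR_unique(3)[rule_format]

lemma posR_sym: assumes "(e, e') \<in> posR Q E c" "\<And>w w'. Q w w' \<Longrightarrow> Q w' w" shows "(e', e) \<in> posR Q E c"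
  using assms unfolding posR_def by (auto intro: BR_sym)

lemma Q_sym: "sym Ra \<Longrightarrow> sym Rb \<Longrightarrow> Qprod Ra Rb w w' \<Longrightarrow> Qprod Ra Rb w' w"
  "sym Ra \<Longrightarrow> sym Rb \<Longrightarrow> Qsum E A B Ra Rb w w' \<Longrightarrow> Qsum E A B Ra Rb w' w"
  "sym Ra \<Longrightarrow> Qpure Ra w w' \<Longrightarrow> Qpure Ra w' w"
  unfolding Qprod_def Qsum_def Qpure_def by (auto dest: symD)

lemma Q_trans: "trans Ra \<Longrightarrow> trans Rb \<Longrightarrow> Qprod Ra Rb w w' \<Longrightarrow> Qprod Ra Rb w' w'' \<Longrightarrow> Qprod Ra Rb w w''"
  "trans Ra \<Longrightarrow> trans Rb \<Longrightarrow> Qsum E A B Ra Rb w w' \<Longrightarrow> Qsum E A B Ra Rb w' w'' \<Longrightarrow> Qsum E A B Ra Rb w w''"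
  "trans Ra \<Longrightarrow> Qpure Ra w w' \<Longrightarrow> Qpure Ra w' w'' \<Longrightarrow> Qpure Ra w w''"
  unfolding Qprod_def Qsum_def Qpure_def by (auto dest: transD)

lemma Q_valform: "Qprod Ra Rb w w' \<Longrightarrow> valform w \<and> valform w'" "Qsum E A B Ra Rb w w' \<Longrightarrow> valform w \<and> valform w'"
  "Qpure Ra w w' \<Longrightarrow> valform w \<and> valform w'"
  unfolding Qprod_def Qsum_def Qpure_def valform_def by blast+

text \<open>A normal form of the middle term is inspected on both sides. It cannot be both stuck and
  an introduction form, so the outer terms fall into the same alternative.\<close>

lemma posR_trans:
  assumes 1: "(e, e') \<in> posR Q E c" and 2: "(e', e'') \<in> posR Q E c"
    and Q: "\<And>w w' w''. Q w w' \<Longrightarrow> Q w' w'' \<Longrightarrow> Q w w''" "\<And>w w'. Q w w' \<Longrightarrow> valform w \<and> valform w'"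
  shows "(e, e'') \<in> posR Q E c"
proof -
  have b: "(e, e') \<in> BR E c" "(e', e'') \<in> BR E c" using 1 2 by (auto simp: posR_def)
  then obtain w' where w': "reds S e' w'" "fin w'" using SN_nf BB_D(1) BR_D(2) unfolding fin_def by blast
  show ?thesis unfolding posR_def
  proof (clarify, intro conjI allI impI)
    show "(e, e'') \<in> BR E c" using b by (rule BR_trans)
    fix w w'' assume w: "reds S e w" "reds S e'' w''" "fin w" "fin w''"
    have "stuck w \<and> stuck w' \<or> Q w w'" "stuck w' \<and> stuck w'' \<or> Q w' w''" using 1 2 w w' by (auto simp: posR_def)
    then show "stuck w \<and> stuck w'' \<or> Q w w''" using Q stuck_nt nt_not(1) by blast
  qed
qed

text \<open>Swapping functions also swaps their arguments, while the result relation is indexed by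
  the left argument. The relations indexed by two related arguments are equal by
  \<open>UC_unique\<close>, since both interpret the result type at one of these arguments.\<close>

lemma LR_sym:
  "U n K E X R \<Longrightarrow> sym R" "V n K E X R \<Longrightarrow> sym R" "UC n K E c R \<Longrightarrow> sym R"
proof (induct rule: LR_induct)
  case (U_I E i X R)
  from SN_nf[OF BB_D(1)[OF U_I(1)]] obtain W where "reds S X W" "is_value S W" by blast
  then show ?case using U_I(2) tfin_def by blast
next
  case (V_Pi E F C i RF RC)
  show ?case
  proof (rule symI)
    fix f f' assume f: "(f, f') \<in> piR E F C RF RC"
    have "(ren r f' \<cdot> a, ren r f \<cdot> a') \<in> RC E' r a" if w: "wk E r E'" and a: "(a, a') \<in> RF E' r" for E' r a a'
    proof -
      have a': "(a', a) \<in> RF E' r" using V_Pi(2) w a symD by meson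
      then have "(ren r f \<cdot> a', ren r f' \<cdot> a) \<in> RC E' r a'" using f w unfolding piR_def by blast
      then have "(ren r f' \<cdot> a, ren r f \<cdot> a') \<in> RC E' r a'" using V_Pi(3) w a' symD by meson
      moreover have "RC E' r a' = RC E' r a" using V_Pi(3) w a a' UC_unique by meson
      ultimately show ?thesis by simp
    qed
    then show "(f', f) \<in> piR E F C RF RC" using f BR_sym unfolding piR_def by blast
  qed
qed (auto simp: sym_def[of "posR _ _ _"] intro: posR_sym Q_sym, (auto simp: sym_def intro: BR_sym)+)

text \<open>Two types related through a third share a denotation because that of the middle type is
  unique. This requires universes to be interpreted by \<open>U\<close> itself, hence
  \<open>KK\<close> in place of an arbitrary \<open>K\<close>.\<close>

lemma LR_trans:
  "LU n E X R \<Longrightarrow> trans R" "LV n E X R \<Longrightarrow> trans R" "LC n E c R \<Longrightarrow> trans R"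
proof (induct rule: LR_induct)
  case (U_I E i X R)
  from SN_nf[OF BB_D(1)[OF U_I(1)]] obtain W where "reds S X W" "is_value S W" by blast
  then show ?case using U_I(2) tfin_def by blast
next
  case (V_Pi E F C i RF RC)
  show ?case
  proof (rule transI)
    fix f g h assume f: "(f, g) \<in> piR E F C RF RC" "(g, h) \<in> piR E F C RF RC"
    have "(ren r f \<cdot> a, ren r h \<cdot> a') \<in> RC E' r a" if w: "wk E r E'" and a: "(a, a') \<in> RF E' r" for E' r a a'
    proof -
      have "(a', a) \<in> RF E' r" using V_Pi(2) w a LR_sym(1) symD by meson
      then have aa: "(a, a) \<in> RF E' r" using V_Pi(2) w a transD by meson
      then have "(ren r f \<cdot> a, ren r g \<cdot> a) \<in> RC E' r a" "(ren r g \<cdot> a, ren r h \<cdot> a') \<in> RC E' r a" using f w a unfolding piR_def by blast+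
      then show ?thesis using V_Pi(3) w a transD by meson
    qed
    then show "(f, h) \<in> piR E F C RF RC" using f BR_trans unfolding piR_def by blast
  qed
next
  case (V_Refine E t \<phi> i R)
  then show ?case by (auto simp: trans_def intro: BR_trans)
next
  case (V_Univ j E)
  show ?case
  proof (rule transI, clarify, intro conjI)
    fix A B C
    assume 1: "\<forall>E' r. wk E r E' \<longrightarrow> (\<exists>R. KK n j E' (ren r A) R \<and> KK n j E' (ren r B) R)"
      and 2: "\<forall>E' r. wk E r E' \<longrightarrow> (\<exists>R. KK n j E' (ren r B) R \<and> KK n j E' (ren r C) R)"
    show "\<forall>E' r. wk E r E' \<longrightarrow> (\<exists>R. KK n j E' (ren r A) R \<and> KK n j E' (ren r C) R)"
    proof (intro allI impI)
      fix E' r assume "wk E r E'"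
      with 1 2 obtain R R' where "KK n j E' (ren r A) R" "KK n j E' (ren r B) R" "KK n j E' (ren r B) R'" "KK n j E' (ren r C) R'" by meson
      then show "\<exists>R. KK n j E' (ren r A) R \<and> KK n j E' (ren r C) R" unfolding KK_eq[OF V_Univ] using U_unique by metis
    qed
  qed (auto intro: BR_trans)
next
  case (V_Prod E a b i Ra Rb)
  show ?case by (rule transI, erule (1) posR_trans) (auto intro: Q_trans V_Prod dest: Q_valform)
next
  case (V_Sum E a b i Ra Rb)
  show ?case by (rule transI, erule (1) posR_trans) (auto intro: Q_trans V_Sum dest: Q_valform)
next
  case (V_Inert E W i)
  then show ?case by (auto simp: trans_def intro: BR_trans)
next
  case (UC_Pure E t wp R)
  show ?case by (rule transI, erule (1) posR_trans) (auto intro: Q_trans UC_Pure dest: Q_valform)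
next
  case (UC_F F D E t wp R)
  then show ?case by (auto simp: trans_def intro: BR_trans)
qed

lemma posR_reds: "(e, e') \<in> posR Q E c \<Longrightarrow> reds S e x \<Longrightarrow> (x, e') \<in> posR Q E c"
  unfolding posR_def by (auto intro: BR_reds rtranclp_trans)

lemma LR_reds:
  "LU n E X R \<Longrightarrow> (e, e') \<in> R \<Longrightarrow> reds S e x \<Longrightarrow> (x, e') \<in> R"
  "LV n E X R \<Longrightarrow> (e, e') \<in> R \<Longrightarrow> reds S e x \<Longrightarrow> (x, e') \<in> R"
  "LC n E c R \<Longrightarrow> (e, e') \<in> R \<Longrightarrow> reds S e x \<Longrightarrow> (x, e') \<in> R"
proof (induct arbitrary: e e' x and e e' x and e e' x rule: LR_induct)
  case (U_I E i X R)
  from SN_nf[OF BB_D(1)[OF U_I(1)]] obtain W where "reds S X W" "is_value S W" by blast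
  then show ?case using U_I(2-4) tfin_def by blast
next
  case (V_Pi E F C i RF RC)
  from V_Pi(4) have f: "(e, e') \<in> BR E (Tot (Pi F C))" 
    "\<And>E' r a a'. wk E r E' \<Longrightarrow> (a, a') \<in> RF E' r \<Longrightarrow> (ren r e \<cdot> a, ren r e' \<cdot> a') \<in> RC E' r a" unfolding piR_def by blast+
  have "(ren r x \<cdot> a, ren r e' \<cdot> a') \<in> RC E' r a" if w: "wk E r E'" and a: "(a, a') \<in> RF E' r" for E' r a a'
    using V_Pi(3) w a f(2)[OF w a] reds_AppL[OF reds_ren[OF V_Pi(5)]] by blast
  then show ?case using BR_reds[OF f(1) V_Pi(5)] unfolding piR_def by blast
next
  case (V_Refine E t \<phi> i R)
  then show ?case by (auto intro: BR_reds)
next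
  case (V_Univ j E)
  then show ?case unfolding KK_eq[OF V_Univ(1)] using U_reds[OF _ reds_ren[OF V_Univ(3)]] BR_reds by blast
next
  case (UC_F F D E t wp R)
  then show ?case by (auto intro: BR_reds reds_Reify)
qed (auto intro: BR_reds posR_reds)

lemma LR_reds2:
  "LU n E X R \<Longrightarrow> (e, e') \<in> R \<Longrightarrow> reds S e' x \<Longrightarrow> (e, x) \<in> R"
  "LC n E c R \<Longrightarrow> (e, e') \<in> R \<Longrightarrow> reds S e' x \<Longrightarrow> (e, x) \<in> R"
  using LR_reds LR_sym symD by meson+

lemma BR_step:
  assumes t: "ty S E e c" and x0: "red S e x0" and H: "\<And>x. red S e x \<Longrightarrow> (x, e') \<in> BR E c"
  shows "(e, e') \<in> BR E c"
proof (rule BR_I)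
  show b: "BB E c e" by (rule BB_step[OF t BR_D(1)[OF H]])
  show "BB E c e'" by (rule BR_D(2)[OF H[OF x0]])
  show "cv E c e e'" using BB_cv[OF b r_into_rtranclp[of "red S", OF x0]] BR_D(3)[OF H[OF x0]] by (rule cv_trans)
qed

lemma posR_step:
  assumes t: "ty S E e c" and n: "nt e" and x0: "red S e x0" and H: "\<And>x. red S e x \<Longrightarrow> (x, e') \<in> posR Q E c"
  shows "(e, e') \<in> posR Q E c"
  unfolding posR_def
proof (clarify, intro conjI allI impI)
  show "(e, e') \<in> BR E c" by (rule BR_step[OF t x0]) (use H in \<open>auto simp: posR_def\<close>)
  fix w w' assume w: "reds S e w" "reds S e' w'" "fin w" "fin w'"
  have "\<not> fin e" using n x0 nt_not(1) by (auto simp: fin_def is_value_def)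
  then obtain z where "red S e z" "reds S z w" using reds_step w by blast
  then show "stuck w \<and> stuck w' \<or> Q w w'" using H w by (auto simp: posR_def)
qed

text \<open>Closure under expansion, as for reducibility candidates: a reducible term that is no
  introduction form is inspected only after a step. A first reduct \<open>x0\<close> is asked for
  because a normal term would satisfy the last premise vacuously; stuck terms are treated by
  \<open>LR_stuck\<close>.\<close>

lemma LR_exp:
  "LU n E X R \<Longrightarrow> tyt E e X \<Longrightarrow> nt e \<Longrightarrow> red S e x0 \<Longrightarrow> (\<And>x. red S e x \<Longrightarrow> (x, e') \<in> R) \<Longrightarrow> (e, e') \<in> R"
  "LV n E X R \<Longrightarrow> tyt E e X \<Longrightarrow> nt e \<Longrightarrow> red S e x0 \<Longrightarrow> (\<And>x. red S e x \<Longrightarrow> (x, e') \<in> R) \<Longrightarrow> (e, e') \<in> R"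
  "LC n E c R \<Longrightarrow> ty S E e c \<Longrightarrow> nt e \<Longrightarrow> red S e x0 \<Longrightarrow> (\<And>x. red S e x \<Longrightarrow> (x, e') \<in> R) \<Longrightarrow> (e, e') \<in> R"
proof (induct arbitrary: e e' x0 and e e' x0 and e e' x0 rule: LR_induct)
  case (U_I E i X R)
  from SN_nf[OF BB_D(1)[OF U_I(1)]] obtain W where W: "reds S X W" "is_value S W" by blast
  then show ?case using U_I(2-6) tfin_def ty_conv[OF U_I(3) BB_cv[OF U_I(1) W(1)]] by blast
next
  case (V_Pi E F C i RF RC)
  note H = V_Pi(7)
  have b: "(e, e') \<in> BR E (Tot (Pi F C))" by (rule BR_step[OF V_Pi(4,6)]) (use H in \<open>auto simp: piR_def\<close>)
  have "(ren r e \<cdot> a, ren r e' \<cdot> a') \<in> RC E' r a" if w: "wk E r E'" and a: "(a, a') \<in> RF E' r" for E' r a a'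
  proof -
    have RF: "LU n E' (ren r F) (RF E' r)" using V_Pi(2) w by blast
    have "isty E' (ren r (Pi F C)) i" using ty_ren(1)[OF w V_Pi(1)] by simp
    then obtain k j where F: "isty E' (ren r F) k" and C: "hu S (ren r F # E') (renc (upr r) C) j" using pi_inv by force
    have e: "tyt E' (ren r e) (Pi (ren r F) (renc (upr r) C))" using ty_ren(1)[OF w V_Pi(4)] by simp
    \<comment> \<open>The application may also step inside its argument, so the claim is proved by
      induction on the normalization of \<open>a\<close>; the result relation at a reduct of
      \<open>a\<close> is the same by uniqueness.\<close>
    have "SN a" using a U_BR[OF RF] BR_D(1) BB_D(1) by blast
    then show ?thesis using a
    proof (induct a rule: SN.induct)
      case (SN_I a)
      have UCa: "LC n E' (instc (renc (upr r) C) a) (RC E' r a)" "LC n E' (instc (renc (upr r) C) a') (RC E' r a)" using V_Pi(3) w SN_I(3) by blast+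
      have ta: "tyt E' a (ren r F)" using SN_I(3) U_BR[OF RF] BR_D(1) BB_D(2) by blast
      have IH: "\<And>e e' x0. ty S E' e (instc (renc (upr r) C) a) \<Longrightarrow> nt e \<Longrightarrow> red S e x0 \<Longrightarrow> (\<And>x. red S e x \<Longrightarrow> (x, e') \<in> RC E' r a) \<Longrightarrow> (e, e') \<in> RC E' r a"
        using V_Pi(3) w SN_I(3) by blast
      show ?case
      proof (rule IH[OF Y_App[OF e ta F C]])
        show "nt (ren r e \<cdot> a)" using V_Pi(5) by simp
        show "red S (ren r e \<cdot> a) (ren r x0 \<cdot> a)" using red_ren[OF V_Pi(6)] E_AppL by blast
        fix x assume "red S (ren r e \<cdot> a) x"
        then consider e1 where "red S (ren r e) e1" "x = e1 \<cdot> a" | a1 where "red S a a1" "x = ren r e \<cdot> a1"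
          using red_app_nt V_Pi(5) by (metis nt_ren)
        then show "(x, ren r e' \<cdot> a') \<in> RC E' r a"
        proof cases
          case 1
          then obtain e2 where "red S e e2" "e1 = ren r e2" using red_ren_inv by blast
          then show ?thesis using H[of e2] w SN_I(3) 1 by (auto simp: piR_def)
        next
          case 2
          have a1: "(a1, a') \<in> RF E' r" using LR_reds(1)[OF RF SN_I(3)] 2(1) by blast
          then have "(ren r e \<cdot> a1, ren r e' \<cdot> a') \<in> RC E' r a1" using SN_I(2) 2(1) by blast
          moreover have "RC E' r a1 = RC E' r a" using V_Pi(3) w a1 UCa UC_unique by meson
          ultimately show ?thesis using 2 by simp
        qed
      qed
    qed
  qed
  then show ?case using b unfolding piR_def by blast
next
  case (V_Refine E t \<phi> i R)
  have b: "(e, e') \<in> BR E (Tot (Refine t \<phi>))" by (rule BR_step[OF V_Refine(4,6)]) (use V_Refine(7) in auto)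
  obtain k where "isty E t k" using U_BB[OF V_Refine(2)] BB_D(2) by blast
  then have "tyt E e t" using ty_st[OF V_Refine(4) ST_RefineL V_Refine(1)] by blast
  then show ?case using b V_Refine by blast
next
  case (V_Univ j E)
  have b: "(e, e') \<in> BR E (Tot (Ty j))" by (rule BR_step[OF V_Univ(2,4)]) (use V_Univ(5) in auto)
  have "\<exists>R. LU j E' (ren r e) R \<and> LU j E' (ren r e') R" if w: "wk E r E'" for E' r
  proof -
    \<comment> \<open>All one-step reducts of the type \<open>e\<close> have the same denotation
      because each of them shares one with \<open>e'\<close>.\<close>
    have H: "\<exists>R. \<forall>x. red S e x \<longrightarrow> LU j E'' (ren q x) R \<and> LU j E'' (ren q e') R" if w': "wk E q E''" for E'' q
    proof -
      from V_Univ(5)[OF V_Univ(4)] w' obtain R where R: "LU j E'' (ren q e') R" unfolding KK_eq[OF V_Univ(1)] by blast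
      have "LU j E'' (ren q x) R" if x: "red S e x" for x
      proof -
        from V_Univ(5)[OF x] w' obtain R' where R': "LU j E'' (ren q e') R'" "LU j E'' (ren q x) R'" unfolding KK_eq[OF V_Univ(1)] by blast
        then show ?thesis using U_unique[OF R R'(1)] by simp
      qed
      then show ?thesis using R by blast
    qed
    from H[OF w] obtain R where R: "\<And>x. red S e x \<Longrightarrow> LU j E' (ren r x) R \<and> LU j E' (ren r e') R" by blast
    have "LU j E' (ren r e) R"
    proof (rule U_exp)
      show "isty E' (ren r e) j" using ty_ren(1)[OF w V_Univ(2)] by simp
      show "nt (ren r e)" using V_Univ(3) by simp
      show "red S (ren r e) (ren r x0)" by (rule red_ren[OF V_Univ(4)])
      fix x assume "red S (ren r e) x"
      then obtain x1 where x1: "red S e x1" "x = ren r x1" using red_ren_inv by blast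
      then show "LU j E' x R" using R by blast
      have "BB E (Tot (Ty j)) x1" using V_Univ(5)[OF x1(1)] BR_D(1) by blast
      then show "BB E' (Tot (Ty j)) x" using BB_ren[OF w] x1(2) by fastforce
    next
      fix E'' q assume "wk E' q E''"
      from H[OF wk_comp[OF w this]] obtain R where R: "\<And>x. red S e x \<Longrightarrow> LU j E'' (ren (\<lambda>n. q (r n)) x) R" by blast
      have "LU j E'' (ren q x) R" if "red S (ren r e) x" for x
        using red_ren_inv[OF that refl] R by (auto simp: ren_ren)
      then show "\<exists>R. \<forall>x. red S (ren r e) x \<longrightarrow> LU j E'' (ren q x) R" by blast
    qed
    then show ?thesis using R[OF V_Univ(4)] by blast
  qed
  then show ?case unfolding KK_eq[OF V_Univ(1)] using b by blast
next
  case (V_Prod E a b i Ra Rb)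
  show ?case by (rule posR_step[OF V_Prod(6,7,8,9)])
next
  case (V_Sum E a b i Ra Rb)
  show ?case by (rule posR_step[OF V_Sum(6,7,8,9)])
next
  case (V_Inert E W i)
  show ?case by (rule BR_step[OF V_Inert(4,6,7)])
next
  case (UC_Tot E X R)
  then show ?case by blast
next
  case (UC_Pure E t wp R)
  show ?case by (rule posR_step[OF UC_Pure(4-7)])
next
  case (UC_F F D E t wp R)
  have b: "(e, e') \<in> BR E (Comp (Usr F) t wp)" by (rule BR_step[OF UC_F(5,7)]) (use UC_F(8) in auto)
  have "(Reify e, Reify e') \<in> R"
  proof (rule UC_F(4)[OF Y_Reify[OF UC_F(1,5,2)]])
    show "nt (Reify e)" by simp
    show "red S (Reify e) (Reify x0)" using UC_F(7) by (rule E_Reify)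
    fix x assume "red S (Reify e) x"
    then show "(x, Reify e') \<in> R" using red_Reify_nt[OF UC_F(6)] UC_F(8) by blast
  qed
  then show ?case using b by blast
qed

end

section \<open>Expansion and monotonicity\<close>

context sigc begin

lemmas reds_snoc = rtranclp.rtrancl_into_rtrancl[of "red S"] and reds_trans = rtranclp_trans[of "red S"]

text \<open>No sequence of steps turns \<open>f\<close> into an abstraction or into a projection
  awaiting its pair, so an application of \<open>f\<close> reduces only componentwise.\<close>

definition nr :: "tm \<Rightarrow> bool" where
  "nr f \<longleftrightarrow> (\<forall>f'. reds S f f' \<longrightarrow> \<not> is_Lam f' \<and> \<not> proj2 f')"

lemma nr_reds: "nr f \<Longrightarrow> reds S f f' \<Longrightarrow> nr f'"
  unfolding nr_def using reds_trans by blast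

lemma nr_stuck: "stuck f \<Longrightarrow> nr f"
  unfolding nr_def using stuck_reds stuck_nt nt_not by blast

lemma red_app_nr: "nr f \<Longrightarrow> red S (f \<cdot> a) x \<Longrightarrow> (\<exists>f'. red S f f' \<and> x = f' \<cdot> a) \<or> (\<exists>a'. red S a a' \<and> x = f \<cdot> a')"
  by (erule red_AppE) (auto simp: nr_def)

lemma reds_app_nr: assumes "nr f" "reds S (f \<cdot> a) x" shows "\<exists>f' a'. reds S f f' \<and> reds S a a' \<and> x = f' \<cdot> a'"
  using assms(2)
proof (induct rule: rtranclp_induct)
  case (step y z)
  then obtain f' a' where *: "reds S f f'" "reds S a a'" "y = f' \<cdot> a'" by blast
  from red_app_nr[OF nr_reds[OF assms(1) *(1)], of a' z] step(2) *(3) show ?case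
    using reds_snoc[OF *(1)] reds_snoc[OF *(2)] *(1,2) by blast
qed blast

lemma reds_Con: "reds S (Con k) x \<Longrightarrow> x = Con k"
  by (induct rule: rtranclp_induct) (auto elim: red_ConE)

lemma nr_Con: "nr (Con k)"
  unfolding nr_def using reds_Con is_Lam_simps(2) proj2_simps(1) by metis

lemma nr_app: "nr f \<Longrightarrow> (\<And>f' a'. reds S f f' \<Longrightarrow> \<not> proj2 (f' \<cdot> a')) \<Longrightarrow> nr (f \<cdot> a)"
  unfolding nr_def[of "f \<cdot> a"] using reds_app_nr by (metis is_Lam_simps(3))

lemma nr_Con1: "nr (Con k \<cdot> a)"
  by (rule nr_app[OF nr_Con]) (auto dest: reds_Con)
lemma reds_Con1: "reds S (Con k \<cdot> a) x \<Longrightarrow> \<exists>a'. reds S a a' \<and> x = Con k \<cdot> a'"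
  using reds_app_nr[OF nr_Con] reds_Con by metis
lemma nr_Con2: "k \<noteq> FstC \<Longrightarrow> k \<noteq> SndC \<Longrightarrow> nr (Con k \<cdot> a \<cdot> b)"
  by (rule nr_app[OF nr_Con1]) (auto dest: reds_Con1)
lemma reds_Con2: "reds S (Con k \<cdot> a \<cdot> b) x \<Longrightarrow> \<exists>a' b'. reds S a a' \<and> reds S b b' \<and> x = Con k \<cdot> a' \<cdot> b'"
  using reds_app_nr[OF nr_Con1] reds_Con1 by metis
lemma nr_Con3: "k \<noteq> FstC \<Longrightarrow> k \<noteq> SndC \<Longrightarrow> nr (Con k \<cdot> a \<cdot> b \<cdot> d)"
  by (rule nr_app[OF nr_Con2]) (auto dest: reds_Con2)
lemma reds_Con3: "k \<noteq> FstC \<Longrightarrow> k \<noteq> SndC \<Longrightarrow> reds S (Con k \<cdot> a \<cdot> b \<cdot> d) x \<Longrightarrow>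
   \<exists>a' b' d'. reds S a a' \<and> reds S b b' \<and> reds S d d' \<and> x = Con k \<cdot> a' \<cdot> b' \<cdot> d'"
  using reds_app_nr[OF nr_Con2] reds_Con2 by metis
lemma reds_Con4: "k \<noteq> FstC \<Longrightarrow> k \<noteq> SndC \<Longrightarrow> reds S (Con k \<cdot> a \<cdot> b \<cdot> d \<cdot> e) x \<Longrightarrow>
   \<exists>a' b' d' e'. reds S a a' \<and> reds S b b' \<and> reds S d d' \<and> reds S e e' \<and> x = Con k \<cdot> a' \<cdot> b' \<cdot> d' \<cdot> e'"
  using reds_app_nr[OF nr_Con3] reds_Con3 by metis

lemma SN_app_nr: "SN f \<Longrightarrow> SN a \<Longrightarrow> nr f \<Longrightarrow> SN (f \<cdot> a)"
proof (induct f arbitrary: a rule: SN.induct)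
  case (SN_I f)
  note IHf = SN_I(2)
  from SN_I(3,4) show ?case
  proof (induct a rule: SN.induct)
    case (SN_I a)
    show ?case
    proof (rule SN.SN_I)
      fix x assume "red S (f \<cdot> a) x"
      then consider f' where "red S f f'" "x = f' \<cdot> a" | a' where "red S a a'" "x = f \<cdot> a'" using red_app_nr[OF SN_I(3)] by blast
      then show "SN x"
      proof cases
        case 1
        then show ?thesis using IHf[OF 1(1) SN.SN_I] nr_reds[OF SN_I(3)] SN_I(1) by blast
      next
        case 2
        then show ?thesis using SN_I by blast
      qed
    qed
  qed
qed

lemma ty_app_reds:
  assumes f: "BB E (Tot (Pi F C)) f" and a: "BB E (Tot F) a" and F: "isty E F k" and C: "hu S (F # E) C j"
    and r: "reds S f f'" "reds S a a'"
  shows "ty S E (f' \<cdot> a') (instc C a)"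
proof -
  have cv: "cv E (Tot F) a' a" by (rule cv_sym[OF BB_cv[OF a r(2)]])
  have "ty S E (f' \<cdot> a') (instc C a')" by (rule Y_App[OF BB_D(3)[OF f r(1)] BB_D(3)[OF a r(2)] F C])
  then show ?thesis using sc_inst[OF F C cv] hu_inst[OF C cv_ty1[OF cv]] hu_inst[OF C cv_ty2[OF cv]] by (rule Y_Sub)
qed

lemma BB_app:
  assumes f: "BB E (Tot (Pi F C)) f" and a: "BB E (Tot F) a" and F: "isty E F k" and C: "hu S (F # E) C j"
    and n: "nr f"
  shows "BB E (instc C a) (f \<cdot> a)"
  unfolding BB_def using SN_app_nr[OF BB_D(1)[OF f] BB_D(1)[OF a] n] reds_app_nr[OF n] ty_app_reds[OF f a F C] by blast

lemma BR_app:
  assumes f: "(f, f') \<in> BR E (Tot (Pi F C))" and a: "(a, a') \<in> BR E (Tot F)" and F: "isty E F k" and C: "hu S (F # E) C j"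
    and n: "nr f" "nr f'"
  shows "(f \<cdot> a, f' \<cdot> a') \<in> BR E (instc C a)"
proof (rule BR_I)
  show "BB E (instc C a) (f \<cdot> a)" by (rule BB_app[OF BR_D(1)[OF f] BR_D(1)[OF a] F C n(1)])
  have b: "BB E (instc C a') (f' \<cdot> a')" by (rule BB_app[OF BR_D(2)[OF f] BR_D(2)[OF a] F C n(2)])
  note cv = cv_sym[OF BR_D(3)[OF a]]
  show "BB E (instc C a) (f' \<cdot> a')" by (rule BB_sc[OF b sc_inst[OF F C cv] hu_inst[OF C cv_ty1[OF cv]] hu_inst[OF C cv_ty2[OF cv]]])
  show "cv E (instc C a) (f \<cdot> a) (f' \<cdot> a')" by (rule cv_app[OF BR_D(3)[OF f] BR_D(3)[OF a] F C])
qed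

lemma SN_Reify_nt: "SN e \<Longrightarrow> stuck e \<Longrightarrow> SN (Reify e)"
proof (induct e rule: SN.induct)
  case (SN_I e)
  show ?case by (rule SN.SN_I) (use red_Reify_nt[OF stuck_nt[OF SN_I(3)]] SN_I(2) stuck_red[OF SN_I(3)] in blast)
qed

lemma reds_Reify_stuck: assumes "reds S (Reify e) x" "stuck e" shows "\<exists>e'. reds S e e' \<and> x = Reify e'"
  using assms(1)
proof (induct rule: rtranclp_induct)
  case (step y z)
  then obtain e' where e': "reds S e e'" "y = Reify e'" by blast
  then have "stuck e'" using stuck_reds assms(2) by blast
  then show ?case using red_Reify_nt[OF stuck_nt, of e' S z] step(2) e' rtranclp.rtrancl_into_rtrancl[of "red S"] by blast
qed blast

lemma BB_Reify_stuck: "eff_of S F = Some D \<Longrightarrow> hu S E (Comp (Usr F) t wp) 0 \<Longrightarrow> BB E (Comp (Usr F) t wp) e \<Longrightarrow> stuck e \<Longrightarrow>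
   BB E (Tot (repr D \<cdot> t \<cdot> wp)) (Reify e)"
  unfolding BB_def using SN_Reify_nt reds_Reify_stuck Y_Reify by blast

lemma cv_Reify: "eff_of S F = Some D \<Longrightarrow> hu S E (Comp (Usr F) t wp) 0 \<Longrightarrow> cv E (Comp (Usr F) t wp) e e' \<Longrightarrow>
   cv E (Tot (repr D \<cdot> t \<cdot> wp)) (Reify e) (Reify e')"
  by (rule cv_map[of E "Comp (Usr F) t wp"]) (auto intro: reds_Reify Y_Reify cv_ty2)

lemma posR_stuck: "(e, e') \<in> BR E c \<Longrightarrow> stuck e \<Longrightarrow> stuck e' \<Longrightarrow> (e, e') \<in> posR Q E c"
  unfolding posR_def using stuck_reds by blast

text \<open>Every denotation contains the base-related stuck terms, hence the variables. An
  application or reification of a stuck term is stuck again and normalizes with its parts, so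
  products and effects pass to the types of these; positive types admit stuck terms by
  definition.\<close>

lemma LR_stuck:
  "LU n E X R \<Longrightarrow> (e, e') \<in> BR E (Tot X) \<Longrightarrow> stuck e \<Longrightarrow> stuck e' \<Longrightarrow> (e, e') \<in> R"
  "LV n E X R \<Longrightarrow> (e, e') \<in> BR E (Tot X) \<Longrightarrow> stuck e \<Longrightarrow> stuck e' \<Longrightarrow> (e, e') \<in> R"
  "LC n E c R \<Longrightarrow> (e, e') \<in> BR E c \<Longrightarrow> stuck e \<Longrightarrow> stuck e' \<Longrightarrow> (e, e') \<in> R"
proof (induct arbitrary: e e' and e e' and e e' rule: LR_induct)
  case (U_I E i X R)
  from SN_nf[OF BB_D(1)[OF U_I(1)]] obtain W where W: "reds S X W" "is_value S W" by blast
  then have "tfin W" by (simp add: tfin_def)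
  then show ?case using U_I(2-5) BR_conv[OF BB_cv[OF U_I(1) W(1)]] W(1) by blast
next
  case (V_Pi E F C i RF RC)
  have "(ren r e \<cdot> a, ren r e' \<cdot> a') \<in> RC E' r a" if w: "wk E r E'" and a: "(a, a') \<in> RF E' r" for E' r a a'
  proof -
    have RF: "LU n E' (ren r F) (RF E' r)" using V_Pi(2) w by blast
    have "isty E' (ren r (Pi F C)) i" using ty_ren(1)[OF w V_Pi(1)] by simp
    then obtain k j where F: "isty E' (ren r F) k" and C: "hu S (ren r F # E') (renc (upr r) C) j" using pi_inv by force
    have s: "stuck (ren r e)" "stuck (ren r e')" using V_Pi(5,6) stuck_ren by auto
    have "(ren r e \<cdot> a, ren r e' \<cdot> a') \<in> BR E' (instc (renc (upr r) C) a)"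
      by (rule BR_app[OF _ _ F C]) (use BR_ren[OF w V_Pi(4)] U_BR[OF RF] a s nr_stuck in auto)
    then show ?thesis using V_Pi(3) w a s stuck.intros(2) by blast
  qed
  then show ?case using V_Pi(4) unfolding piR_def by blast
next
  case (V_Refine E t \<phi> i R)
  obtain k where "isty E t k" using U_BB[OF V_Refine(2)] BB_D(2) by blast
  then have "(e, e') \<in> BR E (Tot t)" using BR_st[OF V_Refine(4) ST_RefineL V_Refine(1)] by blast
  then show ?case using V_Refine by blast
next
  case (V_Univ j E)
  have "\<exists>R. LU j E' (ren r e) R \<and> LU j E' (ren r e') R" if w: "wk E r E'" for E' r
  proof -
    have b: "(ren r e, ren r e') \<in> BR E' (Tot (Ty j))" using BR_ren[OF w V_Univ(2)] by simp
    have "LU j E' (ren r e) (BR E' (Tot (ren r e)))" "LU j E' (ren r e') (BR E' (Tot (ren r e')))"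
      using U_stuck BR_D(1,2)[OF b] V_Univ(3,4) stuck_ren by blast+
    then show ?thesis using BR_conv[OF BR_D(3)[OF b]] by metis
  qed
  then show ?case unfolding KK_eq[OF V_Univ(1)] using V_Univ(2) by blast
next
  case (UC_F F D E t wp R)
  have "(Reify e, Reify e') \<in> BR E (Tot (repr D \<cdot> t \<cdot> wp))"
    using BB_Reify_stuck[OF UC_F(1,2)] cv_Reify[OF UC_F(1,2)] UC_F(5-7) unfolding BR_def by blast
  then have "(Reify e, Reify e') \<in> R" using UC_F(4,6,7) stuck.intros(5) by blast
  then show ?case using UC_F(5) by blast
qed (auto intro: posR_stuck)

lemma LR_level:
  assumes "n \<le> m" "\<And>j. j < n \<Longrightarrow> K j = K' j"
  shows "U n K E X R \<Longrightarrow> U m K' E X R" "V n K E X R \<Longrightarrow> V m K' E X R" "UC n K E c R \<Longrightarrow> UC m K' E c R"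
proof (induct rule: U_V_UC.inducts)
  case (U_I E i X RR)
  show ?case by (rule U_V_UC.U_I[OF U_I(1)]) (use U_I(2) in blast)
next
  case (V_Pi E F C i RF RC)
  show ?case by (rule U_V_UC.V_Pi[OF V_Pi(1)]) (use V_Pi(2,3) in blast)+
next
  case (V_Univ j E)
  then show ?case using U_V_UC.V_Univ[of j m K' E] assms by simp
qed (auto intro: U_V_UC.intros)

lemma LU_mono: "LU n E X R \<Longrightarrow> n \<le> m \<Longrightarrow> LU m E X R"
  by (erule LR_level(1)[rotated 2]) (auto simp: KK_eq)
lemma LC_mono: "LC n E c R \<Longrightarrow> n \<le> m \<Longrightarrow> LC m E c R"
  by (erule LR_level(3)[rotated 2]) (auto simp: KK_eq)

text \<open>Levels may be raised, so derivations at different levels are compared at their maximum.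
  From here on the level at which a denotation was obtained is immaterial.\<close>

lemma LU_unique: "LU n E X R \<Longrightarrow> LU m E X R' \<Longrightarrow> R = R'"
  using LU_mono[of n E X R "max n m"] LU_mono[of m E X R' "max n m"] U_unique by simp
lemma LC_unique: "LC n E c R \<Longrightarrow> LC m E c R' \<Longrightarrow> R = R'"
  using LC_mono[of n E c R "max n m"] LC_mono[of m E c R' "max n m"] UC_unique by simp

lemma valform_ren: "valform (ren r w) = valform w"
proof
  assume "valform (ren r w)"
  then show "valform w" by (auto simp: valform_def ren_inv eq_commute[of "ren r w"])
qed (auto simp: valform_def)

lemma fin_ren: "fin (ren r w) = fin w"
  by (simp add: fin_def valform_ren is_value_ren)

lemma posR_ren:
  assumes w: "wk E r E'" and e: "(e, e') \<in> posR Q E c" and Q: "\<And>w w'. Q w w' \<Longrightarrow> Q' (ren r w) (ren r w')"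
  shows "(ren r e, ren r e') \<in> posR Q' E' (renc r c)"
  unfolding posR_def
proof (clarify, intro conjI allI impI)
  show "(ren r e, ren r e') \<in> BR E' (renc r c)" using BR_ren[OF w] e by (auto simp: posR_def)
  fix u u' assume u: "reds S (ren r e) u" "reds S (ren r e') u'" "fin u" "fin u'"
  then obtain v v' where v: "reds S e v" "reds S e' v'" "u = ren r v" "u' = ren r v'" using reds_ren_inv by blast
  then have "stuck v \<and> stuck v' \<or> Q v v'" using e u by (auto simp: posR_def fin_ren)
  then show "stuck u \<and> stuck u' \<or> Q' u u'" using v Q stuck_ren by blast
qed

lemma upr_upr: "(\<lambda>n. upr q (upr r n)) = upr (\<lambda>n. q (r n))"
  by (rule nat_ext) simp_all

text \<open>Monotonicity in the world. For an arbitrary type the inclusion is known at a normal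
  form, and uniqueness there identifies the relation that \<open>U_kripke\<close> gives to the
  renamed type with that of the renamed normal form.\<close>

lemma LR_ren:
  "U n K E X R \<Longrightarrow> wk E r E' \<Longrightarrow> \<exists>R'. U n K E' (ren r X) R' \<and> (\<forall>e e'. (e, e') \<in> R \<longrightarrow> (ren r e, ren r e') \<in> R')"
  "V n K E X R \<Longrightarrow> wk E r E' \<Longrightarrow> \<exists>R'. V n K E' (ren r X) R' \<and> (\<forall>e e'. (e, e') \<in> R \<longrightarrow> (ren r e, ren r e') \<in> R')"
  "UC n K E c R \<Longrightarrow> wk E r E' \<Longrightarrow> \<exists>R'. UC n K E' (renc r c) R' \<and> (\<forall>e e'. (e, e') \<in> R \<longrightarrow> (ren r e, ren r e') \<in> R')"
proof (induct arbitrary: E' r and E' r and E' r rule: U_V_UC.inducts)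
  case (U_I E i X RR)
  from SN_nf[OF BB_D(1)[OF U_I(1)]] obtain W where W: "reds S X W" "is_value S W" by blast
  then have f: "tfin W" by (simp add: tfin_def)
  have "U n K E X (RR E (\<lambda>m. m))" by (rule U_V_UC.U_I[OF U_I(1)]) (use U_I(2) in blast)
  from U_kripke[OF this U_I(3)] obtain R' where R': "U n K E' (ren r X) R'" by blast
  have "\<exists>R'. V n K E' (ren r (ren (\<lambda>m. m) W)) R' \<and> (\<forall>e e'. (e, e') \<in> RR E (\<lambda>m. m) \<longrightarrow> (ren r e, ren r e') \<in> R')"
    using U_I(2) wk_id W(1) f U_I(3) by blast
  then obtain R'' where R'': "V n K E' (ren r W) R''" "\<forall>e e'. (e, e') \<in> RR E (\<lambda>m. m) \<longrightarrow> (ren r e, ren r e') \<in> R''" by auto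
  have "V n K E' (ren r W) R'" using U_inv[OF R'] reds_ren[OF W(1)] f tfin_ren by blast
  then have "R' = R''" using LR_unique(2) R''(1) by blast
  then show ?case using R' R''(2) by blast
next
  case (V_Pi E F C i RF RC)
  let ?RF = "\<lambda>E'' q. RF E'' (\<lambda>n. q (r n))" and ?RC = "\<lambda>E'' q. RC E'' (\<lambda>n. q (r n))"
  have "V n K E' (Pi (ren r F) (renc (upr r) C)) (piR E' (ren r F) (renc (upr r) C) ?RF ?RC)"
  proof (rule U_V_UC.V_Pi)
    show "isty E' (Pi (ren r F) (renc (upr r) C)) i" using ty_ren(1)[OF V_Pi(4,1)] by simp
    show "\<forall>E'' q. wk E' q E'' \<longrightarrow> U n K E'' (ren q (ren r F)) (?RF E'' q)"
      using V_Pi(2) wk_comp[OF V_Pi(4)] by (auto simp: ren_ren)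
    show "\<forall>E'' q a a'. wk E' q E'' \<longrightarrow> (a, a') \<in> ?RF E'' q \<longrightarrow>
        UC n K E'' (instc (renc (upr q) (renc (upr r) C)) a) (?RC E'' q a) \<and> UC n K E'' (instc (renc (upr q) (renc (upr r) C)) a') (?RC E'' q a)"
      using V_Pi(3) wk_comp[OF V_Pi(4)] unfolding renc_renc upr_upr by blast
  qed
  moreover have "(ren r e, ren r e') \<in> piR E' (ren r F) (renc (upr r) C) ?RF ?RC" if e: "(e, e') \<in> piR E F C RF RC" for e e'
    unfolding piR_def
  proof (clarify, intro conjI allI impI)
    show "(ren r e, ren r e') \<in> BR E' (Tot (Pi (ren r F) (renc (upr r) C)))" using BR_ren[OF V_Pi(4), of e e' "Tot (Pi F C)"] e by (auto simp: piR_def)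
    fix E'' q a a' assume "wk E' q E''" "(a, a') \<in> ?RF E'' q"
    then show "(ren q (ren r e) \<cdot> a, ren q (ren r e') \<cdot> a') \<in> ?RC E'' q a"
      using e wk_comp[OF V_Pi(4)] unfolding piR_def ren_ren by blast
  qed
  ultimately show ?case by auto
next
  case (V_Refine E t \<phi> i R)
  from V_Refine(3)[OF V_Refine(4)] obtain R' where R': "U n K E' (ren r t) R'" "\<forall>e e'. (e, e') \<in> R \<longrightarrow> (ren r e, ren r e') \<in> R'" by blast
  have "isty E' (Refine (ren r t) (ren (upr r) \<phi>)) i" using ty_ren(1)[OF V_Refine(4,1)] by simp
  from U_V_UC.V_Refine[OF this R'(1)] show ?case using R'(2) BR_ren[OF V_Refine(4), where c = "Tot (Refine t \<phi>)"] by fastforce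
next
  case (V_Univ j E)
  have *: "(ren r e, ren r e') \<in> univR K j E'"
    if "(e, e') \<in> univR K j E" for e e'
    using that BR_ren[OF V_Univ(2), where c = "Tot (Ty j)"] wk_comp[OF V_Univ(2)] by (auto simp: ren_ren)
  have "V n K E' (ren r (Ty j)) (univR K j E')"
    using U_V_UC.V_Univ[OF V_Univ(1), of K E'] by simp
  then show ?case using * by blast
next
  case (V_Prod E a b i Ra Rb)
  from V_Prod(3,5)[OF V_Prod(6)] obtain Ra' Rb' where R': "U n K E' (ren r a) Ra'" "\<forall>e e'. (e, e') \<in> Ra \<longrightarrow> (ren r e, ren r e') \<in> Ra'"
    "U n K E' (ren r b) Rb'" "\<forall>e e'. (e, e') \<in> Rb \<longrightarrow> (ren r e, ren r e') \<in> Rb'" by blast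
  have "isty E' (tprod (ren r a) (ren r b)) i" using ty_ren(1)[OF V_Prod(6,1)] by simp
  moreover have "Qprod Ra' Rb' (ren r w) (ren r w')" if "Qprod Ra Rb w w'" for w w' using that R'(2,4) unfolding Qprod_def by auto
  ultimately show ?case using U_V_UC.V_Prod[of E' "ren r a" "ren r b" i n K Ra' Rb'] R'(1,3) posR_ren[OF V_Prod(6), where c = "Tot (tprod a b)"]
    by (intro exI[of _ "posR (Qprod Ra' Rb') E' (Tot (tprod (ren r a) (ren r b)))"]) auto
next
  case (V_Sum E a b i Ra Rb)
  from V_Sum(3,5)[OF V_Sum(6)] obtain Ra' Rb' where R': "U n K E' (ren r a) Ra'" "\<forall>e e'. (e, e') \<in> Ra \<longrightarrow> (ren r e, ren r e') \<in> Ra'"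
    "U n K E' (ren r b) Rb'" "\<forall>e e'. (e, e') \<in> Rb \<longrightarrow> (ren r e, ren r e') \<in> Rb'" by blast
  have "isty E' (tsum (ren r a) (ren r b)) i" using ty_ren(1)[OF V_Sum(6,1)] by simp
  moreover have "Qsum E' (ren r a) (ren r b) Ra' Rb' (ren r w) (ren r w')" if "Qsum E a b Ra Rb w w'" for w w'
    using that R'(2,4) cv_ren[OF V_Sum(6), where c = "Tot (tsum a b)"] unfolding Qsum_def by fastforce
  ultimately show ?case using U_V_UC.V_Sum[of E' "ren r a" "ren r b" i n K Ra' Rb'] R'(1,3) posR_ren[OF V_Sum(6), where c = "Tot (tsum a b)"]
    by (intro exI[of _ "posR (Qsum E' (ren r a) (ren r b) Ra' Rb') E' (Tot (tsum (ren r a) (ren r b)))"]) auto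
next
  case (V_Inert E W i)
  have "V n K E' (ren r W) (BR E' (Tot (ren r W)))"
    using U_V_UC.V_Inert[of E' "ren r W" i] ty_ren(1)[OF V_Inert(4,1)] V_Inert(2,3) by (simp add: is_value_ren canon_ren)
  then show ?case using BR_ren[OF V_Inert(4), where c = "Tot W"] by auto
next
  case (UC_Tot E X R)
  then show ?case by (metis U_V_UC.UC_Tot renc.simps(1))
next
  case (UC_Pure E t wp R)
  from UC_Pure(3)[OF UC_Pure(4)] obtain R' where R': "U n K E' (ren r t) R'" "\<forall>e e'. (e, e') \<in> R \<longrightarrow> (ren r e, ren r e') \<in> R'" by blast
  have "hu S E' (Comp Pure (ren r t) (ren r wp)) 0" using ty_ren(2)[OF UC_Pure(4,1)] by simp
  moreover have "Qpure R' (ren r w) (ren r w')" if "Qpure R w w'" for w w' using that R'(2) unfolding Qpure_def by auto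
  ultimately show ?case using U_V_UC.UC_Pure[of E' "ren r t" "ren r wp" n K R'] R'(1) posR_ren[OF UC_Pure(4), where c = "Comp Pure t wp"]
    by (intro exI[of _ "posR (Qpure R') E' (Comp Pure (ren r t) (ren r wp))"]) auto
next
  case (UC_F F D E t wp R)
  from UC_F(4)[OF UC_F(5)] obtain R' where R': "U n K E' (repr D \<cdot> ren r t \<cdot> ren r wp) R'" "\<forall>e e'. (e, e') \<in> R \<longrightarrow> (ren r e, ren r e') \<in> R'"
    using csD(2)[OF UC_F(1)] by (auto simp: closed_ren)
  have "hu S E' (Comp (Usr F) (ren r t) (ren r wp)) 0" using ty_ren(2)[OF UC_F(5,2)] by simp
  from U_V_UC.UC_F[OF UC_F(1) this R'(1)] show ?case using R'(2) BR_ren[OF UC_F(5), where c = "Comp (Usr F) t wp"] by fastforce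
qed

end

section \<open>Semantic typing\<close>

context sigc begin

declare KK.simps [simp del]

lemma upr_id [simp]: "upr (\<lambda>m. m) = (\<lambda>m. m)"
  by (rule nat_ext) simp_all

lemma ren_upr_ups: "ren (upr r) (sub (ups \<sigma>) e) = sub (ups (\<lambda>n. ren r (\<sigma> n))) e"
  and renc_upr_ups: "renc (upr r) (subc (ups \<sigma>) c) = subc (ups (\<lambda>n. ren r (\<sigma> n))) c"
proof -
  have "(\<lambda>n. ren (upr r) (ups \<sigma> n)) = ups (\<lambda>n. ren r (\<sigma> n))" by (rule nat_ext) (simp_all add: ren_ren)
  then show "ren (upr r) (sub (ups \<sigma>) e) = sub (ups (\<lambda>n. ren r (\<sigma> n))) e" "renc (upr r) (subc (ups \<sigma>) c) = subc (ups (\<lambda>n. ren r (\<sigma> n))) c"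
    by (simp_all add: ren_sub renc_subc)
qed

lemma ups_scons: "ups \<sigma> = scons (Var 0) (\<lambda>n. sh (\<sigma> n))"
  by (rule nat_ext) simp_all

lemma LC_Tot: "LC n E (Tot X) R \<longleftrightarrow> LU n E X R"
  using UC_Tot LR_inv(5) by blast

lemma LU_D: "LU n E X R \<Longrightarrow> (e, e') \<in> R \<Longrightarrow> (e, e') \<in> BR E (Tot X)"
  using U_BR by blast
lemma LC_D: "LC n E c R \<Longrightarrow> (e, e') \<in> R \<Longrightarrow> (e, e') \<in> BR E c"
  using UC_BR by blast

lemma LR_refl: "LU n E X R \<Longrightarrow> (e, e') \<in> R \<Longrightarrow> (e, e) \<in> R \<and> (e', e') \<in> R"
  by (meson LR_sym(1) LR_trans(1) symD transD)

definition UnivR :: "nat \<Rightarrow> tm list \<Rightarrow> trel" where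
  "UnivR i E = univR LU i E"

lemma LV_Univ: "i < n \<Longrightarrow> LV n E (Ty i) (UnivR i E)"
  using V_Univ[of i n "KK n" E] by (simp add: UnivR_def KK_eq)

lemma BB_Con: "ty S E (Con k) c \<Longrightarrow> BB E c (Con k)"
  unfolding BB_def using reds_Con SN_I red_ConE by metis

lemma LU_Univ: "i < n \<Longrightarrow> LU n E (Ty i) (UnivR i E)"
proof (rule U_intro[OF BB_Con[OF Y_Univ]])
  fix E' r assume "i < n"
  then show "\<exists>R. \<forall>W. reds S (Ty i) W \<longrightarrow> tfin W \<longrightarrow> LV n E' (ren r W) R"
    by (intro exI[of _ "UnivR i E'"]) (auto dest!: reds_Con intro: LV_Univ)
qed (auto dest!: reds_Con intro: LV_Univ)

lemma LU_Univ_D: "LU n E (Ty i) R \<Longrightarrow> R = UnivR i E"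
  using LU_unique LU_Univ[of i "Suc i"] by blast

text \<open>Uniqueness lets the families hidden in a product be replaced by any known denotation of
  the domain in the current world.\<close>

lemma pi_elim:
  assumes "LU n E (Pi F C) R" "(f, f') \<in> R" "LU m E F RF" "(a, a') \<in> RF"
  shows "\<exists>RC. LC n E (instc C a) RC \<and> LC n E (instc C a') RC \<and> (f \<cdot> a, f' \<cdot> a') \<in> RC"
proof -
  have "LV n E (Pi F C) R" using U_inv[OF assms(1)] by (auto simp: tfin_def)
  from V_Pi_inv[OF this] obtain RF' RC' where *: "R = piR E F C RF' RC'" "\<forall>E' r. wk E r E' \<longrightarrow> LU n E' (ren r F) (RF' E' r)"
    "\<forall>E' r a a'. wk E r E' \<longrightarrow> (a, a') \<in> RF' E' r \<longrightarrow>
      LC n E' (instc (renc (upr r) C) a) (RC' E' r a) \<and> LC n E' (instc (renc (upr r) C) a') (RC' E' r a)" by blast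
  have "RF' E (\<lambda>m. m) = RF" using *(2)[rule_format, OF wk_id] LU_unique[OF assms(3)] by simp
  then have a: "(a, a') \<in> RF' E (\<lambda>m. m)" using assms(4) by simp
  have "(f \<cdot> a, f' \<cdot> a') \<in> RC' E (\<lambda>m. m) a" using assms(2) a wk_id[of E] unfolding *(1) piR_def by force
  then show ?thesis using *(3)[rule_format, OF wk_id a] by auto
qed

lemma pi_intro:
  assumes "LU n E (Pi F C) R" "(f, f') \<in> BR E (Tot (Pi F C))"
    and H: "\<And>E' r a a' RF RC. wk E r E' \<Longrightarrow> LU n E' (ren r F) RF \<Longrightarrow> (a, a') \<in> RF \<Longrightarrow> LC n E' (instc (renc (upr r) C) a) RC \<Longrightarrow>
      LC n E' (instc (renc (upr r) C) a') RC \<Longrightarrow> (ren r f \<cdot> a, ren r f' \<cdot> a') \<in> RC"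
  shows "(f, f') \<in> R"
proof -
  have "LV n E (Pi F C) R" using U_inv[OF assms(1)] by (auto simp: tfin_def)
  from V_Pi_inv[OF this] obtain RF RC where *: "R = piR E F C RF RC" "\<forall>E' r. wk E r E' \<longrightarrow> LU n E' (ren r F) (RF E' r)"
    "\<forall>E' r a a'. wk E r E' \<longrightarrow> (a, a') \<in> RF E' r \<longrightarrow>
      LC n E' (instc (renc (upr r) C) a) (RC E' r a) \<and> LC n E' (instc (renc (upr r) C) a') (RC E' r a)" by blast
  show ?thesis unfolding *(1) piR_def using assms(2) H *(2,3) by blast
qed

text \<open>Related substitutions; that both instances of a type have the same interpretation is required in every extension of the world.\<close>

definition G1 :: "nat \<Rightarrow> tm list \<Rightarrow> tm \<Rightarrow> tm \<Rightarrow> tm \<Rightarrow> tm \<Rightarrow> bool" where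
  "G1 m E X Y a b \<longleftrightarrow> (\<forall>E' r. wk E r E' \<longrightarrow> (\<exists>R. LU m E' (ren r X) R \<and> LU m E' (ren r Y) R \<and> (ren r a, ren r b) \<in> R))"

lemma G1_ren: "G1 m E X Y a b \<Longrightarrow> wk E r E' \<Longrightarrow> G1 m E' (ren r X) (ren r Y) (ren r a) (ren r b)"
  unfolding G1_def using wk_comp by (simp add: ren_ren)

lemma G1_D: "G1 m E X Y a b \<Longrightarrow> \<exists>R. LU m E X R \<and> LU m E Y R \<and> (a, b) \<in> R"
  unfolding G1_def using wk_id by (metis ren_id)

lemma G1_sym: "G1 m E X Y a b \<Longrightarrow> G1 m E Y X b a"
  unfolding G1_def using LR_sym(1) symD by meson

lemma G1_refl: "G1 m E X Y a b \<Longrightarrow> G1 m E X X a a"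
  unfolding G1_def using LR_refl by meson

definition G :: "tm list \<Rightarrow> tm list \<Rightarrow> (nat \<Rightarrow> tm) \<Rightarrow> (nat \<Rightarrow> tm) \<Rightarrow> bool" where
  "G E \<Gamma> \<sigma> \<tau> \<longleftrightarrow> (\<forall>n<length \<Gamma>. \<exists>m. G1 m E (sub \<sigma> (lk \<Gamma> n)) (sub \<tau> (lk \<Gamma> n)) (\<sigma> n) (\<tau> n))"

lemma G_sym: "G E \<Gamma> \<sigma> \<tau> \<Longrightarrow> G E \<Gamma> \<tau> \<sigma>"
  unfolding G_def using G1_sym by blast
lemma G_refl: "G E \<Gamma> \<sigma> \<tau> \<Longrightarrow> G E \<Gamma> \<sigma> \<sigma>"
  unfolding G_def using G1_refl by blast
lemma G_ren: "G E \<Gamma> \<sigma> \<tau> \<Longrightarrow> wk E r E' \<Longrightarrow> G E' \<Gamma> (\<lambda>n. ren r (\<sigma> n)) (\<lambda>n. ren r (\<tau> n))"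
  unfolding G_def
proof (intro allI impI)
  fix n assume g: "\<forall>n<length \<Gamma>. \<exists>m. G1 m E (sub \<sigma> (lk \<Gamma> n)) (sub \<tau> (lk \<Gamma> n)) (\<sigma> n) (\<tau> n)"
    and wk: "wk E r E'" and n: "n < length \<Gamma>"
  from g n obtain m where m: "G1 m E (sub \<sigma> (lk \<Gamma> n)) (sub \<tau> (lk \<Gamma> n)) (\<sigma> n) (\<tau> n)" by blast
  show "\<exists>m. G1 m E' (sub (\<lambda>n. ren r (\<sigma> n)) (lk \<Gamma> n)) (sub (\<lambda>n. ren r (\<tau> n)) (lk \<Gamma> n)) (ren r (\<sigma> n)) (ren r (\<tau> n))"
    using G1_ren[OF m wk] by (intro exI[of _ m]) (simp only: ren_sub)
qed

lemma G_Nil: "G E [] \<sigma> \<tau>"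
  by (simp add: G_def)

lemma G_scv: assumes "G E \<Gamma> \<sigma> \<tau>" shows "scv E \<Gamma> \<sigma> \<tau>"
  unfolding scv_def tsb_def
proof (intro conjI allI impI)
  fix n assume n: "n < length \<Gamma>"
  then obtain m where "G1 m E (sub \<sigma> (lk \<Gamma> n)) (sub \<tau> (lk \<Gamma> n)) (\<sigma> n) (\<tau> n)" 
    using assms unfolding G_def by blast
  from G1_D[OF this] obtain R where R: "LU m E (sub \<sigma> (lk \<Gamma> n)) R"
     "LU m E (sub \<tau> (lk \<Gamma> n)) R" "(\<sigma> n, \<tau> n) \<in> R" by blast
  show "tyt E (\<sigma> n) (sub \<sigma> (lk \<Gamma> n))" by (rule BB_D(2)[OF BR_D(1)[OF LU_D[OF R(1,3)]]])
  show "tyt E (\<tau> n) (sub \<tau> (lk \<Gamma> n))" by (rule BB_D(2)[OF BR_D(2)[OF LU_D[OF R(2,3)]]])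
  show "cv E (Tot (sub \<sigma> (lk \<Gamma> n))) (\<sigma> n) (\<tau> n)" by (rule BR_D(3)[OF LU_D[OF R(1,3)]])
qed

lemma G_tsb: "G E \<Gamma> \<sigma> \<tau> \<Longrightarrow> tsb E \<sigma> \<Gamma>"
  using G_scv scv_def by blast

lemma G_tl: assumes "G E (t # \<Gamma>) \<sigma> \<tau>" shows "G E \<Gamma> (\<lambda>n. \<sigma> (Suc n)) (\<lambda>n. \<tau> (Suc n))"
  unfolding G_def
proof (intro allI impI)
  fix n assume "n < length \<Gamma>"
  with assms[unfolded G_def, rule_format, of "Suc n"]
  show "\<exists>m. G1 m E (sub (\<lambda>n. \<sigma> (Suc n)) (lk \<Gamma> n)) (sub (\<lambda>n. \<tau> (Suc n)) (lk \<Gamma> n)) (\<sigma> (Suc n)) (\<tau> (Suc n))"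
    by (simp only: sub_tl nth_Cons_Suc length_Cons Suc_less_eq)
qed

definition semc :: "tm list \<Rightarrow> comp \<Rightarrow> nat \<Rightarrow> bool" where
  "semc \<Gamma> c j \<longleftrightarrow> (\<forall>E \<sigma> \<tau>. G E \<Gamma> \<sigma> \<tau> \<longrightarrow> (\<exists>R. LC j E (subc \<sigma> c) R \<and> LC j E (subc \<tau> c) R))"

text \<open>The level \<open>n\<close> is chosen once for all substitutions, and both instances of
  the type share the relation; \<open>sem_use\<close> turns this into membership in whatever
  denotation is at hand.\<close>

definition sem :: "tm list \<Rightarrow> tm \<Rightarrow> comp \<Rightarrow> bool" where
  "sem \<Gamma> e c \<longleftrightarrow> (\<exists>n. \<forall>E \<sigma> \<tau>. G E \<Gamma> \<sigma> \<tau> \<longrightarrow> (\<exists>R. LC n E (subc \<sigma> c) R \<and> LC n E (subc \<tau> c) R \<and> (sub \<sigma> e, sub \<tau> e) \<in> R))"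

lemma semcD: "semc \<Gamma> c j \<Longrightarrow> G E \<Gamma> \<sigma> \<tau> \<Longrightarrow> \<exists>R. LC j E (subc \<sigma> c) R \<and> LC j E (subc \<tau> c) R"
  unfolding semc_def by blast

lemma semD: "sem \<Gamma> e c \<Longrightarrow> \<exists>n. \<forall>E \<sigma> \<tau>. G E \<Gamma> \<sigma> \<tau> \<longrightarrow> (\<exists>R. LC n E (subc \<sigma> c) R \<and> LC n E (subc \<tau> c) R \<and> (sub \<sigma> e, sub \<tau> e) \<in> R)"
  unfolding sem_def by blast

lemma sem_use: assumes "sem \<Gamma> e c" "G E \<Gamma> \<sigma> \<tau>" "LC m E (subc \<sigma> c) R" shows "(sub \<sigma> e, sub \<tau> e) \<in> R"
proof -
  from semD[OF assms(1)] assms(2) obtain n R' where "LC n E (subc \<sigma> c) R'" "(sub \<sigma> e, sub \<tau> e) \<in> R'" by blast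
  then show ?thesis using LC_unique[OF assms(3)] by blast
qed

lemma semI: "semc \<Gamma> c n \<Longrightarrow> (\<And>E \<sigma> \<tau> R. G E \<Gamma> \<sigma> \<tau> \<Longrightarrow> LC n E (subc \<sigma> c) R \<Longrightarrow> LC n E (subc \<tau> c) R \<Longrightarrow> (sub \<sigma> e, sub \<tau> e) \<in> R) \<Longrightarrow> sem \<Gamma> e c"
  unfolding sem_def semc_def by meson

lemma sem_BR: "sem \<Gamma> e c \<Longrightarrow> G E \<Gamma> \<sigma> \<tau> \<Longrightarrow> (sub \<sigma> e, sub \<tau> e) \<in> BR E (subc \<sigma> c)"
  using semD LC_D by blast

lemma sem_BB: "sem \<Gamma> e c \<Longrightarrow> G E \<Gamma> \<sigma> \<tau> \<Longrightarrow> BB E (subc \<sigma> c) (sub \<sigma> e)"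
  using sem_BR BR_D(1) by blast

lemma semc_Univ: "semc \<Gamma> (Tot (Ty i)) (Suc i)"
  unfolding semc_def using LU_Univ LC_Tot by auto

lemma semc_tot: assumes "sem \<Gamma> X (Tot (Ty i))" shows "semc \<Gamma> (Tot X) i"
  unfolding semc_def
proof (intro allI impI)
  fix E \<sigma> \<tau> assume g: "G E \<Gamma> \<sigma> \<tau>"
  have "(sub \<sigma> X, sub \<tau> X) \<in> UnivR i E"
    by (rule sem_use[OF assms g, of "Suc i"]) (simp add: LC_Tot LU_Univ)
  then show "\<exists>R. LC i E (subc \<sigma> (Tot X)) R \<and> LC i E (subc \<tau> (Tot X)) R"
    unfolding UnivR_def using wk_id by (force simp: LC_Tot)
qed

lemma sem_univ_I:
  assumes b: "\<And>E \<sigma> \<tau>. G E \<Gamma> \<sigma> \<tau> \<Longrightarrow> (sub \<sigma> X, sub \<tau> X) \<in> BR E (Tot (Ty i))" and c: "semc \<Gamma> (Tot X) i"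
  shows "sem \<Gamma> X (Tot (Ty i))"
proof (rule semI[OF semc_Univ])
  fix E \<sigma> \<tau> R assume g: "G E \<Gamma> \<sigma> \<tau>" and "LC (Suc i) E (subc \<sigma> (Tot (Ty i))) R"
  then have "R = UnivR i E" using LU_Univ_D by (simp add: LC_Tot)
  moreover have "\<exists>R. LU i E' (ren r (sub \<sigma> X)) R \<and> LU i E' (ren r (sub \<tau> X)) R" if "wk E r E'" for E' r
    using semcD[OF c G_ren[OF g that]] by (simp add: LC_Tot ren_sub)
  ultimately show "(sub \<sigma> X, sub \<tau> X) \<in> R" using b[OF g] by (auto simp: UnivR_def)
qed

lemma G_cons:
  assumes g: "G E \<Gamma> \<sigma> \<tau>" and t: "semc \<Gamma> (Tot t) i" and R: "LU m E (sub \<sigma> t) R" "(a, b) \<in> R"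
  shows "G E (t # \<Gamma>) (scons a \<sigma>) (scons b \<tau>)"
  unfolding G_def
proof (intro allI impI)
  fix n assume n: "n < length (t # \<Gamma>)"
  show "\<exists>m. G1 m E (sub (scons a \<sigma>) (lk (t # \<Gamma>) n)) (sub (scons b \<tau>) (lk (t # \<Gamma>) n)) (scons a \<sigma> n) (scons b \<tau> n)"
  proof (cases n)
    case 0
    have "G1 i E (sub \<sigma> t) (sub \<tau> t) a b" unfolding G1_def
    proof (intro allI impI)
      fix E' r assume w: "wk E r E'"
      from semcD[OF t G_ren[OF g w]] obtain R1 where R1: "LU i E' (ren r (sub \<sigma> t)) R1" "LU i E' (ren r (sub \<tau> t)) R1" by (auto simp: LC_Tot ren_sub)
      from LR_ren(1)[OF R(1) w] R(2) obtain R2 where "LU m E' (ren r (sub \<sigma> t)) R2" "(ren r a, ren r b) \<in> R2" by blast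
      then show "\<exists>R. LU i E' (ren r (sub \<sigma> t)) R \<and> LU i E' (ren r (sub \<tau> t)) R \<and> (ren r a, ren r b) \<in> R" using R1 LU_unique by blast
    qed
    then show ?thesis unfolding 0 by (simp only: sub_scons_drop scons_simps nth_Cons_0) blast
  next
    case (Suc k)
    then show ?thesis using g n unfolding G_def by (simp only: sub_scons_drop scons_simps nth_Cons_Suc length_Cons Suc_less_eq)
  qed
qed

lemma BR_Var0: "isty E F i \<Longrightarrow> (Var 0, Var 0) \<in> BR (F # E) (Tot (sh F))"
proof (rule BR_I)
  have t: "tyt (F # E) (Var 0) (sh F)" using Y_Var[of 0 "F # E" S] by simp
  have "x = Var 0" if "reds S (Var 0) x" for x using that by (induct rule: rtranclp_induct) (auto elim: red_VarE)
  then show "BB (F # E) (Tot (sh F)) (Var 0)" "BB (F # E) (Tot (sh F)) (Var 0)" unfolding BB_def using t by (auto intro: SN_I elim: red_VarE)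
  show "cv (F # E) (Tot (sh F)) (Var 0) (Var 0)" by (rule cv_refl[OF t])
qed

text \<open>The fresh variable is stuck and therefore related to itself. Thus the body of a binder
  is covered by a pair of related substitutions, in the world extended by the type of the
  variable.\<close>

lemma G_up:
  assumes g: "G E \<Gamma> \<sigma> \<tau>" and t: "semc \<Gamma> (Tot t) i"
  shows "G (sub \<sigma> t # E) (t # \<Gamma>) (ups \<sigma>) (ups \<tau>)"
proof -
  from semcD[OF t g] obtain R where R: "LU i E (sub \<sigma> t) R" by (auto simp: LC_Tot)
  then obtain k where F: "isty E (sub \<sigma> t) k" using U_BB BB_D(2) by blast
  obtain R' where R': "LU i (sub \<sigma> t # E) (sh (sub \<sigma> t)) R'" using U_kripke[OF R wk_Suc] by blast
  have "(Var 0, Var 0) \<in> R'" using LR_stuck(1)[OF R' BR_Var0[OF F]] stuck.intros(1) by blast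
  with G_cons[OF G_ren[OF g wk_Suc] t, of i "sub \<sigma> t" R'] R' show ?thesis unfolding ups_scons by (simp add: ren_sub)
qed

lemma scv_sym: assumes w: "wfc \<Gamma>" and s: "scv E \<Gamma> \<sigma> \<tau>" shows "scv E \<Gamma> \<tau> \<sigma>"
  unfolding scv_def
proof (intro conjI allI impI)
  show "tsb E \<sigma> \<Gamma>" "tsb E \<tau> \<Gamma>" using s by (auto simp: scv_def)
    fix n assume n: "n < length \<Gamma>"
    then have 1: "cv E (Tot (sub \<sigma> (lk \<Gamma> n))) (\<sigma> n) (\<tau> n)" using s unfolding scv_def by blast
    have "\<exists>i. isty \<Gamma> (lk \<Gamma> n) i" using w n
    proof (induct \<Gamma> arbitrary: n)
      case (Cons t \<Gamma>)
      show ?case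
      proof (cases n)
        case 0
        obtain i where "isty \<Gamma> t i" using Cons(2) by auto
        from ty_ren(1)[OF wk_Suc this, of t] show ?thesis using 0 by auto
      next
        case (Suc k)
        then obtain i where "isty \<Gamma> (lk \<Gamma> k) i" using Cons by auto
        from ty_ren(1)[OF wk_Suc this, of t] show ?thesis unfolding Suc by (auto simp: ren_ren)
      qed
    qed simp
    then obtain i where "isty \<Gamma> (lk \<Gamma> n) i" by blast
    from cv_conv[OF 1 cvsub_type[OF w s this]] show "cv E (Tot (sub \<tau> (lk \<Gamma> n))) (\<tau> n) (\<sigma> n)" by (rule cv_sym)
qed

text \<open>Each instance is a reduct of the corresponding application of the closure
  \<open>clo\<close>, and the two applications are convertible.\<close>

lemma cvsub:
  assumes w: "wfc \<Gamma>" and s: "scv E \<Gamma> \<sigma> \<tau>" and e: "ty S \<Gamma> e c" and c: "hu S \<Gamma> c j"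
  shows "cv E (subc \<sigma> c) (sub \<sigma> e) (sub \<tau> e)"
proof -
  have t: "tsb E \<sigma> \<Gamma>" "tsb E \<tau> \<Gamma>" using s by (auto simp: scv_def)
  note s' = scv_sym[OF w s]
  have h: "hu S E (subc \<sigma> c) j" "hu S E (subc \<tau> c) j" using ty_sub(2)[OF t(1) c] ty_sub(2)[OF t(2) c] by blast+
  have 1: "cv E (subc \<sigma> c) (clo \<Gamma> \<sigma> e) (clo \<Gamma> \<tau> e)" by (rule clo_cv[OF w s e c])
  have 2: "ty S E (sub \<sigma> e) (subc \<sigma> c)" by (rule ty_sub(1)[OF t(1) e])
  have 3: "ty S E (sub \<tau> e) (subc \<sigma> c)" by (rule Y_Sub[OF ty_sub(1)[OF t(2) e] cvsub_sc[OF w s' c] h(2,1)])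
  show ?thesis using cv_trans[OF cv_exp[OF 2 cv_ty1[OF 1] clo_reds] cv_trans[OF 1 cv_red[OF cv_ty2[OF 1] 3 clo_reds]]] .
qed

lemma G_cv: "wfc \<Gamma> \<Longrightarrow> G E \<Gamma> \<sigma> \<tau> \<Longrightarrow> ty S \<Gamma> e c \<Longrightarrow> hu S \<Gamma> c j \<Longrightarrow> cv E (subc \<sigma> c) (sub \<sigma> e) (sub \<tau> e)"
  using cvsub G_scv by blast

lemma G_sc: "wfc \<Gamma> \<Longrightarrow> G E \<Gamma> \<sigma> \<tau> \<Longrightarrow> hu S \<Gamma> c i \<Longrightarrow> sc S E (subc \<sigma> c) (subc \<tau> c)"
  using cvsub_sc G_scv by blast

lemma G_cvt: "wfc \<Gamma> \<Longrightarrow> G E \<Gamma> \<sigma> \<tau> \<Longrightarrow> isty \<Gamma> X i \<Longrightarrow> cv E (Tot (Ty i)) (sub \<sigma> X) (sub \<tau> X)"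
  using cvsub_type G_scv by blast

text \<open>By symmetry, it suffices to consider the left instance.\<close>

lemma sem_base:
  assumes w: "wfc \<Gamma>" and e: "ty S \<Gamma> e c" and c: "hu S \<Gamma> c j"
    and H: "\<And>E \<sigma> \<tau>. G E \<Gamma> \<sigma> \<tau> \<Longrightarrow> BB E (subc \<sigma> c) (sub \<sigma> e)" and g: "G E \<Gamma> \<sigma> \<tau>"
  shows "(sub \<sigma> e, sub \<tau> e) \<in> BR E (subc \<sigma> c)"
proof (rule BR_I)
  show "BB E (subc \<sigma> c) (sub \<sigma> e)" by (rule H[OF g])
  show "BB E (subc \<sigma> c) (sub \<tau> e)"
    by (rule BB_sc[OF H[OF G_sym[OF g]] G_sc[OF w G_sym[OF g] c] ty_sub(2)[OF G_tsb[OF G_sym[OF g]] c] ty_sub(2)[OF G_tsb[OF g] c]])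
  show "cv E (subc \<sigma> c) (sub \<sigma> e) (sub \<tau> e)" by (rule G_cv[OF w g e c])
qed

section \<open>Variables, universes, products, refinements and functions\<close>

lemma sem_var:
  assumes n: "n < length \<Gamma>" and c: "semc \<Gamma> (Tot (lk \<Gamma> n)) i"
  shows "sem \<Gamma> (Var n) (Tot (lk \<Gamma> n))"
proof (rule semI[OF c])
  fix E \<sigma> \<tau> R assume g: "G E \<Gamma> \<sigma> \<tau>" and R: "LC i E (subc \<sigma> (Tot (lk \<Gamma> n))) R"
  then show "(sub \<sigma> (Var n), sub \<tau> (Var n)) \<in> R"
    using n G1_D LU_unique unfolding G_def LC_Tot subc.simps sub.simps by blast
qed

lemma sem_univ: "sem \<Gamma> (Ty i) (Tot (Ty (Suc i)))"
proof (rule sem_univ_I[OF _ semc_Univ])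
  fix E \<sigma> \<tau>
  have "BB E (Tot (Ty (Suc i))) (Ty i)" by (rule BB_Con[OF Y_Univ])
  then show "(sub \<sigma> (Ty i), sub \<tau> (Ty i)) \<in> BR E (Tot (Ty (Suc i)))" using cv_refl[OF Y_Univ] by (auto intro: BR_I)
qed

text \<open>A type determines its relation, so the relation can be described; the families required
  by a product are then written directly in terms of instances of its parts.\<close>

definition elU :: "tm list \<Rightarrow> tm \<Rightarrow> trel" where "elU E X = (THE R. \<exists>n. LU n E X R)"
definition elC :: "tm list \<Rightarrow> comp \<Rightarrow> trel" where "elC E c = (THE R. \<exists>n. LC n E c R)"

lemma elU: "LU n E X R \<Longrightarrow> elU E X = R"
  unfolding elU_def using LU_unique by (intro the_equality) blast+
lemma elC: "LC n E c R \<Longrightarrow> elC E c = R"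
  unfolding elC_def using LC_unique by (intro the_equality) blast+

lemma reds_normal: "reds S X W \<Longrightarrow> (\<And>x. \<not> red S X x) \<Longrightarrow> W = X"
  using reds_step by blast

text \<open>No instance of the type reduces, so each is its own normal form and only the
  interpretation of normal types has to be supplied.\<close>

lemma sem_normal:
  assumes w: "wfc \<Gamma>" and X: "isty \<Gamma> X i" and nf: "\<And>\<sigma> x. \<not> red S (sub \<sigma> X) x"
    and V: "\<And>E \<sigma> \<tau>. G E \<Gamma> \<sigma> \<tau> \<Longrightarrow> \<exists>R. LV i E (sub \<sigma> X) R \<and> LV i E (sub \<tau> X) R"
  shows "sem \<Gamma> X (Tot (Ty i))"
proof -
  have BB: "BB E (Tot (Ty i)) (sub \<sigma> X)" if g: "G E \<Gamma> \<sigma> \<tau>" for E \<sigma> \<tau>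
  proof -
    have "SN (sub \<sigma> X)" by (rule SN_I) (use nf in blast)
    then show ?thesis unfolding BB_def using reds_normal[OF _ nf] ty_sub(1)[OF G_tsb[OF g] X] by auto
  qed
  have U: "LU i E (sub \<sigma> X) R" if g: "G E \<Gamma> \<sigma> \<tau>" and R: "LV i E (sub \<sigma> X) R" for E \<sigma> \<tau> R
  proof (rule U_intro[OF BB[OF g]])
    fix E' r assume "wk E r E'"
    from V[OF G_ren[OF g this]] obtain R where "LV i E' (ren r (sub \<sigma> X)) R" unfolding ren_sub by blast
    then show "\<exists>R. \<forall>W. reds S (sub \<sigma> X) W \<longrightarrow> tfin W \<longrightarrow> LV i E' (ren r W) R" using reds_normal[OF _ nf] by blast
  next
    fix W assume "reds S (sub \<sigma> X) W"
    then show "LV i E W R" using R reds_normal[OF _ nf] by blast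
  qed
  show ?thesis
  proof (rule sem_univ_I)
    fix E \<sigma> \<tau> assume "G E \<Gamma> \<sigma> \<tau>"
    from sem_base[OF w X hu_Ty _ this] show "(sub \<sigma> X, sub \<tau> X) \<in> BR E (Tot (Ty i))" using BB by simp
  next
    show "semc \<Gamma> (Tot X) i" unfolding semc_def
    proof (intro allI impI)
      fix E \<sigma> \<tau> assume g: "G E \<Gamma> \<sigma> \<tau>"
      from V[OF g] obtain R where "LV i E (sub \<sigma> X) R" "LV i E (sub \<tau> X) R" by blast
      with U[OF g] U[OF G_sym[OF g]] show "\<exists>R. LC i E (subc \<sigma> (Tot X)) R \<and> LC i E (subc \<tau> (Tot X)) R" by (auto simp: LC_Tot)
    qed
  qed
qed

lemma semc_mono: "semc \<Gamma> c i \<Longrightarrow> i \<le> j \<Longrightarrow> semc \<Gamma> c j"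
  unfolding semc_def using LC_mono by meson

lemma sem_pi:
  assumes w: "wfc \<Gamma>" and t: "isty \<Gamma> t i" "semc \<Gamma> (Tot t) i" and c: "hu S (t # \<Gamma>) c j" "semc (t # \<Gamma>) c j"
  shows "sem \<Gamma> (Pi t c) (Tot (Ty (max i j)))"
proof (rule sem_normal[OF w Y_Pi[OF t(1) c(1)]])
  show "\<not> red S (sub \<sigma> (Pi t c)) x" for \<sigma> x by (auto elim: red_PiE)
  let ?n = "max i j"
  note t' = semc_mono[OF t(2), of ?n, simplified] and c' = semc_mono[OF c(2), of ?n, simplified]
  let ?RF = "\<lambda>\<sigma> E' r. elU E' (sub (\<lambda>n. ren r (\<sigma> n)) t)" and ?RC = "\<lambda>\<sigma> E' r a. elC E' (subc (scons a (\<lambda>n. ren r (\<sigma> n))) c)"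
  have C: "instc (renc (upr r) (subc (ups \<sigma>) c)) a = subc (scons a (\<lambda>n. ren r (\<sigma> n))) c" for r \<sigma> a
    by (simp add: renc_upr_ups instc_ups)
  have F: "\<exists>R. LU ?n E' (sub (\<lambda>n. ren r (\<sigma> n)) t) R \<and> LU ?n E' (sub (\<lambda>n. ren r (\<tau> n)) t) R \<and> ?RF \<sigma> E' r = R \<and> ?RF \<tau> E' r = R"
    if g: "G E \<Gamma> \<sigma> \<tau>" and wk: "wk E r E'" for E \<sigma> \<tau> E' r
    using semcD[OF t' G_ren[OF g wk]] elU by (auto simp: LC_Tot)
  have K: "\<exists>R. LC ?n E' (subc (scons a (\<lambda>n. ren r (\<sigma> n))) c) R \<and> LC ?n E' (subc (scons a' (\<lambda>n. ren r (\<tau> n))) c) R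
      \<and> ?RC \<sigma> E' r a = R \<and> ?RC \<tau> E' r a' = R"
    if g: "G E \<Gamma> \<sigma> \<tau>" and wk: "wk E r E'" and a: "(a, a') \<in> ?RF \<sigma> E' r" for E \<sigma> \<tau> E' r a a'
  proof -
    from F[OF g wk] obtain R where "LU ?n E' (sub (\<lambda>n. ren r (\<sigma> n)) t) R" "?RF \<sigma> E' r = R" by blast
    then have "G E' (t # \<Gamma>) (scons a (\<lambda>n. ren r (\<sigma> n))) (scons a' (\<lambda>n. ren r (\<tau> n)))" using G_cons[OF G_ren[OF g wk] t'] a by blast
    from semcD[OF c' this] show ?thesis using elC by blast
  qed
  have V: "LV ?n E (sub \<sigma> (Pi t c)) (piR E (sub \<sigma> t) (subc (ups \<sigma>) c) (?RF \<sigma>) (?RC \<sigma>))" if g: "G E \<Gamma> \<sigma> \<tau>" for E \<sigma> \<tau>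
    unfolding sub.simps
  proof (rule V_Pi)
    note g' = G_refl[OF g]
    show "isty E (Pi (sub \<sigma> t) (subc (ups \<sigma>) c)) ?n" using ty_sub(1)[OF G_tsb[OF g] Y_Pi[OF t(1) c(1)]] by simp
    show "\<forall>E' r. wk E r E' \<longrightarrow> LU ?n E' (ren r (sub \<sigma> t)) (?RF \<sigma> E' r)" using F[OF g'] by (auto simp: ren_sub)
    show "\<forall>E' r a a'. wk E r E' \<longrightarrow> (a, a') \<in> ?RF \<sigma> E' r \<longrightarrow>
       LC ?n E' (instc (renc (upr r) (subc (ups \<sigma>) c)) a) (?RC \<sigma> E' r a) \<and> LC ?n E' (instc (renc (upr r) (subc (ups \<sigma>) c)) a') (?RC \<sigma> E' r a)"
      unfolding C using K[OF g'] by blast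
  qed
  fix E \<sigma> \<tau> assume g: "G E \<Gamma> \<sigma> \<tau>"
  have "BR E (Tot (sub \<sigma> (Pi t c))) = BR E (Tot (sub \<tau> (Pi t c)))" by (rule BR_conv[OF G_cvt[OF w g Y_Pi[OF t(1) c(1)]]])
  moreover have "?RF \<sigma> E' r = ?RF \<tau> E' r" if "wk E r E'" for E' r using F[OF g that] by auto
  \<comment> \<open>Both families are evaluated at the same argument, so the two substitutions are
    extended by the pair of \<open>a\<close> with itself.\<close>
  moreover have "?RC \<sigma> E' r a = ?RC \<tau> E' r a" if wk: "wk E r E'" and a: "(a, a') \<in> ?RF \<sigma> E' r" for E' r a a'
  proof -
    from F[OF g wk] obtain R where "LU ?n E' (sub (\<lambda>n. ren r (\<sigma> n)) t) R" "?RF \<sigma> E' r = R" by blast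
    then have "(a, a) \<in> ?RF \<sigma> E' r" using LR_refl a by blast
    from K[OF g wk this] show ?thesis by auto
  qed
  ultimately have "piR E (sub \<sigma> t) (subc (ups \<sigma>) c) (?RF \<sigma>) (?RC \<sigma>) = piR E (sub \<tau> t) (subc (ups \<tau>) c) (?RF \<tau>) (?RC \<tau>)"
    unfolding piR_def by auto
  then show "\<exists>R. LV ?n E (sub \<sigma> (Pi t c)) R \<and> LV ?n E (sub \<tau> (Pi t c)) R" using V[OF g] V[OF G_sym[OF g]] by metis
qed

lemma sem_refine:
  assumes w: "wfc \<Gamma>" and t: "semc \<Gamma> (Tot t) i" and R: "isty \<Gamma> (Refine t \<phi>) i"
  shows "sem \<Gamma> (Refine t \<phi>) (Tot (Ty i))"
proof (rule sem_normal[OF w R])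
  show "\<not> red S (sub \<sigma> (Refine t \<phi>)) x" for \<sigma> x by (auto elim: red_RefineE)
  fix E \<sigma> \<tau> assume g: "G E \<Gamma> \<sigma> \<tau>"
  from semcD[OF t g] obtain R0 where R0: "LU i E (sub \<sigma> t) R0" "LU i E (sub \<tau> t) R0" by (auto simp: LC_Tot)
  have e: "BR E (Tot (sub \<sigma> (Refine t \<phi>))) = BR E (Tot (sub \<tau> (Refine t \<phi>)))" by (rule BR_conv[OF G_cvt[OF w g R]])
  have "LV i E (sub \<sigma> (Refine t \<phi>)) (R0 \<inter> BR E (Tot (sub \<sigma> (Refine t \<phi>))))"
    using V_Refine[OF _ R0(1), of "sub (ups \<sigma>) \<phi>" i] ty_sub(1)[OF G_tsb[OF g] R] by simp
  moreover have "LV i E (sub \<tau> (Refine t \<phi>)) (R0 \<inter> BR E (Tot (sub \<sigma> (Refine t \<phi>))))"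
    unfolding e using V_Refine[OF _ R0(2), of "sub (ups \<tau>) \<phi>" i] ty_sub(1)[OF G_tsb[OF G_sym[OF g]] R] by simp
  ultimately show "\<exists>R. LV i E (sub \<sigma> (Refine t \<phi>)) R \<and> LV i E (sub \<tau> (Refine t \<phi>)) R" by blast
qed

lemma sem_app:
  assumes e1: "sem \<Gamma> e1 (Tot (Pi t c))" and e2: "sem \<Gamma> e2 (Tot t)" and t: "semc \<Gamma> (Tot t) i" and c: "semc (t # \<Gamma>) c j"
  shows "sem \<Gamma> (e1 \<cdot> e2) (instc c e2)"
proof -
  have E: "subc \<sigma> (instc c e2) = subc (scons (sub \<sigma> e2) \<sigma>) c" "instc (subc (ups \<sigma>) c) (sub \<sigma> e2) = subc (scons (sub \<sigma> e2) \<sigma>) c" for \<sigma>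
    by (simp_all add: subc_instc instc_ups)
  show ?thesis
  proof (rule semI)
    show "semc \<Gamma> (instc c e2) j" unfolding semc_def E
    proof (intro allI impI)
      fix E \<sigma> \<tau> assume g: "G E \<Gamma> \<sigma> \<tau>"
      from semcD[OF t g] obtain R where R: "LC i E (subc \<sigma> (Tot t)) R" by blast
      from semcD[OF c G_cons[OF g t, of i R "sub \<sigma> e2" "sub \<tau> e2"]] R sem_use[OF e2 g R]
      show "\<exists>R. LC j E (subc (scons (sub \<sigma> e2) \<sigma>) c) R \<and> LC j E (subc (scons (sub \<tau> e2) \<tau>) c) R" by (simp add: LC_Tot)
    qed
    fix E \<sigma> \<tau> R assume g: "G E \<Gamma> \<sigma> \<tau>" and R: "LC j E (subc \<sigma> (instc c e2)) R"
    from semcD[OF t g] obtain Rt where Rt: "LC i E (subc \<sigma> (Tot t)) Rt" by blast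
    from semD[OF e1] g obtain n R1 where R1: "LU n E (Pi (sub \<sigma> t) (subc (ups \<sigma>) c)) R1" "(sub \<sigma> e1, sub \<tau> e1) \<in> R1"
      by (fastforce simp: LC_Tot)
    from pi_elim[OF R1, of i Rt "sub \<sigma> e2" "sub \<tau> e2"] Rt sem_use[OF e2 g Rt]
    obtain RC where "LC n E (subc (scons (sub \<sigma> e2) \<sigma>) c) RC" "(sub \<sigma> e1 \<cdot> sub \<sigma> e2, sub \<tau> e1 \<cdot> sub \<tau> e2) \<in> RC"
      by (auto simp: LC_Tot E)
    then show "(sub \<sigma> (e1 \<cdot> e2), sub \<tau> (e1 \<cdot> e2)) \<in> R" using LC_unique R unfolding E by fastforce
  qed
qed

lemma red_Lam_inv: "red S (Lam t b) x \<Longrightarrow> \<exists>b'. red S b b' \<and> x = Lam t b'"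
  by (erule red_LamE) blast

lemma reds_Lam_inv: assumes "reds S (Lam t b) x" shows "\<exists>b'. reds S b b' \<and> x = Lam t b'"
  using assms
proof (induct rule: rtranclp_induct)
  case (step y z)
  then show ?case using red_Lam_inv reds_snoc by blast
qed blast

lemma SN_Lam: "SN b \<Longrightarrow> SN (Lam t b)"
proof (induct b rule: SN.induct)
  case (SN_I b)
  show ?case by (rule SN.SN_I) (use red_Lam_inv SN_I(2) in blast)
qed

lemma BB_Lam: "BB (F # E) C b \<Longrightarrow> isty E F k \<Longrightarrow> hu S (F # E) C j \<Longrightarrow> BB E (Tot (Pi F C)) (Lam F b)"
  unfolding BB_def using SN_Lam reds_Lam_inv Y_Lam by blast

text \<open>The premise \<open>H\<close> concerns the contracta at all reducts of the argument,
  because \<open>inst b a1\<close> need not be a reduct of \<open>inst b a\<close>. With it the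
  redex is expanded by induction on the normalization of the body and then of the argument; a step
  of the body is a step of every contractum.\<close>

lemma LR_beta:
  assumes R: "LC n E c R" and a: "SN a" and b: "SN b"
    and H: "\<And>a1. reds S a a1 \<Longrightarrow> (inst b a1, z) \<in> R"
    and T: "\<And>a1 b1. reds S a a1 \<Longrightarrow> reds S b b1 \<Longrightarrow> ty S E (Lam t b1 \<cdot> a1) c"
  shows "(Lam t b \<cdot> a, z) \<in> R"
  using b a H T
proof (induct b arbitrary: a rule: SN.induct)
  case (SN_I b)
  note IHb = SN_I(2)
  from SN_I(3-5) show ?case
  proof (induct a rule: SN.induct)
    case (SN_I a)
    show ?case
    proof (rule LR_exp(3)[OF R, of _ "inst b a"])
      show "ty S E (Lam t b \<cdot> a) c" using SN_I(4) by blast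
      show "nt (Lam t b \<cdot> a)" by simp
      show "red S (Lam t b \<cdot> a) (inst b a)" by (rule R_Beta)
      fix x assume "red S (Lam t b \<cdot> a) x"
      then consider "x = inst b a" | b' where "red S b b'" "x = Lam t b' \<cdot> a" | a' where "red S a a'" "x = Lam t b \<cdot> a'"
        by (rule red_AppE) (auto dest: red_Lam_inv)
      then show "(x, z) \<in> R"
      proof cases
        case 1
        then show ?thesis using SN_I(3) by blast
      next
        case (2 b')
        show ?thesis unfolding 2(2)
        proof (rule IHb[OF 2(1)])
          show "SN a" using SN_I(1) by (rule SN.SN_I)
          fix a1 assume a1: "reds S a a1"
          have "red S (inst b a1) (inst b' a1)" unfolding inst_def by (rule red_sub[OF 2(1)])
          then show "(inst b' a1, z) \<in> R" using LR_reds(3)[OF R SN_I(3)[OF a1]] by blast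
        next
          fix a1 b1 assume "reds S a a1" "reds S b' b1"
          then show "ty S E (Lam t b1 \<cdot> a1) c" using SN_I(4) converse_rtranclp_into_rtranclp[of "red S", OF 2(1)] by blast
        qed
      next
        case (3 a')
        note s = converse_rtranclp_into_rtranclp[of "red S", OF 3(1)]
        show ?thesis unfolding 3(2) by (rule SN_I(2)[OF 3(1)]) (use SN_I(3,4) s in blast)+
      qed
    qed
  qed
qed

lemma sem_lam:
  assumes w: "wfc \<Gamma>" and t: "isty \<Gamma> t i" "semc \<Gamma> (Tot t) i" and c: "hu S (t # \<Gamma>) c j" "semc (t # \<Gamma>) c j"
    and e: "ty S (t # \<Gamma>) e c" "sem (t # \<Gamma>) e c"
  shows "sem \<Gamma> (Lam t e) (Tot (Pi t c))"
proof (rule semI[OF semc_tot[OF sem_pi[OF w t c]]])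
  let ?n = "max i j"
  fix E \<sigma> \<tau> R assume g: "G E \<Gamma> \<sigma> \<tau>" and "LC ?n E (subc \<sigma> (Tot (Pi t c))) R"
  then have R: "LU ?n E (Pi (sub \<sigma> t) (subc (ups \<sigma>) c)) R" by (simp add: LC_Tot)
  have base: "BB E (subc \<sigma> (Tot (Pi t c))) (sub \<sigma> (Lam t e))" if g: "G E \<Gamma> \<sigma> \<tau>" for E \<sigma> \<tau>
  proof -
    have "isty E (sub \<sigma> t) i" using ty_sub(1)[OF G_tsb[OF g] t(1)] by simp
    from BB_Lam[OF sem_BB[OF e(2) G_up[OF g t(2)]] this] ty_sub(2)[OF tsb_up[OF G_tsb[OF g]] c(1)] show ?thesis by simp
  qed
  from sem_base[OF w Y_Lam[OF t(1) c(1) e(1)] H_Tot[OF Y_Pi[OF t(1) c(1)]] base g]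
  have b: "(sub \<sigma> (Lam t e), sub \<tau> (Lam t e)) \<in> BR E (Tot (Pi (sub \<sigma> t) (subc (ups \<sigma>) c)))" by simp
  show "(sub \<sigma> (Lam t e), sub \<tau> (Lam t e)) \<in> R"
  proof (rule pi_intro[OF R b])
    fix E' r a a' RF RC
    let ?s = "\<lambda>n. ren r (\<sigma> n)" and ?t = "\<lambda>n. ren r (\<tau> n)"
    assume wk: "wk E r E'" and RF: "LU ?n E' (ren r (sub \<sigma> t)) RF" and a: "(a, a') \<in> RF"
      and RC: "LC ?n E' (instc (renc (upr r) (subc (ups \<sigma>) c)) a) RC" "LC ?n E' (instc (renc (upr r) (subc (ups \<sigma>) c)) a') RC"
    note g' = G_ren[OF g wk]
    have C: "instc (renc (upr r) (subc (ups \<sigma>) c)) x = subc (scons x ?s) c" for x by (simp add: renc_upr_ups instc_ups)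
    from RF have RF: "LU ?n E' (sub ?s t) RF" by (simp add: ren_sub)
    from semcD[OF semc_mono[OF t(2), of ?n] g'] RF LU_unique have RF': "LU ?n E' (sub ?t t) RF" unfolding LC_Tot subc.simps by fastforce
    \<comment> \<open>The two arguments are reduced independently of each other, since
      \<open>LR_beta\<close> is applied once to each side.\<close>
    have inst: "(inst (sub (ups ?s) e) a1, inst (sub (ups ?t) e) a2) \<in> RC" if "reds S a a1" "reds S a' a2" for a1 a2
    proof -
      have a1: "(a1, a2) \<in> RF" "(a1, a') \<in> RF" "(a, a') \<in> RF" using LR_reds(1)[OF RF] LR_reds2(1)[OF RF] a that by blast+
      have "(a, a2) \<in> RF" using LR_reds2(1)[OF RF a that(2)] .
      then have "(a2, a) \<in> RF" using LR_sym(1)[OF RF] symD by metis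
      have "(a1, a) \<in> RF" using LR_trans(1)[OF RF] LR_sym(1)[OF RF] a1 by (meson symD transD)
      then have "G E' (t # \<Gamma>) (scons a1 ?s) (scons a ?s)" using G_cons[OF G_refl[OF g'] t(2) RF] by blast
      from semcD[OF semc_mono[OF c(2), of ?n] this] RC(1)[unfolded C] LC_unique have "LC ?n E' (subc (scons a1 ?s) c) RC" by fastforce
      from sem_use[OF e(2) G_cons[OF g' t(2) RF a1(1)] this] show ?thesis by (simp add: inst_ups)
    qed
    have r: "ren r (sub \<sigma> (Lam t e)) = Lam (sub ?s t) (sub (ups ?s) e)" "ren r (sub \<tau> (Lam t e)) = Lam (sub ?t t) (sub (ups ?t) e)" by (simp_all only: sub.simps ren.simps ren_upr_ups) (simp_all only: ren_sub)
    have BBa: "BB E' (Tot (sub ?s t)) a" "BB E' (Tot (sub ?t t)) a'" using LU_D[OF RF a] LU_D[OF RF' a] BR_D by blast+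
    have SNe: "SN (sub (ups ?s) e)" "SN (sub (ups ?t) e)"
      using sem_BB[OF e(2) G_up[OF g' t(2)]] sem_BB[OF e(2) G_up[OF G_sym[OF g'] t(2)]] BB_D(1) by blast+
    have T: "ty S E' (Lam (sub \<rho> t) b1 \<cdot> a1) (subc (scons x \<rho>) c)"
      if g: "G E' \<Gamma> \<rho> \<rho>'" and x: "BB E' (Tot (sub \<rho> t)) x" "reds S x a1" and b1: "reds S (sub (ups \<rho>) e) b1" for \<rho> \<rho>' x a1 b1
    proof -
      have "isty E' (sub \<rho> t) i" using ty_sub(1)[OF G_tsb[OF g] t(1)] by simp
      moreover have "hu S (sub \<rho> t # E') (subc (ups \<rho>) c) j" by (rule ty_sub(2)[OF tsb_up[OF G_tsb[OF g]] c(1)])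
      ultimately show ?thesis using ty_app_reds[OF _ x(1), of "subc (ups \<rho>) c" "Lam (sub \<rho> t) (sub (ups \<rho>) e)" i j "Lam (sub \<rho> t) b1" a1]
         base[OF g] reds_Lam[OF b1] x(2) by (simp add: instc_ups)
    qed
    have "LC ?n E' (subc (scons a' ?t) c) RC"
      using semcD[OF semc_mono[OF c(2), of ?n] G_cons[OF g' t(2) RF a]] RC(1)[unfolded C] LC_unique by fastforce
    \<comment> \<open>The outer use of \<open>LR_beta\<close> expands the right redex, and within
      its premise the inner use expands the left redex towards a fixed contractum on the right;
      symmetry exchanges the sides in between and at the end.\<close>
    note L = LR_beta[OF this BB_D(1)[OF BBa(2)] SNe(2), of "Lam (sub ?s t) (sub (ups ?s) e) \<cdot> a" "sub ?t t"]
    have "(Lam (sub ?t t) (sub (ups ?t) e) \<cdot> a', Lam (sub ?s t) (sub (ups ?s) e) \<cdot> a) \<in> RC"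
    proof (rule L)
      fix a2 assume a2: "reds S a' a2"
      have "(Lam (sub ?s t) (sub (ups ?s) e) \<cdot> a, inst (sub (ups ?t) e) a2) \<in> RC"
        by (rule LR_beta[OF RC(1)[unfolded C] BB_D(1)[OF BBa(1)] SNe(1) inst[OF _ a2] T[OF g' BBa(1)]])
      then show "(inst (sub (ups ?t) e) a2, Lam (sub ?s t) (sub (ups ?s) e) \<cdot> a) \<in> RC" using LR_sym(3)[OF RC(1)] symD by metis
    next
      fix a1 b1 assume "reds S a' a1" "reds S (sub (ups ?t) e) b1"
      then show "ty S E' (Lam (sub ?t t) b1 \<cdot> a1) (subc (scons a' ?t) c)" by (rule T[OF G_sym[OF g'] BBa(2)])
    qed
    then show "(ren r (sub \<sigma> (Lam t e)) \<cdot> a, ren r (sub \<tau> (Lam t e)) \<cdot> a') \<in> RC" unfolding r using LR_sym(3)[OF RC(1)] symD by metis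
  qed
qed

end

section \<open>Subtyping\<close>

context sigc begin

text \<open>Inclusion of relations for each single instance. The second substitution only certifies
  that \<open>\<sigma>\<close> is semantically well typed.\<close>

definition semst :: "tm list \<Rightarrow> tm \<Rightarrow> tm \<Rightarrow> bool" where
  "semst \<Gamma> X X' \<longleftrightarrow> (\<forall>E \<sigma> \<tau> n m R R'. G E \<Gamma> \<sigma> \<tau> \<longrightarrow> LU n E (sub \<sigma> X) R \<longrightarrow> LU m E (sub \<sigma> X') R' \<longrightarrow> R \<subseteq> R')"
definition semsc :: "tm list \<Rightarrow> comp \<Rightarrow> comp \<Rightarrow> bool" where
  "semsc \<Gamma> c c' \<longleftrightarrow> (\<forall>E \<sigma> \<tau> n m R R'. G E \<Gamma> \<sigma> \<tau> \<longrightarrow> LC n E (subc \<sigma> c) R \<longrightarrow> LC m E (subc \<sigma> c') R' \<longrightarrow> R \<subseteq> R')"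

lemma semstD: "semst \<Gamma> X X' \<Longrightarrow> G E \<Gamma> \<sigma> \<tau> \<Longrightarrow> LU n E (sub \<sigma> X) R \<Longrightarrow> LU m E (sub \<sigma> X') R' \<Longrightarrow> R \<subseteq> R'"
  unfolding semst_def by blast
lemma semscD: "semsc \<Gamma> c c' \<Longrightarrow> G E \<Gamma> \<sigma> \<tau> \<Longrightarrow> LC n E (subc \<sigma> c) R \<Longrightarrow> LC m E (subc \<sigma> c') R' \<Longrightarrow> R \<subseteq> R'"
  unfolding semsc_def by blast

lemma U_BR_st: assumes "LU n E X R" "LU m E X' R'" "st S E X X'" shows "R \<subseteq> BR E (Tot X')"
proof -
  obtain i j where "isty E X i" "isty E X' j" using U_BB[OF assms(1)] U_BB[OF assms(2)] BB_D(2) by blast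
  then show ?thesis using BR_st[OF _ assms(3)] U_BR[OF assms(1)] by auto
qed

lemma semst_pi:
  assumes w: "wfc \<Gamma>" and t: "isty \<Gamma> t i" "semc \<Gamma> (Tot t) i" and s: "st S \<Gamma> (Pi t' c') (Pi t c)"
    and 1: "semst \<Gamma> t t'" and 2: "semsc (t # \<Gamma>) c' c"
  shows "semst \<Gamma> (Pi t' c') (Pi t c)"
  unfolding semst_def
proof (intro allI impI subrelI)
  fix E \<sigma> \<tau> n m R R' f f'
  assume g: "G E \<Gamma> \<sigma> \<tau>" and R: "LU n E (sub \<sigma> (Pi t' c')) R" and R': "LU m E (sub \<sigma> (Pi t c)) R'" and f: "(f, f') \<in> R"
  show "(f, f') \<in> R'"
  proof (rule pi_intro[OF R'[unfolded sub.simps]])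
    show "(f, f') \<in> BR E (Tot (Pi (sub \<sigma> t) (subc (ups \<sigma>) c)))"
      using U_BR_st[OF R R' ty_sub(3)[OF G_tsb[OF g] s]] f by auto
    fix E' r a a' RF RC
    assume wk: "wk E r E'" and RF: "LU m E' (ren r (sub \<sigma> t)) RF" and a: "(a, a') \<in> RF"
      and RC: "LC m E' (instc (renc (upr r) (subc (ups \<sigma>) c)) a) RC"
    let ?s = "\<lambda>n. ren r (\<sigma> n)"
    note g' = G_refl[OF G_ren[OF g wk]]
    from RF have RF: "LU m E' (sub ?s t) RF" by (simp add: ren_sub)
    from LR_ren(1)[OF R wk] f obtain R1 where R1: "LU n E' (Pi (sub ?s t') (subc (ups ?s) c')) R1" "(ren r f, ren r f') \<in> R1"
      by (auto simp: ren_sub renc_upr_ups)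
    \<comment> \<open>The domain of the smaller product has a relation in this world because the
      product itself has one.\<close>
    have "LV n E' (Pi (sub ?s t') (subc (ups ?s) c')) R1" using U_inv[OF R1(1)] by (auto simp: tfin_def)
    from V_Pi_inv[OF this] wk_id obtain RF' where "LU n E' (ren (\<lambda>m. m) (sub ?s t')) RF'" by blast
    then have RF': "LU n E' (sub ?s t') RF'" by simp
    have "(a, a') \<in> RF'" using semstD[OF 1 g' RF RF'] a by blast
    from pi_elim[OF R1 RF' this] obtain RC' where RC': "LC n E' (instc (subc (ups ?s) c') a) RC'" "(ren r f \<cdot> a, ren r f' \<cdot> a') \<in> RC'" by blast
    have "(a, a) \<in> RF" using LR_refl[OF RF a] by blast
    from semscD[OF 2 G_cons[OF g' t(2) RF this], of n RC' m RC] RC RC' show "(ren r f \<cdot> a, ren r f' \<cdot> a') \<in> RC"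
      by (auto simp: renc_upr_ups instc_ups)
  qed
qed

lemma Refine_inv: "LU n E (Refine t p) R \<Longrightarrow> \<exists>R0. R = R0 \<inter> BR E (Tot (Refine t p)) \<and> LU n E t R0"
  using U_inv LR_inv(1) by (metis canon_simps(2) rtranclp.rtrancl_refl tfin_def)

lemma semst_refineL: "semst \<Gamma> (Refine t p) t"
  unfolding semst_def using Refine_inv LU_unique by (metis Int_lower1 sub.simps(3))

text \<open>The relation of the refinement adds only typability at the refined type, and the
  syntactic subtyping provides exactly this.\<close>

lemma semst_refineR: assumes "st S \<Gamma> t (Refine t p)" shows "semst \<Gamma> t (Refine t p)"
  unfolding semst_def
proof (intro allI impI)
  fix E \<sigma> \<tau> n m R R'
  assume g: "G E \<Gamma> \<sigma> \<tau>" and R: "LU n E (sub \<sigma> t) R" and R': "LU m E (sub \<sigma> (Refine t p)) R'"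
  from Refine_inv[OF R'[unfolded sub.simps]] LU_unique[OF R] have "R' = R \<inter> BR E (Tot (Refine (sub \<sigma> t) (sub (ups \<sigma>) p)))" by blast
  then show "R \<subseteq> R'" using U_BR_st[OF R R' ty_sub(3)[OF G_tsb[OF g] assms]] by auto
qed

lemma semst_red: "reds S t' t \<Longrightarrow> semst \<Gamma> t' t" "reds S t t' \<Longrightarrow> semst \<Gamma> t' t"
  unfolding semst_def using U_reds reds_sub LU_unique by blast+

lemma posR_mono: "(\<And>w w'. Q w w' \<Longrightarrow> Q' w w') \<Longrightarrow> posR Q E c \<inter> BR E c' \<subseteq> posR Q' E c'"
  unfolding posR_def by blast

lemma C_BR_sc: assumes "LC n E c R" "LC m E c' R'" "sc S E c c'" shows "R \<subseteq> BR E c'"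
  using UC_hu[OF assms(1)] UC_hu[OF assms(2)] BR_sc[OF _ assms(3)] UC_BR[OF assms(1)] by auto

text \<open>The specification enters the relation only through typability, so its change is covered
  by the syntactic subtyping, while the returned values follow the result type.\<close>

lemma semsc_pure:
  assumes s: "sc S \<Gamma> (Comp Pure t' wp') (Comp Pure t wp)" and t: "semst \<Gamma> t' t"
  shows "semsc \<Gamma> (Comp Pure t' wp') (Comp Pure t wp)"
  unfolding semsc_def
proof (intro allI impI)
  fix E \<sigma> \<tau> n m R R'
  assume g: "G E \<Gamma> \<sigma> \<tau>" and R: "LC n E (subc \<sigma> (Comp Pure t' wp')) R" and R': "LC m E (subc \<sigma> (Comp Pure t wp)) R'"
  from LR_inv(6)[OF R[unfolded subc.simps]] obtain R0 where R0: "R = posR (Qpure R0) E (Comp Pure (sub \<sigma> t') (sub \<sigma> wp'))" "LU n E (sub \<sigma> t') R0" by blast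
  from LR_inv(6)[OF R'[unfolded subc.simps]] obtain R0' where R0': "R' = posR (Qpure R0') E (Comp Pure (sub \<sigma> t) (sub \<sigma> wp))" "LU m E (sub \<sigma> t) R0'" by blast
  have "Qpure R0 w w' \<Longrightarrow> Qpure R0' w w'" for w w' using semstD[OF t g R0(2) R0'(2)] unfolding Qpure_def by blast
  then have p: "R \<inter> BR E (subc \<sigma> (Comp Pure t wp)) \<subseteq> R'" unfolding R0(1) R0'(1) subc.simps by (rule posR_mono)
  show "R \<subseteq> R'" by (rule subset_trans[OF Int_greatest[OF subset_refl C_BR_sc[OF R R' ty_sub(4)[OF G_tsb[OF g] s]]] p])
qed

lemma semsc_F:
  assumes D: "eff_of S F = Some D" and s: "sc S \<Gamma> (Comp (Usr F) t' wp') (Comp (Usr F) t wp)" and t: "semst \<Gamma> (repr D \<cdot> t' \<cdot> wp') (repr D \<cdot> t \<cdot> wp)"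
  shows "semsc \<Gamma> (Comp (Usr F) t' wp') (Comp (Usr F) t wp)"
  unfolding semsc_def
proof (intro allI impI)
  fix E \<sigma> \<tau> n m R R'
  assume g: "G E \<Gamma> \<sigma> \<tau>" and R: "LC n E (subc \<sigma> (Comp (Usr F) t' wp')) R" and R': "LC m E (subc \<sigma> (Comp (Usr F) t wp)) R'"
  note b = C_BR_sc[OF R R' ty_sub(4)[OF G_tsb[OF g] s]]
  from LR_inv(7)[OF R[unfolded subc.simps]] D obtain R0 where R0: "R = effR E (Comp (Usr F) (sub \<sigma> t') (sub \<sigma> wp')) R0" "LU n E (repr D \<cdot> sub \<sigma> t' \<cdot> sub \<sigma> wp') R0" by auto
  from LR_inv(7)[OF R'[unfolded subc.simps]] D obtain R0' where R0': "R' = effR E (Comp (Usr F) (sub \<sigma> t) (sub \<sigma> wp)) R0'" "LU m E (repr D \<cdot> sub \<sigma> t \<cdot> sub \<sigma> wp) R0'" by auto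
  have "R0 \<subseteq> R0'" using semstD[OF t g, of n R0 m R0'] R0(2) R0'(2) csD(2)[OF D] by (simp add: closed_sub)
  then show "R \<subseteq> R'" using b R0(1) R0'(1) by auto
qed

lemma semst_trans: "semst \<Gamma> X Y \<Longrightarrow> semc \<Gamma> (Tot Y) i \<Longrightarrow> semst \<Gamma> Y Z \<Longrightarrow> semst \<Gamma> X Z"
  unfolding semst_def semc_def subc.simps LC_Tot by (meson subset_trans)
lemma semsc_trans: "semsc \<Gamma> X Y \<Longrightarrow> semc \<Gamma> Y i \<Longrightarrow> semsc \<Gamma> Y Z \<Longrightarrow> semsc \<Gamma> X Z"
  unfolding semsc_def semc_def by (meson subset_trans)

lemma sem_sub: assumes "sem \<Gamma> e c'" "semsc \<Gamma> c' c" "semc \<Gamma> c i" shows "sem \<Gamma> e c"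
proof (rule semI[OF assms(3)])
  fix E \<sigma> \<tau> R assume g: "G E \<Gamma> \<sigma> \<tau>" and R: "LC i E (subc \<sigma> c) R"
  from semD[OF assms(1)] g obtain n R' where R': "LC n E (subc \<sigma> c') R'" "(sub \<sigma> e, sub \<tau> e) \<in> R'" by blast
  from semscD[OF assms(2) g R'(1) R] R'(2) show "(sub \<sigma> e, sub \<tau> e) \<in> R" by blast
qed

lemma ty_v: "n < length \<Gamma> \<Longrightarrow> lk \<Gamma> n = X \<Longrightarrow> tyt \<Gamma> (Var n) X"
  using Y_Var by blast

lemma ty_arr_app: 
  assumes "tyt \<Gamma> f (arr a b)" "tyt \<Gamma> x a" "isty \<Gamma> a i" "isty \<Gamma> b j"
  shows "tyt \<Gamma> (f \<cdot> x) b"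
  using Y_App[OF assms(1,2,3) H_Tot[OF ty_ren(1)[OF wk_Suc assms(4), simplified]]] by simp

lemma ty_ppi: "isty \<Gamma> t i \<Longrightarrow> isty (t # \<Gamma>) u j \<Longrightarrow> isty \<Gamma> (Pi t (Tot u)) (max i j)"
  by (rule Y_Pi[OF _ H_Tot])

lemma ty_bin: assumes "k = ProdC \<or> k = SumC"
  shows "tyt \<Gamma> (Con k) (arr (Ty i) (arr (Ty j) (Ty (max i j))))"
  using assms Y_Con[OF const_type.intros(4) _ ty_arr[OF Y_Univ ty_arr[OF Y_Univ Y_Univ]]]
    Y_Con[OF const_type.intros(8) _ ty_arr[OF Y_Univ ty_arr[OF Y_Univ Y_Univ]]] by auto

lemma ty_bin_app: assumes "k = ProdC \<or> k = SumC" "isty \<Gamma> a i" "isty \<Gamma> b j"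
  shows "isty \<Gamma> (Con k \<cdot> a \<cdot> b) (max i j)"
  by (rule ty_arr_app[OF ty_arr_app[OF ty_bin[OF assms(1)] assms(2)] assms(3)]) (rule ty_arr ty_bin Y_Univ)+

lemma const_type_ty: assumes "const_type k t" shows "\<exists>i. isty \<Gamma> t i"
proof -
  let ?A = "\<lambda>i j. Ty j # Ty i # \<Gamma>"
  have v: "isty (?A i j) (Var 1) i" "isty (?A i j) (Var 0) j" "isty (Ty i # \<Gamma>) (Var 0) i" for i j
    by (rule ty_v; simp)+
  have p: "isty (?A i j) (tprod (Var 1) (Var 0)) (max i j)" "isty (?A i j) (tsum (Var 1) (Var 0)) (max i j)" for i j
    by (rule ty_bin_app[OF _ v(1,2)], simp)+
  from assms show ?thesis
    by cases (hypsubst, rule exI, (rule ty_arr ty_ppi Y_Univ ty_unit v p)+)+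
qed

end

section \<open>Products and sums\<close>

lemma sub_VarSuc [simp]: "sub (\<lambda>n. Var (Suc n)) e = sh e" "subc (\<lambda>n. Var (Suc n)) c = renc Suc c"
  by (simp_all add: ren_eq_sub renc_eq_subc)

context sigc begin

lemma ty_inl:
  assumes a: "isty \<Gamma> a i" and b: "isty \<Gamma> b j"
  shows "tyt \<Gamma> (Con InlC \<cdot> a \<cdot> b) (arr a (tsum a b))" "tyt \<Gamma> (Con InrC \<cdot> a \<cdot> b) (arr b (tsum a b))"
proof -
  have v: "isty (Ty j # Ty i # \<Gamma>) (Var 1) i" "isty (Ty j # Ty i # \<Gamma>) (Var 0) j" by (rule ty_v; simp)+
  have s: "isty (Ty j # Ty i # \<Gamma>) (tsum (Var 1) (Var 0)) (max i j)" by (rule ty_bin_app[OF _ v]) simp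
  note 1 = ty_arr[OF v(1) s] and 2 = ty_arr[OF v(2) s]
  have c: "tyt \<Gamma> (Con InlC) (Pi (Ty i) (Tot (Pi (Ty j) (Tot (arr (Var 1) (tsum (Var 1) (Var 0)))))))"
    "tyt \<Gamma> (Con InrC) (Pi (Ty i) (Tot (Pi (Ty j) (Tot (arr (Var 0) (tsum (Var 1) (Var 0)))))))"
    by (rule Y_Con[OF const_type.intros(9) _ ty_ppi[OF Y_Univ ty_ppi[OF Y_Univ 1]]], simp)
      (rule Y_Con[OF const_type.intros(10) _ ty_ppi[OF Y_Univ ty_ppi[OF Y_Univ 2]]], simp)
  have b': "tyt \<Gamma> b (inst (Ty j) a)" using b by simp
  have h: "hu S (inst (Ty j) a # \<Gamma>) (subc (ups (scons a Var)) (Tot (arr (Var 1) (tsum (Var 1) (Var 0))))) (max i (max i j))"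
     "hu S (inst (Ty j) a # \<Gamma>) (subc (ups (scons a Var)) (Tot (arr (Var 0) (tsum (Var 1) (Var 0))))) (max j (max i j))"
    using ty_sub(2)[OF tsb_up[OF tsb_single[OF a]] H_Tot[OF 1]] ty_sub(2)[OF tsb_up[OF tsb_single[OF a]] H_Tot[OF 2]] by (simp_all add: inst_def)
  have "tyt \<Gamma> (Con InlC \<cdot> a) (inst (Pi (Ty j) (Tot (arr (Var 1) (tsum (Var 1) (Var 0))))) a)"
    "tyt \<Gamma> (Con InrC \<cdot> a) (inst (Pi (Ty j) (Tot (arr (Var 0) (tsum (Var 1) (Var 0))))) a)"
    using Y_App[OF c(1) a Y_Univ H_Tot[OF ty_ppi[OF Y_Univ 1]]] Y_App[OF c(2) a Y_Univ H_Tot[OF ty_ppi[OF Y_Univ 2]]] by simp_all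
  then have "tyt \<Gamma> (Con InlC \<cdot> a) (Pi (inst (Ty j) a) (subc (ups (scons a Var)) (Tot (arr (Var 1) (tsum (Var 1) (Var 0))))))"
    "tyt \<Gamma> (Con InrC \<cdot> a) (Pi (inst (Ty j) a) (subc (ups (scons a Var)) (Tot (arr (Var 0) (tsum (Var 1) (Var 0))))))" by (simp_all add: inst_def)
  moreover have u: "isty \<Gamma> (inst (Ty j) a) (Suc j)" by (simp add: Y_Univ)
  ultimately have "ty S \<Gamma> (Con InlC \<cdot> a \<cdot> b) (instc (subc (ups (scons a Var)) (Tot (arr (Var 1) (tsum (Var 1) (Var 0))))) b)"
    "ty S \<Gamma> (Con InrC \<cdot> a \<cdot> b) (instc (subc (ups (scons a Var)) (Tot (arr (Var 0) (tsum (Var 1) (Var 0))))) b)"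
    using Y_App[OF _ b' u h(1)] Y_App[OF _ b' u h(2)] by blast+
  then show
    "tyt \<Gamma> (Con InlC \<cdot> a \<cdot> b) (arr a (tsum a b))" "tyt \<Gamma> (Con InrC \<cdot> a \<cdot> b) (arr b (tsum a b))"
    by (simp_all add: subst_simps)
qed

lemma ty_tinl:
  assumes "isty \<Gamma> a i" "isty \<Gamma> b j"
  shows "tyt \<Gamma> x a \<Longrightarrow> tyt \<Gamma> (tinl a b x) (tsum a b)" "tyt \<Gamma> x b \<Longrightarrow> tyt \<Gamma> (tinr a b x) (tsum a b)"
  using ty_arr_app[OF ty_inl(1)[OF assms] _ assms(1) ty_bin_app[OF _ assms]] ty_arr_app[OF ty_inl(2)[OF assms] _ assms(2) ty_bin_app[OF _ assms]] by simp_all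

lemma cv_bin: assumes "k = ProdC \<or> k = SumC" "cv E (Tot (Ty i)) a a'" "cv E (Tot (Ty j)) b b'"
  shows "cv E (Tot (Ty (max i j))) (Con k \<cdot> a \<cdot> b) (Con k \<cdot> a' \<cdot> b')"
proof (rule cv_trans)
  show "cv E (Tot (Ty (max i j))) (Con k \<cdot> a \<cdot> b) (Con k \<cdot> a' \<cdot> b)"
    using assms by (intro cv_map[OF assms(2), of "\<lambda>x. Con k \<cdot> x \<cdot> b"]) (auto intro: reds_App ty_bin_app dest: cv_ty2 cv_ty1)
  show "cv E (Tot (Ty (max i j))) (Con k \<cdot> a' \<cdot> b) (Con k \<cdot> a' \<cdot> b')"
    using assms by (intro cv_map[OF assms(3), of "\<lambda>x. Con k \<cdot> a' \<cdot> x"]) (auto intro: reds_App ty_bin_app dest: cv_ty2 cv_ty1)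
qed

text \<open>All three arguments of an injection are in evaluation position and can be exchanged one
  at a time; the condition \<open>I\<close> lets one proof serve both injections.\<close>

lemma cv_tinj:
  assumes I: "k = InlC \<and> X = a \<and> X' = a' \<or> k = InrC \<and> X = b \<and> X' = b'"
    and a: "cv E (Tot (Ty i)) a a'" and b: "cv E (Tot (Ty j)) b b'" and x: "cv E (Tot X) x x'"
  shows "cv E (Tot (tsum a b)) (Con k \<cdot> a \<cdot> b \<cdot> x) (Con k \<cdot> a' \<cdot> b' \<cdot> x')"
proof -
  have T: "tyt E (Con k \<cdot> c \<cdot> d \<cdot> y) (tsum a b)" if c: "cv E (Tot (Ty i)) a c" and d: "cv E (Tot (Ty j)) b d" and y: "cv E (Tot X) x y" for c d y
  proof -
    have "tyt E (Con k \<cdot> c \<cdot> d \<cdot> y) (tsum c d)" using I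
    proof
      assume "k = InlC \<and> X = a \<and> X' = a'"
      then show ?thesis using ty_tinl(1)[OF cv_ty2[OF c] cv_ty2[OF d] ty_conv[OF _ c]] cv_ty2[OF y] by simp
    next
      assume "k = InrC \<and> X = b \<and> X' = b'"
      then show ?thesis using ty_tinl(2)[OF cv_ty2[OF c] cv_ty2[OF d] ty_conv[OF _ d]] cv_ty2[OF y] by simp
    qed
    then show ?thesis by (rule ty_conv[OF _ cv_sym[OF cv_bin[OF disjI2[OF refl] c d]]])
  qed
  have "cv E (Tot (tsum a b)) (Con k \<cdot> a \<cdot> b \<cdot> x) (Con k \<cdot> a' \<cdot> b \<cdot> x)"
    by (rule cv_map[OF a, of "\<lambda>u. Con k \<cdot> u \<cdot> b \<cdot> x"]) (use T cv_refl[OF cv_ty1[OF b]] cv_refl[OF cv_ty1[OF x]] in \<open>auto intro: reds_App\<close>)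
  moreover have "cv E (Tot (tsum a b)) (Con k \<cdot> a' \<cdot> b \<cdot> x) (Con k \<cdot> a' \<cdot> b' \<cdot> x)"
    by (rule cv_map[OF b, of "\<lambda>u. Con k \<cdot> a' \<cdot> u \<cdot> x"]) (use T a cv_refl[OF cv_ty1[OF x]] in \<open>auto intro: reds_App\<close>)
  moreover have "cv E (Tot (tsum a b)) (Con k \<cdot> a' \<cdot> b' \<cdot> x) (Con k \<cdot> a' \<cdot> b' \<cdot> x')"
    by (rule cv_map[OF x, of "\<lambda>u. Con k \<cdot> a' \<cdot> b' \<cdot> u"]) (use T a b in \<open>auto intro: reds_App\<close>)
  ultimately show ?thesis by (meson cv_trans)
qed

lemmas cv_tinl = cv_tinj[where k = InlC, OF disjI1, OF conjI, OF refl conjI, OF refl refl]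
  and cv_tinr = cv_tinj[where k = InrC, OF disjI2, OF conjI, OF refl conjI, OF refl refl]

text \<open>The relation of a sum mentions its type arguments in its conversion clauses. It must not
  change when these arguments are replaced by convertible ones, as happens when the sum type
  reduces.\<close>

lemma Qsum_conv:
  assumes a: "cv E (Tot (Ty i)) a a'" and b: "cv E (Tot (Ty j)) b b'" and Ra: "LU n E a Ra" and Rb: "LU m E b Rb"
    and Q: "Qsum E a b Ra Rb w w'"
  shows "Qsum E a' b' Ra Rb w w'"
proof -
  note c = cv_bin[of SumC, OF disjI2[OF refl] a b]
  have x: "cv E (Tot a) x x \<and> cv E (Tot a) x' x'" if "(x, x') \<in> Ra" for x x'
    using LU_D[OF Ra that] BR_D BB_D(2) cv_refl by blast
  have y: "cv E (Tot b) x x \<and> cv E (Tot b) x' x'" if "(x, x') \<in> Rb" for x x'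
    using LU_D[OF Rb that] BR_D BB_D(2) cv_refl by blast
  from Q consider (l) p q u p' q' u' where "w = tinl p q u" "w' = tinl p' q' u'" "(u, u') \<in> Ra" "cv E (Tot (tsum a b)) w (tinl a b u)" "cv E (Tot (tsum a b)) w' (tinl a b u')"
    | (r) p q u p' q' u' where "w = tinr p q u" "w' = tinr p' q' u'" "(u, u') \<in> Rb" "cv E (Tot (tsum a b)) w (tinr a b u)" "cv E (Tot (tsum a b)) w' (tinr a b u')"
    unfolding Qsum_def by blast
  then show ?thesis
  proof cases
    case l
    have "cv E (Tot (tsum a' b')) w (tinl a' b' u)" "cv E (Tot (tsum a' b')) w' (tinl a' b' u')"
      using cv_conv[OF cv_trans[OF l(4) cv_tinl[OF a b]] c] cv_conv[OF cv_trans[OF l(5) cv_tinl[OF a b]] c] x[OF l(3)] by blast+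
    then show ?thesis unfolding Qsum_def using l(1-3) by blast
  next
    case r
    have "cv E (Tot (tsum a' b')) w (tinr a' b' u)" "cv E (Tot (tsum a' b')) w' (tinr a' b' u')"
      using cv_conv[OF cv_trans[OF r(4) cv_tinr[OF a b]] c] cv_conv[OF cv_trans[OF r(5) cv_tinr[OF a b]] c] y[OF r(3)] by blast+
    then show ?thesis unfolding Qsum_def using r(1-3) by blast
  qed
qed

lemma bin_reds: "reds S (Con k \<cdot> a \<cdot> b) W \<Longrightarrow> \<exists>a' b'. W = Con k \<cdot> a' \<cdot> b' \<and> reds S a a' \<and> reds S b b'"
  using reds_Con2 by blast

text \<open>The type arguments may reduce, but every reduct is again a product of reducts, whose
  relations are the same by \<open>U_reds\<close>; the base relations agree by conversion.\<close>

lemma LU_prod: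
  assumes X: "BB E (Tot (Ty i)) (tprod a b)" and a: "LU n E a Ra" and b: "LU n E b Rb"
  shows "LU n E (tprod a b) (posR (Qprod Ra Rb) E (Tot (tprod a b)))"
proof -
  have *: "LV n E' (ren r W) (posR (Qprod Ra' Rb') E' (Tot (ren r (tprod a b))))"
    if wk: "wk E r E'" and R: "LU n E' (ren r a) Ra'" "LU n E' (ren r b) Rb'" and W: "reds S (tprod a b) W" for E' r Ra' Rb' W
  proof -
    obtain a' b' where W': "W = tprod a' b'" "reds S a a'" "reds S b b'" using bin_reds[OF W] by blast
    have "isty E' (tprod (ren r a') (ren r b')) i" using ty_ren(1)[OF wk BB_D(3)[OF X W]] W'(1) by simp
    from V_Prod[OF this U_reds[OF R(1) reds_ren[OF W'(2)]] U_reds[OF R(2) reds_ren[OF W'(3)]]]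
    show ?thesis using BR_conv[OF cv_ren[OF wk BB_cv[OF X W], unfolded renc.simps ren.simps]] unfolding posR_def W'(1) by simp
  qed
  show ?thesis
  proof (rule U_intro[OF X])
    fix E' r assume wk: "wk E r E'"
    from LR_ren(1)[OF a wk] LR_ren(1)[OF b wk] obtain Ra' Rb' where "LU n E' (ren r a) Ra'" "LU n E' (ren r b) Rb'" by blast
    from *[OF wk this] show "\<exists>R. \<forall>W. reds S (tprod a b) W \<longrightarrow> tfin W \<longrightarrow> LV n E' (ren r W) R" by blast
  qed (use *[OF wk_id] a b in simp)
qed

lemma LU_sum:
  assumes X: "BB E (Tot (Ty i)) (tsum a b)" and a: "LU n E a Ra" and b: "LU n E b Rb"
  shows "LU n E (tsum a b) (posR (Qsum E a b Ra Rb) E (Tot (tsum a b)))"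
proof -
  obtain k l where k: "BB E (Tot (Ty k)) a" "BB E (Tot (Ty l)) b" using U_BB[OF a] U_BB[OF b] by blast
  have *: "LV n E' (ren r W) (posR (Qsum E' (ren r a) (ren r b) Ra' Rb') E' (Tot (ren r (tsum a b))))"
    if wk: "wk E r E'" and R: "LU n E' (ren r a) Ra'" "LU n E' (ren r b) Rb'" and W: "reds S (tsum a b) W" for E' r Ra' Rb' W
  proof -
    obtain a' b' where W': "W = tsum a' b'" "reds S a a'" "reds S b b'" using bin_reds[OF W] by blast
    have c: "cv E' (Tot (Ty k)) (ren r a) (ren r a')" "cv E' (Tot (Ty l)) (ren r b) (ren r b')"
      using cv_ren[OF wk BB_cv[OF k(1) W'(2)]] cv_ren[OF wk BB_cv[OF k(2) W'(3)]] by simp_all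
    note R' = U_reds[OF R(1) reds_ren[OF W'(2)]] U_reds[OF R(2) reds_ren[OF W'(3)]]
    have "Qsum E' (ren r a') (ren r b') Ra' Rb' = Qsum E' (ren r a) (ren r b) Ra' Rb'"
      by (intro ext iffI) (erule Qsum_conv[OF c(1,2)[THEN cv_sym] R'], erule Qsum_conv[OF c R])
    moreover have "isty E' (tsum (ren r a') (ren r b')) i" using ty_ren(1)[OF wk BB_D(3)[OF X W]] W'(1) by simp
    ultimately show ?thesis using V_Sum[OF _ R', of i] BR_conv[OF cv_ren[OF wk BB_cv[OF X W], unfolded renc.simps ren.simps]] unfolding posR_def W'(1) by simp
  qed
  show ?thesis
  proof (rule U_intro[OF X])
    fix E' r assume wk: "wk E r E'"
    from LR_ren(1)[OF a wk] LR_ren(1)[OF b wk] obtain Ra' Rb' where "LU n E' (ren r a) Ra'" "LU n E' (ren r b) Rb'" by blast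
    from *[OF wk this] show "\<exists>R. \<forall>W. reds S (tsum a b) W \<longrightarrow> tfin W \<longrightarrow> LV n E' (ren r W) R" by blast
  qed (use *[OF wk_id] a b in simp)
qed

text \<open>The syntactic half of \<open>sem\<close>. For a partially applied constant it can be
  established argument by argument, before membership in the relation of the result type is
  considered.\<close>

definition sbase :: "tm list \<Rightarrow> tm \<Rightarrow> comp \<Rightarrow> bool" where
  "sbase \<Gamma> e c \<longleftrightarrow> (\<forall>E \<sigma> \<tau>. G E \<Gamma> \<sigma> \<tau> \<longrightarrow> (sub \<sigma> e, sub \<tau> e) \<in> BR E (subc \<sigma> c))"

lemma sbaseD: "sbase \<Gamma> e c \<Longrightarrow> G E \<Gamma> \<sigma> \<tau> \<Longrightarrow> (sub \<sigma> e, sub \<tau> e) \<in> BR E (subc \<sigma> c)"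
  unfolding sbase_def by blast

lemma sbase_con: assumes "const_type k t" "\<And>i. k \<noteq> Univ i" shows "sbase \<Gamma> (Con k) (Tot t)"
  unfolding sbase_def
proof (intro allI impI)
  fix E \<sigma> \<tau>
  obtain i where "isty E t i" using const_type_ty[OF assms(1)] by blast
  then have *: "tyt E (Con k) t" using Y_Con[OF assms(1)] assms(2) by blast
  show "(sub \<sigma> (Con k), sub \<tau> (Con k)) \<in> BR E (subc \<sigma> (Tot t))"
    using BR_I[OF BB_Con[OF *] BB_Con[OF *] cv_refl[OF *]] by (simp add: closed_sub[OF const_type_closed[OF assms(1)]])
qed

lemma G_nth: "G E \<Gamma> \<sigma> \<tau> \<Longrightarrow> n < length \<Gamma> \<Longrightarrow> lk \<Gamma> n = X \<Longrightarrow>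
    \<exists>m R. LU m E (sub \<sigma> X) R \<and> LU m E (sub \<tau> X) R \<and> (\<sigma> n, \<tau> n) \<in> R"
  unfolding G_def using G1_D by blast

text \<open>Membership in a product is tested on arguments, and every pair of related arguments
  instantiates a variable added to the context. The function is thus reduced to its application to a
  variable.\<close>

lemma sem_eta:
  assumes w: "wfc \<Gamma>" and f: "sbase \<Gamma> f (Tot (Pi A C))"
    and A: "isty \<Gamma> A i" "semc \<Gamma> (Tot A) i" and C: "hu S (A # \<Gamma>) C j" "semc (A # \<Gamma>) C j"
    and s: "sem (A # \<Gamma>) (sh f \<cdot> Var 0) C"
  shows "sem \<Gamma> f (Tot (Pi A C))"
proof (rule semI[OF semc_tot[OF sem_pi[OF w A C]]])
    fix E \<sigma> \<tau> R assume g: "G E \<Gamma> \<sigma> \<tau>" and "LC (max i j) E (subc \<sigma> (Tot (Pi A C))) R"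
    then have R: "LU (max i j) E (Pi (sub \<sigma> A) (subc (ups \<sigma>) C)) R" by (simp add: LC_Tot)
    show "(sub \<sigma> f, sub \<tau> f) \<in> R"
    proof (rule pi_intro[OF R])
      show "(sub \<sigma> f, sub \<tau> f) \<in> BR E (Tot (Pi (sub \<sigma> A) (subc (ups \<sigma>) C)))" using sbaseD[OF f g] by simp
      fix E' r a a' RF RC
      assume wk: "wk E r E'" and RF: "LU (max i j) E' (ren r (sub \<sigma> A)) RF" and a: "(a, a') \<in> RF"
        and RC: "LC (max i j) E' (instc (renc (upr r) (subc (ups \<sigma>) C)) a) RC"
      have "G E' (A # \<Gamma>) (scons a (\<lambda>n. ren r (\<sigma> n))) (scons a' (\<lambda>n. ren r (\<tau> n)))"
        using G_cons[OF G_ren[OF g wk] A(2) _ a] RF by (simp add: ren_sub)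
      from sem_use[OF s this] RC show "(ren r (sub \<sigma> f) \<cdot> a, ren r (sub \<tau> f) \<cdot> a') \<in> RC"
        by (auto simp: renc_upr_ups instc_ups sub_ren ren_sub)
    qed
  qed

text \<open>Iterated, it supplies a constant with its arguments one by one until the type is no
  longer a product. The hypothesis on \<open>nr\<close> makes each application reduce componentwise,
  which yields its base relation.\<close>

lemma sem_con:
  assumes w: "wfc \<Gamma>" and f: "sbase \<Gamma> f (Tot (Pi A C))" and nr: "\<And>\<sigma>. nr (sub \<sigma> f)"
    and A: "isty \<Gamma> A i" "semc \<Gamma> (Tot A) i" and C: "hu S (A # \<Gamma>) C j" "semc (A # \<Gamma>) C j"
    and cont: "sbase (A # \<Gamma>) (sh f \<cdot> Var 0) C \<Longrightarrow> sem (A # \<Gamma>) (sh f \<cdot> Var 0) C"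
  shows "sem \<Gamma> f (Tot (Pi A C))"
proof -
  have "sbase (A # \<Gamma>) (sh f \<cdot> Var 0) C" unfolding sbase_def
  proof (intro allI impI)
    fix E \<sigma> \<tau> assume g: "G E (A # \<Gamma>) \<sigma> \<tau>"
    let ?s = "\<lambda>n. \<sigma> (Suc n)" and ?t = "\<lambda>n. \<tau> (Suc n)"
    from G_nth[OF g, of 0 "sh A"] obtain m R where "LU m E (sub ?s A) R" "(\<sigma> 0, \<tau> 0) \<in> R" by (auto simp: sub_ren)
    then have 0: "(\<sigma> 0, \<tau> 0) \<in> BR E (Tot (sub ?s A))" by (rule LU_D)
    have tb: "tsb E ?s \<Gamma>" by (rule G_tsb[OF G_tl[OF g]])
    have "(sub ?s f \<cdot> \<sigma> 0, sub ?t f \<cdot> \<tau> 0) \<in> BR E (instc (subc (ups ?s) C) (\<sigma> 0))"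
      by (rule BR_app[OF _ 0 _ _ nr nr, of _ _ _ i j])
        (use sbaseD[OF f G_tl[OF g]] ty_sub(1)[OF tb A(1)] ty_sub(2)[OF tsb_up[OF tb] C(1)] in simp_all)
    then show "(sub \<sigma> (sh f \<cdot> Var 0), sub \<tau> (sh f \<cdot> Var 0)) \<in> BR E (subc \<sigma> C)" by (simp add: instc_ups sub_ren)
  qed
  from sem_eta[OF w f A C cont[OF this]] show ?thesis .
qed

end

section \<open>Elimination forms\<close>

text \<open>Accessibility for an arbitrary step relation, meant for the side arguments of an
  elimination.\<close>

inductive TR :: "('a \<Rightarrow> 'a \<Rightarrow> bool) \<Rightarrow> 'a \<Rightarrow> bool" for rp where
  TR_I: "(\<And>q. rp p q \<Longrightarrow> TR rp q) \<Longrightarrow> TR rp p"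

context sigc begin

text \<open>Elimination forms \<open>fr p e\<close> with principal argument \<open>e\<close>; the other arguments \<open>p\<close> may be reduced as well.\<close>

definition frame :: "('p \<Rightarrow> tm \<Rightarrow> tm) \<Rightarrow> ('p \<Rightarrow> tm \<Rightarrow> tm \<Rightarrow> bool) \<Rightarrow> ('p \<Rightarrow> 'p \<Rightarrow> bool) \<Rightarrow> bool" where
  "frame fr con rp \<longleftrightarrow> (\<forall>p e. nt (fr p e)) \<and> (\<forall>p e. stuck e \<longrightarrow> stuck (fr p e)) \<and>
     (\<forall>p e x. red S (fr p e) x \<longrightarrow> (\<exists>e1. red S e e1 \<and> x = fr p e1) \<or> (\<exists>p1. rp p p1 \<and> x = fr p1 e) \<or> con p e x \<and> valform e) \<and>
     (\<forall>p e e1. red S e e1 \<longrightarrow> red S (fr p e) (fr p e1)) \<and> (\<forall>p p1 e. rp p p1 \<longrightarrow> red S (fr p e) (fr p1 e))"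

lemma frameD: assumes "frame fr con rp" shows "nt (fr p e)" "stuck e \<Longrightarrow> stuck (fr p e)"
  "red S (fr p e) x \<Longrightarrow> (\<exists>e1. red S e e1 \<and> x = fr p e1) \<or> (\<exists>p1. rp p p1 \<and> x = fr p1 e) \<or> con p e x \<and> valform e"
  "red S e e1 \<Longrightarrow> red S (fr p e) (fr p e1)" "rp p p1 \<Longrightarrow> red S (fr p e) (fr p1 e)"
  using assms unfolding frame_def by blast+

text \<open>Expansion from the contracta, by induction on the side arguments and then on the
  principal one. \<open>vf\<close> rules out a blocked elimination, which would leave no step to
  expand from.\<close>

lemma frame_left:
  assumes F: "frame fr con rp" and R: "LC n E c R" and p: "TR rp p" and e: "SN e"
    and vf: "\<And>w p. reds S e w \<Longrightarrow> is_value S w \<Longrightarrow> \<exists>x. red S (fr p w) x"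
    and T: "\<And>p1 e1. rp\<^sup>*\<^sup>* p p1 \<Longrightarrow> reds S e e1 \<Longrightarrow> ty S E (fr p1 e1) c"
    and H: "\<And>p1 w x. rp\<^sup>*\<^sup>* p p1 \<Longrightarrow> reds S e w \<Longrightarrow> con p1 w x \<Longrightarrow> valform w \<Longrightarrow> (x, z) \<in> R"
  shows "(fr p e, z) \<in> R"
  using p e vf T H
proof (induct p arbitrary: e rule: TR.induct)
  case (TR_I p)
  note IHp = TR_I(2)
  from TR_I(3-6) show ?case
  proof (induct e rule: SN.induct)
    case (SN_I e)
    note A = SN_I(3) and T = SN_I(4) and H = SN_I(5)
    have "\<exists>x0. red S (fr p e) x0"
    proof (cases "is_value S e")
      case True
      then show ?thesis using A by blast
    next
      case False
      then show ?thesis using frameD(4)[OF F] unfolding is_value_def by blast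
    qed
    then obtain x0 where x0: "red S (fr p e) x0" by blast
    show ?case
    proof (rule LR_exp(3)[OF R T frameD(1)[OF F] x0])
      fix x assume "red S (fr p e) x"
      then consider e1 where "red S e e1" "x = fr p e1" | p1 where "rp p p1" "x = fr p1 e" | "con p e x" "valform e"
        using frameD(3)[OF F] by blast
      then show "(x, z) \<in> R"
      proof cases
        case 1
        note s = converse_rtranclp_into_rtranclp[of "red S", OF 1(1)]
        show ?thesis unfolding 1(2) by (rule SN_I(2)[OF 1(1)]) (use A T H s in blast)+
      next
        case 2
        note s = converse_rtranclp_into_rtranclp[of rp, OF 2(1)]
        have "SN e" using SN_I(1) by (rule SN.SN_I)
        show ?thesis unfolding 2(2) by (rule IHp[OF 2(1) \<open>SN e\<close>]) (use A T H s in blast)+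
      next
        case 3
        then show ?thesis using H by blast
      qed
    qed auto
  qed
qed

lemma frame_inv:
  assumes F: "frame fr con rp" and nov: "\<And>w. reds S e w \<Longrightarrow> \<not> valform w" and r: "reds S (fr p e) x"
  shows "\<exists>p1 e1. rp\<^sup>*\<^sup>* p p1 \<and> reds S e e1 \<and> x = fr p1 e1"
  using r
proof (induct rule: rtranclp_induct)
  case (step y z)
  then obtain p1 e1 where *: "rp\<^sup>*\<^sup>* p p1" "reds S e e1" "y = fr p1 e1" by blast
  from frameD(3)[OF F step(2)[unfolded *(3)]] show ?case
    using * nov[OF *(2)] reds_snoc[OF *(2)] rtranclp.rtrancl_into_rtrancl[of rp, OF *(1)] by blast
qed blast

lemma frame_SN:
  assumes F: "frame fr con rp" and p: "TR rp p" and e: "SN e" and nov: "\<And>w. reds S e w \<Longrightarrow> \<not> valform w"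
  shows "SN (fr p e)"
  using p e nov
proof (induct p arbitrary: e rule: TR.induct)
  case (TR_I p)
  note IHp = TR_I(2)
  from TR_I(3-4) show ?case
  proof (induct e rule: SN.induct)
    case (SN_I e)
    show ?case
    proof (rule SN.SN_I)
      fix x assume "red S (fr p e) x"
      then consider e1 where "red S e e1" "x = fr p e1" | p1 where "rp p p1" "x = fr p1 e" | "valform e"
        using frameD(3)[OF F] by blast
      then show "SN x"
      proof cases
        case 1
        then show ?thesis using SN_I(2)[OF 1(1)] SN_I(3) converse_rtranclp_into_rtranclp[of "red S", OF 1(1)] by blast
      next
        case 2
        have "SN e" using SN_I(1) by (rule SN.SN_I)
        then show ?thesis using IHp[OF 2(1)] SN_I(3) 2(2) by blast
      next
        case 3
        then show ?thesis using SN_I(3) by blast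
      qed
    qed
  qed
qed

text \<open>As long as \<open>e\<close> is not stuck it still reduces, so the elimination is
  expanded step by step until \<open>LR_stuck\<close> applies. The base relation to a fixed stuck
  \<open>z\<close> is supplied by \<open>B\<close> for all stages.\<close>

lemma frame_stuck:
  assumes F: "frame fr con rp" and R: "LC n E c R" and p: "TR rp p" and e: "SN e"
    and nf: "\<And>w. reds S e w \<Longrightarrow> is_value S w \<Longrightarrow> stuck w" and nov: "\<And>w. reds S e w \<Longrightarrow> \<not> valform w"
    and B: "\<And>p1 e1. rp\<^sup>*\<^sup>* p p1 \<Longrightarrow> reds S e e1 \<Longrightarrow> (fr p1 e1, z) \<in> BR E c" and z: "stuck z"
  shows "(fr p e, z) \<in> R"
  using p e nf nov B
proof (induct p arbitrary: e rule: TR.induct)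
  case (TR_I p)
  note IHp = TR_I(2)
  from TR_I(3-6) show ?case
  proof (induct e rule: SN.induct)
    case (SN_I e)
    note A = SN_I(3) and V = SN_I(4) and B = SN_I(5)
    have b: "(fr p e, z) \<in> BR E c" using B by blast
    show ?case
    proof (cases "stuck e")
      case True
      then show ?thesis using LR_stuck(3)[OF R b frameD(2)[OF F] z] by blast
    next
      case False
      then have "\<not> is_value S e" using A by blast
      then obtain x0 where x0: "red S (fr p e) x0" using frameD(4)[OF F] unfolding is_value_def by blast
      show ?thesis
      proof (rule LR_exp(3)[OF R BB_D(2)[OF BR_D(1)[OF b]] frameD(1)[OF F] x0])
        fix x assume "red S (fr p e) x"
        then consider e1 where "red S e e1" "x = fr p e1" | p1 where "rp p p1" "x = fr p1 e" | "valform e"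
          using frameD(3)[OF F] by blast
        then show "(x, z) \<in> R"
        proof cases
          case 1
          note s = converse_rtranclp_into_rtranclp[of "red S", OF 1(1)]
          show ?thesis unfolding 1(2) by (rule SN_I(2)[OF 1(1)]) (use A V B s in blast)+
        next
          case 2
          note s = converse_rtranclp_into_rtranclp[of rp, OF 2(1)]
          have "SN e" using SN_I(1) by (rule SN.SN_I)
          show ?thesis unfolding 2(2) by (rule IHp[OF 2(1) \<open>SN e\<close>]) (use A V B s in blast)+
        next
          case 3
          then show ?thesis using V by blast
        qed
      qed
    qed
  qed
qed

text \<open>The common pattern of projections, \<open>Run\<close>, pure \<open>Bind\<close> and
  \<open>Case\<close>. One pair of normal forms decides which alternative of \<open>posR\<close>
  holds, and then no other pair can take the opposite one, since a stuck term is never an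
  introduction form.\<close>

lemma frame_elim:
  assumes F: "frame fr con rp" and R: "LC n E c R"
    and e: "(e, e') \<in> posR Q E c0" and Q: "\<And>w w'. Q w w' \<Longrightarrow> valform w \<and> valform w'"
    and p: "TR rp p" "TR rp p'"
    and ex: "\<And>w w' p. Q w w' \<Longrightarrow> (\<exists>x. red S (fr p w) x) \<and> (\<exists>x. red S (fr p w') x)"
    and T: "\<And>p1 e1. rp\<^sup>*\<^sup>* p p1 \<Longrightarrow> reds S e e1 \<Longrightarrow> ty S E (fr p1 e1) c"
    and T': "\<And>p1 e1. rp\<^sup>*\<^sup>* p' p1 \<Longrightarrow> reds S e' e1 \<Longrightarrow> ty S E (fr p1 e1) c"
    and cv: "cv E c (fr p e) (fr p' e')"
    and H: "\<And>p1 p1' w w' x x'. rp\<^sup>*\<^sup>* p p1 \<Longrightarrow> rp\<^sup>*\<^sup>* p' p1' \<Longrightarrow> reds S e w \<Longrightarrow> reds S e' w' \<Longrightarrow> Q w w' \<Longrightarrow>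
       con p1 w x \<Longrightarrow> con p1' w' x' \<Longrightarrow> (x, x') \<in> R"
  shows "(fr p e, fr p' e') \<in> R"
proof -
  have b: "(e, e') \<in> BR E c0" and P: "\<And>w w'. reds S e w \<Longrightarrow> reds S e' w' \<Longrightarrow> fin w \<Longrightarrow> fin w' \<Longrightarrow> stuck w \<and> stuck w' \<or> Q w w'"
    using e unfolding posR_def by blast+
  note SN = BB_D(1)[OF BR_D(1)[OF b]] BB_D(1)[OF BR_D(2)[OF b]]
  obtain w0 w0' where w0: "reds S e w0" "is_value S w0" "reds S e' w0'" "is_value S w0'" using SN_nf[OF SN(1)] SN_nf[OF SN(2)] by blast
  then have f0: "fin w0" "fin w0'" by (auto simp: fin_def)
  note nv = stuck_nt[THEN nt_not(1)]
  note sy = LR_sym(3)[OF R, THEN symD]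
  from P[OF w0(1,3) f0] show ?thesis
  proof
    assume st: "stuck w0 \<and> stuck w0'"
    \<comment> \<open>A reduct in introduction form, paired with the stuck normal form of the other
      side, would violate both alternatives of \<open>posR\<close>.\<close>
    have nov: "\<not> valform w" if "reds S e w" for w
      using P[OF that w0(3) _ f0(2)] nv st Q unfolding fin_def by blast
    have nov': "\<not> valform w" if "reds S e' w" for w
      using P[OF w0(1) that f0(1)] nv st Q unfolding fin_def by blast
    have nf: "stuck w" if "reds S e w" "is_value S w" for w
      using P[OF that(1) w0(3) _ f0(2)] that Q nv st unfolding fin_def by blast
    have nf': "stuck w" if "reds S e' w" "is_value S w" for w
      using P[OF w0(1) that(1) f0(1)] that Q nv st unfolding fin_def by blast
    have B: "BB E c (fr p e)" unfolding BB_def using frame_SN[OF F p(1) SN(1) nov] frame_inv[OF F nov] T by blast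
    have B': "BB E c (fr p' e')" unfolding BB_def using frame_SN[OF F p(2) SN(2) nov'] frame_inv[OF F nov'] T' by blast
    have fe: "reds S (fr q x) (fr q1 y)" if "rp\<^sup>*\<^sup>* q q1" "reds S x y" for q q1 x y
    proof -
      have "reds S (fr q x) (fr q1 x)" using that(1) by (induct rule: rtranclp_induct) (auto intro: reds_snoc frameD(5)[OF F])
      moreover have "reds S (fr q1 x) (fr q1 y)" using that(2) by (induct rule: rtranclp_induct) (auto intro: reds_snoc frameD(4)[OF F])
      ultimately show ?thesis by (rule reds_trans)
    qed
    have s0: "stuck (fr p w0)" "stuck (fr p' w0')" using frameD(2)[OF F] st by blast+
    note r0 = fe[OF rtranclp.rtrancl_refl w0(1), of p] fe[OF rtranclp.rtrancl_refl w0(3), of p']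
    have b1: "(fr p1 e1, fr p' w0') \<in> BR E c" if "rp\<^sup>*\<^sup>* p p1" "reds S e e1" for p1 e1
      using BR_I[OF BB_reds[OF B fe[OF that]] BB_reds[OF B' r0(2)]] BB_cv[OF B fe[OF that]] BB_cv[OF B' r0(2)] cv cv_trans cv_sym by blast
    have b2: "(fr p1 e1, fr p w0) \<in> BR E c" if "rp\<^sup>*\<^sup>* p' p1" "reds S e' e1" for p1 e1
      using BR_I[OF BB_reds[OF B' fe[OF that]] BB_reds[OF B r0(1)]] BB_cv[OF B' fe[OF that]] BB_cv[OF B r0(1)] cv cv_trans cv_sym by blast
    \<comment> \<open>The eliminations need not be stuck themselves, so each is related to the stuck
      reduct of the other; a chain through these two stuck reducts joins them.\<close>
    have 1: "(fr p e, fr p' w0') \<in> R" by (rule frame_stuck[OF F R p(1) SN(1) nf nov b1 s0(2)])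
    have 2: "(fr p' e', fr p w0) \<in> R" by (rule frame_stuck[OF F R p(2) SN(2) nf' nov' b2 s0(1)])
    show ?thesis using LR_trans(3)[OF R, THEN transD] 1 LR_reds(3)[OF R 2 r0(2)] sy[OF 2] by blast
  next
    assume q: "Q w0 w0'"
    have q1: "Q w w'" if "reds S e w" "reds S e' w'" "fin w" "fin w'" for w w'
    proof (rule ccontr)
      assume "\<not> Q w w'"
      then have s: "stuck w" "stuck w'" using P[OF that] by blast+
      then show False using P[OF that(1) w0(3) that(3) f0(2)] q Q nv by blast
    qed
    \<comment> \<open>For a fixed contractum on the right the left elimination is expanded; the
      right one is expanded afterwards, with this as its premise.\<close>
    have left: "(fr p e, x') \<in> R" if "rp\<^sup>*\<^sup>* p' p1'" "reds S e' w'" "valform w'" "con p1' w' x'" for p1' w' x'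
    proof (rule frame_left[OF F R p(1) SN(1) _ T])
      fix w q assume "reds S e w" "is_value S w"
      then show "\<exists>x. red S (fr q w) x" using q1[OF _ w0(3) _ f0(2)] ex unfolding fin_def by blast
    next
      fix p1 w x assume "rp\<^sup>*\<^sup>* p p1" "reds S e w" "con p1 w x" "valform w"
      then show "(x, x') \<in> R" using H[OF _ that(1) _ that(2) q1[OF _ that(2)] _ that(4)] that(3) unfolding fin_def by blast
    qed
    have "(fr p' e', fr p e) \<in> R"
    proof (rule frame_left[OF F R p(2) SN(2) _ T'])
      fix w q assume "reds S e' w" "is_value S w"
      then show "\<exists>x. red S (fr q w) x" using q1[OF w0(1) _ f0(1)] ex unfolding fin_def by blast
    next
      fix p1 w x assume "rp\<^sup>*\<^sup>* p' p1" "reds S e' w" "con p1 w x" "valform w"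
      then show "(x, fr p e) \<in> R" using left sy by blast
    qed
    then show ?thesis by (rule sy)
  qed
qed

end

section \<open>Constants\<close>

context sigc begin

fun rp2 :: "tm \<times> tm \<Rightarrow> tm \<times> tm \<Rightarrow> bool" where
  "rp2 (a, b) (a', b') = (red S a a' \<and> b = b' \<or> a = a' \<and> red S b b')"

lemma TR_rp2: "SN a \<Longrightarrow> SN b \<Longrightarrow> TR rp2 (a, b)"
proof (induct a arbitrary: b rule: SN.induct)
  case (SN_I a)
  note IHa = SN_I(2)
  from SN_I(3) show ?case
  proof (induct b rule: SN.induct)
    case (SN_I b)
    have "SN b" using SN_I(1) by (rule SN.SN_I)
    show ?case by (rule TR_I) (use IHa SN_I(2) \<open>SN b\<close> in auto)
  qed
qed

lemma rp2_reds: assumes "rp2\<^sup>*\<^sup>* p p1" shows "reds S (fst p) (fst p1) \<and> reds S (snd p) (snd p1)"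
  using assms
proof (induct rule: rtranclp_induct)
  case (step q q1)
  then show ?case by (cases q; cases q1) (auto intro: reds_snoc)
qed simp

definition ok :: "tm list \<Rightarrow> tm \<Rightarrow> nat \<Rightarrow> bool" where
  "ok \<Gamma> X i \<longleftrightarrow> isty \<Gamma> X i \<and> sem \<Gamma> X (Tot (Ty i))"

lemma okD: "ok \<Gamma> X i \<Longrightarrow> isty \<Gamma> X i" "ok \<Gamma> X i \<Longrightarrow> sem \<Gamma> X (Tot (Ty i))" "ok \<Gamma> X i \<Longrightarrow> semc \<Gamma> (Tot X) i"
  unfolding ok_def using semc_tot by blast+

lemma ok_wfc: "wfc \<Gamma> \<Longrightarrow> ok \<Gamma> X i \<Longrightarrow> wfc (X # \<Gamma>)"
  using okD(1) by auto

lemma sem_wk: assumes "sem \<Gamma> e c" shows "sem (t # \<Gamma>) (sh e) (renc Suc c)"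
  using assms unfolding sem_def using G_tl by (simp add: sub_ren subc_renc) meson

lemma ok_univ: "ok \<Gamma> (Ty i) (Suc i)"
  unfolding ok_def using Y_Univ sem_univ by blast

lemma ok_var: "n < length \<Gamma> \<Longrightarrow> lk \<Gamma> n = Ty i \<Longrightarrow> ok \<Gamma> (Var n) i"
  unfolding ok_def using ty_v sem_var[of n \<Gamma> "Suc i"] semc_Univ by metis

lemma ok_wk: assumes "ok \<Gamma> X i" shows "ok (t # \<Gamma>) (sh X) i"
  unfolding ok_def using ty_ren(1)[OF wk_Suc okD(1)[OF assms]] sem_wk[OF okD(2)[OF assms]] by simp

lemma ok_pi: assumes "wfc \<Gamma>" "ok \<Gamma> A i" "ok (A # \<Gamma>) B j" shows "ok \<Gamma> (Pi A (Tot B)) (max i j)"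
  unfolding ok_def
  using ty_ppi[OF okD(1)[OF assms(2)] okD(1)[OF assms(3)]]
    sem_pi[OF assms(1) okD(1,3)[OF assms(2)] H_Tot[OF okD(1)[OF assms(3)]] okD(3)[OF assms(3)]] by blast

lemma sem_con1:
  assumes "wfc \<Gamma>" "sbase \<Gamma> f (Tot (Pi A (Tot B)))" "\<And>\<sigma>. nr (sub \<sigma> f)" "ok \<Gamma> A i" "ok (A # \<Gamma>) B j"
    "sbase (A # \<Gamma>) (sh f \<cdot> Var 0) (Tot B) \<Longrightarrow> sem (A # \<Gamma>) (sh f \<cdot> Var 0) (Tot B)"
  shows "sem \<Gamma> f (Tot (Pi A (Tot B)))"
  using sem_con[OF assms(1-3) okD(1,3)[OF assms(4)] H_Tot[OF okD(1)[OF assms(5)]] okD(3)[OF assms(5)] assms(6)] .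

lemma G_univ: assumes "G E \<Gamma> \<sigma> \<tau>" "n < length \<Gamma>" "lk \<Gamma> n = Ty i"
  shows "\<exists>R. LU i E (\<sigma> n) R \<and> LU i E (\<tau> n) R \<and> (\<sigma> n, \<tau> n) \<in> BR E (Tot (Ty i))"
proof -
  from G_nth[OF assms] obtain m R where "LU m E (Ty i) R" "(\<sigma> n, \<tau> n) \<in> R" by auto
  then have "(\<sigma> n, \<tau> n) \<in> UnivR i E" using LU_Univ_D by metis
  then show ?thesis unfolding UnivR_def using wk_id[of E] by fastforce
qed

text \<open>Serves unit, falsity, existentials and equalities: their reducts keep the constant at
  the head, so none becomes canonical.\<close>

lemma sem_inert:
  assumes b: "sbase \<Gamma> X (Tot (Ty i))" and nc: "\<And>\<sigma> W. reds S (sub \<sigma> X) W \<Longrightarrow> \<not> canon W"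
  shows "sem \<Gamma> X (Tot (Ty i))"
proof (rule sem_univ_I)
  show "(sub \<sigma> X, sub \<tau> X) \<in> BR E (Tot (Ty i))" if "G E \<Gamma> \<sigma> \<tau>" for E \<sigma> \<tau> using sbaseD[OF b that] by simp
  show "semc \<Gamma> (Tot X) i" unfolding semc_def
  proof (intro allI impI)
    fix E \<sigma> \<tau> assume "G E \<Gamma> \<sigma> \<tau>"
    from sbaseD[OF b this] have *: "(sub \<sigma> X, sub \<tau> X) \<in> BR E (Tot (Ty i))" by simp
    have "LU i E (sub \<sigma> X) (BR E (Tot (sub \<sigma> X)))" "LU i E (sub \<tau> X) (BR E (Tot (sub \<tau> X)))"
      by (rule U_inert[OF BR_D(1)[OF *]], erule nc) (rule U_inert[OF BR_D(2)[OF *]], erule nc)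
    then show "\<exists>R. LC i E (subc \<sigma> (Tot X)) R \<and> LC i E (subc \<tau> (Tot X)) R"
      using BR_conv[OF BR_D(3)[OF *]] by (auto simp: LC_Tot)
  qed
qed

text \<open>The constant is a type former, so after two arguments it remains to find one relation
  for both instances. For sums the relation depends on the instance of the type arguments, and
  \<open>Qsum_conv\<close> reconciles the two.\<close>

lemma sem_bin: assumes k: "k = ProdC \<or> k = SumC" and w: "wfc \<Gamma>" shows "sem \<Gamma> (Con k) (Tot (arr (Ty i) (arr (Ty j) (Ty (max i j)))))"
proof -
  let ?G1 = "Ty i # \<Gamma>" and ?G2 = "Ty j # Ty i # \<Gamma>"
  have w1: "wfc ?G1" and w2: "wfc ?G2" using w Y_Univ by auto
  have 2: "sem ?G2 (Con k \<cdot> Var (Suc 0) \<cdot> Var 0) (Tot (Ty (max i j)))" if b: "sbase ?G2 (Con k \<cdot> Var (Suc 0) \<cdot> Var 0) (Tot (Ty (max i j)))"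
  proof (rule sem_univ_I)
    show "(sub \<sigma> (Con k \<cdot> Var (Suc 0) \<cdot> Var 0), sub \<tau> (Con k \<cdot> Var (Suc 0) \<cdot> Var 0)) \<in> BR E (Tot (Ty (max i j)))"
      if "G E ?G2 \<sigma> \<tau>" for E \<sigma> \<tau> using sbaseD[OF b that] by simp
    show "semc ?G2 (Tot (Con k \<cdot> Var (Suc 0) \<cdot> Var 0)) (max i j)" unfolding semc_def
    proof (intro allI impI)
      fix E \<sigma> \<tau> assume g: "G E ?G2 \<sigma> \<tau>"
      from sbaseD[OF b g] have *: "(Con k \<cdot> \<sigma> (Suc 0) \<cdot> \<sigma> 0, Con k \<cdot> \<tau> (Suc 0) \<cdot> \<tau> 0) \<in> BR E (Tot (Ty (max i j)))" by simp
      from G_univ[OF g, of "Suc 0" i] G_univ[OF g, of 0 j] obtain Ra Rb where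
        a: "LU i E (\<sigma> (Suc 0)) Ra" "LU i E (\<tau> (Suc 0)) Ra" "(\<sigma> (Suc 0), \<tau> (Suc 0)) \<in> BR E (Tot (Ty i))" and
        b: "LU j E (\<sigma> 0) Rb" "LU j E (\<tau> 0) Rb" "(\<sigma> 0, \<tau> 0) \<in> BR E (Tot (Ty j))" by auto
      note a' = a(1,2)[THEN LU_mono, of "max i j", simplified] and b' = b(1,2)[THEN LU_mono, of "max i j", simplified]
      note c = BR_conv[OF BR_D(3)[OF *]]
      have "\<exists>R. LU (max i j) E (Con k \<cdot> \<sigma> (Suc 0) \<cdot> \<sigma> 0) R \<and> LU (max i j) E (Con k \<cdot> \<tau> (Suc 0) \<cdot> \<tau> 0) R" using k
      proof
        assume k: "k = ProdC"
        show ?thesis using LU_prod[OF BR_D(1)[OF *[unfolded k]] a'(1) b'(1)] LU_prod[OF BR_D(2)[OF *[unfolded k]] a'(2) b'(2)] c unfolding k posR_def by auto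
      next
        assume k: "k = SumC"
        have "Qsum E (\<sigma> (Suc 0)) (\<sigma> 0) Ra Rb = Qsum E (\<tau> (Suc 0)) (\<tau> 0) Ra Rb"
          by (intro ext iffI) (erule Qsum_conv[OF a(3)[THEN BR_D(3)] b(3)[THEN BR_D(3)] a(1) b(1)],
            erule Qsum_conv[OF a(3)[THEN BR_D(3), THEN cv_sym] b(3)[THEN BR_D(3), THEN cv_sym] a(2) b(2)])
        then show ?thesis using LU_sum[OF BR_D(1)[OF *[unfolded k]] a'(1) b'(1)] LU_sum[OF BR_D(2)[OF *[unfolded k]] a'(2) b'(2)] c unfolding k posR_def by auto
      qed
      then show "\<exists>R. LC (max i j) E (subc \<sigma> (Tot (Con k \<cdot> Var (Suc 0) \<cdot> Var 0))) R \<and> LC (max i j) E (subc \<tau> (Tot (Con k \<cdot> Var (Suc 0) \<cdot> Var 0))) R"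
        by (simp add: LC_Tot)
    qed
  qed
  have n: "nr (sub \<sigma> (Con k))" "nr (sub \<sigma> (Con k \<cdot> Var 0))" for \<sigma> using nr_Con nr_Con1 by simp_all
  have o: "ok ?G2 (Ty (max i j)) (Suc (max i j))" "ok ?G1 (Pi (Ty j) (Tot (Ty (max i j)))) (max (Suc j) (Suc (max i j)))"
    using ok_pi[OF w1 ok_univ ok_univ] ok_univ by blast+
  have 1: "sem ?G1 (Con k \<cdot> Var 0) (Tot (Pi (Ty j) (Tot (Ty (max i j)))))" if "sbase ?G1 (Con k \<cdot> Var 0) (Tot (Pi (Ty j) (Tot (Ty (max i j)))))"
    by (rule sem_con1[OF w1 that n(2) ok_univ o(1)]) (use 2 in simp)
  have "sbase \<Gamma> (Con k) (Tot (Pi (Ty i) (Tot (Pi (Ty j) (Tot (Ty (max i j)))))))"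
    using sbase_con[OF const_type.intros(4)] sbase_con[OF const_type.intros(8)] k by auto
  from sem_con1[OF w this n(1) ok_univ o(2)] 1 show ?thesis by simp
qed

lemma ok_bin: assumes k: "k = ProdC \<or> k = SumC" and w: "wfc \<Gamma>" and a: "ok \<Gamma> a i" and b: "ok \<Gamma> b j"
  shows "ok \<Gamma> (Con k \<cdot> a \<cdot> b) (max i j)"
proof -
  have w1: "wfc (Ty i # \<Gamma>)" using w Y_Univ by auto
  have 1: "sem \<Gamma> (Con k \<cdot> a) (Tot (Pi (Ty j) (Tot (Ty (max i j)))))"
    using sem_app[OF _ okD(2)[OF a] semc_Univ okD(3)[OF ok_pi[OF w1 ok_univ ok_univ]], of "Con k" j "max i j"] sem_bin[OF k w, of i j]
    by (simp add: inst_def)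
  have "sem \<Gamma> (Con k \<cdot> a \<cdot> b) (Tot (Ty (max i j)))"
    using sem_app[OF 1 okD(2)[OF b] semc_Univ semc_Univ] by simp
  then show ?thesis unfolding ok_def using ty_bin_app[OF k okD(1)[OF a] okD(1)[OF b]] by simp
qed

lemma sem_0: assumes "const_type k (Ty 0)" "k = UnitC \<or> k = FalsityC" shows "ok \<Gamma> (Con k) 0"
proof -
  have nc: "\<not> canon W" if "reds S (sub \<sigma> (Con k)) W" for \<sigma> W
    using that assms(2) reds_Con[of k W] by (auto simp: canon_def)
  have k: "k \<noteq> Univ i" for i using assms(2) by auto
  show ?thesis unfolding ok_def
  proof
    show "isty \<Gamma> (Con k) 0" by (rule Y_Con[OF assms(1) _ Y_Univ]) (use k in blast)
    show "sem \<Gamma> (Con k) (Tot (Ty 0))" by (rule sem_inert[OF sbase_con[OF assms(1) k] nc])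
  qed
qed

lemma sem_tt: "sem \<Gamma> tt (Tot tunit)"
proof -
  have o: "ok \<Gamma> tunit 0" for \<Gamma> by (rule sem_0[OF const_type.intros(2)]) simp
  show ?thesis
  proof (rule semI[OF okD(3)[OF o]])
    fix E \<sigma> \<tau> R assume g: "G E \<Gamma> \<sigma> \<tau>" and R: "LC 0 E (subc \<sigma> (Tot tunit)) R"
    have "BB E (Tot (Ty 0)) tunit" by (rule BB_Con[OF ty_unit])
    from U_inert[OF this, of 0 "KK 0"] have "LU 0 E tunit (BR E (Tot tunit))" using reds_Con by (auto simp: canon_def)
    then have "R = BR E (Tot tunit)" using R LU_unique[of 0] by (simp add: LC_Tot)
    then show "(sub \<sigma> tt, sub \<tau> tt) \<in> R" using sbaseD[OF sbase_con[OF const_type.intros(3)] g] by simp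
  qed
qed

lemma nr_sub: "nr (sub \<sigma> (Con k))" "nr (sub \<sigma> (Con k \<cdot> a))" "k \<noteq> FstC \<Longrightarrow> k \<noteq> SndC \<Longrightarrow> nr (sub \<sigma> (Con k \<cdot> a \<cdot> b))"
   "k \<noteq> FstC \<Longrightarrow> k \<noteq> SndC \<Longrightarrow> nr (sub \<sigma> (Con k \<cdot> a \<cdot> b \<cdot> d))"
  using nr_Con nr_Con1 nr_Con2 nr_Con3 by simp_all

abbreviation (input) "TT i j \<Gamma> \<equiv> Ty j # Ty i # \<Gamma>"

lemma sem_con2:
  assumes w: "wfc \<Gamma>" and k: "const_type k (Pi (Ty i) (Tot (Pi (Ty j) (Tot B))))" "\<And>i. k \<noteq> Univ i" and B: "ok (TT i j \<Gamma>) B l"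
    and c: "sbase (TT i j \<Gamma>) (Con k \<cdot> Var (Suc 0) \<cdot> Var 0) (Tot B) \<Longrightarrow> sem (TT i j \<Gamma>) (Con k \<cdot> Var (Suc 0) \<cdot> Var 0) (Tot B)"
  shows "sem \<Gamma> (Con k) (Tot (Pi (Ty i) (Tot (Pi (Ty j) (Tot B)))))"
proof -
  have w1: "wfc (Ty i # \<Gamma>)" using w Y_Univ by auto
  note o = ok_pi[OF w1 ok_univ B]
  have 1: "sem (Ty i # \<Gamma>) (Con k \<cdot> Var 0) (Tot (Pi (Ty j) (Tot B)))" if "sbase (Ty i # \<Gamma>) (Con k \<cdot> Var 0) (Tot (Pi (Ty j) (Tot B)))"
    by (rule sem_con1[OF w1 that nr_sub(2) ok_univ B]) (use c in simp)
  show ?thesis by (rule sem_con1[OF w sbase_con[OF k] nr_sub(1) ok_univ o]) (use 1 in simp)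
qed

lemma TT_ok: assumes "wfc \<Gamma>" shows "wfc (TT i j \<Gamma>)" "ok (TT i j \<Gamma>) (Var (Suc 0)) i" "ok (TT i j \<Gamma>) (Var 0) j"
  "k = ProdC \<or> k = SumC \<Longrightarrow> ok (TT i j \<Gamma>) (Con k \<cdot> Var (Suc 0) \<cdot> Var 0) (max i j)"
proof -
  show w: "wfc (TT i j \<Gamma>)" using assms Y_Univ by auto
  show o: "ok (TT i j \<Gamma>) (Var (Suc 0)) i" "ok (TT i j \<Gamma>) (Var 0) j" by (rule ok_var; simp)+
  show "k = ProdC \<or> k = SumC \<Longrightarrow> ok (TT i j \<Gamma>) (Con k \<cdot> Var (Suc 0) \<cdot> Var 0) (max i j)" by (rule ok_bin[OF _ w o])
qed

lemma sem_pair: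
  assumes w: "wfc \<Gamma>" and t: "const_type PairC (Pi (Ty i) (Tot (Pi (Ty j) (Tot (arr (Var 1) (arr (Var 0) (tprod (Var 1) (Var 0))))))))"
  shows "sem \<Gamma> (Con PairC) (Tot (Pi (Ty i) (Tot (Pi (Ty j) (Tot (arr (Var 1) (arr (Var 0) (tprod (Var 1) (Var 0)))))))))"
proof -
  let ?G2 = "TT i j \<Gamma>" let ?p = "Suc 0" let ?q = "Suc ?p" let ?r = "Suc ?q"
  let ?G3 = "Var ?p # ?G2" let ?G4 = "Var ?p # ?G3"
  note T = TT_ok[OF w, where i = i and j = j]
  note p = T(4)[where k = ProdC, simplified]
  have w3: "wfc ?G3" by (rule ok_wfc[OF T(1,2)])
  have o3: "ok ?G3 (Var ?p) j" "ok ?G3 (tprod (Var ?q) (Var ?p)) (max i j)" using ok_wk[OF T(3)] ok_wk[OF p] by simp_all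
  have w4: "wfc ?G4" by (rule ok_wfc[OF w3 o3(1)])
  have o4: "ok ?G4 (tprod (Var ?r) (Var ?q)) (max i j)" using ok_wk[OF o3(2)] by simp
  have 4: "sem ?G4 (tpair (Var ?r) (Var ?q) (Var ?p) (Var 0)) (Tot (tprod (Var ?r) (Var ?q)))"
    if b: "sbase ?G4 (tpair (Var ?r) (Var ?q) (Var ?p) (Var 0)) (Tot (tprod (Var ?r) (Var ?q)))"
  proof (rule semI[OF okD(3)[OF o4]])
    fix E \<sigma> \<tau> R assume g: "G E ?G4 \<sigma> \<tau>" and "LC (max i j) E (subc \<sigma> (Tot (tprod (Var ?r) (Var ?q)))) R"
    then have R: "LU (max i j) E (tprod (\<sigma> ?r) (\<sigma> ?q)) R" by (simp add: LC_Tot)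
    from U_inv[OF this] have "LV (max i j) E (tprod (\<sigma> ?r) (\<sigma> ?q)) R" by (auto simp: tfin_def)
    from LR_inv(3)[OF this] obtain Ra Rb where R': "R = posR (Qprod Ra Rb) E (Tot (tprod (\<sigma> ?r) (\<sigma> ?q)))"
      "LU (max i j) E (\<sigma> ?r) Ra" "LU (max i j) E (\<sigma> ?q) Rb" by blast
    from G_nth[OF g, of ?p "Var ?r"] obtain m Rx where "LU m E (\<sigma> ?r) Rx" "(\<sigma> ?p, \<tau> ?p) \<in> Rx" by auto
    then have x: "(\<sigma> ?p, \<tau> ?p) \<in> Ra" using LU_unique[OF R'(2)] by blast
    from G_nth[OF g, of 0 "Var ?q"] obtain m Ry where "LU m E (\<sigma> ?q) Ry" "(\<sigma> 0, \<tau> 0) \<in> Ry" by auto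
    then have y: "(\<sigma> 0, \<tau> 0) \<in> Rb" using LU_unique[OF R'(3)] by blast
    \<comment> \<open>Every reduct of the pair is a pair of reducts, so closure of the component
      relations under reduction covers all of them.\<close>
    have "Qprod Ra Rb w w'" if "reds S (tpair (\<sigma> ?r) (\<sigma> ?q) (\<sigma> ?p) (\<sigma> 0)) w" "reds S (tpair (\<tau> ?r) (\<tau> ?q) (\<tau> ?p) (\<tau> 0)) w'" for w w'
      using reds_Con4[OF _ _ that(1)] reds_Con4[OF _ _ that(2)] LR_reds2(1)[OF R'(2) LR_reds(1)[OF R'(2) x]] LR_reds2(1)[OF R'(3) LR_reds(1)[OF R'(3) y]]
      unfolding Qprod_def by blast
    then show "(sub \<sigma> (tpair (Var ?r) (Var ?q) (Var ?p) (Var 0)), sub \<tau> (tpair (Var ?r) (Var ?q) (Var ?p) (Var 0))) \<in> R"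
      using sbaseD[OF b g] unfolding R'(1) posR_def by auto
  qed
  have 3: "sem ?G3 (Con PairC \<cdot> Var ?q \<cdot> Var ?p \<cdot> Var 0) (Tot (Pi (Var ?p) (Tot (tprod (Var ?r) (Var ?q)))))"
    if "sbase ?G3 (Con PairC \<cdot> Var ?q \<cdot> Var ?p \<cdot> Var 0) (Tot (Pi (Var ?p) (Tot (tprod (Var ?r) (Var ?q)))))"
    by (rule sem_con1[OF w3 that nr_sub(4) o3(1) o4]) (use 4 in simp_all)
  have o3': "ok ?G3 (Pi (Var ?p) (Tot (tprod (Var ?r) (Var ?q)))) (max j (max i j))" by (rule ok_pi[OF w3 o3(1) o4])
  have 2: "sem ?G2 (Con PairC \<cdot> Var ?p \<cdot> Var 0) (Tot (Pi (Var ?p) (Tot (Pi (Var ?p) (Tot (tprod (Var ?r) (Var ?q)))))))"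
    if "sbase ?G2 (Con PairC \<cdot> Var ?p \<cdot> Var 0) (Tot (Pi (Var ?p) (Tot (Pi (Var ?p) (Tot (tprod (Var ?r) (Var ?q)))))))"
    by (rule sem_con1[OF T(1) that nr_sub(3) T(2) o3']) (use 3 in simp_all)
  show ?thesis using sem_con2[of \<Gamma> PairC i j "arr (Var 1) (arr (Var 0) (tprod (Var 1) (Var 0)))" "max i (max j (max i j))"]
    ok_pi[OF T(1,2) o3'] w t 2 by simp
qed

definition projcon :: "const \<Rightarrow> tm \<times> tm \<Rightarrow> tm \<Rightarrow> tm \<Rightarrow> bool" where
  "projcon k p w x \<longleftrightarrow> (\<exists>a b y z. w = tpair a b y z \<and> x = (if k = FstC then y else z))"

lemma frame_proj: assumes "k = FstC \<or> k = SndC" shows "frame (\<lambda>p e. Con k \<cdot> fst p \<cdot> snd p \<cdot> e) (projcon k) rp2"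
  unfolding frame_def
proof (intro conjI allI impI)
  fix p e x assume r: "red S (Con k \<cdot> fst p \<cdot> snd p \<cdot> e) x"
  show "(\<exists>e1. red S e e1 \<and> x = Con k \<cdot> fst p \<cdot> snd p \<cdot> e1) \<or> (\<exists>p1. rp2 p p1 \<and> x = Con k \<cdot> fst p1 \<cdot> snd p1 \<cdot> e) \<or> projcon k p e x \<and> valform e"
  proof -
    have L: "\<exists>p1. rp2 p p1 \<and> y = Con k \<cdot> fst p1 \<cdot> snd p1" if "red S (Con k \<cdot> fst p \<cdot> snd p) y" for y
      using red_Con2[OF that] by (cases p) fastforce
    show ?thesis using r by (rule red_AppE) (use L in \<open>auto simp: projcon_def valform_def\<close>)
  qed
qed (use assms in \<open>auto intro: stuck.intros E_AppR intro!: E_AppL\<close>)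

lemma reds_App3: "reds S a a' \<Longrightarrow> reds S b b' \<Longrightarrow> reds S (Con k \<cdot> a \<cdot> b) (Con k \<cdot> a' \<cdot> b')"
  by (intro reds_App rtranclp.rtrancl_refl)

text \<open>With both type arguments present a projection is waiting for a pair and can form a
  redex, so \<open>sem_con\<close> does not cover its last application. This application is a frame
  instead, and \<open>sem_eta\<close> leads to \<open>frame_elim\<close>.\<close>

lemma sem_proj:
  assumes w: "wfc \<Gamma>" and t: "const_type k (Pi (Ty i) (Tot (Pi (Ty j) (Tot (arr (tprod (Var (Suc 0)) (Var 0)) (Var v))))))"
    and k: "k = FstC \<and> v = Suc 0 \<or> k = SndC \<and> v = 0"
  shows "sem \<Gamma> (Con k) (Tot (Pi (Ty i) (Tot (Pi (Ty j) (Tot (arr (tprod (Var (Suc 0)) (Var 0)) (Var v)))))))"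
proof -
  let ?G2 = "TT i j \<Gamma>" let ?p = "Suc 0" let ?q = "Suc ?p" let ?G3 = "tprod (Var ?p) (Var 0) # ?G2" let ?h = "if k = FstC then i else j"
  note T = TT_ok[OF w, where i = i and j = j]
  note p = T(4)[where k = ProdC, simplified]
  have v: "ok ?G2 (Var v) ?h" using T(2,3) k by auto
  have o3: "ok ?G3 (Var (Suc v)) ?h" using ok_wk[OF v] by simp
  have 2: "sem ?G2 (Con k \<cdot> Var ?p \<cdot> Var 0) (Tot (Pi (tprod (Var ?p) (Var 0)) (Tot (Var (Suc v)))))"
    if b: "sbase ?G2 (Con k \<cdot> Var ?p \<cdot> Var 0) (Tot (Pi (tprod (Var ?p) (Var 0)) (Tot (Var (Suc v)))))"
  proof (rule sem_eta[OF T(1) b okD(1,3)[OF p] H_Tot[OF okD(1)[OF o3]] okD(3)[OF o3]])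
    show "sem ?G3 (sh (Con k \<cdot> Var ?p \<cdot> Var 0) \<cdot> Var 0) (Tot (Var (Suc v)))"
    proof (rule semI[OF okD(3)[OF o3]])
      fix E \<sigma> \<tau> R assume g: "G E ?G3 \<sigma> \<tau>" and R: "LC ?h E (subc \<sigma> (Tot (Var (Suc v)))) R"
      then have Rv: "LU ?h E (\<sigma> (Suc v)) R" by (simp add: LC_Tot)
      from sbaseD[OF b G_tl[OF g]] have f: "(Con k \<cdot> \<sigma> ?q \<cdot> \<sigma> ?p, Con k \<cdot> \<tau> ?q \<cdot> \<tau> ?p) \<in> BR E (Tot (arr (tprod (\<sigma> ?q) (\<sigma> ?p)) (\<sigma> (Suc v))))" by simp
      from G_univ[OF g, of ?q i] G_univ[OF g, of ?p j] have ab: "(\<sigma> ?q, \<tau> ?q) \<in> BR E (Tot (Ty i))" "(\<sigma> ?p, \<tau> ?p) \<in> BR E (Tot (Ty j))" by auto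
      from G_nth[OF g, of 0 "tprod (Var ?q) (Var ?p)"] obtain m Rp where Rp: "LU m E (tprod (\<sigma> ?q) (\<sigma> ?p)) Rp" "(\<sigma> 0, \<tau> 0) \<in> Rp" by auto
      from U_inv[OF Rp(1)] have "LV m E (tprod (\<sigma> ?q) (\<sigma> ?p)) Rp" by (auto simp: tfin_def)
      from LR_inv(3)[OF this] obtain Ra Rb where R': "Rp = posR (Qprod Ra Rb) E (Tot (tprod (\<sigma> ?q) (\<sigma> ?p)))"
        "LU m E (\<sigma> ?q) Ra" "LU m E (\<sigma> ?p) Rb" by blast
      have sel: "R = (if k = FstC then Ra else Rb)" using k Rv LU_unique[OF R'(2)] LU_unique[OF R'(3)] by auto
      note F = BB_D(2)[OF BR_D(1)[OF ab(1)]] BB_D(2)[OF BR_D(1)[OF ab(2)]]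
      have P: "isty E (tprod (\<sigma> ?q) (\<sigma> ?p)) (max i j)" by (rule ty_bin_app[OF _ F]) simp
      have V: "isty E (\<sigma> (Suc v)) ?h" using F k by auto
      have C: "hu S (tprod (\<sigma> ?q) (\<sigma> ?p) # E) (Tot (sh (\<sigma> (Suc v)))) ?h" using ty_ren(1)[OF wk_Suc V] by (intro H_Tot) simp
      have T: "tyt E (Con k \<cdot> fst p1 \<cdot> snd p1 \<cdot> e1) (\<sigma> (Suc v))"
        if f: "BB E (Tot (arr (tprod (\<sigma> ?q) (\<sigma> ?p)) (\<sigma> (Suc v)))) (Con k \<cdot> fst q \<cdot> snd q)"
          and e: "BB E (Tot (tprod (\<sigma> ?q) (\<sigma> ?p))) e" and r: "rp2\<^sup>*\<^sup>* q p1" "reds S e e1" for q p1 e e1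
        using ty_app_reds[OF f e P C reds_App3 r(2)] rp2_reds[OF r(1)] by simp
      note e = LU_D[OF Rp]
      have "(Con k \<cdot> fst (\<sigma> ?q, \<sigma> ?p) \<cdot> snd (\<sigma> ?q, \<sigma> ?p) \<cdot> \<sigma> 0, Con k \<cdot> fst (\<tau> ?q, \<tau> ?p) \<cdot> snd (\<tau> ?q, \<tau> ?p) \<cdot> \<tau> 0) \<in> R"
      proof (rule frame_elim[OF frame_proj R Rp(2)[unfolded R'(1)] Q_valform(1)])
        show "k = FstC \<or> k = SndC" using k by blast
        show "TR rp2 (\<sigma> ?q, \<sigma> ?p)" "TR rp2 (\<tau> ?q, \<tau> ?p)" using TR_rp2 ab[THEN BR_D(1)] ab[THEN BR_D(2)] BB_D(1) by blast+
        show "(\<exists>x. red S (Con k \<cdot> fst p \<cdot> snd p \<cdot> w) x) \<and> (\<exists>x. red S (Con k \<cdot> fst p \<cdot> snd p \<cdot> w') x)" if "Qprod Ra Rb w w'" for w w' p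
          using that k unfolding Qprod_def by (auto intro: red.intros)
        show "ty S E (Con k \<cdot> fst p1 \<cdot> snd p1 \<cdot> e1) (subc \<sigma> (Tot (Var (Suc v))))" if "rp2\<^sup>*\<^sup>* (\<sigma> ?q, \<sigma> ?p) p1" "reds S (\<sigma> 0) e1" for p1 e1
          using T[OF _ BR_D(1)[OF e] that] BR_D(1)[OF f] by simp
        show "ty S E (Con k \<cdot> fst p1 \<cdot> snd p1 \<cdot> e1) (subc \<sigma> (Tot (Var (Suc v))))" if "rp2\<^sup>*\<^sup>* (\<tau> ?q, \<tau> ?p) p1" "reds S (\<tau> 0) e1" for p1 e1
          using T[OF _ BR_D(2)[OF e] that] BR_D(2)[OF f] by simp
        show "cv E (subc \<sigma> (Tot (Var (Suc v)))) (Con k \<cdot> fst (\<sigma> ?q, \<sigma> ?p) \<cdot> snd (\<sigma> ?q, \<sigma> ?p) \<cdot> \<sigma> 0) (Con k \<cdot> fst (\<tau> ?q, \<tau> ?p) \<cdot> snd (\<tau> ?q, \<tau> ?p) \<cdot> \<tau> 0)"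
          using cv_app[OF BR_D(3)[OF f] BR_D(3)[OF e] P C] by simp
        show "(x, x') \<in> R" if "Qprod Ra Rb w w'" "projcon k p1 w x" "projcon k p1' w' x'" for p1 p1' w w' x x'
          using that sel unfolding Qprod_def projcon_def by (auto split: if_splits)
      qed
      then show "(sub \<sigma> (sh (Con k \<cdot> Var ?p \<cdot> Var 0) \<cdot> Var 0), sub \<tau> (sh (Con k \<cdot> Var ?p \<cdot> Var 0) \<cdot> Var 0)) \<in> R" by simp
    qed
  qed
  have ku: "k \<noteq> Univ l" for l using k by auto
  show ?thesis by (rule sem_con2[OF w t ku]) (use ok_pi[OF T(1) p o3] 2 in simp_all)
qed

text \<open>The type arguments found in a reduct are reducts of those at hand, on the right even of
  the other instance; \<open>cv_tinj\<close> converts them to the left instance, to which the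
  relation of the sum refers.\<close>

lemma sem_inj:
  assumes w: "wfc \<Gamma>" and t: "const_type k (Pi (Ty i) (Tot (Pi (Ty j) (Tot (arr (Var v) (tsum (Var (Suc 0)) (Var 0)))))))"
    and k: "k = InlC \<and> v = Suc 0 \<or> k = InrC \<and> v = 0"
  shows "sem \<Gamma> (Con k) (Tot (Pi (Ty i) (Tot (Pi (Ty j) (Tot (arr (Var v) (tsum (Var (Suc 0)) (Var 0))))))))"
proof -
  let ?G2 = "TT i j \<Gamma>" let ?p = "Suc 0" let ?q = "Suc ?p" let ?G3 = "Var v # ?G2" let ?h = "if k = InlC then i else j"
  note T = TT_ok[OF w, where i = i and j = j]
  note p = T(4)[where k = SumC, simplified]
  have v: "ok ?G2 (Var v) ?h" using T(2,3) k by auto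
  have o3: "ok ?G3 (tsum (Var ?q) (Var ?p)) (max i j)" using ok_wk[OF p] by simp
  have kk: "k \<noteq> FstC" "k \<noteq> SndC" "k \<noteq> Univ l" for l using k by auto
  have 3: "sem ?G3 (Con k \<cdot> Var ?q \<cdot> Var ?p \<cdot> Var 0) (Tot (tsum (Var ?q) (Var ?p)))"
    if b: "sbase ?G3 (Con k \<cdot> Var ?q \<cdot> Var ?p \<cdot> Var 0) (Tot (tsum (Var ?q) (Var ?p)))"
  proof (rule semI[OF okD(3)[OF o3]])
    fix E \<sigma> \<tau> R assume g: "G E ?G3 \<sigma> \<tau>" and "LC (max i j) E (subc \<sigma> (Tot (tsum (Var ?q) (Var ?p)))) R"
    then have R: "LU (max i j) E (tsum (\<sigma> ?q) (\<sigma> ?p)) R" by (simp add: LC_Tot)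
    from U_inv[OF this] have "LV (max i j) E (tsum (\<sigma> ?q) (\<sigma> ?p)) R" by (auto simp: tfin_def)
    from LR_inv(4)[OF this] obtain Ra Rb where R': "R = posR (Qsum E (\<sigma> ?q) (\<sigma> ?p) Ra Rb) E (Tot (tsum (\<sigma> ?q) (\<sigma> ?p)))"
      "LU (max i j) E (\<sigma> ?q) Ra" "LU (max i j) E (\<sigma> ?p) Rb" by blast
    let ?X = "\<sigma> (Suc v)" let ?RX = "if k = InlC then Ra else Rb"
    have RX: "LU (max i j) E ?X ?RX" using k R'(2,3) by auto
    from G_nth[OF g, of 0 "Var (Suc v)"] obtain m Rx where "LU m E ?X Rx" "(\<sigma> 0, \<tau> 0) \<in> Rx" by auto
    then have x: "(\<sigma> 0, \<tau> 0) \<in> ?RX" using LU_unique[OF RX] by blast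
    from G_univ[OF g, of ?q i] G_univ[OF g, of ?p j] have ab: "(\<sigma> ?q, \<tau> ?q) \<in> BR E (Tot (Ty i))" "(\<sigma> ?p, \<tau> ?p) \<in> BR E (Tot (Ty j))" by auto
    have q: "Qsum E (\<sigma> ?q) (\<sigma> ?p) Ra Rb w w'"
      if r: "reds S (Con k \<cdot> \<sigma> ?q \<cdot> \<sigma> ?p \<cdot> \<sigma> 0) w" "reds S (Con k \<cdot> \<tau> ?q \<cdot> \<tau> ?p \<cdot> \<tau> 0) w'" for w w'
    proof -
      from reds_Con3[OF kk(1,2) r(1)] obtain a b y where w: "w = Con k \<cdot> a \<cdot> b \<cdot> y" "reds S (\<sigma> ?q) a" "reds S (\<sigma> ?p) b" "reds S (\<sigma> 0) y" by blast
      from reds_Con3[OF kk(1,2) r(2)] obtain a' b' y' where w': "w' = Con k \<cdot> a' \<cdot> b' \<cdot> y'" "reds S (\<tau> ?q) a'" "reds S (\<tau> ?p) b'" "reds S (\<tau> 0) y'" by blast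
      have y: "(y, y') \<in> ?RX" by (rule LR_reds2(1)[OF RX LR_reds(1)[OF RX x w(4)] w'(4)])
      have cy: "cv E (Tot ?X) y y" "cv E (Tot ?X) y' y'" using LU_D[OF RX y] BR_D(1,2) BB_D(2) cv_refl by blast+
      have ca: "cv E (Tot (Ty i)) (\<sigma> ?q) a" "cv E (Tot (Ty j)) (\<sigma> ?p) b" "cv E (Tot (Ty i)) (\<sigma> ?q) a'" "cv E (Tot (Ty j)) (\<sigma> ?p) b'"
        using BB_cv[OF BR_D(1)[OF ab(1)] w(2)] BB_cv[OF BR_D(1)[OF ab(2)] w(3)]
          cv_trans[OF BR_D(3)[OF ab(1)] BB_cv[OF BR_D(2)[OF ab(1)] w'(2)]] cv_trans[OF BR_D(3)[OF ab(2)] BB_cv[OF BR_D(2)[OF ab(2)] w'(3)]] by blast+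
      have I: "k = InlC \<and> ?X = \<sigma> ?q \<and> X' = X' \<or> k = InrC \<and> ?X = \<sigma> ?p \<and> X' = X'" for X' :: tm using k by auto
      have "cv E (Tot (tsum (\<sigma> ?q) (\<sigma> ?p))) w (Con k \<cdot> \<sigma> ?q \<cdot> \<sigma> ?p \<cdot> y)"
        unfolding w(1) by (rule cv_sym, rule cv_tinj[of k ?X _ "if k = InlC then a else b", OF _ ca(1,2) cy(1)]) (use k in auto)
      moreover have "cv E (Tot (tsum (\<sigma> ?q) (\<sigma> ?p))) w' (Con k \<cdot> \<sigma> ?q \<cdot> \<sigma> ?p \<cdot> y')"
        unfolding w'(1) by (rule cv_sym, rule cv_tinj[of k ?X _ "if k = InlC then a' else b'", OF _ ca(3,4) cy(2)]) (use k in auto)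
      ultimately show ?thesis using k y unfolding Qsum_def w(1) w'(1) by auto
    qed
    then show "(sub \<sigma> (Con k \<cdot> Var ?q \<cdot> Var ?p \<cdot> Var 0), sub \<tau> (Con k \<cdot> Var ?q \<cdot> Var ?p \<cdot> Var 0)) \<in> R"
      using sbaseD[OF b g] unfolding R'(1) posR_def by auto
  qed
  have 2: "sem ?G2 (Con k \<cdot> Var ?p \<cdot> Var 0) (Tot (Pi (Var v) (Tot (tsum (Var ?q) (Var ?p)))))"
    if "sbase ?G2 (Con k \<cdot> Var ?p \<cdot> Var 0) (Tot (Pi (Var v) (Tot (tsum (Var ?q) (Var ?p)))))"
    by (rule sem_con1[OF T(1) that nr_sub(3)[OF kk(1,2)] v o3]) (use 3 in simp)
  show ?thesis by (rule sem_con2[OF w t kk(3)]) (use ok_pi[OF T(1) v o3] 2 in simp_all)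
qed

lemma sem_exists: assumes w: "wfc \<Gamma>" and t: "const_type ExistsC (Pi (Ty i) (Tot (arr (arr (Var 0) (Ty 0)) (Ty 0))))"
  shows "sem \<Gamma> (Con ExistsC) (Tot (Pi (Ty i) (Tot (arr (arr (Var 0) (Ty 0)) (Ty 0)))))"
proof -
  let ?G1 = "Ty i # \<Gamma>" and ?A = "Pi (Var 0) (Tot (Ty 0))"
  have w1: "wfc ?G1" using w Y_Univ by auto
  have v: "ok ?G1 (Var 0) i" by (rule ok_var) simp_all
  have A: "ok ?G1 ?A (max i (Suc 0))" by (rule ok_pi[OF w1 v ok_univ])
  have nc: "\<not> canon W" if "reds S (sub \<sigma> (Con ExistsC \<cdot> Var (Suc 0) \<cdot> Var 0)) W" for \<sigma> W
    using that reds_Con2[of ExistsC "\<sigma> (Suc 0)" "\<sigma> 0" W] by (auto simp: canon_def)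
  have 2: "sem (?A # ?G1) (Con ExistsC \<cdot> Var (Suc 0) \<cdot> Var 0) (Tot (Ty 0))" if "sbase (?A # ?G1) (Con ExistsC \<cdot> Var (Suc 0) \<cdot> Var 0) (Tot (Ty 0))"
    by (rule sem_inert[OF that]) (erule nc)
  have 1: "sem ?G1 (Con ExistsC \<cdot> Var 0) (Tot (Pi ?A (Tot (Ty 0))))" if "sbase ?G1 (Con ExistsC \<cdot> Var 0) (Tot (Pi ?A (Tot (Ty 0))))"
    by (rule sem_con1[OF w1 that nr_sub(2) A ok_univ]) (use 2 in simp)
  have k: "ExistsC \<noteq> Univ l" for l by simp
  show ?thesis
    using sem_con1[OF w _ nr_sub(1) ok_univ ok_pi[OF w1 A ok_univ], of ExistsC] sbase_con[OF t k] 1 by simp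
qed

lemma sem_equal: assumes w: "wfc \<Gamma>" and t: "const_type EqualC (Pi (Ty i) (Tot (arr (Var 0) (arr (Var 0) (Ty 0)))))"
  shows "sem \<Gamma> (Con EqualC) (Tot (Pi (Ty i) (Tot (arr (Var 0) (arr (Var 0) (Ty 0))))))"
proof -
  let ?p = "Suc 0" let ?q = "Suc ?p" let ?G1 = "Ty i # \<Gamma>" let ?G2 = "Var 0 # ?G1"
  have w1: "wfc ?G1" using w Y_Univ by auto
  have v: "ok ?G1 (Var 0) i" by (rule ok_var) simp_all
  have w2: "wfc ?G2" by (rule ok_wfc[OF w1 v])
  have v2: "ok ?G2 (Var ?p) i" using ok_wk[OF v] by simp
  have nc: "\<not> canon W" if "reds S (sub \<sigma> (Con EqualC \<cdot> Var ?q \<cdot> Var ?p \<cdot> Var 0)) W" for \<sigma> W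
    using that reds_Con3[of EqualC "\<sigma> ?q" "\<sigma> ?p" "\<sigma> 0" W] by (auto simp: canon_def)
  have 3: "sem (Var ?p # ?G2) (Con EqualC \<cdot> Var ?q \<cdot> Var ?p \<cdot> Var 0) (Tot (Ty 0))" if "sbase (Var ?p # ?G2) (Con EqualC \<cdot> Var ?q \<cdot> Var ?p \<cdot> Var 0) (Tot (Ty 0))"
    by (rule sem_inert[OF that]) (erule nc)
  have 2: "sem ?G2 (Con EqualC \<cdot> Var ?p \<cdot> Var 0) (Tot (Pi (Var ?p) (Tot (Ty 0))))" if "sbase ?G2 (Con EqualC \<cdot> Var ?p \<cdot> Var 0) (Tot (Pi (Var ?p) (Tot (Ty 0))))"
    by (rule sem_con1[OF w2 that nr_sub(3) v2 ok_univ]) (use 3 in simp_all)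
  have 1: "sem ?G1 (Con EqualC \<cdot> Var 0) (Tot (Pi (Var 0) (Tot (Pi (Var ?p) (Tot (Ty 0))))))" if "sbase ?G1 (Con EqualC \<cdot> Var 0) (Tot (Pi (Var 0) (Tot (Pi (Var ?p) (Tot (Ty 0))))))"
    by (rule sem_con1[OF w1 that nr_sub(2) v ok_pi[OF w2 v2 ok_univ]]) (use 2 in simp)
  have k: "EqualC \<noteq> Univ l" for l by simp
  show ?thesis
    using sem_con1[OF w _ nr_sub(1) ok_univ ok_pi[OF w1 v ok_pi[OF w2 v2 ok_univ]], of EqualC] sbase_con[OF t k] 1 by simp
qed

lemma sem_const: assumes w: "wfc \<Gamma>" and t: "const_type k t" and k: "\<forall>i. k \<noteq> Univ i" shows "sem \<Gamma> (Con k) (Tot t)"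
  using t
proof cases
  case (5 i j)
  then show ?thesis using sem_pair[OF w] t by simp
next
  case (6 i j)
  then show ?thesis using sem_proj[OF w, of k i j "Suc 0"] t by simp
next
  case (7 i j)
  then show ?thesis using sem_proj[OF w, of k i j 0] t by simp
next
  case (9 i j)
  then show ?thesis using sem_inj[OF w, of k i j "Suc 0"] t by simp
next
  case (10 i j)
  then show ?thesis using sem_inj[OF w, of k i j 0] t by simp
next
  case (12 i)
  then show ?thesis using sem_exists[OF w] t by simp
next
  case (13 i)
  then show ?thesis using sem_equal[OF w] t by simp
qed (use k t sem_bin[OF _ w] sem_0 okD(2) sem_tt in auto)

end

section \<open>Validity and pure computations\<close>

context sigc begin

text \<open>The logical equality contains reduction, and substitutivity is applied with the variable
  itself as the formula.\<close>

lemma valid_reds: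
  assumes a: "isty \<Gamma> \<phi> i" and b: "isty \<Gamma> \<psi> i" and r: "reds S \<phi> \<psi>" and v: "valid S \<Gamma> \<phi>"
  shows "valid S \<Gamma> \<psi>"
proof -
  have e: "valid S \<Gamma> (FEq (Ty i) \<phi> \<psi>)" by (rule V_EqRed[OF ty_orig(1)[OF Y_Univ] ty_orig(1)[OF a] ty_orig(1)[OF b] r])
  have "isty (Ty i # \<Gamma>) (Var 0) i" by (rule ty_v) simp_all
  from V_EqSubst[OF e ty_orig(1)[OF this]] v show ?thesis by simp
qed

lemma valid_AllImp:
  assumes "valid S \<Gamma> (FAll t (FImp (sh w \<cdot> Var 0) (sh w' \<cdot> Var 0)))" "typing S \<Gamma> p (Tot t)" "valid S \<Gamma> (w \<cdot> p)"
  shows "valid S \<Gamma> (w' \<cdot> p)"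
proof -
  have "inst (FImp (sh w \<cdot> Var 0) (sh w' \<cdot> Var 0)) p = FImp (w \<cdot> p) (w' \<cdot> p)"
    unfolding inst_def sub_formulas by (simp add: sub_ren)
  then show ?thesis using V_AllE[OF assms(1,2)] V_ImpE assms(3) by metis
qed

text \<open>A postcondition on the larger result type is one on the smaller by contravariance. It
  can thus be followed down a chain of subtypings, while validity passes from the transformer of the
  supertype to that of the subtype.\<close>

lemma sc_pure_inv_aux:
  "ty S \<Gamma> e c0 \<Longrightarrow> True" "hu S \<Gamma> c0 i0 \<Longrightarrow> True" "st S \<Gamma> X Y \<Longrightarrow> True"
  "sc S \<Gamma> c' c \<Longrightarrow> \<forall>t w. c = Comp Pure t w \<longrightarrow> (\<exists>i. hu S \<Gamma> c i) \<longrightarrow> (\<exists>i. hu S \<Gamma> c' i) \<longrightarrow>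
    (\<exists>t' w'. c' = Comp Pure t' w' \<and> (\<forall>p. tyt \<Gamma> p (arr t (Ty 0)) \<longrightarrow> valid S \<Gamma> (w \<cdot> p) \<longrightarrow> tyt \<Gamma> p (arr t' (Ty 0)) \<and> valid S \<Gamma> (w' \<cdot> p)))"
proof (induct rule: ty_hu_st_sc.inducts)
  case (SB_Trans \<Gamma> c1 c2 i c3)
  show ?case
  proof (intro allI impI)
    fix t w assume c: "c3 = Comp Pure t w" "\<exists>i. hu S \<Gamma> c3 i" "\<exists>i. hu S \<Gamma> c1 i"
    have h2: "\<exists>i. hu S \<Gamma> c2 i" using SB_Trans(3) by blast
    from SB_Trans(6)[rule_format, OF c(1,2) h2] obtain t2 w2 where 2: "c2 = Comp Pure t2 w2"
      "\<forall>p. tyt \<Gamma> p (arr t (Ty 0)) \<longrightarrow> valid S \<Gamma> (w \<cdot> p) \<longrightarrow> tyt \<Gamma> p (arr t2 (Ty 0)) \<and> valid S \<Gamma> (w2 \<cdot> p)" by blast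
    from SB_Trans(2)[rule_format, OF 2(1) h2 c(3)] obtain t1 w1 where 1: "c1 = Comp Pure t1 w1"
      "\<forall>p. tyt \<Gamma> p (arr t2 (Ty 0)) \<longrightarrow> valid S \<Gamma> (w2 \<cdot> p) \<longrightarrow> tyt \<Gamma> p (arr t1 (Ty 0)) \<and> valid S \<Gamma> (w1 \<cdot> p)" by blast
    show "\<exists>t' w'. c1 = Comp Pure t' w' \<and> (\<forall>p. tyt \<Gamma> p (arr t (Ty 0)) \<longrightarrow> valid S \<Gamma> (w \<cdot> p) \<longrightarrow> tyt \<Gamma> p (arr t' (Ty 0)) \<and> valid S \<Gamma> (w' \<cdot> p))"
      using 1 2 by blast
  qed
next
  case (SB_Pure \<Gamma> t' t wp wp')
  show ?case
  proof (intro allI impI)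
    fix t0 w assume c: "Comp Pure t wp = Comp Pure t0 w" "\<exists>i. hu S \<Gamma> (Comp Pure t wp) i" "\<exists>i. hu S \<Gamma> (Comp Pure t' wp') i"
    then have t: "isty \<Gamma> t 0" "isty \<Gamma> t' 0" using hu_t(1) by blast+
    have "tyt \<Gamma> p (arr t' (Ty 0)) \<and> valid S \<Gamma> (wp' \<cdot> p)" if p: "tyt \<Gamma> p (arr t (Ty 0))" "valid S \<Gamma> (wp \<cdot> p)" for p
    proof
      have "st S \<Gamma> (arr t (Ty 0)) (arr t' (Ty 0))" by (rule ST_Pi[OF t(2) SB_Pure(1) SB_Refl])
      from ty_st[OF p(1) this ty_arr[OF t(1) Y_Univ] ty_arr[OF t(2) Y_Univ]] show "tyt \<Gamma> p (arr t' (Ty 0))" .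
      show "valid S \<Gamma> (wp' \<cdot> p)" by (rule valid_AllImp[OF SB_Pure(3) ty_orig(1)[OF p(1)] p(2)])
    qed
    then show "\<exists>ta w'. Comp Pure t' wp' = Comp Pure ta w' \<and> (\<forall>p. tyt \<Gamma> p (arr t0 (Ty 0)) \<longrightarrow> valid S \<Gamma> (w \<cdot> p) \<longrightarrow> tyt \<Gamma> p (arr ta (Ty 0)) \<and> valid S \<Gamma> (w' \<cdot> p))"
      using c(1) by blast
  qed
qed simp_all

lemma red_beta_sub: "red S (sub \<sigma> (Lam A b) \<cdot> a) (sub (scons a \<sigma>) b)"
  using R_Beta[of S "sub \<sigma> A" "sub (ups \<sigma>) b" a] by (simp add: inst_ups)

lemma reds_beta_sub: "reds S f (sub \<sigma> (Lam A b)) \<Longrightarrow> reds S (f \<cdot> a) (sub (scons a \<sigma>) b)"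
  by (rule reds_snoc[OF reds_AppL red_beta_sub])

lemma reds_ret_star: "reds S (pure_ret_star \<cdot> t \<cdot> v \<cdot> p) (p \<cdot> v)"
proof -
  have "reds S pure_ret_star (sub Var pure_ret_star)" by simp
  from reds_beta_sub[OF reds_beta_sub[OF reds_beta_sub[OF this[unfolded pure_ret_star_def]]], of t v p]
  show ?thesis by (simp add: pure_ret_star_def)
qed

text \<open>Only the rule for \<open>Return Pure\<close> and subsumption give such a type to a
  return; under the former the specification at \<open>p\<close> reduces to \<open>p\<close> at the
  returned term.\<close>

lemma ret_inv_aux:
  "ty S \<Gamma> e c \<Longrightarrow> \<forall>t' v t w. e = Return Pure t' v \<longrightarrow> c = Comp Pure t w \<longrightarrow>
     (\<forall>p. tyt \<Gamma> p (arr t (Ty 0)) \<longrightarrow> valid S \<Gamma> (w \<cdot> p) \<longrightarrow> valid S \<Gamma> (p \<cdot> v))"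
  "hu S \<Gamma> c0 i0 \<Longrightarrow> True" "st S \<Gamma> X Y \<Longrightarrow> True" "sc S \<Gamma> c1 c2 \<Longrightarrow> True"
proof (induct rule: ty_hu_st_sc.inducts)
  case (Y_ReturnP \<Gamma> t e)
  show ?case
  proof (intro allI impI)
    fix t' v t0 w p
    assume e: "Return Pure t e = Return Pure t' v" "Comp Pure t (pure_ret_star \<cdot> t \<cdot> e) = Comp Pure t0 w"
      and p: "tyt \<Gamma> p (arr t0 (Ty 0))" and v: "valid S \<Gamma> (w \<cdot> p)"
    have [simp]: "t' = t" "v = e" "t0 = t" "w = pure_ret_star \<cdot> t \<cdot> e" using e by auto
    have u: "isty \<Gamma> (Ty 0) (Suc 0)" by (rule Y_Univ)
    have w: "tyt \<Gamma> w (arr (arr t (Ty 0)) (Ty 0))" using hu_inv(2)[OF Y_ReturnP(5)] by simp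
    have 1: "isty \<Gamma> (w \<cdot> p) 0" by (rule ty_arr_app[OF w _ ty_arr[OF Y_ReturnP(1) u] u]) (use p in simp)
    have 2: "isty \<Gamma> (p \<cdot> v) 0" by (rule ty_arr_app[OF p _ _ u]) (use Y_ReturnP(1,3) in simp_all)
    show "valid S \<Gamma> (p \<cdot> v)" by (rule valid_reds[OF 1 2 _ v]) (simp add: reds_ret_star)
  qed
next
  case (Y_Sub \<Gamma> e c' c j i)
  show ?case
  proof (intro allI impI)
    fix t' v t w p
    assume e: "e = Return Pure t' v" "c = Comp Pure t w" and p: "tyt \<Gamma> p (arr t (Ty 0))" "valid S \<Gamma> (w \<cdot> p)"
    from sc_pure_inv_aux(4)[OF Y_Sub(3), rule_format, OF e(2)] Y_Sub(5,7) obtain t1 w1 where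
      "c' = Comp Pure t1 w1" "tyt \<Gamma> p (arr t1 (Ty 0)) \<and> valid S \<Gamma> (w1 \<cdot> p)" using p by blast
    then show "valid S \<Gamma> (p \<cdot> v)" using Y_Sub(2) e(1) by blast
  qed
qed (simp_all (no_asm))

lemma ret_inv: "ty S \<Gamma> (Return Pure t' v) (Comp Pure t w) \<Longrightarrow> tyt \<Gamma> p (arr t (Ty 0)) \<Longrightarrow> valid S \<Gamma> (w \<cdot> p) \<Longrightarrow> valid S \<Gamma> (p \<cdot> v)"
  using ret_inv_aux(1) by blast

lemma reds_bnd_star: "reds S (apps pure_bnd_star [t1, t2, wp1, wp2] \<cdot> p) (wp1 \<cdot> Lam t1 (sh wp2 \<cdot> Var 0 \<cdot> sh p))"
proof -
  have "reds S pure_bnd_star (sub Var pure_bnd_star)" by simp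
  from reds_beta_sub[OF reds_beta_sub[OF reds_beta_sub[OF reds_beta_sub[OF reds_beta_sub[OF this[unfolded pure_bnd_star_def]]]]], of t1 t2 wp1 wp2 p]
  show ?thesis by (simp add: pure_bnd_star_def numeral_eq_Suc)
qed

text \<open>The contractum of a bind has the specification \<open>wp2\<close> at \<open>v\<close>,
  which must follow from that of the bind. The latter at \<open>p\<close> reduces to
  \<open>wp1\<close> at the postcondition \<open>?Q\<close>; the returned term satisfies every
  postcondition for which \<open>wp1\<close> is valid, and \<open>?Q\<close> at \<open>v\<close>
  reduces to the claim.\<close>

lemma bind_valid:
  assumes h1: "hu S \<Gamma> (Comp Pure t1 wp1) 0" and h2: "hu S (t1 # \<Gamma>) (Comp Pure (sh t2) (sh wp2 \<cdot> Var 0)) 0"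
    and h: "hu S \<Gamma> (Comp Pure t2 (apps pure_bnd_star [t1, t2, wp1, wp2])) 0"
    and r: "ty S \<Gamma> (Return Pure t' v) (Comp Pure t1 wp1)" and v: "tyt \<Gamma> v t1"
    and p: "tyt \<Gamma> p (arr t2 (Ty 0))" and V: "valid S \<Gamma> (apps pure_bnd_star [t1, t2, wp1, wp2] \<cdot> p)"
  shows "valid S \<Gamma> (wp2 \<cdot> v \<cdot> p)"
proof -
  let ?Q = "Lam t1 (sh wp2 \<cdot> Var 0 \<cdot> sh p)"
  have u: "isty \<Gamma> (Ty 0) (Suc 0)" for \<Gamma> by (rule Y_Univ)
  note t1 = hu_t(1)[OF h1] and t2 = hu_t(1)[OF h]
  have p': "tyt (t1 # \<Gamma>) (sh p) (arr (sh t2) (Ty 0))" using ty_ren(1)[OF wk_Suc p, of t1] by (simp add: ren_upr_Suc)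
  have "isty (t1 # \<Gamma>) (sh wp2 \<cdot> Var 0 \<cdot> sh p) 0"
    using ty_arr_app[OF _ p' ty_arr[OF hu_t(1)[OF h2] u] u] hu_inv(2)[OF h2] by blast
  then have Q: "tyt \<Gamma> ?Q (arr t1 (Ty 0))" using Y_Lam[OF t1 hu_Ty] by simp
  have 1: "isty \<Gamma> (apps pure_bnd_star [t1, t2, wp1, wp2] \<cdot> p) 0"
    using ty_arr_app[OF _ p ty_arr[OF t2 u] u] hu_inv(2)[OF h] by blast
  have 2: "isty \<Gamma> (wp1 \<cdot> ?Q) 0"
    using ty_arr_app[OF _ Q ty_arr[OF t1 u] u] hu_inv(2)[OF h1] by blast
  have 3: "isty \<Gamma> (?Q \<cdot> v) 0" by (rule ty_arr_app[OF Q v t1 u])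
  have w: "tyt \<Gamma> (wp2 \<cdot> v) (arr (arr t2 (Ty 0)) (Ty 0))"
    using hu_inst[OF h2 v] hu_inv(2)[of \<Gamma> t2 "wp2 \<cdot> v"] by simp
  have 4: "isty \<Gamma> (wp2 \<cdot> v \<cdot> p) 0" by (rule ty_arr_app[OF w p ty_arr[OF t2 u] u])
  have "valid S \<Gamma> (wp1 \<cdot> ?Q)" by (rule valid_reds[OF 1 2 reds_bnd_star V])
  from ret_inv[OF r Q this] have "valid S \<Gamma> (?Q \<cdot> v)" .
  then show ?thesis by (rule valid_reds[OF 3 4, rotated]) (rule r_into_rtranclp[of "red S"], use R_Beta[of S t1 "sh wp2 \<cdot> Var 0 \<cdot> sh p" v] in simp)
qed

text \<open>Internalizes an implication between validities that is known in all extensions of the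
  context; it is used in the extension by a generic postcondition and a proof of \<open>w\<close> at
  it.\<close>

lemma valid_AllImpI:
  assumes t: "isty E t 0" and w: "tyt E w (arr (arr t (Ty 0)) (Ty 0))" "tyt E w' (arr (arr t (Ty 0)) (Ty 0))"
    and H: "\<And>\<Theta> r p. wk E r \<Theta> \<Longrightarrow> tyt \<Theta> p (arr (ren r t) (Ty 0)) \<Longrightarrow> valid S \<Theta> (ren r w \<cdot> p) \<Longrightarrow> valid S \<Theta> (ren r w' \<cdot> p)"
  shows "valid S E (FAll (arr t (Ty 0)) (FImp (sh w \<cdot> Var 0) (sh w' \<cdot> Var 0)))"
proof -
  let ?P = "arr t (Ty 0)" let ?A = "sh w \<cdot> Var 0" and ?B = "sh w' \<cdot> Var 0"
  have u: "isty \<Gamma> (Ty 0) (Suc 0)" for \<Gamma> by (rule Y_Univ)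
  have P: "isty E ?P (Suc 0)" using ty_arr[OF t u] by simp
  have P': "isty (?P # E) (sh ?P) (Suc 0)" using ty_ren(1)[OF wk_Suc P] by simp
  have v: "tyt (?P # E) (Var 0) (sh ?P)" by (rule ty_v) simp_all
  have AB: "isty (?P # E) ?A 0" "isty (?P # E) ?B 0"
    using ty_arr_app[OF _ v P' u] ty_ren(1)[OF wk_Suc w(1), of ?P] ty_ren(1)[OF wk_Suc w(2), of ?P] by simp_all
  let ?T = "?A # ?P # E"
  have wk: "wk E (\<lambda>n. Suc (Suc n)) ?T" by (rule wk_comp[OF wk_Suc wk_Suc])
  have p: "tyt ?T (Var (Suc 0)) (arr (ren (\<lambda>n. Suc (Suc n)) t) (Ty 0))" by (rule ty_v) (simp_all add: ren_ren)
  have sA: "isty ?T (sh ?A) 0" using ty_ren(1)[OF wk_Suc AB(1), of ?A] by simp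
  have "tyt ?T (Var 0) (sh ?A)" by (rule ty_v) simp_all
  then have "valid S ?T (sh ?A)" using sA by (meson V_Inhab ty_orig(1))
  then have "valid S ?T (sh ?B)" using H[OF wk p] by (simp add: ren_ren)
  then have "valid S (?P # E) (FImp ?A ?B)" using AB by (meson V_ImpI ty_orig(1))
  moreover have "isty (?P # E) (FImp ?A ?B) 0" unfolding FImp_def by (rule ty_squash[OF ty_arr[OF AB]])
  ultimately show ?thesis using P by (meson V_AllI ty_orig(1))
qed

lemma sem_ex: "sem \<Gamma> e c \<Longrightarrow> G E \<Gamma> \<sigma> \<tau> \<Longrightarrow> \<exists>n R. LC n E (subc \<sigma> c) R \<and> LC n E (subc \<tau> c) R \<and> (sub \<sigma> e, sub \<tau> e) \<in> R"
  using semD by blast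

text \<open>The denotation of \<open>Comp M t wp\<close> does not determine that of \<open>wp\<close>, so \<open>cinf\<close> records it as well.\<close>

definition cinf :: "tm list \<Rightarrow> comp \<Rightarrow> nat \<Rightarrow> bool" where
  "cinf \<Gamma> c i \<longleftrightarrow> semc \<Gamma> c i \<and> (\<forall>M t wp. c = Comp M t wp \<longrightarrow> sem \<Gamma> t (Tot (Ty 0)) \<and>
     (case M of Pure \<Rightarrow> sem \<Gamma> wp (Tot (arr (arr t (Ty 0)) (Ty 0)))
      | Usr F \<Rightarrow> \<exists>D. eff_of S F = Some D \<and> sem \<Gamma> wp (Tot (wp_type D \<cdot> t)) \<and> sem \<Gamma> (repr D \<cdot> t \<cdot> wp) (Tot (Ty 0))))"

lemma cinfD: "cinf \<Gamma> c i \<Longrightarrow> semc \<Gamma> c i" "cinf \<Gamma> (Comp M t wp) i \<Longrightarrow> sem \<Gamma> t (Tot (Ty 0))"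
  "cinf \<Gamma> (Comp Pure t wp) i \<Longrightarrow> sem \<Gamma> wp (Tot (arr (arr t (Ty 0)) (Ty 0)))"
  "cinf \<Gamma> (Comp (Usr F) t wp) i \<Longrightarrow> \<exists>D. eff_of S F = Some D \<and> sem \<Gamma> wp (Tot (wp_type D \<cdot> t)) \<and> sem \<Gamma> (repr D \<cdot> t \<cdot> wp) (Tot (Ty 0))"
  unfolding cinf_def by auto

lemma BR_sceq: "sc S E c c' \<Longrightarrow> sc S E c' c \<Longrightarrow> hu S E c i \<Longrightarrow> hu S E c' j \<Longrightarrow> BR E c = BR E c'"
  using BR_sc by (intro equalityI subrelI; blast)

lemma cinf_tot: "sem \<Gamma> X (Tot (Ty i)) \<Longrightarrow> cinf \<Gamma> (Tot X) i"
  unfolding cinf_def using semc_tot by blast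

lemma G_BR: "wfc \<Gamma> \<Longrightarrow> G E \<Gamma> \<sigma> \<tau> \<Longrightarrow> hu S \<Gamma> c i \<Longrightarrow> BR E (subc \<sigma> c) = BR E (subc \<tau> c)"
  by (rule BR_sceq[OF G_sc G_sc[OF _ G_sym] ty_sub(2)[OF G_tsb] ty_sub(2)[OF G_tsb[OF G_sym]]])

lemma cinf_pure:
  assumes w: "wfc \<Gamma>" and h: "hu S \<Gamma> (Comp Pure t wp) 0" and t: "sem \<Gamma> t (Tot (Ty 0))" and wp: "sem \<Gamma> wp (Tot (arr (arr t (Ty 0)) (Ty 0)))"
  shows "cinf \<Gamma> (Comp Pure t wp) 0"
proof -
  have "semc \<Gamma> (Comp Pure t wp) 0" unfolding semc_def
  proof (intro allI impI)
    fix E \<sigma> \<tau> assume g: "G E \<Gamma> \<sigma> \<tau>"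
    from semcD[OF semc_tot[OF t] g] obtain R where R: "LU 0 E (sub \<sigma> t) R" "LU 0 E (sub \<tau> t) R" by (auto simp: LC_Tot)
    have "LC 0 E (Comp Pure (sub \<sigma> t) (sub \<sigma> wp)) (posR (Qpure R) E (Comp Pure (sub \<sigma> t) (sub \<sigma> wp)))"
      using UC_Pure[OF _ R(1)] ty_sub(2)[OF G_tsb[OF g] h] by simp
    moreover have "LC 0 E (Comp Pure (sub \<tau> t) (sub \<tau> wp)) (posR (Qpure R) E (Comp Pure (sub \<tau> t) (sub \<tau> wp)))"
      using UC_Pure[OF _ R(2)] ty_sub(2)[OF G_tsb[OF G_sym[OF g]] h] by simp
    ultimately show "\<exists>R. LC 0 E (subc \<sigma> (Comp Pure t wp)) R \<and> LC 0 E (subc \<tau> (Comp Pure t wp)) R"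
      using G_BR[OF w g h] unfolding posR_def by auto
  qed
  then show ?thesis using t wp unfolding cinf_def by simp
qed

lemma cinf_F:
  assumes w: "wfc \<Gamma>" and h: "hu S \<Gamma> (Comp (Usr F) t wp) 0" and D: "eff_of S F = Some D" and t: "sem \<Gamma> t (Tot (Ty 0))"
    and wp: "sem \<Gamma> wp (Tot (wp_type D \<cdot> t))" and r: "sem \<Gamma> (repr D \<cdot> t \<cdot> wp) (Tot (Ty 0))"
  shows "cinf \<Gamma> (Comp (Usr F) t wp) 0"
proof -
  have "semc \<Gamma> (Comp (Usr F) t wp) 0" unfolding semc_def
  proof (intro allI impI)
    fix E \<sigma> \<tau> assume g: "G E \<Gamma> \<sigma> \<tau>"
    from semcD[OF semc_tot[OF r] g] obtain R where R: "LU 0 E (repr D \<cdot> sub \<sigma> t \<cdot> sub \<sigma> wp) R" "LU 0 E (repr D \<cdot> sub \<tau> t \<cdot> sub \<tau> wp) R"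
      using csD(2)[OF D] by (auto simp: LC_Tot closed_sub)
    show "\<exists>R. LC 0 E (subc \<sigma> (Comp (Usr F) t wp)) R \<and> LC 0 E (subc \<tau> (Comp (Usr F) t wp)) R"
      using UC_F[OF D _ R(1)] UC_F[OF D _ R(2)] ty_sub(2)[OF G_tsb[OF g] h] ty_sub(2)[OF G_tsb[OF G_sym[OF g]] h] G_BR[OF w g h] by auto
  qed
  then show ?thesis using D t wp r unfolding cinf_def by simp
qed

text \<open>When a term reduces, the specification assigned to it may reduce along. Both computation
  types are then subtypes of each other: for \<open>Pure\<close> through logical equivalence, for a
  user-defined effect through reduction of the representation type.\<close>

lemma sc_wp:
  assumes h: "hu S E (Comp M t w) i" "hu S E (Comp M t w1) j" and r: "reds S w w1"
  shows "sc S E (Comp M t w) (Comp M t w1)" "sc S E (Comp M t w1) (Comp M t w)"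
proof -
  have "sc S E (Comp M t w) (Comp M t w1) \<and> sc S E (Comp M t w1) (Comp M t w)"
  proof (cases M)
    case Pure
    note 1 = hu_inv(2)[OF h(1)[unfolded Pure]] and 2 = hu_inv(2)[OF h(2)[unfolded Pure]]
    have "cv E (Tot (arr (arr t (Ty 0)) (Ty 0))) w w1" using 1 2 cv_red[OF _ _ r] by blast
    then show ?thesis unfolding Pure using sc_pure[OF cv_refl] cv_sym 1 by blast
  next
    case (Usr F)
    obtain D where D: "eff_of S F = Some D" using hu_inv(3)[OF h(1)[unfolded Usr]] by blast
    have "reds S (repr D \<cdot> t \<cdot> w) (repr D \<cdot> t \<cdot> w1)" by (rule reds_AppR[OF r])
    then show ?thesis unfolding Usr using SB_F[OF D ST_Red] SB_F[OF D ST_Exp] by blast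
  qed
  then show "sc S E (Comp M t w) (Comp M t w1)" "sc S E (Comp M t w1) (Comp M t w)" by blast+
qed

text \<open>Serves the selection of a branch, whose specification is a reduct of the specification
  of the whole case analysis.\<close>

lemma LC_wp:
  assumes R: "LC n E (Comp M t w) R" and h: "hu S E (Comp M t w1) 0" and r: "reds S w w1"
  shows "LC n E (Comp M t w1) R"
proof -
  obtain i where i: "hu S E (Comp M t w) i" using UC_hu[OF R] by blast
  have b: "BR E (Comp M t w) = BR E (Comp M t w1)" by (rule BR_sceq[OF sc_wp[OF i h r] i h])
  show ?thesis
  proof (cases M)
    case Pure
    with LR_inv(6) R obtain R0 where "R = posR (Qpure R0) E (Comp Pure t w)" "LU n E t R0" by blast
    then show ?thesis using UC_Pure[OF h[unfolded Pure], of n "KK n" R0] b unfolding Pure posR_def by simp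
  next
    case (Usr F)
    obtain D where F: "eff_of S F = Some D" using hu_inv(3)[OF h[unfolded Usr]] by blast
    from LR_inv(7)[OF R[unfolded Usr] F] F obtain R0 where D: "eff_of S F = Some D" "LU n E (repr D \<cdot> t \<cdot> w) R0"
      "R = effR E (Comp (Usr F) t w) R0" by blast
    from UC_F[OF D(1) h[unfolded Usr] U_reds[OF D(2) reds_AppR[OF r]]] show ?thesis using b unfolding Usr D(3) by simp
  qed
qed

text \<open>\<open>cinf\<close> makes the specification and the representation type semantically
  typed, so subject reduction is available for them before it is known in general.\<close>

lemma hu_wp_reds:
  assumes h: "cinf \<Gamma> (Comp M t wp) 0" and g: "G E \<Gamma> \<sigma> \<tau>" and r: "reds S (sub \<sigma> wp) w"
  shows "hu S E (Comp M (sub \<sigma> t) w) 0"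
proof (cases M)
  case Pure
  note h = h[unfolded Pure]
  have "isty E (sub \<sigma> t) 0" using BB_D(2)[OF sem_BB[OF cinfD(2)[OF h] g]] by simp
  moreover have "tyt E w (arr (arr (sub \<sigma> t) (Ty 0)) (Ty 0))" using BB_D(3)[OF sem_BB[OF cinfD(3)[OF h] g] r] by (simp add: sub_ups_sh)
  ultimately show ?thesis unfolding Pure by (rule H_Pure)
next
  case (Usr F)
  note h = h[unfolded Usr]
  obtain D where D: "eff_of S F = Some D" "sem \<Gamma> wp (Tot (wp_type D \<cdot> t))" "sem \<Gamma> (repr D \<cdot> t \<cdot> wp) (Tot (Ty 0))" using cinfD(4)[OF h] by blast
  note c = csD(1,2)[OF D(1), THEN closed_sub]
  have "isty E (sub \<sigma> t) 0" using BB_D(2)[OF sem_BB[OF cinfD(2)[OF h] g]] by simp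
  moreover have "tyt E w (wp_type D \<cdot> sub \<sigma> t)" using BB_D(3)[OF sem_BB[OF D(2) g] r] by (simp add: c)
  moreover have "isty E (repr D \<cdot> sub \<sigma> t \<cdot> w) 0" using BB_D(3)[OF sem_BB[OF D(3) g]] reds_AppR[OF r] by (simp add: c)
  ultimately show ?thesis unfolding Usr by (rule H_F[OF D(1)])
qed

lemma SN_ctx: assumes "\<And>e x. red S (h e) x \<Longrightarrow> \<exists>e1. red S e e1 \<and> x = h e1" shows "SN e \<Longrightarrow> SN (h e)"
proof (induct e rule: SN.induct)
  case (SN_I e)
  show ?case by (rule SN.SN_I) (use assms SN_I(2) in blast)
qed

lemma reds_ctx: assumes "\<And>e x. red S (h e) x \<Longrightarrow> \<exists>e1. red S e e1 \<and> x = h e1" "reds S (h e) x" shows "\<exists>e1. reds S e e1 \<and> x = h e1"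
  using assms(2)
proof (induct rule: rtranclp_induct)
  case (step y z)
  then show ?case using assms(1) reds_snoc by blast
qed blast

lemma red_Return: "red S (Return M t e) x \<Longrightarrow> \<exists>e1. red S e e1 \<and> x = Return M t e1"
  by (erule red_ReturnE) blast

lemma sem_returnP:
  assumes w: "wfc \<Gamma>" and t: "isty \<Gamma> t 0" and e: "tyt \<Gamma> e t" "sem \<Gamma> e (Tot t)"
    and h: "hu S \<Gamma> (Comp Pure t (pure_ret_star \<cdot> t \<cdot> e)) 0" "cinf \<Gamma> (Comp Pure t (pure_ret_star \<cdot> t \<cdot> e)) 0"
  shows "sem \<Gamma> (Return Pure t e) (Comp Pure t (pure_ret_star \<cdot> t \<cdot> e))"
proof (rule semI[OF cinfD(1)[OF h(2)]])
  let ?c = "Comp Pure t (pure_ret_star \<cdot> t \<cdot> e)"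
  note cl = closed_pure(2)[THEN closed_sub]
  have B: "BB E (subc \<sigma> ?c) (sub \<sigma> (Return Pure t e))" if g: "G E \<Gamma> \<sigma> \<tau>" for E \<sigma> \<tau>
    unfolding BB_def
  proof (intro conjI allI impI)
    note be = sem_BB[OF e(2) g]
    show "SN (sub \<sigma> (Return Pure t e))" using SN_ctx[OF red_Return BB_D(1)[OF be]] by simp
    fix x assume "reds S (sub \<sigma> (Return Pure t e)) x"
    then obtain e1 where e1: "reds S (sub \<sigma> e) e1" "x = Return Pure (sub \<sigma> t) e1" using reds_ctx[OF red_Return] by fastforce
    have r: "reds S (sub \<sigma> (pure_ret_star \<cdot> t \<cdot> e)) (pure_ret_star \<cdot> sub \<sigma> t \<cdot> e1)" using reds_AppR[OF e1(1)] by (simp add: cl)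
    note h1 = hu_wp_reds[OF h(2) g r] and h0 = ty_sub(2)[OF G_tsb[OF g] h(1)]
    \<comment> \<open>A step in the returned term changes the specification that the typing rule
      assigns; \<open>sc_wp\<close> leads back to the original one.\<close>
    have "ty S E x (Comp Pure (sub \<sigma> t) (pure_ret_star \<cdot> sub \<sigma> t \<cdot> e1))"
      unfolding e1(2) by (rule Y_ReturnP[OF _ _ h1]) (use ty_sub(1)[OF G_tsb[OF g] t] BB_D(3)[OF be e1(1)] in simp_all)
    then show "ty S E x (subc \<sigma> ?c)" using Y_Sub[OF _ _ h1 h0] sc_wp(2)[OF h0[unfolded subc.simps] h1 r] by simp
  qed
  fix E \<sigma> \<tau> R assume g: "G E \<Gamma> \<sigma> \<tau>" and R: "LC 0 E (subc \<sigma> ?c) R"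
  from sem_base[OF w Y_ReturnP[OF t e(1) h(1)] h(1) B g] have b: "(sub \<sigma> (Return Pure t e), sub \<tau> (Return Pure t e)) \<in> BR E (subc \<sigma> ?c)" .
  from LR_inv(6)[OF R[unfolded subc.simps]] obtain R0 where R0: "R = posR (Qpure R0) E (subc \<sigma> ?c)" "LU 0 E (sub \<sigma> t) R0" by auto
  have "(sub \<sigma> e, sub \<tau> e) \<in> R0" using sem_use[OF e(2) g, of 0 R0] R0(2) by (simp add: LC_Tot)
  then have "Qpure R0 w w'" if "reds S (sub \<sigma> (Return Pure t e)) w" "reds S (sub \<tau> (Return Pure t e)) w'" for w w'
    using reds_ctx[OF red_Return that(1)[unfolded sub.simps]] reds_ctx[OF red_Return that(2)[unfolded sub.simps]]
      LR_reds2(1)[OF R0(2) LR_reds(1)[OF R0(2)]] unfolding Qpure_def by blast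
  then show "(sub \<sigma> (Return Pure t e), sub \<tau> (Return Pure t e)) \<in> R" using b unfolding R0(1) posR_def by blast
qed

text \<open>The empty step relation, for frames whose side arguments do not reduce.\<close>

definition NR :: "'p \<Rightarrow> 'p \<Rightarrow> bool" where "NR p q \<longleftrightarrow> False"

lemma TR_NR: "TR NR p" by (rule TR_I) (simp add: NR_def)
lemma NR_rtc: "NR\<^sup>*\<^sup>* p q \<Longrightarrow> q = p" by (induct rule: rtranclp_induct) (auto simp: NR_def)

lemma frame_run: "frame (\<lambda>(p::unit) e. Run e) (\<lambda>p w x. \<exists>t. w = Return Pure t x) NR"
  unfolding frame_def by (auto simp: NR_def valform_def intro: stuck.intros E_Run elim!: red_RunE)

lemma frame_bind: "frame (\<lambda>(t1, t2, w1, w2, e2) e. Bind Pure t1 t2 w1 e w2 e2) (\<lambda>(t1, t2, w1, w2, e2) w x. \<exists>t v. w = Return Pure t v \<and> x = inst e2 v) NR"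
  unfolding frame_def by (auto simp: NR_def valform_def intro: stuck.intros E_Bind elim!: red_BindE)

lemma tsb_sbt: "tsb E \<sigma> \<Gamma> \<Longrightarrow> sbt E \<sigma> \<Gamma>"
  unfolding tsb_def sbt_def using ty_orig(1) by blast

lemma Qpure_ex: "Qpure R w w' \<Longrightarrow> \<exists>t v t' v'. w = Return Pure t v \<and> w' = Return Pure t' v' \<and> (v, v') \<in> R"
  unfolding Qpure_def by blast

lemma sem_run:
  assumes w: "wfc \<Gamma>" and t: "isty \<Gamma> t 0" "semc \<Gamma> (Tot t) 0" and e: "sem \<Gamma> e (Comp Pure t wp)" "ty S \<Gamma> e (Comp Pure t wp)"
    and v: "valid S \<Gamma> (FEx (arr t (Ty 0)) (sh wp \<cdot> Var 0))"
  shows "sem \<Gamma> (Run e) (Tot t)"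
proof (rule semI[OF t(2)])
  fix E \<sigma> \<tau> R assume g: "G E \<Gamma> \<sigma> \<tau>" and R: "LC 0 E (subc \<sigma> (Tot t)) R"
  from sem_ex[OF e(1) g] obtain n P where P: "LC n E (Comp Pure (sub \<sigma> t) (sub \<sigma> wp)) P" "(sub \<sigma> e, sub \<tau> e) \<in> P" by auto
  from LR_inv(6)[OF P(1)] obtain R0 where R0: "P = posR (Qpure R0) E (Comp Pure (sub \<sigma> t) (sub \<sigma> wp))" "LU n E (sub \<sigma> t) R0" by blast
  have RR: "R0 = R" using LU_unique[OF R0(2)] R by (simp add: LC_Tot)
  have T: "tyt E (Run e1) (sub \<sigma> t)" if g: "G E \<Gamma> \<sigma> \<tau>" and r: "reds S (sub \<sigma> e) e1" for \<sigma> \<tau> e1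
  proof (rule Y_Run)
    show "ty S E e1 (Comp Pure (sub \<sigma> t) (sub \<sigma> wp))" using BB_D(3)[OF sem_BB[OF e(1) g] r] by simp
    show "valid S E (FEx (arr (sub \<sigma> t) (Ty 0)) (sh (sub \<sigma> wp) \<cdot> Var 0))"
      using valid_sub[OF tsb_sbt[OF G_tsb[OF g]] v] by (simp add: sub_laws)
    show "isty E (sub \<sigma> t) 0" using ty_sub(1)[OF G_tsb[OF g] t(1)] by simp
  qed
  have "((\<lambda>(p::unit) e. Run e) () (sub \<sigma> e), (\<lambda>(p::unit) e. Run e) () (sub \<tau> e)) \<in> R"
  proof (rule frame_elim[OF frame_run R P(2)[unfolded R0(1)] Q_valform(3) TR_NR TR_NR])
    show "(\<exists>x. red S (Run w) x) \<and> (\<exists>x. red S (Run w') x)" if "Qpure R0 w w'" for w w'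
      using Qpure_ex[OF that] R_RunReturn by blast
    show "ty S E (Run e1) (subc \<sigma> (Tot t))" if "reds S (sub \<sigma> e) e1" for e1 using T[OF g that] by simp
    show "ty S E (Run e1) (subc \<sigma> (Tot t))" if "reds S (sub \<tau> e) e1" for e1
      using ty_conv[OF T[OF G_sym[OF g] that] G_cvt[OF w G_sym[OF g] t(1)]] by simp
    show "cv E (subc \<sigma> (Tot t)) (Run (sub \<sigma> e)) (Run (sub \<tau> e))"
      using G_cv[OF w g Y_Run[OF e(2) v t(1)] H_Tot[OF t(1)]] by simp
    show "(x, x') \<in> R" if "Qpure R0 w w'" "\<exists>t. w = Return Pure t x" "\<exists>t. w' = Return Pure t x'" for w w' x x'
      using that unfolding Qpure_def RR by auto
  qed
  then show "(sub \<sigma> (Run e), sub \<tau> (Run e)) \<in> R" by simp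
qed

text \<open>The returned values are handled by the frame. What remains is the typing of the
  contractum, which carries \<open>wp2\<close> at the value in place of the specification of the
  bind; this passage is justified logically, by \<open>bind_valid\<close> in every extension of the
  world.\<close>

lemma sem_bindP:
  assumes w: "wfc \<Gamma>" and t1: "isty \<Gamma> t1 0" "semc \<Gamma> (Tot t1) 0" and t2: "isty \<Gamma> t2 0"
    and wp2: "tyt \<Gamma> wp2 (arr t1 (pure_wp_type \<cdot> t2))"
    and e1: "ty S \<Gamma> e1 (Comp Pure t1 wp1)" "sem \<Gamma> e1 (Comp Pure t1 wp1)"
    and e2: "ty S (t1 # \<Gamma>) e2 (Comp Pure (sh t2) (sh wp2 \<cdot> Var 0))" "sem (t1 # \<Gamma>) e2 (Comp Pure (sh t2) (sh wp2 \<cdot> Var 0))"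
    and h1: "hu S \<Gamma> (Comp Pure t1 wp1) 0" and h2: "hu S (t1 # \<Gamma>) (Comp Pure (sh t2) (sh wp2 \<cdot> Var 0)) 0"
    and h: "hu S \<Gamma> (Comp Pure t2 (apps pure_bnd_star [t1, t2, wp1, wp2])) 0" "semc \<Gamma> (Comp Pure t2 (apps pure_bnd_star [t1, t2, wp1, wp2])) 0"
  shows "sem \<Gamma> (Bind Pure t1 t2 wp1 e1 wp2 e2) (Comp Pure t2 (apps pure_bnd_star [t1, t2, wp1, wp2]))"
proof (rule semI[OF h(2)])
  let ?c = "Comp Pure t2 (apps pure_bnd_star [t1, t2, wp1, wp2])"
  note cl = closed_pure(3)[THEN closed_sub] closed_pure(1)[THEN closed_sub]
  fix E \<sigma> \<tau> R assume g: "G E \<Gamma> \<sigma> \<tau>" and R: "LC 0 E (subc \<sigma> ?c) R"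
  let ?p = "\<lambda>\<sigma>. (sub \<sigma> t1, sub \<sigma> t2, sub \<sigma> wp1, sub \<sigma> wp2, sub (ups \<sigma>) e2)"
  let ?fr = "\<lambda>(t1, t2, w1, w2, e2) e. Bind Pure t1 t2 w1 e w2 e2"
  from sem_ex[OF e1(2) g] obtain n P where P: "LC n E (Comp Pure (sub \<sigma> t1) (sub \<sigma> wp1)) P" "(sub \<sigma> e1, sub \<tau> e1) \<in> P" by auto
  from LR_inv(6)[OF P(1)] obtain R0 where R0: "P = posR (Qpure R0) E (Comp Pure (sub \<sigma> t1) (sub \<sigma> wp1))" "LU n E (sub \<sigma> t1) R0" by blast
  from LR_inv(6)[OF R[unfolded subc.simps]] obtain Rt where Rt: "R = posR (Qpure Rt) E (subc \<sigma> ?c)" "LU 0 E (sub \<sigma> t2) Rt" by auto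
  have T: "ty S E (?fr (?p \<sigma>) x) (subc \<sigma> ?c)" if g: "G E \<Gamma> \<sigma> \<tau>" and r: "reds S (sub \<sigma> e1) x" for \<sigma> \<tau> x
  proof -
    note tb = G_tsb[OF g] and tu = tsb_up[OF G_tsb[OF g]]
    show ?thesis
      using Y_BindP[of S E "sub \<sigma> t1" "sub \<sigma> t2" "sub \<sigma> wp2" x "sub \<sigma> wp1" "sub (ups \<sigma>) e2"]
        ty_sub(1)[OF tb t1(1)] ty_sub(1)[OF tb t2] ty_sub(1)[OF tb wp2] BB_D(3)[OF sem_BB[OF e1(2) g] r] ty_sub(1)[OF tu e2(1)]
        ty_sub(2)[OF tb h1] ty_sub(2)[OF tu h2] ty_sub(2)[OF tb h(1)]
      by (simp add: cl sub_laws)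
  qed
  note e = BR_D(1,2)[OF LC_D[OF P]]
  have "(?fr (?p \<sigma>) (sub \<sigma> e1), ?fr (?p \<tau>) (sub \<tau> e1)) \<in> R"
  proof (rule frame_elim[OF frame_bind R P(2)[unfolded R0(1)] Q_valform(3) TR_NR TR_NR])
    show "(\<exists>x. red S (?fr p w) x) \<and> (\<exists>x. red S (?fr p w') x)" if "Qpure R0 w w'" for p w w'
      using Qpure_ex[OF that] R_BindReturn by (cases p) fastforce
    show "ty S E (?fr p x) (subc \<sigma> ?c)" if "NR\<^sup>*\<^sup>* (?p \<sigma>) p" "reds S (sub \<sigma> e1) x" for p x
      using T[OF g that(2)] NR_rtc[OF that(1)] by simp
    show "ty S E (?fr p x) (subc \<sigma> ?c)" if "NR\<^sup>*\<^sup>* (?p \<tau>) p" "reds S (sub \<tau> e1) x" for p x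
      using Y_Sub[OF T[OF G_sym[OF g] that(2)] G_sc[OF w G_sym[OF g] h(1)] ty_sub(2)[OF G_tsb[OF G_sym[OF g]] h(1)] ty_sub(2)[OF G_tsb[OF g] h(1)]] NR_rtc[OF that(1)] by simp
    show "cv E (subc \<sigma> ?c) (?fr (?p \<sigma>) (sub \<sigma> e1)) (?fr (?p \<tau>) (sub \<tau> e1))"
      using G_cv[OF w g Y_BindP[OF t1(1) t2 wp2 e1(1) e2(1) h1 h2 h(1)] h(1)] by simp
    show "(x, x') \<in> R" if p: "NR\<^sup>*\<^sup>* (?p \<sigma>) p" "NR\<^sup>*\<^sup>* (?p \<tau>) p'" and r: "reds S (sub \<sigma> e1) w" and q: "Qpure R0 w w'"
      and x: "(\<lambda>(t1, t2, w1, w2, e2) w x. \<exists>t v. w = Return Pure t v \<and> x = inst e2 v) p w x"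
      and x': "(\<lambda>(t1, t2, w1, w2, e2) w x. \<exists>t v. w = Return Pure t v \<and> x = inst e2 v) p' w' x'" for p p' w w' x x'
    proof -
      from Qpure_ex[OF q] obtain t v t' v' where v: "w = Return Pure t v" "w' = Return Pure t' v'" "(v, v') \<in> R0" by blast
      have xx: "x = sub (scons v \<sigma>) e2" "x' = sub (scons v' \<tau>) e2" using x x' v NR_rtc[OF p(1)] NR_rtc[OF p(2)] by (auto simp: inst_ups)
      note gv = G_cons[OF g t1(2) R0(2) v(3)]
      from sem_ex[OF e2(2) gv] obtain m R2 where R2: "LC m E (Comp Pure (sub \<sigma> t2) (sub \<sigma> wp2 \<cdot> v)) R2" "(x, x') \<in> R2"
        unfolding xx by (auto simp: sub_ren)
      from LR_inv(6)[OF R2(1)] obtain Rt' where Rt': "R2 = posR (Qpure Rt') E (Comp Pure (sub \<sigma> t2) (sub \<sigma> wp2 \<cdot> v))" "LU m E (sub \<sigma> t2) Rt'" by blast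
      \<comment> \<open>The two specifications share the result type, so the value parts of their
        relations coincide and only the base relation has to be transferred.\<close>
      have Rt_eq: "Rt' = Rt" by (rule LU_unique[OF Rt'(2) Rt(2)])
      let ?b = "apps pure_bnd_star [sub \<sigma> t1, sub \<sigma> t2, sub \<sigma> wp1, sub \<sigma> wp2]"
      have cs: "subc \<sigma> ?c = Comp Pure (sub \<sigma> t2) ?b" by (simp add: cl)
      note tb = G_tsb[OF g] and tu = tsb_up[OF G_tsb[OF g]]
      have H1: "hu S E (Comp Pure (sub \<sigma> t1) (sub \<sigma> wp1)) 0" using ty_sub(2)[OF tb h1] by simp
      have H2: "hu S (sub \<sigma> t1 # E) (Comp Pure (sh (sub \<sigma> t2)) (sh (sub \<sigma> wp2) \<cdot> Var 0)) 0" using ty_sub(2)[OF tu h2] by (simp add: sub_ups_sh)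
      have H: "hu S E (Comp Pure (sub \<sigma> t2) ?b) 0" using ty_sub(2)[OF tb h(1)] unfolding cs .
      have tv: "tyt E v (sub \<sigma> t1)" using BB_D(2)[OF BR_D(1)[OF LU_D[OF R0(2) v(3)]]] .
      have ret: "ty S E (Return Pure t v) (Comp Pure (sub \<sigma> t1) (sub \<sigma> wp1))" using BB_D(3)[OF e(1) r] unfolding v(1) .
      have H3: "hu S E (Comp Pure (sub \<sigma> t2) (sub \<sigma> wp2 \<cdot> v)) 0" using hu_inst[OF H2 tv] by simp
      have "sc S E (Comp Pure (sub \<sigma> t2) (sub \<sigma> wp2 \<cdot> v)) (Comp Pure (sub \<sigma> t2) ?b)"
      proof (rule SB_Pure[OF ST_Refl valid_AllImpI])
        show "isty E (sub \<sigma> t2) 0" "tyt E ?b (arr (arr (sub \<sigma> t2) (Ty 0)) (Ty 0))" using hu_inv(2)[OF H] by blast+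
        show "tyt E (sub \<sigma> wp2 \<cdot> v) (arr (arr (sub \<sigma> t2) (Ty 0)) (Ty 0))" using hu_inv(2)[OF H3] by blast
        fix \<Theta> r p assume wk: "wk E r \<Theta>" and p: "tyt \<Theta> p (arr (ren r (sub \<sigma> t2)) (Ty 0))" and V: "valid S \<Theta> (ren r ?b \<cdot> p)"
        note cr = closed_pure(3)[THEN closed_ren]
        have "valid S \<Theta> (ren r (sub \<sigma> wp2) \<cdot> ren r v \<cdot> p)"
        proof (rule bind_valid[of \<Theta> "ren r (sub \<sigma> t1)" "ren r (sub \<sigma> wp1)" "ren r (sub \<sigma> t2)" "ren r (sub \<sigma> wp2)" "ren r t" "ren r v" p])
          show "hu S \<Theta> (Comp Pure (ren r (sub \<sigma> t1)) (ren r (sub \<sigma> wp1))) 0" using ty_ren(2)[OF wk H1] by simp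
          show "hu S (ren r (sub \<sigma> t1) # \<Theta>) (Comp Pure (sh (ren r (sub \<sigma> t2))) (sh (ren r (sub \<sigma> wp2)) \<cdot> Var 0)) 0"
            using ty_ren(2)[OF wk_up[OF wk] H2] by (simp add: ren_upr_Suc)
          show "hu S \<Theta> (Comp Pure (ren r (sub \<sigma> t2)) (apps pure_bnd_star [ren r (sub \<sigma> t1), ren r (sub \<sigma> t2), ren r (sub \<sigma> wp1), ren r (sub \<sigma> wp2)])) 0"
            using ty_ren(2)[OF wk H] by (simp add: cr)
          show "ty S \<Theta> (Return Pure (ren r t) (ren r v)) (Comp Pure (ren r (sub \<sigma> t1)) (ren r (sub \<sigma> wp1)))" using ty_ren(1)[OF wk ret] by simp
          show "tyt \<Theta> (ren r v) (ren r (sub \<sigma> t1))" using ty_ren(1)[OF wk tv] by simp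
        qed (use p V in \<open>simp_all add: cr\<close>)
        then show "valid S \<Theta> (ren r (sub \<sigma> wp2 \<cdot> v) \<cdot> p)" by simp
      qed
      from BR_sc[OF LC_D[OF R2] this H3 H] have "(x, x') \<in> BR E (subc \<sigma> ?c)" unfolding cs .
      then show ?thesis using R2(2) unfolding Rt(1) Rt'(1) Rt_eq posR_def by blast
    qed
  qed
  then show "(sub \<sigma> (Bind Pure t1 t2 wp1 e1 wp2 e2), sub \<tau> (Bind Pure t1 t2 wp1 e1 wp2 e2)) \<in> R" by simp
qed

end

section \<open>Case analysis\<close>

context sigc begin

lemma frame_case: "frame (\<lambda>(t, p) e. Case t e (fst p) (snd p))
   (\<lambda>(t, p) w x. (\<exists>a b v. w = tinl a b v \<and> x = inst (fst p) v) \<or> (\<exists>a b v. w = tinr a b v \<and> x = inst (snd p) v))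
   (\<lambda>(t, p) (t', p'). t = t' \<and> rp2 p p')"
  unfolding frame_def by (auto simp: valform_def intro: stuck.intros E_Case E_CaseL E_CaseR elim!: red_CaseE)

lemma TR_case: assumes "TR rp2 p" shows "TR (\<lambda>(t, p) (t', p'). t = t' \<and> rp2 p p') (t, p)"
  using assms by (induct p rule: TR.induct) (rule TR_I, auto)

lemma case_rtc: assumes "(\<lambda>(t, p) (t', p'). t = t' \<and> rp2 p p')\<^sup>*\<^sup>* (t, p) q"
  shows "fst q = t \<and> reds S (fst p) (fst (snd q)) \<and> reds S (snd p) (snd (snd q))"
  using assms
proof (induct rule: rtranclp_induct)
  case (step y z)
  obtain a b c a' b' c' where "y = (a, b, c)" "z = (a', b', c')" by (cases y, cases z) auto
  then show ?case using step(2,3) by (auto intro: reds_snoc)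
qed simp

lemma Qsum_ex: "Qsum E A B Ra Rb w w' \<Longrightarrow>
   (\<exists>a b v a' b' v'. w = tinl a b v \<and> w' = tinl a' b' v' \<and> (v, v') \<in> Ra \<and> cv E (Tot (tsum A B)) w (tinl A B v) \<and> cv E (Tot (tsum A B)) w' (tinl A B v')) \<or>
   (\<exists>a b v a' b' v'. w = tinr a b v \<and> w' = tinr a' b' v' \<and> (v, v') \<in> Rb \<and> cv E (Tot (tsum A B)) w (tinr A B v) \<and> cv E (Tot (tsum A B)) w' (tinr A B v'))"
  unfolding Qsum_def by blast

text \<open>The part common to dependent case analysis and case analysis between computations. The
  branches reduce independently of the scrutinee, but contracta of reduced branches are reducts of
  contracta of the original ones, so only the latter occur in the premises.\<close>

lemma case_core:
  assumes R: "LC n E c R" and e: "(e, e') \<in> posR (Qsum E A B Ra Rb) E c0"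
    and SN: "SN b1" "SN b2" "SN b1'" "SN b2'"
    and T: "\<And>x x1 x2. reds S e x \<Longrightarrow> reds S b1 x1 \<Longrightarrow> reds S b2 x2 \<Longrightarrow> ty S E (Case t x x1 x2) c"
    and T': "\<And>x x1 x2. reds S e' x \<Longrightarrow> reds S b1' x1 \<Longrightarrow> reds S b2' x2 \<Longrightarrow> ty S E (Case t' x x1 x2) c"
    and cv: "cv E c (Case t e b1 b2) (Case t' e' b1' b2')"
    and L: "\<And>a b v a' b' v'. reds S e (tinl a b v) \<Longrightarrow> reds S e' (tinl a' b' v') \<Longrightarrow> (v, v') \<in> Ra \<Longrightarrow>
      cv E (Tot (tsum A B)) (tinl a b v) (tinl A B v) \<Longrightarrow> (inst b1 v, inst b1' v') \<in> R"
    and L': "\<And>a b v a' b' v'. reds S e (tinr a b v) \<Longrightarrow> reds S e' (tinr a' b' v') \<Longrightarrow> (v, v') \<in> Rb \<Longrightarrow>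
      cv E (Tot (tsum A B)) (tinr a b v) (tinr A B v) \<Longrightarrow> (inst b2 v, inst b2' v') \<in> R"
  shows "(Case t e b1 b2, Case t' e' b1' b2') \<in> R"
proof -
  let ?fr = "\<lambda>(t, p) e. Case t e (fst p) (snd p)"
  let ?con = "\<lambda>(t, p) w x. (\<exists>a b v. w = tinl a b v \<and> x = inst (fst p) v) \<or> (\<exists>a b v. w = tinr a b v \<and> x = inst (snd p) v)"
  let ?rp = "\<lambda>(t, p) (t', p'). t = t' \<and> rp2 p p'"
  have ri: "reds S (inst b v) (inst b' v)" if "reds S b b'" for b b' v unfolding inst_def by (rule reds_sub[OF that])
  note rr = LR_reds2(2)[OF R LR_reds(3)[OF R]]
  have "(?fr (t, (b1, b2)) e, ?fr (t', (b1', b2')) e') \<in> R"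
  proof (rule frame_elim[OF frame_case R e Q_valform(2) TR_case[OF TR_rp2[OF SN(1,2)]] TR_case[OF TR_rp2[OF SN(3,4)]]])
    show "(\<exists>x. red S (?fr p w) x) \<and> (\<exists>x. red S (?fr p w') x)" if "Qsum E A B Ra Rb w w'" for p w w'
      using Qsum_ex[OF that] by (cases p) (auto intro: R_CaseInl R_CaseInr)
    show "ty S E (?fr p x) c" if "?rp\<^sup>*\<^sup>* (t, (b1, b2)) p" "reds S e x" for p x
      using T[OF that(2)] case_rtc[OF that(1)] by (cases p) auto
    show "ty S E (?fr p x) c" if "?rp\<^sup>*\<^sup>* (t', (b1', b2')) p" "reds S e' x" for p x
      using T'[OF that(2)] case_rtc[OF that(1)] by (cases p) auto
    show "cv E c (?fr (t, (b1, b2)) e) (?fr (t', (b1', b2')) e')" using cv by simp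
    show "(x, x') \<in> R" if p: "?rp\<^sup>*\<^sup>* (t, (b1, b2)) p" "?rp\<^sup>*\<^sup>* (t', (b1', b2')) p'" and r: "reds S e w" "reds S e' w'"
      and q: "Qsum E A B Ra Rb w w'" and x: "?con p w x" "?con p' w' x'" for p p' w w' x x'
    proof -
      obtain q1 q2 q1' q2' where pq: "p = (t, (q1, q2))" "p' = (t', (q1', q2'))" "reds S b1 q1" "reds S b2 q2" "reds S b1' q1'" "reds S b2' q2'"
        using case_rtc[OF p(1)] case_rtc[OF p(2)] by (cases p, cases p') auto
      from Qsum_ex[OF q] show ?thesis
      proof (elim disjE exE conjE)
        fix a b v a' b' v' assume w: "w = tinl a b v" "w' = tinl a' b' v'" "(v, v') \<in> Ra" "cv E (Tot (tsum A B)) w (tinl A B v)"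
        have "(inst b1 v, inst b1' v') \<in> R" by (rule L[OF _ _ w(3)]) (use r w in auto)
        from rr[OF this ri[OF pq(3)] ri[OF pq(5)]] show ?thesis using x w(1,2) pq(1,2) by auto
      next
        fix a b v a' b' v' assume w: "w = tinr a b v" "w' = tinr a' b' v'" "(v, v') \<in> Rb" "cv E (Tot (tsum A B)) w (tinr A B v)"
        have "(inst b2 v, inst b2' v') \<in> R" by (rule L'[OF _ _ w(3)]) (use r w in auto)
        from rr[OF this ri[OF pq(4)] ri[OF pq(6)]] show ?thesis using x w(1,2) pq(1,2) by auto
      qed
    qed
  qed
  then show ?thesis by simp
qed

text \<open>Replacing the type arguments of an injection by those of the type does not leave the interpretation of the sum.\<close>

lemma sum_anchor:
  assumes A: "LU n E A Ra" and B: "LU m E B Rb" and SR: "LU l E (tsum A B) SR" "SR = posR (Qsum E A B Ra Rb) E (Tot (tsum A B))"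
    and e: "(e, e') \<in> SR" and k: "k = InlC \<and> X = Ra \<or> k = InrC \<and> X = Rb"
    and w: "reds S e (Con k \<cdot> a \<cdot> b \<cdot> v)" and v: "(v, v') \<in> X" and cv: "cv E (Tot (tsum A B)) (Con k \<cdot> a \<cdot> b \<cdot> v) (Con k \<cdot> A \<cdot> B \<cdot> v)"
  shows "(e, Con k \<cdot> A \<cdot> B \<cdot> v) \<in> SR"
proof -
  let ?w = "Con k \<cdot> A \<cdot> B \<cdot> v" and ?C = "if k = InlC then A else B"
  obtain i j where AB: "BB E (Tot (Ty i)) A" "BB E (Tot (Ty j)) B" using U_BB[OF A] U_BB[OF B] by blast
  have kk: "k \<noteq> FstC" "k \<noteq> SndC" using k by auto
  have X: "\<exists>n. LU n E ?C X" using k A B by auto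
  then obtain nx where X: "LU nx E ?C X" by blast
  have bv: "BB E (Tot ?C) v" by (rule BR_D(1)[OF LU_D[OF X v]])
  have b: "(e, e') \<in> BR E (Tot (tsum A B))" by (rule LU_D[OF SR(1) e])
  have P: "\<And>w w'. reds S e w \<Longrightarrow> reds S e' w' \<Longrightarrow> fin w \<Longrightarrow> fin w' \<Longrightarrow> stuck w \<and> stuck w' \<or> Qsum E A B Ra Rb w w'"
    using e unfolding SR(2) posR_def by blast
  have u: "cv E (Tot (tsum A B)) ?w u" if r: "reds S A a1" "reds S B b1" "reds S v v1" "u = Con k \<cdot> a1 \<cdot> b1 \<cdot> v1" for u a1 b1 v1
    unfolding r(4) by (rule cv_tinj[of k ?C _ "if k = InlC then a1 else b1", OF _ BB_cv[OF AB(1) r(1)] BB_cv[OF AB(2) r(2)] BB_cv[OF bv r(3)]]) (use k in auto)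
  have SN: "SN ?w" by (rule SN_app_nr[OF SN_app_nr[OF SN_app_nr[OF _ BB_D(1)[OF AB(1)] nr_Con] BB_D(1)[OF AB(2)] nr_Con1] BB_D(1)[OF bv] nr_Con2[OF kk]], rule SN_I) (auto elim: red_ConE)
  have bw: "BB E (Tot (tsum A B)) ?w" unfolding BB_def using SN reds_Con3[OF kk] u cv_ty2 by blast
  have c: "cv E (Tot (tsum A B)) ?w e'"
    by (rule cv_trans[OF cv_sym[OF cv_trans[OF BB_cv[OF BR_D(1)[OF b] w] cv]] BR_D(3)[OF b]])
  \<comment> \<open>Shown for the partner \<open>e'\<close> rather than for \<open>e\<close>: its
    inspected reducts are injections because \<open>e\<close> has one as a reduct. Transitivity then
    returns to \<open>e\<close>.\<close>
  have "(?w, e') \<in> SR" unfolding SR(2) posR_def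
  proof (clarify, intro conjI allI impI)
    show "(?w, e') \<in> BR E (Tot (tsum A B))" by (rule BR_I[OF bw BR_D(2)[OF b] c])
    fix x y assume x: "reds S ?w x" and y: "reds S e' y" "fin y"
    from reds_Con3[OF kk x] obtain a1 b1 v1 where r: "reds S A a1" "reds S B b1" "reds S v v1" "x = Con k \<cdot> a1 \<cdot> b1 \<cdot> v1" by blast
    have vf: "valform (Con k \<cdot> a \<cdot> b \<cdot> v)" using k by (auto simp: valform_def)
    then have "Qsum E A B Ra Rb (Con k \<cdot> a \<cdot> b \<cdot> v) y" using P[OF w y(1) _ y(2)] stuck_nt nt_not(1) unfolding fin_def by blast
    with k obtain a2 b2 v2 where y2: "y = Con k \<cdot> a2 \<cdot> b2 \<cdot> v2" "(v, v2) \<in> X" "cv E (Tot (tsum A B)) y (Con k \<cdot> A \<cdot> B \<cdot> v2)"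
      unfolding Qsum_def by auto
    have v12: "(v1, v2) \<in> X" by (rule LR_reds(1)[OF X y2(2) r(3)])
    have b1: "BB E (Tot ?C) v1" by (rule BR_D(1)[OF LU_D[OF X v12]])
    have "cv E (Tot (tsum A B)) (Con k \<cdot> A \<cdot> B \<cdot> v1) x"
      unfolding r(4) by (rule cv_tinj[of k ?C _ "if k = InlC then a1 else b1", OF _ BB_cv[OF AB(1) r(1)] BB_cv[OF AB(2) r(2)] cv_refl[OF BB_D(2)[OF b1]]]) (use k in auto)
    then have "Qsum E A B Ra Rb x y" using k y2 v12 cv_sym unfolding Qsum_def r(4) by auto
    then show "stuck x \<and> stuck y \<or> Qsum E A B Ra Rb x y" ..
  qed
  then show ?thesis using e LR_trans(1)[OF SR(1)] LR_sym(1)[OF SR(1)] by (meson symD transD)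
qed

lemma LU_sum_inv: assumes "LU n E (tsum A B) R" shows "\<exists>Ra Rb. R = posR (Qsum E A B Ra Rb) E (Tot (tsum A B)) \<and> LU n E A Ra \<and> LU n E B Rb"
proof -
  have "LV n E (tsum A B) R" using U_inv[OF assms] by (auto simp: tfin_def)
  from LR_inv(4)[OF this] show ?thesis .
qed

lemma sub_inj_branch: "sub (scons v \<sigma>) (sub (scons (Con k \<cdot> sh a \<cdot> sh b \<cdot> Var 0) (\<lambda>n. Var (Suc n))) t) = sub (scons (Con k \<cdot> sub \<sigma> a \<cdot> sub \<sigma> b \<cdot> v) \<sigma>) t"
  by (simp add: sub_sub comp_scons sub_ren)

lemma sem_caseTot:
  assumes w: "wfc \<Gamma>" and e: "tyt \<Gamma> e (tsum t1 t2)" "sem \<Gamma> e (Tot (tsum t1 t2))"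
    and t1: "isty \<Gamma> t1 i" "semc \<Gamma> (Tot t1) i" and t2: "isty \<Gamma> t2 j" "semc \<Gamma> (Tot t2) j"
    and s: "isty \<Gamma> (tsum t1 t2) l" "semc \<Gamma> (Tot (tsum t1 t2)) l"
    and t: "isty (tsum t1 t2 # \<Gamma>) t k" "semc (tsum t1 t2 # \<Gamma>) (Tot t) k"
    and e1: "tyt (t1 # \<Gamma>) e1 (sub (scons (tinl (sh t1) (sh t2) (Var 0)) (\<lambda>n. Var (Suc n))) t)"
      "sem (t1 # \<Gamma>) e1 (Tot (sub (scons (tinl (sh t1) (sh t2) (Var 0)) (\<lambda>n. Var (Suc n))) t))"
    and e2: "tyt (t2 # \<Gamma>) e2 (sub (scons (tinr (sh t1) (sh t2) (Var 0)) (\<lambda>n. Var (Suc n))) t)"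
      "sem (t2 # \<Gamma>) e2 (Tot (sub (scons (tinr (sh t1) (sh t2) (Var 0)) (\<lambda>n. Var (Suc n))) t))"
  shows "sem \<Gamma> (Case t e e1 e2) (Tot (inst t e))"
proof (rule semI)
  let ?c = "Tot (inst t e)" let ?T = "\<lambda>\<sigma>. sub (ups \<sigma>) t"
  have Y: "ty S \<Gamma> (Case t e e1 e2) ?c" by (rule Y_CaseTot[OF e(1) t1(1) t2(1) s(1) t(1) e1(1) e2(1)])
  have h: "hu S \<Gamma> ?c k" using hu_inst[OF H_Tot[OF t(1)] e(1)] by simp
  have st: "sub \<sigma> (inst t e) = sub (scons (sub \<sigma> e) \<sigma>) t" for \<sigma> by (simp add: sub_inst inst_ups)
  have SR: "\<exists>SR. LU l E (tsum (sub \<sigma> t1) (sub \<sigma> t2)) SR \<and> (sub \<sigma> e, sub \<tau> e) \<in> SR" if g: "G E \<Gamma> \<sigma> \<tau>" for E \<sigma> \<tau>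
    using semcD[OF s(2) g] sem_use[OF e(2) g] by (fastforce simp: LC_Tot)
  show "semc \<Gamma> ?c k" unfolding semc_def
  proof (intro allI impI)
    fix E \<sigma> \<tau> assume g: "G E \<Gamma> \<sigma> \<tau>"
    from SR[OF g] obtain SR where "LU l E (sub \<sigma> (tsum t1 t2)) SR" "(sub \<sigma> e, sub \<tau> e) \<in> SR" by auto
    from semcD[OF t(2) G_cons[OF g s(2) this]] show "\<exists>R. LC k E (subc \<sigma> ?c) R \<and> LC k E (subc \<tau> ?c) R" by (simp add: st)
  qed
  fix E \<sigma> \<tau> R assume g: "G E \<Gamma> \<sigma> \<tau>" and R: "LC k E (subc \<sigma> ?c) R"
  from SR[OF g] obtain SR where SR': "LU l E (tsum (sub \<sigma> t1) (sub \<sigma> t2)) SR" "(sub \<sigma> e, sub \<tau> e) \<in> SR" by blast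
  from LU_sum_inv[OF SR'(1)] obtain Ra Rb where RR: "SR = posR (Qsum E (sub \<sigma> t1) (sub \<sigma> t2) Ra Rb) E (Tot (tsum (sub \<sigma> t1) (sub \<sigma> t2)))"
    "LU l E (sub \<sigma> t1) Ra" "LU l E (sub \<sigma> t2) Rb" by blast
  have T: "ty S E (Case (?T \<sigma>) x x1 x2) (subc \<sigma> ?c)"
    if g: "G E \<Gamma> \<sigma> \<tau>" and r: "reds S (sub \<sigma> e) x" "reds S (sub (ups \<sigma>) e1) x1" "reds S (sub (ups \<sigma>) e2) x2" for \<sigma> \<tau> x x1 x2
  proof -
    note tb = G_tsb[OF g] and tu = tsb_up[OF G_tsb[OF g]]
    have x: "tyt E x (tsum (sub \<sigma> t1) (sub \<sigma> t2))" and cx: "cv E (Tot (tsum (sub \<sigma> t1) (sub \<sigma> t2))) x (sub \<sigma> e)"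
      using BB_D(3)[OF sem_BB[OF e(2) g] r(1)] cv_sym[OF BB_cv[OF sem_BB[OF e(2) g] r(1)]] by simp_all
    have S': "isty E (tsum (sub \<sigma> t1) (sub \<sigma> t2)) l" and tt: "isty (tsum (sub \<sigma> t1) (sub \<sigma> t2) # E) (?T \<sigma>) k"
      using ty_sub(1)[OF tb s(1)] ty_sub(1)[OF tu t(1)] by simp_all
    have "tyt E (Case (?T \<sigma>) x x1 x2) (inst (?T \<sigma>) x)"
      using Y_CaseTot[OF x _ _ S' tt] ty_sub(1)[OF tb t1(1)] ty_sub(1)[OF tb t2(1)]
        BB_D(3)[OF sem_BB[OF e1(2) G_up[OF g t1(2)]] r(2)] BB_D(3)[OF sem_BB[OF e2(2) G_up[OF g t2(2)]] r(3)]
      by (simp add: sub_laws)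
    from ty_conv[OF this cv_inst_type[OF S' tt cx]] show ?thesis by (simp add: sub_inst)
  qed
  \<comment> \<open>The branch is typed at the motive for an injection with the types of the
    scrutinee, while the scrutinee reduces to an injection with other type arguments. By
    \<open>sum_anchor\<close> the former is related to the scrutinee, so the motive has the same
    denotation at both.\<close>
  have br: "LC k E (Tot (sub (scons (Con q \<cdot> sub \<sigma> t1 \<cdot> sub \<sigma> t2 \<cdot> v) \<sigma>) t)) R"
    if q: "q = InlC \<and> X = Ra \<or> q = InrC \<and> X = Rb" and r: "reds S (sub \<sigma> e) (Con q \<cdot> a \<cdot> b \<cdot> v)" and v: "(v, v') \<in> X"
      and c: "cv E (Tot (tsum (sub \<sigma> t1) (sub \<sigma> t2))) (Con q \<cdot> a \<cdot> b \<cdot> v) (Con q \<cdot> sub \<sigma> t1 \<cdot> sub \<sigma> t2 \<cdot> v)" for q X a b v v'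
  proof -
    have "(sub \<sigma> e, Con q \<cdot> sub \<sigma> t1 \<cdot> sub \<sigma> t2 \<cdot> v) \<in> SR"
      by (rule sum_anchor[OF RR(2,3) SR'(1) RR(1) SR'(2) q r v c])
    from semcD[OF t(2) G_cons[OF G_refl[OF g] s(2) _ this]] SR'(1) obtain R' where
      "LC k E (Tot (sub (scons (sub \<sigma> e) \<sigma>) t)) R'" "LC k E (Tot (sub (scons (Con q \<cdot> sub \<sigma> t1 \<cdot> sub \<sigma> t2 \<cdot> v) \<sigma>) t)) R'" by auto
    then show ?thesis using LC_unique R unfolding subc.simps st by blast
  qed
  have SNb: "SN (sub (ups \<sigma>) e1) \<and> SN (sub (ups \<sigma>) e2)" if "G E \<Gamma> \<sigma> \<tau>" for \<sigma> \<tau>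
    using BB_D(1)[OF sem_BB[OF e1(2) G_up[OF that t1(2)]]] BB_D(1)[OF sem_BB[OF e2(2) G_up[OF that t2(2)]]] by blast
  have "(Case (?T \<sigma>) (sub \<sigma> e) (sub (ups \<sigma>) e1) (sub (ups \<sigma>) e2), Case (?T \<tau>) (sub \<tau> e) (sub (ups \<tau>) e1) (sub (ups \<tau>) e2)) \<in> R"
  proof (rule case_core[OF R SR'(2)[unfolded RR(1)]])
    show "SN (sub (ups \<sigma>) e1)" "SN (sub (ups \<sigma>) e2)" "SN (sub (ups \<tau>) e1)" "SN (sub (ups \<tau>) e2)" using SNb[OF g] SNb[OF G_sym[OF g]] by blast+
    show "ty S E (Case (?T \<sigma>) x x1 x2) (subc \<sigma> ?c)" if "reds S (sub \<sigma> e) x" "reds S (sub (ups \<sigma>) e1) x1" "reds S (sub (ups \<sigma>) e2) x2" for x x1 x2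
      by (rule T[OF g that])
    show "ty S E (Case (?T \<tau>) x x1 x2) (subc \<sigma> ?c)" if "reds S (sub \<tau> e) x" "reds S (sub (ups \<tau>) e1) x1" "reds S (sub (ups \<tau>) e2) x2" for x x1 x2
      by (rule Y_Sub[OF T[OF G_sym[OF g] that] G_sc[OF w G_sym[OF g] h] ty_sub(2)[OF G_tsb[OF G_sym[OF g]] h] ty_sub(2)[OF G_tsb[OF g] h]])
    show "cv E (subc \<sigma> ?c) (Case (?T \<sigma>) (sub \<sigma> e) (sub (ups \<sigma>) e1) (sub (ups \<sigma>) e2)) (Case (?T \<tau>) (sub \<tau> e) (sub (ups \<tau>) e1) (sub (ups \<tau>) e2))"
      using G_cv[OF w g Y h] by simp
    show "(inst (sub (ups \<sigma>) e1) v, inst (sub (ups \<tau>) e1) v') \<in> R"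
      if "reds S (sub \<sigma> e) (tinl a b v)" "(v, v') \<in> Ra" "cv E (Tot (tsum (sub \<sigma> t1) (sub \<sigma> t2))) (tinl a b v) (tinl (sub \<sigma> t1) (sub \<sigma> t2) v)" for a b v v'
      unfolding inst_ups by (rule sem_use[OF e1(2) G_cons[OF g t1(2) RR(2) that(2)]])
        (use br[of InlC Ra, OF _ that] in \<open>simp add: sub_inj_branch\<close>)
    show "(inst (sub (ups \<sigma>) e2) v, inst (sub (ups \<tau>) e2) v') \<in> R"
      if "reds S (sub \<sigma> e) (tinr a b v)" "(v, v') \<in> Rb" "cv E (Tot (tsum (sub \<sigma> t1) (sub \<sigma> t2))) (tinr a b v) (tinr (sub \<sigma> t1) (sub \<sigma> t2) v)" for a b v v'
      unfolding inst_ups by (rule sem_use[OF e2(2) G_cons[OF g t2(2) RR(3) that(2)]])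
        (use br[of InrC Rb, OF _ that] in \<open>simp add: sub_inj_branch\<close>)
  qed
  then show "(sub \<sigma> (Case t e e1 e2), sub \<tau> (Case t e e1 e2)) \<in> R" by simp
qed

text \<open>The specification is itself a case analysis on the same scrutinee. It reduces in step
  with the term, and once a branch is chosen it has become the specification of that branch.\<close>

lemma sem_caseComp:
  assumes w: "wfc \<Gamma>" and e: "tyt \<Gamma> e (tsum t1 t2)" "sem \<Gamma> e (Tot (tsum t1 t2))"
    and t1: "isty \<Gamma> t1 i" "semc \<Gamma> (Tot t1) i" and t2: "isty \<Gamma> t2 j" "semc \<Gamma> (Tot t2) j"
    and s: "isty \<Gamma> (tsum t1 t2) l" "semc \<Gamma> (Tot (tsum t1 t2)) l"
    and t: "isty \<Gamma> t 0" and W: "wp_type_of S M = Some W" "isty \<Gamma> (W \<cdot> t) k"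
    and e1: "ty S (t1 # \<Gamma>) e1 (Comp M (sh t) wp1)" "sem (t1 # \<Gamma>) e1 (Comp M (sh t) wp1)"
    and e2: "ty S (t2 # \<Gamma>) e2 (Comp M (sh t) wp2)" "sem (t2 # \<Gamma>) e2 (Comp M (sh t) wp2)"
    and wp: "tyt (t1 # \<Gamma>) wp1 (sh (W \<cdot> t))" "tyt (t2 # \<Gamma>) wp2 (sh (W \<cdot> t))"
    and h1: "hu S (t1 # \<Gamma>) (Comp M (sh t) wp1) 0" and h2: "hu S (t2 # \<Gamma>) (Comp M (sh t) wp2) 0"
    and h: "hu S \<Gamma> (Comp M t (Case (sh (W \<cdot> t)) e wp1 wp2)) 0" "cinf \<Gamma> (Comp M t (Case (sh (W \<cdot> t)) e wp1 wp2)) 0"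
  shows "sem \<Gamma> (Case (sh t) e e1 e2) (Comp M t (Case (sh (W \<cdot> t)) e wp1 wp2))"
proof (rule semI[OF cinfD(1)[OF h(2)]])
  let ?w = "Case (sh (W \<cdot> t)) e wp1 wp2" let ?c = "Comp M t ?w"
  have Y: "ty S \<Gamma> (Case (sh t) e e1 e2) ?c" by (rule Y_CaseComp[OF e(1) t1(1) t2(1) s(1) t W e1(1) e2(1) wp h1 h2 h(1)])
  note cW = csD(12)[OF W(1), THEN closed_sub] csD(12)[OF W(1), THEN closed_ren]
  let ?wr = "\<lambda>\<sigma> x. Case (sh (W \<cdot> sub \<sigma> t)) x (sub (ups \<sigma>) wp1) (sub (ups \<sigma>) wp2)"
  have sw: "sub \<sigma> ?w = ?wr \<sigma> (sub \<sigma> e)" for \<sigma> by (simp add: cW sub_ups_sh)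
  fix E \<sigma> \<tau> R assume g: "G E \<Gamma> \<sigma> \<tau>" and R: "LC 0 E (subc \<sigma> ?c) R"
  obtain SR where SR': "LU l E (tsum (sub \<sigma> t1) (sub \<sigma> t2)) SR" "(sub \<sigma> e, sub \<tau> e) \<in> SR"
    using semcD[OF s(2) g] sem_use[OF e(2) g] by (fastforce simp: LC_Tot)
  from LU_sum_inv[OF SR'(1)] obtain Ra Rb where RR: "SR = posR (Qsum E (sub \<sigma> t1) (sub \<sigma> t2) Ra Rb) E (Tot (tsum (sub \<sigma> t1) (sub \<sigma> t2)))"
    "LU l E (sub \<sigma> t1) Ra" "LU l E (sub \<sigma> t2) Rb" by blast
  have T: "ty S E (Case (sh (sub \<sigma> t)) x x1 x2) (subc \<sigma> ?c)"
    if g: "G E \<Gamma> \<sigma> \<tau>" and r: "reds S (sub \<sigma> e) x" "reds S (sub (ups \<sigma>) e1) x1" "reds S (sub (ups \<sigma>) e2) x2" for \<sigma> \<tau> x x1 x2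
  proof -
    note tb = G_tsb[OF g] and tu = tsb_up[OF G_tsb[OF g]]
    have rw: "reds S (sub \<sigma> ?w) (?wr \<sigma> x)" unfolding sw by (rule reds_Case[OF r(1)])
    note hx = hu_wp_reds[OF h(2) g rw] and h0 = ty_sub(2)[OF tb h(1), unfolded subc.simps]
    have "ty S E (Case (sh (sub \<sigma> t)) x x1 x2) (Comp M (sub \<sigma> t) (?wr \<sigma> x))"
    proof (rule Y_CaseComp[OF _ _ _ _ _ W(1) _ _ _ _ _ _ _ hx])
      show "tyt E x (tsum (sub \<sigma> t1) (sub \<sigma> t2))" using BB_D(3)[OF sem_BB[OF e(2) g] r(1)] by simp
      show "isty E (sub \<sigma> t1) i" "isty E (sub \<sigma> t2) j" "isty E (tsum (sub \<sigma> t1) (sub \<sigma> t2)) l"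
        "isty E (sub \<sigma> t) 0" "isty E (W \<cdot> sub \<sigma> t) k"
        using ty_sub(1)[OF tb t1(1)] ty_sub(1)[OF tb t2(1)] ty_sub(1)[OF tb s(1)] ty_sub(1)[OF tb t] ty_sub(1)[OF tb W(2)] by (simp_all add: cW)
      show "ty S (sub \<sigma> t1 # E) x1 (Comp M (sh (sub \<sigma> t)) (sub (ups \<sigma>) wp1))" "ty S (sub \<sigma> t2 # E) x2 (Comp M (sh (sub \<sigma> t)) (sub (ups \<sigma>) wp2))"
        using BB_D(3)[OF sem_BB[OF e1(2) G_up[OF g t1(2)]] r(2)] BB_D(3)[OF sem_BB[OF e2(2) G_up[OF g t2(2)]] r(3)] by (simp_all add: sub_ups_sh)
      show "tyt (sub \<sigma> t1 # E) (sub (ups \<sigma>) wp1) (sh (W \<cdot> sub \<sigma> t))" "tyt (sub \<sigma> t2 # E) (sub (ups \<sigma>) wp2) (sh (W \<cdot> sub \<sigma> t))"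
        using ty_sub(1)[OF tu wp(1)] ty_sub(1)[OF tu wp(2)] by (simp_all add: cW sub_ups_sh)
      show "hu S (sub \<sigma> t1 # E) (Comp M (sh (sub \<sigma> t)) (sub (ups \<sigma>) wp1)) 0" "hu S (sub \<sigma> t2 # E) (Comp M (sh (sub \<sigma> t)) (sub (ups \<sigma>) wp2)) 0"
        using ty_sub(2)[OF tu h1] ty_sub(2)[OF tu h2] by (simp_all add: sub_ups_sh)
    qed
    from Y_Sub[OF this sc_wp(2)[OF h0 hx rw] hx h0] show ?thesis by simp
  qed
  have SNb: "SN (sub (ups \<sigma>) e1) \<and> SN (sub (ups \<sigma>) e2)" if "G E \<Gamma> \<sigma> \<tau>" for \<sigma> \<tau>
    using BB_D(1)[OF sem_BB[OF e1(2) G_up[OF that t1(2)]]] BB_D(1)[OF sem_BB[OF e2(2) G_up[OF that t2(2)]]] by blast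
  have "(Case (sh (sub \<sigma> t)) (sub \<sigma> e) (sub (ups \<sigma>) e1) (sub (ups \<sigma>) e2), Case (sh (sub \<tau> t)) (sub \<tau> e) (sub (ups \<tau>) e1) (sub (ups \<tau>) e2)) \<in> R"
  proof (rule case_core[OF R SR'(2)[unfolded RR(1)]])
    show "SN (sub (ups \<sigma>) e1)" "SN (sub (ups \<sigma>) e2)" "SN (sub (ups \<tau>) e1)" "SN (sub (ups \<tau>) e2)" using SNb[OF g] SNb[OF G_sym[OF g]] by blast+
    show "ty S E (Case (sh (sub \<sigma> t)) x x1 x2) (subc \<sigma> ?c)" if "reds S (sub \<sigma> e) x" "reds S (sub (ups \<sigma>) e1) x1" "reds S (sub (ups \<sigma>) e2) x2" for x x1 x2
      by (rule T[OF g that])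
    show "ty S E (Case (sh (sub \<tau> t)) x x1 x2) (subc \<sigma> ?c)" if "reds S (sub \<tau> e) x" "reds S (sub (ups \<tau>) e1) x1" "reds S (sub (ups \<tau>) e2) x2" for x x1 x2
      by (rule Y_Sub[OF T[OF G_sym[OF g] that] G_sc[OF w G_sym[OF g] h(1)] ty_sub(2)[OF G_tsb[OF G_sym[OF g]] h(1)] ty_sub(2)[OF G_tsb[OF g] h(1)]])
    show "cv E (subc \<sigma> ?c) (Case (sh (sub \<sigma> t)) (sub \<sigma> e) (sub (ups \<sigma>) e1) (sub (ups \<sigma>) e2)) (Case (sh (sub \<tau> t)) (sub \<tau> e) (sub (ups \<tau>) e1) (sub (ups \<tau>) e2))"
      using G_cv[OF w g Y h(1)] by (simp add: sub_ups_sh)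
    show "(inst (sub (ups \<sigma>) e1) v, inst (sub (ups \<tau>) e1) v') \<in> R" if r: "reds S (sub \<sigma> e) (tinl a b v)" and v: "(v, v') \<in> Ra" for a b v v'
    proof -
      note gv = G_cons[OF g t1(2) RR(2) v]
      have rw: "reds S (sub \<sigma> ?w) (sub (scons v \<sigma>) wp1)" unfolding sw
        using reds_snoc[OF reds_Case[OF r] R_CaseInl, of "sh (W \<cdot> sub \<sigma> t)" "sub (ups \<sigma>) wp1" "sub (ups \<sigma>) wp2"] by (simp add: inst_ups)
      have "hu S E (Comp M (sub \<sigma> t) (sub (scons v \<sigma>) wp1)) 0" using ty_sub(2)[OF G_tsb[OF gv] h1] by (simp add: sub_ren)
      from LC_wp[OF R[unfolded subc.simps] this rw] sem_use[OF e1(2) gv, of 0 R] show ?thesis by (simp add: inst_ups sub_ren)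
    qed
    show "(inst (sub (ups \<sigma>) e2) v, inst (sub (ups \<tau>) e2) v') \<in> R" if r: "reds S (sub \<sigma> e) (tinr a b v)" and v: "(v, v') \<in> Rb" for a b v v'
    proof -
      note gv = G_cons[OF g t2(2) RR(3) v]
      have rw: "reds S (sub \<sigma> ?w) (sub (scons v \<sigma>) wp2)" unfolding sw
        using reds_snoc[OF reds_Case[OF r] R_CaseInr, of "sh (W \<cdot> sub \<sigma> t)" "sub (ups \<sigma>) wp1" "sub (ups \<sigma>) wp2"] by (simp add: inst_ups)
      have "hu S E (Comp M (sub \<sigma> t) (sub (scons v \<sigma>) wp2)) 0" using ty_sub(2)[OF G_tsb[OF gv] h2] by (simp add: sub_ren)
      from LC_wp[OF R[unfolded subc.simps] this rw] sem_use[OF e2(2) gv, of 0 R] show ?thesis by (simp add: inst_ups sub_ren)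
    qed
  qed
  then show "(sub \<sigma> (Case (sh t) e e1 e2), sub \<tau> (Case (sh t) e e1 e2)) \<in> R" by (simp add: sub_ups_sh)
qed

end

section \<open>Computations of user-defined effects\<close>

context sigc begin

text \<open>Besides steps inside \<open>x\<close>, the term \<open>Reify x\<close> has a single
  contraction, with result \<open>d\<close>.\<close>

definition unf :: "tm \<Rightarrow> tm \<Rightarrow> bool" where
  "unf x d \<longleftrightarrow> red S (Reify x) d \<and> (\<forall>y. red S (Reify x) y \<longrightarrow> y = d \<or> (\<exists>x'. red S x x' \<and> y = Reify x'))"

text \<open>The reification of \<open>h\<close> is expanded from its unfolding. A step inside
  \<open>h\<close> changes the unfolding only to another reduct of \<open>d\<close>, so membership
  of \<open>d\<close> serves all stages of the induction.\<close>

lemma F_core: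
  assumes R: "LU n E (repr D \<cdot> t \<cdot> wp) R" and D: "eff_of S F = Some D" and hu: "hu S E (Comp (Usr F) t wp) 0" and z: "(d, z) \<in> R"
    and h: "SN h" "\<And>x. reds S h x \<Longrightarrow> ty S E x (Comp (Usr F) t wp) \<and> (\<exists>d'. reds S d d' \<and> unf x d')"
  shows "(Reify h, z) \<in> R"
  using h
proof (induct h rule: SN.induct)
  case (SN_I h)
  from SN_I(3)[OF rtranclp.rtrancl_refl] obtain d' where *: "ty S E h (Comp (Usr F) t wp)" "reds S d d'" "unf h d'" by blast
  show ?case
  proof (rule LR_exp(1)[OF R Y_Reify[OF D *(1) hu]])
    show "nt (Reify h)" by simp
    show "red S (Reify h) d'" using *(3) unfolding unf_def by blast
    fix x assume "red S (Reify h) x"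
    then consider "x = d'" | h' where "red S h h'" "x = Reify h'" using *(3) unfolding unf_def by blast
    then show "(x, z) \<in> R"
    proof cases
      case 1
      then show ?thesis using LR_reds(1)[OF R z *(2)] by simp
    next
      case (2 h')
      show ?thesis unfolding 2(2)
        by (rule SN_I(2)[OF 2(1)]) (rule SN_I(3), rule converse_rtranclp_into_rtranclp[of "red S", OF 2(1)])
    qed
  qed
qed

text \<open>Beyond the base relation, the relation of a user-defined effect looks only at the
  reification, and this is settled by the semantic typing of the unfolding \<open>d\<close>.
  \<open>F_core\<close> is applied to each instance in turn, with symmetry in between.\<close>

lemma sem_F_intro:
  assumes w: "wfc \<Gamma>" and D: "eff_of S F = Some D" and h: "ty S \<Gamma> h (Comp (Usr F) t wp)" "hu S \<Gamma> (Comp (Usr F) t wp) 0" "semc \<Gamma> (Comp (Usr F) t wp) 0"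
    and d: "sem \<Gamma> d (Tot (repr D \<cdot> t \<cdot> wp))"
    and SN: "\<And>E \<sigma> \<tau>. G E \<Gamma> \<sigma> \<tau> \<Longrightarrow> SN (sub \<sigma> h)"
    and U: "\<And>E \<sigma> \<tau> x. G E \<Gamma> \<sigma> \<tau> \<Longrightarrow> reds S (sub \<sigma> h) x \<Longrightarrow> ty S E x (subc \<sigma> (Comp (Usr F) t wp)) \<and> (\<exists>d'. reds S (sub \<sigma> d) d' \<and> unf x d')"
  shows "sem \<Gamma> h (Comp (Usr F) t wp)"
proof (rule semI[OF h(3)])
  let ?c = "Comp (Usr F) t wp"
  note cl = csD(2)[OF D, THEN closed_sub]
  fix E \<sigma> \<tau> R assume g: "G E \<Gamma> \<sigma> \<tau>" and R: "LC 0 E (subc \<sigma> ?c) R" "LC 0 E (subc \<tau> ?c) R"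
  have B: "BB E (subc \<sigma> ?c) (sub \<sigma> h)" if "G E \<Gamma> \<sigma> \<tau>" for E \<sigma> \<tau>
    unfolding BB_def using SN[OF that] U[OF that] by blast
  from sem_base[OF w h(1,2) B g] have b: "(sub \<sigma> h, sub \<tau> h) \<in> BR E (subc \<sigma> ?c)" .
  from LR_inv(7)[OF R(1)[unfolded subc.simps] D] obtain R0 where R0: "R = effR E (subc \<sigma> ?c) R0"
    "LU 0 E (repr D \<cdot> sub \<sigma> t \<cdot> sub \<sigma> wp) R0" by auto
  from semD[OF d] g obtain n R1 where R1: "LC n E (subc \<sigma> (Tot (repr D \<cdot> t \<cdot> wp))) R1" "LC n E (subc \<tau> (Tot (repr D \<cdot> t \<cdot> wp))) R1" "(sub \<sigma> d, sub \<tau> d) \<in> R1" by blast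
  have "R1 = R0" using LU_unique[OF R0(2)] R1(1) by (simp add: LC_Tot cl)
  then have dd: "(sub \<sigma> d, sub \<tau> d) \<in> R0" and R0': "LU n E (repr D \<cdot> sub \<tau> t \<cdot> sub \<tau> wp) R0" using R1(2,3) by (simp_all add: LC_Tot cl)
  note H = ty_sub(2)[OF G_tsb[OF g] h(2), unfolded subc.simps] ty_sub(2)[OF G_tsb[OF G_sym[OF g]] h(2), unfolded subc.simps]
  have 1: "(Reify (sub \<sigma> h), sub \<tau> d) \<in> R0" by (rule F_core[OF R0(2) D H(1) dd SN[OF g]]) (use U[OF g] in simp)
  note sy = LR_sym(1)[OF R0(2), THEN symD]
  have 2: "(Reify (sub \<tau> h), Reify (sub \<sigma> h)) \<in> R0"
    by (rule F_core[OF R0' D H(2) sy[OF 1] SN[OF G_sym[OF g]]]) (use U[OF G_sym[OF g]] in simp)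
  show "(sub \<sigma> h, sub \<tau> h) \<in> R" using sy[OF 2] b unfolding R0(1) by blast
qed

lemma sem_reify:
  assumes e: "sem \<Gamma> e (Comp (Usr F) t wp)" and h: "cinf \<Gamma> (Comp (Usr F) t wp) 0" and D: "eff_of S F = Some D"
  shows "sem \<Gamma> (Reify e) (Tot (repr D \<cdot> t \<cdot> wp))"
proof (rule semI)
  note cl = csD(2)[OF D, THEN closed_sub]
  show "semc \<Gamma> (Tot (repr D \<cdot> t \<cdot> wp)) 0" using cinfD(4)[OF h] D semc_tot by auto
  fix E \<sigma> \<tau> R assume g: "G E \<Gamma> \<sigma> \<tau>" and R: "LC 0 E (subc \<sigma> (Tot (repr D \<cdot> t \<cdot> wp))) R"
  from sem_ex[OF e g] obtain n R1 where R1: "LC n E (Comp (Usr F) (sub \<sigma> t) (sub \<sigma> wp)) R1" "(sub \<sigma> e, sub \<tau> e) \<in> R1" by auto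
  from LR_inv(7)[OF R1(1) D] obtain R0 where R0: "R1 = effR E (Comp (Usr F) (sub \<sigma> t) (sub \<sigma> wp)) R0" "LU n E (repr D \<cdot> sub \<sigma> t \<cdot> sub \<sigma> wp) R0" by blast
  have "R0 = R" using LU_unique[OF R0(2)] R by (simp add: LC_Tot cl)
  then show "(sub \<sigma> (Reify e), sub \<tau> (Reify e)) \<in> R" using R1(2) R0(1) by auto
qed

lemma red_Reflect: "red S (Reflect e) x \<Longrightarrow> \<exists>e1. red S e e1 \<and> x = Reflect e1"
  by (erule red_ReflectE) blast
lemma red_BindF: "red S (Bind (Usr F) t1 t2 w1 e w2 e2) x \<Longrightarrow> \<exists>e1. red S e e1 \<and> x = Bind (Usr F) t1 t2 w1 e1 w2 e2"
  by (erule red_BindE) auto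
lemma red_Lift: "red S (Lift M M' t wp e) x \<Longrightarrow> \<exists>e1. red S e e1 \<and> x = Lift M M' t wp e1"
  by (erule red_LiftE) blast

lemma sem_reflect:
  assumes w: "wfc \<Gamma>" and D: "eff_of S F = Some D" and e: "tyt \<Gamma> e (repr D \<cdot> t \<cdot> wp)" "sem \<Gamma> e (Tot (repr D \<cdot> t \<cdot> wp))"
    and h: "hu S \<Gamma> (Comp (Usr F) t wp) 0" "semc \<Gamma> (Comp (Usr F) t wp) 0"
  shows "sem \<Gamma> (Reflect e) (Comp (Usr F) t wp)"
proof (rule sem_F_intro[OF w D Y_Reflect[OF D e(1) h(1)] h e(2)])
  note cl = csD(2)[OF D, THEN closed_sub]
  fix E \<sigma> \<tau> assume g: "G E \<Gamma> \<sigma> \<tau>"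
  note be = sem_BB[OF e(2) g]
  show "SN (sub \<sigma> (Reflect e))" using SN_ctx[OF red_Reflect BB_D(1)[OF be]] by simp
  fix x assume "reds S (sub \<sigma> (Reflect e)) x"
  then obtain e1 where e1: "reds S (sub \<sigma> e) e1" "x = Reflect e1" using reds_ctx[of Reflect, OF red_Reflect] by fastforce
  have "ty S E (Reflect e1) (Comp (Usr F) (sub \<sigma> t) (sub \<sigma> wp))"
    using Y_Reflect[OF D _ ty_sub(2)[OF G_tsb[OF g] h(1), unfolded subc.simps]] BB_D(3)[OF be e1(1)] by (simp add: cl)
  moreover have "unf x e1" unfolding unf_def e1(2) by (auto intro: R_ReifyReflect elim!: red_ReifyE)
  ultimately show "ty S E x (subc \<sigma> (Comp (Usr F) t wp)) \<and> (\<exists>d'. reds S (sub \<sigma> e) d' \<and> unf x d')" using e1 by auto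
qed

lemma reds_apps: "list_all2 (reds S) es es1 \<Longrightarrow> reds S f f' \<Longrightarrow> reds S (apps f es) (apps f' es1)"
proof (induct es arbitrary: es1 f f')
  case (Cons e es)
  then obtain e1 es1' where "es1 = e1 # es1'" "reds S e e1" "list_all2 (reds S) es es1'" by (auto simp: list_all2_Cons1)
  then show ?case using Cons(1)[of es1' "f \<cdot> e" "f' \<cdot> e1"] Cons(3) reds_App by simp
qed simp

lemma sem_returnF:
  assumes w: "wfc \<Gamma>" and D: "eff_of S F = Some D" and t: "isty \<Gamma> t 0" and e: "tyt \<Gamma> e t" "sem \<Gamma> e (Tot t)"
    and h: "hu S \<Gamma> (Comp (Usr F) t (ret_star D \<cdot> t \<cdot> e)) 0" "cinf \<Gamma> (Comp (Usr F) t (ret_star D \<cdot> t \<cdot> e)) 0"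
    and d: "tyt \<Gamma> (apps (ret D) [t, e]) (repr D \<cdot> t \<cdot> (ret_star D \<cdot> t \<cdot> e))" "sem \<Gamma> (apps (ret D) [t, e]) (Tot (repr D \<cdot> t \<cdot> (ret_star D \<cdot> t \<cdot> e)))"
  shows "sem \<Gamma> (Return (Usr F) t e) (Comp (Usr F) t (ret_star D \<cdot> t \<cdot> e))"
proof (rule sem_F_intro[OF w D Y_ReturnF[OF D t e(1) h(1) d(1)] h(1) cinfD(1)[OF h(2)] d(2)])
  let ?c = "Comp (Usr F) t (ret_star D \<cdot> t \<cdot> e)"
  note cl = csD(2,3,4)[OF D, THEN closed_sub]
  fix E \<sigma> \<tau> assume g: "G E \<Gamma> \<sigma> \<tau>"
  note be = sem_BB[OF e(2) g]
  show "SN (sub \<sigma> (Return (Usr F) t e))" using SN_ctx[OF red_Return BB_D(1)[OF be]] by simp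
  fix x assume "reds S (sub \<sigma> (Return (Usr F) t e)) x"
  then obtain e1 where e1: "reds S (sub \<sigma> e) e1" "x = Return (Usr F) (sub \<sigma> t) e1" using reds_ctx[OF red_Return] by fastforce
  have r: "reds S (sub \<sigma> (ret_star D \<cdot> t \<cdot> e)) (ret_star D \<cdot> sub \<sigma> t \<cdot> e1)" using reds_AppR[OF e1(1)] by (simp add: cl)
  note h1 = hu_wp_reds[OF h(2) g r] and h0 = ty_sub(2)[OF G_tsb[OF g] h(1)]
  have rd: "reds S (sub \<sigma> (apps (ret D) [t, e])) (apps (ret D) [sub \<sigma> t, e1])" using reds_AppR[OF e1(1)] by (simp add: cl)
  have td: "tyt E (apps (ret D) [sub \<sigma> t, e1]) (sub \<sigma> (repr D \<cdot> t \<cdot> (ret_star D \<cdot> t \<cdot> e)))" using BB_D(3)[OF sem_BB[OF d(2) g] rd] by simp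
  have rr: "reds S (sub \<sigma> (repr D \<cdot> t \<cdot> (ret_star D \<cdot> t \<cdot> e))) (repr D \<cdot> sub \<sigma> t \<cdot> (ret_star D \<cdot> sub \<sigma> t \<cdot> e1))" using reds_AppR[OF r] by (simp add: cl)
  have "isty E (sub \<sigma> (repr D \<cdot> t \<cdot> (ret_star D \<cdot> t \<cdot> e))) 0" "isty E (repr D \<cdot> sub \<sigma> t \<cdot> (ret_star D \<cdot> sub \<sigma> t \<cdot> e1)) 0"
    using hu_inv(3)[OF h0[unfolded subc.simps]] hu_inv(3)[OF h1] D by (auto simp: cl)
  from ty_conv[OF td cv_red[OF this rr]] have td': "tyt E (apps (ret D) [sub \<sigma> t, e1]) (repr D \<cdot> sub \<sigma> t \<cdot> (ret_star D \<cdot> sub \<sigma> t \<cdot> e1))" .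
  have "ty S E x (Comp (Usr F) (sub \<sigma> t) (ret_star D \<cdot> sub \<sigma> t \<cdot> e1))"
    unfolding e1(2) by (rule Y_ReturnF[OF D _ _ h1 td']) (use ty_sub(1)[OF G_tsb[OF g] t] BB_D(3)[OF be e1(1)] in simp_all)
  then have "ty S E x (subc \<sigma> ?c)" using Y_Sub[OF _ _ h1 h0] sc_wp(2)[OF h0[unfolded subc.simps] h1 r] by simp
  moreover have "unf x (apps (ret D) [sub \<sigma> t, e1])" unfolding unf_def e1(2) using D by (auto intro!: R_ReifyReturn[OF D, simplified] elim!: red_ReifyE)
  ultimately show "ty S E x (subc \<sigma> ?c) \<and> (\<exists>d'. reds S (sub \<sigma> (apps (ret D) [t, e])) d' \<and> unf x d')" using rd by blast
qed

lemma sem_bindF: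
  assumes w: "wfc \<Gamma>" and D: "eff_of S F = Some D" and t1: "isty \<Gamma> t1 0" and t2: "isty \<Gamma> t2 0"
    and wp2: "tyt \<Gamma> wp2 (arr t1 (wp_type D \<cdot> t2))"
    and e1: "ty S \<Gamma> e1 (Comp (Usr F) t1 wp1)" "sem \<Gamma> e1 (Comp (Usr F) t1 wp1)"
    and e2: "ty S (t1 # \<Gamma>) e2 (Comp (Usr F) (sh t2) (sh wp2 \<cdot> Var 0))"
    and h1: "hu S \<Gamma> (Comp (Usr F) t1 wp1) 0" and h2: "hu S (t1 # \<Gamma>) (Comp (Usr F) (sh t2) (sh wp2 \<cdot> Var 0)) 0"
    and h: "hu S \<Gamma> (Comp (Usr F) t2 (apps (bnd_star D) [t1, t2, wp1, wp2])) 0" "semc \<Gamma> (Comp (Usr F) t2 (apps (bnd_star D) [t1, t2, wp1, wp2])) 0"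
    and d: "tyt \<Gamma> (apps (bnd D) [t1, t2, wp1, Reify e1, wp2, Lam t1 (Reify e2)]) (repr D \<cdot> t2 \<cdot> apps (bnd_star D) [t1, t2, wp1, wp2])"
      "sem \<Gamma> (apps (bnd D) [t1, t2, wp1, Reify e1, wp2, Lam t1 (Reify e2)]) (Tot (repr D \<cdot> t2 \<cdot> apps (bnd_star D) [t1, t2, wp1, wp2]))"
  shows "sem \<Gamma> (Bind (Usr F) t1 t2 wp1 e1 wp2 e2) (Comp (Usr F) t2 (apps (bnd_star D) [t1, t2, wp1, wp2]))"
proof (rule sem_F_intro[OF w D Y_BindF[OF D t1 t2 wp2 e1(1) e2 h1 h2 h(1) d(1)] h d(2)])
  let ?c = "Comp (Usr F) t2 (apps (bnd_star D) [t1, t2, wp1, wp2])"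
  note cl = csD(1,2,5,6)[OF D, THEN closed_sub]
  fix E \<sigma> \<tau> assume g: "G E \<Gamma> \<sigma> \<tau>"
  note be = sem_BB[OF e1(2) g]
  show "SN (sub \<sigma> (Bind (Usr F) t1 t2 wp1 e1 wp2 e2))" using SN_ctx[of "\<lambda>e. Bind (Usr F) _ _ _ e _ _", OF red_BindF BB_D(1)[OF be]] by simp
  fix x assume "reds S (sub \<sigma> (Bind (Usr F) t1 t2 wp1 e1 wp2 e2)) x"
  then obtain y where y: "reds S (sub \<sigma> e1) y" "x = Bind (Usr F) (sub \<sigma> t1) (sub \<sigma> t2) (sub \<sigma> wp1) y (sub \<sigma> wp2) (sub (ups \<sigma>) e2)"
    using reds_ctx[of "\<lambda>e. Bind (Usr F) _ _ _ e _ _", OF red_BindF] by fastforce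
  let ?d = "apps (bnd D) [sub \<sigma> t1, sub \<sigma> t2, sub \<sigma> wp1, Reify y, sub \<sigma> wp2, Lam (sub \<sigma> t1) (Reify (sub (ups \<sigma>) e2))]"
  have rd: "reds S (sub \<sigma> (apps (bnd D) [t1, t2, wp1, Reify e1, wp2, Lam t1 (Reify e2)])) ?d"
    unfolding sub_apps by (rule reds_apps) (simp_all add: reds_Reify[OF y(1)] cl)
  note tb = G_tsb[OF g] and tu = tsb_up[OF G_tsb[OF g]]
  have "ty S E x (subc \<sigma> ?c)" unfolding y(2)
    using Y_BindF[OF D, of E "sub \<sigma> t1" "sub \<sigma> t2" "sub \<sigma> wp2" y "sub \<sigma> wp1" "sub (ups \<sigma>) e2"]
      ty_sub(1)[OF tb t1] ty_sub(1)[OF tb t2] ty_sub(1)[OF tb wp2] BB_D(3)[OF be y(1)] ty_sub(1)[OF tu e2]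
      ty_sub(2)[OF tb h1] ty_sub(2)[OF tu h2] ty_sub(2)[OF tb h(1)] BB_D(3)[OF sem_BB[OF d(2) g] rd]
    by (simp add: cl sub_laws)
  moreover have "unf x ?d" unfolding unf_def y(2) using D by (auto intro!: R_ReifyBind[OF D, simplified] elim!: red_ReifyE)
  ultimately show "ty S E x (subc \<sigma> ?c) \<and> (\<exists>d'. reds S (sub \<sigma> (apps (bnd D) [t1, t2, wp1, Reify e1, wp2, Lam t1 (Reify e2)])) d' \<and> unf x d')" using rd by blast
qed

lemma reds_rep: "reds S e e1 \<Longrightarrow> reds S (rep M e) (rep M e1)"
  by (cases M) (auto intro: reds_Lam reds_ren reds_Reify)

lemma sem_lift:
  assumes w: "wfc \<Gamma>" and l: "lift_of S M (Usr F) = Some (l, l_star)" and D: "eff_of S F = Some D"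
    and e: "ty S \<Gamma> e (Comp M t wp)" "sem \<Gamma> e (Comp M t wp)" and h0: "hu S \<Gamma> (Comp M t wp) 0"
    and h: "hu S \<Gamma> (Comp (Usr F) t (l_star \<cdot> t \<cdot> wp)) 0" "semc \<Gamma> (Comp (Usr F) t (l_star \<cdot> t \<cdot> wp)) 0"
    and d: "tyt \<Gamma> (apps l [t, wp, rep M e]) (repr D \<cdot> t \<cdot> (l_star \<cdot> t \<cdot> wp))" "sem \<Gamma> (apps l [t, wp, rep M e]) (Tot (repr D \<cdot> t \<cdot> (l_star \<cdot> t \<cdot> wp)))"
  shows "sem \<Gamma> (Lift M (Usr F) t wp e) (Comp (Usr F) t (l_star \<cdot> t \<cdot> wp))"
proof (rule sem_F_intro[OF w D Y_Lift[OF l D e(1) h0 h(1) d(1)] h d(2)])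
  let ?c = "Comp (Usr F) t (l_star \<cdot> t \<cdot> wp)"
  note cl = csD(2)[OF D, THEN closed_sub] csD(7,8)[OF l, THEN closed_sub]
  fix E \<sigma> \<tau> assume g: "G E \<Gamma> \<sigma> \<tau>"
  note be = sem_BB[OF e(2) g]
  show "SN (sub \<sigma> (Lift M (Usr F) t wp e))" using SN_ctx[OF red_Lift BB_D(1)[OF be]] by simp
  fix x assume "reds S (sub \<sigma> (Lift M (Usr F) t wp e)) x"
  then obtain y where y: "reds S (sub \<sigma> e) y" "x = Lift M (Usr F) (sub \<sigma> t) (sub \<sigma> wp) y" using reds_ctx[OF red_Lift] by fastforce
  have rd: "reds S (sub \<sigma> (apps l [t, wp, rep M e])) (apps l [sub \<sigma> t, sub \<sigma> wp, rep M y])"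
    unfolding sub_apps by (rule reds_apps) (simp_all add: reds_rep[OF y(1)] sub_rep cl)
  note tb = G_tsb[OF g]
  have "ty S E x (subc \<sigma> ?c)" unfolding y(2)
    using Y_Lift[OF l D, of E y "sub \<sigma> t" "sub \<sigma> wp"] BB_D(3)[OF be y(1)] ty_sub(2)[OF tb h0] ty_sub(2)[OF tb h(1)] BB_D(3)[OF sem_BB[OF d(2) g] rd]
    by (simp add: cl)
  moreover have "unf x (apps l [sub \<sigma> t, sub \<sigma> wp, rep M y])" unfolding unf_def y(2) using l by (auto intro!: R_ReifyLift[OF l, simplified] elim!: red_ReifyE)
  ultimately show "ty S E x (subc \<sigma> ?c) \<and> (\<exists>d'. reds S (sub \<sigma> (apps l [t, wp, rep M e])) d' \<and> unf x d')" using rd by blast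
qed

section \<open>Actions: reduction and conversion of argument lists\<close>

lemma red_Act: "red S (Act F a es) x \<Longrightarrow> \<exists>as e e' bs. es = as @ e # bs \<and> red S e e' \<and> x = Act F a (as @ e' # bs)"
  by (erule red_ActE) blast

definition lred :: "tm list \<Rightarrow> tm list \<Rightarrow> bool" where
  "lred es es' \<longleftrightarrow> (\<exists>as e e' bs. es = as @ e # bs \<and> red S e e' \<and> es' = as @ e' # bs)"

lemma lred_Cons: "lred (x # xs) ys \<Longrightarrow> (\<exists>x'. red S x x' \<and> ys = x' # xs) \<or> (\<exists>xs'. lred xs xs' \<and> ys = x # xs')"
proof -
  assume "lred (x # xs) ys"
  then obtain as e e' bs where *: "x # xs = as @ e # bs" "red S e e'" "ys = as @ e' # bs" unfolding lred_def by blast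
  then show ?thesis
  proof (cases as)
    case (Cons y as')
    then have "lred xs (as' @ e' # bs)" using * unfolding lred_def by auto
    then show ?thesis using * Cons by auto
  qed auto
qed

lemma TR_lred: "\<forall>e\<in>set es. SN e \<Longrightarrow> TR lred es"
proof (induct es)
  case Nil
  show ?case by (rule TR_I) (simp add: lred_def)
next
  case (Cons x xs)
  have "SN x" "TR lred xs" using Cons by auto
  then show ?case
  proof (induct x arbitrary: xs rule: SN.induct)
    case (SN_I x)
    note IHx = SN_I(2)
    from SN_I(3) show ?case
    proof (induct xs rule: TR.induct)
      case (TR_I xs)
      have "TR lred xs" using TR_I(1) by (rule TR.TR_I)
      show ?case
      proof (rule TR.TR_I)
        fix ys assume "lred (x # xs) ys"
        then show "TR lred ys" using lred_Cons IHx[OF _ \<open>TR lred xs\<close>] TR_I(2) by blast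
      qed
    qed
  qed
qed

lemma SN_Act: assumes "\<forall>e\<in>set es. SN e" shows "SN (Act F a es)"
  using TR_lred[OF assms]
proof (induct es rule: TR.induct)
  case (TR_I es)
  show ?case by (rule SN_I) (use red_Act TR_I(2) in \<open>unfold lred_def, blast\<close>)
qed

lemma reds_Act: assumes "reds S (Act F a es) x" shows "\<exists>es1. list_all2 (reds S) es es1 \<and> x = Act F a es1"
  using assms
proof (induct rule: rtranclp_induct)
  case base
  then show ?case by (auto intro: list_all2_refl)
next
  case (step y z)
  then obtain es1 where 1: "list_all2 (reds S) es es1" "y = Act F a es1" by blast
  from red_Act[OF step(2)[unfolded 1(2)]] obtain as e e' bs where 2: "es1 = as @ e # bs" "red S e e'" "z = Act F a (as @ e' # bs)" by blast
  from 1(1)[unfolded 2(1)] obtain us w zs where 3: "es = us @ w # zs" "list_all2 (reds S) us as" "reds S w e" "list_all2 (reds S) zs bs"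
    by (auto simp: list_all2_append2 list_all2_Cons2)
  then have "list_all2 (reds S) es (as @ e' # bs)" using reds_snoc[OF 3(3) 2(2)] by (auto intro!: list_all2_appendI)
  then show ?case using 2(3) by blast
qed

lemma args_snoc: "args (xs @ [x]) = scons x (args xs)"
  by (rule nat_ext) (simp_all add: args_def)

lemma scv_cons:
  assumes s: "scv E \<Gamma> \<sigma> \<tau>" and x: "tyt E x (sub \<sigma> t)" "tyt E y (sub \<tau> t)" "cv E (Tot (sub \<sigma> t)) x y"
  shows "scv E (t # \<Gamma>) (scons x \<sigma>) (scons y \<tau>)"
  unfolding scv_def
proof (intro conjI allI impI)
  show "tsb E (scons x \<sigma>) (t # \<Gamma>)" "tsb E (scons y \<tau>) (t # \<Gamma>)" using s x(1,2) by (auto simp: scv_def intro: tsb_cons)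
  fix n assume n: "n < length (t # \<Gamma>)"
  show "cv E (Tot (sub (scons x \<sigma>) (lk (t # \<Gamma>) n))) (scons x \<sigma> n) (scons y \<tau> n)"
  proof (cases n)
    case 0
    then show ?thesis using x(3) by (simp only: sub_scons_drop scons_simps nth_Cons_0)
  next
    case (Suc k)
    then show ?thesis using s n unfolding scv_def by (simp only: sub_scons_drop scons_simps nth_Cons_Suc length_Cons Suc_less_eq)
  qed
qed

text \<open>The type of an argument depends on the preceding arguments, so conversion of the lists
  is built up along the telescope: the converted prefix converts the type at which the next argument
  of the second list must be typed.\<close>

lemma args_scv:
  assumes len: "length xs = length P" "length ys = length P" and P: "\<forall>i<length P. \<exists>j. isty (rev (take i P)) (P ! i) j"
    and X: "\<forall>i<length P. cv E (Tot (sub (args (take i xs)) (P ! i))) (xs ! i) (ys ! i)"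
  shows "i \<le> length P \<Longrightarrow> wfc (rev (take i P)) \<and> scv E (rev (take i P)) (args (take i xs)) (args (take i ys))"
proof (induct i)
  case 0
  show ?case by (simp add: scv_def tsb_def)
next
  case (Suc i)
  then have i: "i < length P" and w: "wfc (rev (take i P))" and s: "scv E (rev (take i P)) (args (take i xs)) (args (take i ys))" by auto
  obtain j where j: "isty (rev (take i P)) (P ! i) j" using P i by blast
  note c = X[rule_format, OF i]
  have "scv E (P ! i # rev (take i P)) (scons (xs ! i) (args (take i xs))) (scons (ys ! i) (args (take i ys)))"
    by (rule scv_cons[OF s cv_ty1[OF c] _ c]) (rule ty_conv[OF cv_ty2[OF c] cvsub_type[OF w s j]])
  then show ?case using i len w j by (auto simp: take_Suc_conv_app_nth args_snoc)
qed

text \<open>The result type is instantiated with the arguments and changes when they reduce;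
  conversion over the telescope brings it back.\<close>

lemma sem_act:
  assumes w: "wfc \<Gamma>" and A: "act_of S F a = Some A" and D: "eff_of S F = Some D" and len: "length es = length (act_params A)"
    and es: "\<forall>i<length es. tyt \<Gamma> (es ! i) (sub (args (take i es)) (act_params A ! i))"
      "\<forall>i<length es. sem \<Gamma> (es ! i) (Tot (sub (args (take i es)) (act_params A ! i)))"
    and P: "\<forall>i<length es. \<exists>j. isty (rev (take i (act_params A))) (act_params A ! i) j"
    and c: "act_comp A = Comp (Usr F) t wp" "hu S (rev (act_params A)) (act_comp A) 0"
    and h: "hu S \<Gamma> (Comp (Usr F) (sub (args es) t) (sub (args es) wp)) 0" "semc \<Gamma> (Comp (Usr F) (sub (args es) t) (sub (args es) wp)) 0"
    and d: "tyt \<Gamma> (apps (act_impl A) es) (repr D \<cdot> sub (args es) t \<cdot> sub (args es) wp)"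
      "sem \<Gamma> (apps (act_impl A) es) (Tot (repr D \<cdot> sub (args es) t \<cdot> sub (args es) wp))"
  shows "sem \<Gamma> (Act F a es) (Comp (Usr F) (sub (args es) t) (sub (args es) wp))"
proof (rule sem_F_intro[OF w D Y_Act[OF A D len es(1) P c h(1) d(1)] h d(2)])
  let ?c = "Comp (Usr F) (sub (args es) t) (sub (args es) wp)" and ?P = "act_params A"
  note cl = csD(2)[OF D, THEN closed_sub] csD(9)[OF A, THEN closed_sub]
  fix E \<sigma> \<tau> assume g: "G E \<Gamma> \<sigma> \<tau>"
  let ?es = "map (sub \<sigma>) es"
  have B: "BB E (Tot (sub (args (take i ?es)) (?P ! i))) (?es ! i)" if i: "i < length es" for i
  proof -
    have "scoped (length (take i es)) (?P ! i)" using csD(10)[OF A] i len by simp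
    then show ?thesis using sem_BB[OF es(2)[rule_format, OF i] g] i by (simp add: sub_args take_map)
  qed
  show "SN (sub \<sigma> (Act F a es))" using BB_D(1)[OF B] by (simp, intro SN_Act) (auto simp: in_set_conv_nth)
  fix x assume "reds S (sub \<sigma> (Act F a es)) x"
  then obtain ys where y: "list_all2 (reds S) ?es ys" "x = Act F a ys" using reds_Act[of F a ?es x] by auto
  have ly: "length ys = length ?P" using list_all2_lengthD[OF y(1)] len by simp
  have ry: "reds S (?es ! i) (ys ! i)" if "i < length es" for i using list_all2_nthD[OF y(1), of i] that by simp
  have cv_ys: "\<forall>i<length ?P. cv E (Tot (sub (args (take i ?es)) (?P ! i))) (?es ! i) (ys ! i)" using BB_cv[OF B ry] len by metis
  have "wfc (rev (take (length ?P) ?P)) \<and> scv E (rev (take (length ?P) ?P)) (args (take (length ?P) ?es)) (args (take (length ?P) ys))"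
    by (rule args_scv[OF _ ly]) (use len P cv_ys in auto)
  then have wP: "wfc (rev ?P)" and sP: "scv E (rev ?P) (args ?es) (args ys)" using len ly by simp_all
  note sP' = scv_sym[OF wP sP]
  have tP: "tsb E (args ?es) (rev ?P)" "tsb E (args ys) (rev ?P)" using sP by (auto simp: scv_def)
  have s: "scoped (length es) t" "scoped (length es) wp" using csD(11)[OF A] len c(1) by auto
  have cs: "subc \<sigma> ?c = subc (args ?es) (act_comp A)" using s by (simp add: c(1) sub_args)
  have rd: "reds S (sub \<sigma> (apps (act_impl A) es)) (apps (act_impl A) ys)"
    unfolding sub_apps cl by (rule reds_apps[OF y(1)]) simp
  have hy: "hu S E (Comp (Usr F) (sub (args ys) t) (sub (args ys) wp)) 0" using ty_sub(2)[OF tP(2) c(2)] by (simp add: c(1))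
  have tyi: "tyt E (ys ! i) (sub (args (take i ys)) (?P ! i))" if i: "i < length ys" for i
  proof -
    have ie: "i < length es" using i ly len by simp
    have "wfc (rev (take i ?P)) \<and> scv E (rev (take i ?P)) (args (take i ?es)) (args (take i ys))"
      by (rule args_scv[OF _ ly]) (use len P cv_ys ie in auto)
    moreover obtain j where "isty (rev (take i ?P)) (?P ! i) j" using P ie by blast
    ultimately show ?thesis using ty_conv[OF BB_D(3)[OF B[OF ie] ry[OF ie]] cvsub_type] by blast
  qed
  have rt: "isty (rev ?P) (repr D \<cdot> t \<cdot> wp) 0" using hu_inv(3)[of "rev ?P" F t wp 0] c D by auto
  have "tyt E (apps (act_impl A) ys) (repr D \<cdot> sub (args ?es) t \<cdot> sub (args ?es) wp)"
    using BB_D(3)[OF sem_BB[OF d(2) g] rd] s by (simp add: cl sub_args)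
  from ty_conv[OF this] cvsub_type[OF wP sP rt] have td: "tyt E (apps (act_impl A) ys) (repr D \<cdot> sub (args ys) t \<cdot> sub (args ys) wp)"
    by (simp add: cl)
  have "ty S E x (Comp (Usr F) (sub (args ys) t) (sub (args ys) wp))"
    unfolding y(2) by (rule Y_Act[OF A D ly _ _ c hy td]) (use tyi P ly len in auto)
  then have "ty S E x (subc (args ys) (act_comp A))" by (simp add: c(1))
  from Y_Sub[OF this cvsub_sc[OF wP sP' c(2)] ty_sub(2)[OF tP(2) c(2)] ty_sub(2)[OF tP(1) c(2)]]
  have "ty S E x (subc \<sigma> ?c)" unfolding cs .
  moreover have "unf x (apps (act_impl A) ys)" unfolding unf_def y(2) using A by (auto intro!: R_ReifyAct[OF A] elim!: red_ReifyE)
  ultimately show "ty S E x (subc \<sigma> ?c) \<and> (\<exists>d'. reds S (sub \<sigma> (apps (act_impl A) es)) d' \<and> unf x d')" using rd by blast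
qed

end

section \<open>The fundamental theorem\<close>

context sigc begin

primrec wfs :: "tm list \<Rightarrow> bool" where
  "wfs [] = True"
| "wfs (t # \<Gamma>) = (wfs \<Gamma> \<and> (\<exists>i. ok \<Gamma> t i))"

lemma wfs_wfc: "wfs \<Gamma> \<Longrightarrow> wfc \<Gamma>"
  by (induct \<Gamma>) (auto dest: okD(1))

lemma wfs_nth: "wfs \<Gamma> \<Longrightarrow> n < length \<Gamma> \<Longrightarrow> \<exists>i. ok \<Gamma> (lk \<Gamma> n) i"
proof (induct \<Gamma> arbitrary: n)
  case (Cons t \<Gamma>)
  show ?case
  proof (cases n)
    case 0
    obtain i where "ok \<Gamma> t i" using Cons(2) by auto
    from ok_wk[OF this, of t] show ?thesis using 0 by auto
  next
    case (Suc k)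
    then obtain i where "ok \<Gamma> (lk \<Gamma> k) i" using Cons by auto
    from ok_wk[OF this, of t] show ?thesis unfolding Suc by (auto simp: ren_ren)
  qed
qed simp

lemma fundamental_aux:
  "ty S \<Gamma> e c \<Longrightarrow> wfs \<Gamma> \<longrightarrow> sem \<Gamma> e c"
  "hu S \<Gamma> c i \<Longrightarrow> wfs \<Gamma> \<longrightarrow> cinf \<Gamma> c i"
  "st S \<Gamma> X Y \<Longrightarrow> wfs \<Gamma> \<longrightarrow> semst \<Gamma> X Y"
  "sc S \<Gamma> c c' \<Longrightarrow> wfs \<Gamma> \<longrightarrow> semsc \<Gamma> c c'"
proof (induct rule: ty_hu_st_sc.inducts)
  case (Y_Var n \<Gamma>)
  show ?case
  proof
    assume "wfs \<Gamma>"
    from wfs_nth[OF this Y_Var] obtain i where "ok \<Gamma> (lk \<Gamma> n) i" by blast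
    from sem_var[OF Y_Var okD(3)[OF this]] show "sem \<Gamma> (Var n) (Tot (lk \<Gamma> n))" .
  qed
next
  case (Y_Univ \<Gamma> i)
  show ?case using sem_univ by blast
next
  case (Y_Con k t \<Gamma> i)
  then show ?case using sem_const wfs_wfc by blast
next
  case (Y_Pi \<Gamma> t i c j)
  show ?case
  proof
    assume w: "wfs \<Gamma>"
    then have t: "sem \<Gamma> t (Tot (Ty i))" and w': "wfs (t # \<Gamma>)" using Y_Pi(1,2) by (auto simp: ok_def)
    show "sem \<Gamma> (Pi t c) (Tot (Ty (max i j)))"
      by (rule sem_pi[OF wfs_wfc[OF w] Y_Pi(1) semc_tot[OF t] Y_Pi(3) cinfD(1)]) (use Y_Pi(4) w' in blast)
  qed
next
  case (Y_Refine \<Gamma> t i \<phi> j)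
  show ?case
  proof
    assume w: "wfs \<Gamma>"
    then show "sem \<Gamma> (Refine t \<phi>) (Tot (Ty i))"
      using sem_refine[OF wfs_wfc[OF w] semc_tot ty_hu_st_sc.Y_Refine[OF Y_Refine(1,3)]] Y_Refine(2) by blast
  qed
next
  case (Y_Lam \<Gamma> t i c j e)
  show ?case
  proof
    assume w: "wfs \<Gamma>"
    then have t: "sem \<Gamma> t (Tot (Ty i))" and w': "wfs (t # \<Gamma>)" using Y_Lam(1,2) by (auto simp: ok_def)
    show "sem \<Gamma> (Lam t e) (Tot (Pi t c))"
      by (rule sem_lam[OF wfs_wfc[OF w] Y_Lam(1) semc_tot[OF t] Y_Lam(3) cinfD(1) Y_Lam(5)]) (use Y_Lam(4,6) w' in blast)+
  qed
next
  case (Y_App \<Gamma> e1 t c e2 i j)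
  show ?case
  proof
    assume w: "wfs \<Gamma>"
    then have t: "sem \<Gamma> t (Tot (Ty i))" and w': "wfs (t # \<Gamma>)" using Y_App(5,6) by (auto simp: ok_def)
    show "sem \<Gamma> (e1 \<cdot> e2) (instc c e2)"
      by (rule sem_app[OF _ _ semc_tot[OF t] cinfD(1)]) (use Y_App(2,4,8) w w' in blast)+
  qed
next
  case (Y_CaseTot \<Gamma> e t1 t2 i j l t k e1 e2)
  note H = Y_CaseTot
  show ?case
  proof
    assume w: "wfs \<Gamma>"
    then have t: "sem \<Gamma> t1 (Tot (Ty i))" "sem \<Gamma> t2 (Tot (Ty j))" "sem \<Gamma> (tsum t1 t2) (Tot (Ty l))" using H(4,6,8) by blast+
    then have w': "wfs (t1 # \<Gamma>)" "wfs (t2 # \<Gamma>)" "wfs (tsum t1 t2 # \<Gamma>)" using w H(3,5,7) by (auto simp: ok_def)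
    show "sem \<Gamma> (Case t e e1 e2) (Tot (inst t e))"
      by (rule sem_caseTot[OF wfs_wfc[OF w] H(1) _ H(3) semc_tot[OF t(1)] H(5) semc_tot[OF t(2)] H(7) semc_tot[OF t(3)] H(9) semc_tot H(11) _ H(13)])
        (use H(2,10,12,14) w w' in blast)+
  qed
next
  case (Y_CaseComp \<Gamma> e t1 t2 i j l t M W k e1 wp1 e2 wp2)
  note H = Y_CaseComp
  show ?case
  proof
    assume w: "wfs \<Gamma>"
    then have t: "sem \<Gamma> t1 (Tot (Ty i))" "sem \<Gamma> t2 (Tot (Ty j))" "sem \<Gamma> (tsum t1 t2) (Tot (Ty l))" using H(4,6,8) by blast+
    then have w': "wfs (t1 # \<Gamma>)" "wfs (t2 # \<Gamma>)" using w H(3,5) by (auto simp: ok_def)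
    show "sem \<Gamma> (Case (sh t) e e1 e2) (Comp M t (Case (sh (W \<cdot> t)) e wp1 wp2))"
      by (rule sem_caseComp[OF wfs_wfc[OF w] H(1) _ H(3) semc_tot[OF t(1)] H(5) semc_tot[OF t(2)] H(7) semc_tot[OF t(3)] H(9,11,12,14) _ H(16) _ H(18,20,22,24,26)])
        (use H(2,15,17,27) w w' in blast)+
  qed
next
  case (Y_ReturnP \<Gamma> t e)
  show ?case
  proof
    assume w: "wfs \<Gamma>"
    show "sem \<Gamma> (Return Pure t e) (Comp Pure t (pure_ret_star \<cdot> t \<cdot> e))"
      by (rule sem_returnP[OF wfs_wfc[OF w] Y_ReturnP(1,3) _ Y_ReturnP(5)]) (use Y_ReturnP(4,6) w in blast)+
  qed
next
  case (Y_ReturnF F D \<Gamma> t e)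
  note H = Y_ReturnF
  show ?case
  proof
    assume w: "wfs \<Gamma>"
    show "sem \<Gamma> (Return (Usr F) t e) (Comp (Usr F) t (ret_star D \<cdot> t \<cdot> e))"
      by (rule sem_returnF[OF wfs_wfc[OF w] H(1,2,4) _ H(6) _ H(8)]) (use H(5,7,9) w in blast)+
  qed
next
  case (Y_BindP \<Gamma> t1 t2 wp2 e1 wp1 e2)
  note H = Y_BindP
  show ?case
  proof
    assume w: "wfs \<Gamma>"
    then have t: "sem \<Gamma> t1 (Tot (Ty 0))" and w': "wfs (t1 # \<Gamma>)" using H(1,2) by (auto simp: ok_def)
    show "sem \<Gamma> (Bind Pure t1 t2 wp1 e1 wp2 e2) (Comp Pure t2 (apps pure_bnd_star [t1, t2, wp1, wp2]))"
      by (rule sem_bindP[OF wfs_wfc[OF w] H(1) semc_tot[OF t] H(3,5,7) _ H(9) _ H(11,13,15) cinfD(1)]) (use H(8,10,16) w w' in blast)+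
  qed
next
  case (Y_BindF F D \<Gamma> t1 t2 wp2 e1 wp1 e2)
  note H = Y_BindF
  show ?case
  proof
    assume w: "wfs \<Gamma>"
    show "sem \<Gamma> (Bind (Usr F) t1 t2 wp1 e1 wp2 e2) (Comp (Usr F) t2 (apps (bnd_star D) [t1, t2, wp1, wp2]))"
      by (rule sem_bindF[OF wfs_wfc[OF w] H(1,2,4,6,8) _ H(10,12,14,16) cinfD(1) H(18)]) (use H(9,17,19) w in blast)+
  qed
next
  case (Y_Lift M F l l_star D \<Gamma> e t wp)
  note H = Y_Lift
  show ?case
  proof
    assume w: "wfs \<Gamma>"
    show "sem \<Gamma> (Lift M (Usr F) t wp e) (Comp (Usr F) t (l_star \<cdot> t \<cdot> wp))"
      by (rule sem_lift[OF wfs_wfc[OF w] H(1,2,3) _ H(5,7) cinfD(1) H(9)]) (use H(4,8,10) w in blast)+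
  qed
next
  case (Y_Act F a A D es \<Gamma> t wp)
  note H = Y_Act
  show ?case
  proof
    assume w: "wfs \<Gamma>"
    show "sem \<Gamma> (Act F a es) (Comp (Usr F) (sub (args es) t) (sub (args es) wp))"
      by (rule sem_act[OF wfs_wfc[OF w] H(1-3) _ _ _ H(6,7,9) cinfD(1) H(11)]) (use H(4,5,10,12) w in blast)+
  qed
next
  case (Y_Reify F D \<Gamma> e t wp)
  then show ?case using sem_reify by blast
next
  case (Y_Reflect F D \<Gamma> e t wp)
  then show ?case using sem_reflect wfs_wfc cinfD(1) by blast
next
  case (Y_Run \<Gamma> e t wp)
  then show ?case using sem_run[OF wfs_wfc Y_Run(4) semc_tot _ Y_Run(1,3)] by blast
next
  case (Y_Sub \<Gamma> e c' c j i)
  then show ?case using sem_sub cinfD(1) by blast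
next
  case (H_Tot \<Gamma> t i)
  then show ?case using cinf_tot by blast
next
  case (H_Pure \<Gamma> t wp)
  then show ?case using cinf_pure[OF wfs_wfc ty_hu_st_sc.H_Pure] by blast
next
  case (H_F F D \<Gamma> t wp)
  then show ?case using cinf_F[OF wfs_wfc ty_hu_st_sc.H_F[OF H_F(1,2,4,6)] H_F(1)] by blast
next
  case (ST_Refl \<Gamma> t)
  then show ?case using semst_red(1)[OF rtranclp.rtrancl_refl] by blast
next
  case (ST_Trans \<Gamma> t1 t2 i t3)
  then show ?case using semst_trans semc_tot by blast
next
  case (ST_Pi \<Gamma> t i t' c' c)
  show ?case
  proof
    assume w: "wfs \<Gamma>"
    then have t: "sem \<Gamma> t (Tot (Ty i))" and w': "wfs (t # \<Gamma>)" using ST_Pi(1,2) by (auto simp: ok_def)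
    show "semst \<Gamma> (Pi t' c') (Pi t c)"
      by (rule semst_pi[OF wfs_wfc[OF w] ST_Pi(1) semc_tot[OF t] ty_hu_st_sc.ST_Pi[OF ST_Pi(1,3,5)]]) (use ST_Pi(4,6) w w' in blast)+
  qed
next
  case (ST_RefineL \<Gamma> t \<phi>)
  then show ?case using semst_refineL by blast
next
  case (ST_RefineR t \<Gamma> \<phi>)
  then show ?case using semst_refineR[OF ty_hu_st_sc.ST_RefineR] by blast
next
  case (ST_Red t' t \<Gamma>)
  then show ?case using semst_red(1) by blast
next
  case (ST_Exp t t' \<Gamma>)
  then show ?case using semst_red(2) by blast
next
  case (SB_Refl \<Gamma> c)
  show ?case unfolding semsc_def using LC_unique by blast
next
  case (SB_Trans \<Gamma> c1 c2 i c3)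
  then show ?case using semsc_trans cinfD(1) by blast
next
  case (SB_Tot \<Gamma> t' t)
  then show ?case unfolding semsc_def semst_def by (simp add: LC_Tot)
next
  case (SB_Pure \<Gamma> t' t wp wp')
  then show ?case using semsc_pure[OF ty_hu_st_sc.SB_Pure] by blast
next
  case (SB_F F D \<Gamma> t' wp' t wp)
  then show ?case using semsc_F[OF _ ty_hu_st_sc.SB_F] by blast
qed

text \<open>The fundamental theorem for the type of each binding, in the shorter context, yields
  what it presupposes of the longer one.\<close>

lemma wfc_wfs: "wfc \<Gamma> \<Longrightarrow> wfs \<Gamma>"
proof (induct \<Gamma>)
  case (Cons t \<Gamma>)
  then obtain i where "isty \<Gamma> t i" "wfs \<Gamma>" by auto
  then show ?case using fundamental_aux(1) by (auto simp: ok_def)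
qed simp

lemma fundamental: assumes "wfc \<Gamma>" shows "ty S \<Gamma> e c \<Longrightarrow> sem \<Gamma> e c" "hu S \<Gamma> c i \<Longrightarrow> cinf \<Gamma> c i"
  using fundamental_aux wfc_wfs[OF assms] by blast+

text \<open>Iterating \<open>G_up\<close> relates the variables of a context to themselves, so
  semantic statements can be read off at the identity, in the world given by the context.\<close>

lemma G_id: assumes w: "wfc \<Gamma>" shows "G \<Gamma> \<Gamma> Var Var"
  using w
proof (induct \<Gamma>)
  case Nil
  show ?case by (rule G_Nil)
next
  case (Cons t \<Gamma>)
  then obtain i where g: "G \<Gamma> \<Gamma> Var Var" and t: "isty \<Gamma> t i" and w: "wfc \<Gamma>" by auto
  from G_up[OF g semc_tot[OF fundamental(1)[OF w t]]] show ?case by simp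
qed

lemma ty_BB: "wfc \<Gamma> \<Longrightarrow> ty S \<Gamma> e c \<Longrightarrow> BB \<Gamma> c e"
  using sem_BB[OF fundamental(1) G_id] by simp

lemma ty_reds: "wfc \<Gamma> \<Longrightarrow> ty S \<Gamma> e c \<Longrightarrow> reds S e e' \<Longrightarrow> ty S \<Gamma> e' c"
  using ty_BB BB_D(3) by blast

lemma ty_SN: "wfc \<Gamma> \<Longrightarrow> ty S \<Gamma> e c \<Longrightarrow> SN e"
  using ty_BB BB_D(1) by blast

text \<open>A sum type is an application of a constant, and subsumption may intervene at each
  application, so its components are not read off the derivation. The denotation records them as
  types.\<close>

lemma tsum_inv: assumes w: "wfc \<Gamma>" and t: "isty \<Gamma> (tsum a b) l"
  shows "\<exists>i j. isty \<Gamma> a i \<and> isty \<Gamma> b j"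
proof -
  from semcD[OF semc_tot[OF fundamental(1)[OF w t]] G_id[OF w]] obtain R where "LU l \<Gamma> (tsum a b) R" by (auto simp: LC_Tot)
  from LU_sum_inv[OF this] obtain Ra Rb where R: "LU l \<Gamma> a Ra" "LU l \<Gamma> b Rb" by blast
  from U_BB[OF R(1)] U_BB[OF R(2)] show ?thesis using BB_D(2) by blast
qed

end

section \<open>Well-formed signatures\<close>

definition wt :: "signature \<Rightarrow> tm \<Rightarrow> tm \<Rightarrow> bool" where
  "wt S x T \<longleftrightarrow> ty S [] x (Tot T) \<and> (\<exists>i. ty S [] T (Tot (Ty i)))"

definition eff_typed :: "signature \<Rightarrow> effdef \<Rightarrow> bool" where
  "eff_typed S D \<longleftrightarrow> (\<exists>i. wt S (wp_type D) (arr (Ty 0) (Ty i))) \<and> wt S (repr D) (Pi (Ty 0) (Tot (arr (wp_type D \<cdot> Var 0) (Ty 0)))) \<and>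
     wt S (ret_star D) (ret_star_type D) \<and> wt S (bnd_star D) (bnd_star_type D) \<and> wt S (ret D) (ret_type D) \<and> wt S (bnd D) (bnd_type D)"

definition act_typed :: "signature \<Rightarrow> ename \<Rightarrow> effdef \<Rightarrow> action \<Rightarrow> bool" where
  "act_typed S F D A \<longleftrightarrow> (\<forall>i<length (act_params A). \<exists>j. ty S (rev (take i (act_params A))) (act_params A ! i) (Tot (Ty j))) \<and>
     (\<exists>t wp. act_comp A = Comp (Usr F) t wp \<and> ty S (rev (act_params A)) t (Tot (Ty 0)) \<and> ty S (rev (act_params A)) wp (Tot (wp_type D \<cdot> t)) \<and>
        wt S (act_impl A) (pis (act_params A) (repr D \<cdot> t \<cdot> wp)))"

definition lift_typed :: "signature \<Rightarrow> eff \<Rightarrow> eff \<Rightarrow> tm \<Rightarrow> tm \<Rightarrow> bool" where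
  "lift_typed S M M' l ls \<longleftrightarrow> M' \<noteq> Pure \<and> (\<exists>W W' R R'. wp_type_of S M = Some W \<and> wp_type_of S M' = Some W' \<and>
     rep_type S M (Var 1) (Var 0) = Some R \<and> rep_type S M' (Var 2) (ls \<cdot> Var 2 \<cdot> Var 1) = Some R' \<and>
     wt S ls (Pi (Ty 0) (Tot (arr (W \<cdot> Var 0) (W' \<cdot> Var 0)))) \<and> wt S l (pis [Ty 0, W \<cdot> Var 0, R] R'))"

text \<open>The fields are to be typed in the whole signature rather than in the part preceding
  them, because the unfoldings in the rules of \<open>ty\<close> are typed there.\<close>

definition sig_typed :: "signature \<Rightarrow> bool" where
  "sig_typed S \<longleftrightarrow> (\<forall>F D. eff_of S F = Some D \<longrightarrow> eff_typed S D) \<and>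
     (\<forall>F D a A. eff_of S F = Some D \<longrightarrow> act_of S F a = Some A \<longrightarrow> act_typed S F D A) \<and>
     (\<forall>M M' l ls. lift_of S M M' = Some (l, ls) \<longrightarrow> lift_typed S M M' l ls)"

text \<open>Instantiates a telescope from its outermost parameter inwards, as typing an iterated
  application does; \<open>args_asub\<close> identifies it with the instantiation used by
  actions.\<close>

definition asub :: "(nat \<Rightarrow> tm) \<Rightarrow> tm list \<Rightarrow> nat \<Rightarrow> tm" where
  "asub \<sigma> es = foldl (\<lambda>\<sigma> e. scons e \<sigma>) \<sigma> es"

lemma asub_simps [simp]: "asub \<sigma> [] = \<sigma>" "asub \<sigma> (e # es) = asub (scons e \<sigma>) es"
  by (simp_all add: asub_def)

context sigc begin

lemma args_asub: "args es = asub Var es"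
proof (induct es rule: rev_induct)
  case Nil
  show ?case by (rule ext) (simp add: args_def)
next
  case (snoc e es)
  then show ?case by (simp add: args_snoc asub_def)
qed

lemma wt_ctx: assumes "wt S x T" shows "tyt \<Gamma> x T" "\<exists>i. isty \<Gamma> T i" "closed x" "closed T"
proof -
  obtain i where T: "tyt [] x T" "isty [] T i" using assms by (auto simp: wt_def)
  show c: "closed x" "closed T" using ty_scoped(1)[OF T(1)] ty_scoped(1)[OF T(2)] by simp_all
  have s: "tsb \<Gamma> Var []" by (simp add: tsb_def)
  show "tyt \<Gamma> x T" "\<exists>i. isty \<Gamma> T i" using ty_sub(1)[OF s T(1)] ty_sub(1)[OF s T(2)] by auto
qed

text \<open>The substitution \<open>\<sigma>\<close> collects the arguments already consumed, so the
  induction never has to instantiate the remaining telescope.\<close>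

lemma ty_pis:
  "tyt \<Gamma> f (sub \<sigma> (pis P X)) \<Longrightarrow> isty \<Gamma> (sub \<sigma> (pis P X)) i \<Longrightarrow> length es = length P \<Longrightarrow>
   \<forall>k<length P. tyt \<Gamma> (es ! k) (sub (asub \<sigma> (take k es)) (P ! k)) \<Longrightarrow>
   tyt \<Gamma> (apps f es) (sub (asub \<sigma> es) X) \<and> (\<exists>i. isty \<Gamma> (sub (asub \<sigma> es) X) i)"
proof (induct P arbitrary: f \<sigma> es i)
  case Nil
  then show ?case by (auto simp: pis_def)
next
  case (Cons t P)
  obtain e es' where es: "es = e # es'" using Cons(4) by (cases es) auto
  let ?C = "Tot (sub (ups \<sigma>) (pis P X))"
  have pis: "sub \<sigma> (pis (t # P) X) = Pi (sub \<sigma> t) ?C" by (simp add: pis_def)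
  from pi_inv[OF Cons(3)[unfolded pis]] obtain i j where F: "isty \<Gamma> (sub \<sigma> t) i" "hu S (sub \<sigma> t # \<Gamma>) ?C j" by blast
  have e: "tyt \<Gamma> e (sub \<sigma> t)" using Cons(5)[rule_format, of 0] es by simp
  have 1: "tyt \<Gamma> (f \<cdot> e) (sub (scons e \<sigma>) (pis P X))" using Y_App[OF Cons(2)[unfolded pis] e F] by (simp add: inst_ups)
  have 2: "isty \<Gamma> (sub (scons e \<sigma>) (pis P X)) j" using hu_inv(1) hu_inst[OF F(2) e] by (simp add: inst_ups)
  have 3: "\<forall>k<length P. tyt \<Gamma> (es' ! k) (sub (asub (scons e \<sigma>) (take k es')) (P ! k))"
  proof (intro allI impI)
    fix k assume "k < length P"
    then show "tyt \<Gamma> (es' ! k) (sub (asub (scons e \<sigma>) (take k es')) (P ! k))" using Cons(5)[rule_format, of "Suc k"] es by simp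
  qed
  from Cons(1)[OF 1 2 _ 3] show ?case using Cons(4) es by simp
qed

lemma wt_pis:
  assumes f: "wt S f (pis P X)" and len: "length es = length P" and es: "\<forall>k<length P. tyt \<Gamma> (es ! k) (sub (asub Var (take k es)) (P ! k))"
  shows "tyt \<Gamma> (apps f es) (sub (asub Var es) X)" "\<exists>i. isty \<Gamma> (sub (asub Var es) X) i"
proof -
  obtain i where "isty \<Gamma> (pis P X) i" using wt_ctx(2)[OF f] by blast
  from ty_pis[of \<Gamma> f Var P X i es] this wt_ctx(1)[OF f] len es
  show "tyt \<Gamma> (apps f es) (sub (asub Var es) X)" "\<exists>i. isty \<Gamma> (sub (asub Var es) X) i" by auto
qed

lemma wfc_nth: "wfc \<Gamma> \<Longrightarrow> n < length \<Gamma> \<Longrightarrow> \<exists>i. isty \<Gamma> (lk \<Gamma> n) i"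
  using wfs_nth[OF wfc_wfs] okD(1) by blast

text \<open>Narrowing as a substitution: the variable of the smaller type also has the larger one,
  so the identity is a typed substitution between the two contexts.\<close>

lemma narrow:
  assumes s: "st S \<Gamma> t t'" and t: "isty \<Gamma> t i" and t': "isty \<Gamma> t' j" and c: "hu S (t' # \<Gamma>) c k"
  shows "hu S (t # \<Gamma>) c k"
proof -
  have "tyt (t # \<Gamma>) (Var 0) (sh t)" by (rule ty_v) simp_all
  from ty_st[OF this ty_ren(3)[OF wk_Suc s]] ty_ren(1)[OF wk_Suc t, of t] ty_ren(1)[OF wk_Suc t', of t]
  have "tyt (t # \<Gamma>) (Var 0) (sub (\<lambda>n. Var (Suc n)) t')" by simp
  with tsb_cons[OF tsb_ren[OF tsb_Var wk_Suc[of \<Gamma> t]], of "Var 0" t'] have "tsb (t # \<Gamma>) (scons (Var 0) (\<lambda>n. Var (Suc n))) (t' # \<Gamma>)" by simp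
  moreover have "scons (Var 0) (\<lambda>n. Var (Suc n)) = Var" by (rule nat_ext) simp_all
  ultimately show ?thesis using ty_sub(2)[OF _ c] by fastforce
qed

text \<open>Types of pure specifications occur folded in the rule for bind and unfolded in the
  well-formedness of \<open>Pure\<close> types; conversion mediates between the two forms.\<close>

lemma pw_cv: assumes t: "isty \<Gamma> t 0" shows "cv \<Gamma> (Tot (Ty (Suc 0))) (pure_wp_type \<cdot> t) (arr (arr t (Ty 0)) (Ty 0))"
proof -
  have u: "isty \<Gamma> (Ty 0) (Suc 0)" for \<Gamma> by (rule Y_Univ)
  have v: "isty (Ty 0 # \<Gamma>) (Var 0) 0" by (rule ty_v) simp_all
  have b: "isty (Ty 0 # \<Gamma>) (arr (arr (Var 0) (Ty 0)) (Ty 0)) (Suc 0)" using ty_arr[OF ty_arr[OF v u] u] by simp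
  have 1: "isty \<Gamma> (pure_wp_type \<cdot> t) (Suc 0)"
    unfolding pure_wp_type_def using Y_App[OF Y_Lam[OF u hu_Ty b] t u hu_Ty] by simp
  have 2: "isty \<Gamma> (arr (arr t (Ty 0)) (Ty 0)) (Suc 0)" using ty_arr[OF ty_arr[OF t u] u] by simp
  have "red S (pure_wp_type \<cdot> t) (arr (arr t (Ty 0)) (Ty 0))"
    unfolding pure_wp_type_def using R_Beta[of S "Ty 0" "arr (arr (Var 0) (Ty 0)) (Ty 0)" t] by (simp add: inst_def)
  then show ?thesis using cv_red[OF 1 2] by blast
qed

lemma wt_pure_wp: "wt S pure_wp_type (arr (Ty 0) (Ty (Suc 0)))"
proof -
  have u: "isty \<Gamma> (Ty i) (Suc i)" for \<Gamma> i by (rule Y_Univ)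
  have v: "isty [Ty 0] (Var 0) 0" by (rule ty_v) simp_all
  have b: "isty [Ty 0] (arr (arr (Var 0) (Ty 0)) (Ty 0)) (Suc 0)" using ty_arr[OF ty_arr[OF v u] u, of 0 0] by simp
  show ?thesis unfolding wt_def using Y_Lam[OF u hu_Ty b] ty_arr[OF u u] unfolding pure_wp_type_def by auto
qed

lemma pw_ty: assumes "isty \<Gamma> t 0" shows "isty \<Gamma> (pure_wp_type \<cdot> t) (Suc 0)"
  by (rule cv_ty1[OF pw_cv[OF assms]])

lemma hu_comp_pure: "isty \<Gamma> t 0 \<Longrightarrow> tyt \<Gamma> w (pure_wp_type \<cdot> t) \<Longrightarrow> hu S \<Gamma> (Comp Pure t w) 0"
  using H_Pure ty_conv pw_cv by blast

lemma pis_simps [simp]: "pis [] X = X" "pis (t # ts) X = Pi t (Tot (pis ts X))"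
  by (simp_all add: pis_def)

lemma wt_pure_ret_star: "wt S pure_ret_star (pis [Ty 0, Var 0] (pure_wp_type \<cdot> Var (Suc 0)))"
proof -
  let ?p = "Suc 0" let ?q = "Suc ?p" let ?G1 = "[Ty 0]" let ?G2 = "[Var 0, Ty 0]" let ?A = "arr (Var ?p) (Ty 0)" let ?G3 = "?A # ?G2"
  have u: "isty \<Gamma> (Ty i) (Suc i)" for \<Gamma> i by (rule Y_Univ)
  have v: "isty ?G1 (Var 0) 0" "isty ?G2 (Var ?p) 0" "isty ?G3 (Var ?q) 0" "tyt ?G3 (Var ?p) (Var ?q)"
    "tyt ?G3 (Var 0) (arr (Var ?q) (Ty 0))" by (rule ty_v; simp)+
  have A: "isty ?G2 ?A ?p" using ty_arr[OF v(2) u, of 0] by simp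
  have "isty ?G3 (Var 0 \<cdot> Var ?p) 0" by (rule ty_arr_app[OF v(5,4,3) u])
  from Y_Lam[OF A hu_Ty this] have "tyt ?G2 (Lam ?A (Var 0 \<cdot> Var ?p)) (arr ?A (Ty 0))" by simp
  from ty_conv[OF this cv_sym[OF pw_cv[OF v(2)]]] have 1: "tyt ?G2 (Lam ?A (Var 0 \<cdot> Var ?p)) (pure_wp_type \<cdot> Var ?p)" .
  note 2 = H_Tot[OF pw_ty[OF v(2)]]
  from Y_Lam[OF u H_Tot[OF Y_Pi[OF v(1) 2]] Y_Lam[OF v(1) 2 1]] Y_Pi[OF u H_Tot[OF Y_Pi[OF v(1) 2]]]
  show ?thesis unfolding wt_def pure_ret_star_def by auto
qed

lemma wt_pure_bnd_star: "wt S pure_bnd_star (pis [Ty 0, Ty 0, pure_wp_type \<cdot> Var (Suc 0), arr (Var (Suc (Suc 0))) (pure_wp_type \<cdot> Var (Suc 0))] (pure_wp_type \<cdot> Var (Suc (Suc 0))))"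
proof -
  let ?p = "Suc 0" let ?q = "Suc ?p" let ?r = "Suc ?q" let ?s = "Suc ?r" let ?t = "Suc ?s" let ?w = pure_wp_type
  let ?G1 = "[Ty 0]" let ?G2 = "[Ty 0, Ty 0]" let ?G3 = "?w \<cdot> Var ?p # ?G2" let ?A = "arr (Var ?q) (?w \<cdot> Var ?p)" let ?G4 = "?A # ?G3"
  let ?B = "arr (Var ?q) (Ty 0)" let ?G5 = "?B # ?G4" let ?G6 = "Var ?s # ?G5"
  note cw = closed_pure(1)[THEN closed_ren]
  have u: "isty \<Gamma> (Ty i) (Suc i)" for \<Gamma> i by (rule Y_Univ)
  have v: "isty ?G2 (Var ?p) 0" "isty ?G3 (Var ?p) 0" "isty ?G3 (Var ?q) 0" "isty ?G4 (Var ?q) 0"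
    "isty ?G5 (Var ?s) 0" "isty ?G6 (Var ?s) 0" "isty ?G6 (Var ?t) 0"
    "tyt ?G6 (Var ?q) (arr (Var ?t) (?w \<cdot> Var ?s))" "tyt ?G6 (Var 0) (Var ?t)" "tyt ?G6 (Var ?p) (arr (Var ?s) (Ty 0))"
    "tyt ?G5 (Var ?q) (?w \<cdot> Var ?s)" by (rule ty_v; simp add: cw)+
  have A: "isty ?G3 ?A ?p" using ty_arr[OF v(3) pw_ty[OF v(2)]] by simp
  have B: "isty ?G4 ?B ?p" using ty_arr[OF v(4) u, of 0] by simp
  have "tyt ?G6 (Var ?q \<cdot> Var 0) (?w \<cdot> Var ?s)" by (rule ty_arr_app[OF v(8,9,7) pw_ty[OF v(6)]])
  from ty_conv[OF this pw_cv[OF v(6)]] have "isty ?G6 (Var ?q \<cdot> Var 0 \<cdot> Var ?p) 0" by (rule ty_arr_app[OF _ v(10) ty_arr[OF v(6) u] u])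
  from Y_Lam[OF v(5) hu_Ty this] have "tyt ?G5 (Lam (Var ?s) (Var ?q \<cdot> Var 0 \<cdot> Var ?p)) (arr (Var ?s) (Ty 0))" by simp
  from ty_arr_app[OF ty_conv[OF v(11) pw_cv[OF v(5)]] this ty_arr[OF v(5) u] u]
  have "isty ?G5 (Var ?q \<cdot> Lam (Var ?s) (Var ?q \<cdot> Var 0 \<cdot> Var ?p)) 0" .
  from Y_Lam[OF B hu_Ty this] have "tyt ?G4 (Lam ?B (Var ?q \<cdot> Lam (Var ?s) (Var ?q \<cdot> Var 0 \<cdot> Var ?p))) (arr ?B (Ty 0))" by simp
  note 4 = ty_conv[OF this cv_sym[OF pw_cv[OF v(4)]]]
  note h4 = H_Tot[OF pw_ty[OF v(4)]]
  note 3 = Y_Lam[OF A h4 4] and h3 = H_Tot[OF Y_Pi[OF A h4]]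
  note 2 = Y_Lam[OF pw_ty[OF v(1)] h3 3] and h2 = H_Tot[OF Y_Pi[OF pw_ty[OF v(1)] h3]]
  note 1 = Y_Lam[OF u h2 2] and h1 = H_Tot[OF Y_Pi[OF u h2]]
  from Y_Lam[OF u h1 1] Y_Pi[OF u h1]
  show ?thesis unfolding wt_def pure_bnd_star_def by (auto simp: numeral_eq_Suc)
qed

end

section \<open>Presuppositions of derivations over a typed signature\<close>

locale sigt = sigc +
  assumes sty: "sig_typed S"
begin

lemma effD:
  assumes "eff_of S F = Some D"
  shows "\<exists>i. wt S (wp_type D) (arr (Ty 0) (Ty i))" "wt S (repr D) (pis [Ty 0, wp_type D \<cdot> Var 0] (Ty 0))"
    "wt S (ret_star D) (ret_star_type D)" "wt S (bnd_star D) (bnd_star_type D)" "wt S (ret D) (ret_type D)" "wt S (bnd D) (bnd_type D)"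
  using sty assms unfolding sig_typed_def eff_typed_def by auto

lemma wpD: "wp_type_of S M = Some W \<Longrightarrow> \<exists>i. wt S W (arr (Ty 0) (Ty i))"
  using effD(1) wt_pure_wp by (cases M) auto

lemma ty_W: assumes W: "wp_type_of S M = Some W" and t: "isty \<Gamma> t 0" shows "\<exists>k. isty \<Gamma> (W \<cdot> t) k"
proof -
  obtain i where "wt S W (arr (Ty 0) (Ty i))" using wpD[OF W] by blast
  from ty_arr_app[OF wt_ctx(1)[OF this] t Y_Univ Y_Univ] show ?thesis by blast
qed

lemma repr_ty: assumes D: "eff_of S F = Some D" and t: "isty \<Gamma> t 0" and w: "tyt \<Gamma> w (wp_type D \<cdot> t)"
  shows "isty \<Gamma> (repr D \<cdot> t \<cdot> w) 0"
  using wt_pis(1)[OF effD(2)[OF D], of "[t, w]" \<Gamma>] t w csD(1)[OF D] by (simp add: All_less_Suc2 closed_sub)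

lemma hu_comp: assumes W: "wp_type_of S M = Some W" and t: "isty \<Gamma> t 0" and w: "tyt \<Gamma> w (W \<cdot> t)"
  shows "hu S \<Gamma> (Comp M t w) 0"
proof (cases M)
  case Pure
  then show ?thesis using hu_comp_pure t w W by simp
next
  case (Usr F)
  then obtain D where D: "eff_of S F = Some D" "W = wp_type D" using W by auto
  then show ?thesis using H_F[OF D(1) t _ repr_ty[OF D(1) t]] w Usr by simp
qed

lemma hu_comp_wp: assumes W: "wp_type_of S M = Some W" and h: "hu S \<Gamma> (Comp M t w) i" shows "tyt \<Gamma> w (W \<cdot> t)"
proof (cases M)
  case Pure
  then show ?thesis using ty_conv[OF _ cv_sym[OF pw_cv]] hu_inv(2) h W by (auto simp del: pure_wp_type_def)
next
  case (Usr F)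
  then show ?thesis using hu_inv(3) h W by fastforce
qed

lemma ret_star_ty: assumes r: "ret_star_of S M = Some r" and W: "wp_type_of S M = Some W" and t: "isty \<Gamma> t 0" and e: "tyt \<Gamma> e t"
  shows "tyt \<Gamma> (r \<cdot> t \<cdot> e) (W \<cdot> t)"
proof -
  have "wt S r (pis [Ty 0, Var 0] (W \<cdot> Var (Suc 0)))" using r W effD(3) wt_pure_ret_star by (cases M) (auto simp: ret_star_type_def)
  from wt_pis(1)[OF this, of "[t, e]" \<Gamma>] t e csD(12)[OF W] show ?thesis by (simp add: All_less_Suc2 closed_sub)
qed

lemma bnd_star_ty:
  assumes b: "bnd_star_of S M = Some b" and W: "wp_type_of S M = Some W" and t: "isty \<Gamma> t1 0" "isty \<Gamma> t2 0"
    and w: "tyt \<Gamma> w1 (W \<cdot> t1)" "tyt \<Gamma> w2 (arr t1 (W \<cdot> t2))"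
  shows "tyt \<Gamma> (apps b [t1, t2, w1, w2]) (W \<cdot> t2)"
proof -
  have "wt S b (pis [Ty 0, Ty 0, W \<cdot> Var (Suc 0), arr (Var (Suc (Suc 0))) (W \<cdot> Var (Suc 0))] (W \<cdot> Var (Suc (Suc 0))))"
    using b W effD(4) wt_pure_bnd_star by (cases M) (auto simp: bnd_star_type_def numeral_eq_Suc)
  from wt_pis(1)[OF this, of "[t1, t2, w1, w2]" \<Gamma>] t w csD(12)[OF W] show ?thesis by (simp add: All_less_Suc2 closed_sub closed_ren)
qed

lemma ret_ty: assumes D: "eff_of S F = Some D" and t: "isty \<Gamma> t 0" and e: "tyt \<Gamma> e t"
  shows "tyt \<Gamma> (apps (ret D) [t, e]) (repr D \<cdot> t \<cdot> (ret_star D \<cdot> t \<cdot> e))"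
  using wt_pis(1)[OF effD(5)[OF D, unfolded ret_type_def], of "[t, e]" \<Gamma>] t e csD(2,4)[OF D] by (simp add: All_less_Suc2 closed_sub)

lemma bnd_ty:
  assumes D: "eff_of S F = Some D" and t: "isty \<Gamma> t1 0" "isty \<Gamma> t2 0" and w: "tyt \<Gamma> w2 (arr t1 (wp_type D \<cdot> t2))"
    and e1: "ty S \<Gamma> e1 (Comp (Usr F) t1 w1)" "hu S \<Gamma> (Comp (Usr F) t1 w1) 0"
    and e2: "ty S (t1 # \<Gamma>) e2 (Comp (Usr F) (sh t2) (sh w2 \<cdot> Var 0))" "hu S (t1 # \<Gamma>) (Comp (Usr F) (sh t2) (sh w2 \<cdot> Var 0)) 0"
  shows "tyt \<Gamma> (apps (bnd D) [t1, t2, w1, Reify e1, w2, Lam t1 (Reify e2)]) (repr D \<cdot> t2 \<cdot> apps (bnd_star D) [t1, t2, w1, w2])"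
proof -
  have w1: "tyt \<Gamma> w1 (wp_type D \<cdot> t1)" using hu_inv(3)[OF e1(2)] D by auto
  have r: "hu S (t1 # \<Gamma>) (Tot (repr D \<cdot> sh t2 \<cdot> (sh w2 \<cdot> Var 0))) 0" using hu_inv(3)[OF e2(2)] D H_Tot by auto
  from Y_Lam[OF t(1) r Y_Reify[OF D e2]] Y_Reify[OF D e1]
  show ?thesis using wt_pis(1)[OF effD(6)[OF D, unfolded bnd_type_def], of "[t1, t2, w1, Reify e1, w2, Lam t1 (Reify e2)]" \<Gamma>] t w w1 csD(1,2,6)[OF D]
    by (simp add: All_less_Suc2 closed_sub closed_ren numeral_eq_Suc)
qed

lemma lift_ty:
  assumes l: "lift_of S M M' = Some (l, ls)" and e: "ty S \<Gamma> e (Comp M t w)" "hu S \<Gamma> (Comp M t w) 0"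
  shows "\<exists>F D. M' = Usr F \<and> eff_of S F = Some D \<and> hu S \<Gamma> (Comp (Usr F) t (ls \<cdot> t \<cdot> w)) 0 \<and>
    tyt \<Gamma> (apps l [t, w, rep M e]) (repr D \<cdot> t \<cdot> (ls \<cdot> t \<cdot> w))"
proof -
  from sty l have "lift_typed S M M' l ls" unfolding sig_typed_def by blast
  then obtain W W' R R' where H: "M' \<noteq> Pure" "wp_type_of S M = Some W" "wp_type_of S M' = Some W'"
    "rep_type S M (Var 1) (Var 0) = Some R" "rep_type S M' (Var 2) (ls \<cdot> Var 2 \<cdot> Var 1) = Some R'"
    "wt S ls (pis [Ty 0, W \<cdot> Var 0] (W' \<cdot> Var (Suc 0)))" "wt S l (pis [Ty 0, W \<cdot> Var 0, R] R')"
    unfolding lift_typed_def by (auto simp: closed_ren[OF csD(12)])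
  then obtain F D where F: "M' = Usr F" "eff_of S F = Some D" "W' = wp_type D" by (cases M') auto
  note t = hu_t(1)[OF e(2)] and w = hu_comp_wp[OF H(2) e(2)]
  note cl = csD(12)[OF H(2)] csD(1,2)[OF F(2)] csD(7,8)[OF l]
  have 1: "tyt \<Gamma> (ls \<cdot> t \<cdot> w) (wp_type D \<cdot> t)"
    using wt_pis(1)[OF H(6), of "[t, w]" \<Gamma>] t w cl F(3) by (simp add: All_less_Suc2 closed_sub)
  have r: "tyt \<Gamma> (rep M e) (sub (scons w (scons t Var)) R)"
  proof (cases M)
    case Pure
    have "hu S (tunit # \<Gamma>) (Comp Pure (sh t) (sh w)) 0" "ty S (tunit # \<Gamma>) (sh e) (Comp Pure (sh t) (sh w))"
      using ty_ren(2)[OF wk_Suc e(2), of tunit] ty_ren(1)[OF wk_Suc e(1), of tunit] Pure by simp_all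
    from Y_Lam[OF ty_unit this] show ?thesis using H(4) Pure by auto
  next
    case (Usr G)
    then obtain D' where D': "eff_of S G = Some D'" using H(2) by auto
    then have "R = repr D' \<cdot> Var (Suc 0) \<cdot> Var 0" using H(4) Usr by simp
    then show ?thesis using Y_Reify[OF D' e[unfolded Usr]] Usr csD(2)[OF D'] by (simp add: closed_sub)
  qed
  have R': "R' = repr D \<cdot> Var (Suc (Suc 0)) \<cdot> (ls \<cdot> Var (Suc (Suc 0)) \<cdot> Var (Suc 0))" using H(5) F by (simp add: numeral_eq_Suc)
  have "tyt \<Gamma> (apps l [t, w, rep M e]) (repr D \<cdot> t \<cdot> (ls \<cdot> t \<cdot> w))"
    using wt_pis(1)[OF H(7), of "[t, w, rep M e]" \<Gamma>] t w r cl R' by (simp add: All_less_Suc2 closed_sub)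
  then show ?thesis using F H_F[OF F(2) t 1 repr_ty[OF F(2) t 1]] by blast
qed

lemma act_ty:
  assumes A: "act_of S F a = Some A" and len: "length es = length (act_params A)"
    and es: "\<forall>i<length es. tyt \<Gamma> (es ! i) (sub (args (take i es)) (act_params A ! i))"
  shows "\<exists>j. ty S \<Gamma> (Act F a es) (subc (args es) (act_comp A)) \<and> hu S \<Gamma> (subc (args es) (act_comp A)) j"
proof -
  obtain D where D: "eff_of S F = Some D" using A by (auto simp: act_of_def split: option.splits)
  from sty A D have "act_typed S F D A" unfolding sig_typed_def by blast
  then obtain t wp where P: "\<forall>i<length (act_params A). \<exists>j. isty (rev (take i (act_params A))) (act_params A ! i) j"
    and c: "act_comp A = Comp (Usr F) t wp" and t: "isty (rev (act_params A)) t 0" and wp: "tyt (rev (act_params A)) wp (wp_type D \<cdot> t)"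
    and impl: "wt S (act_impl A) (pis (act_params A) (repr D \<cdot> t \<cdot> wp))" unfolding act_typed_def by blast
  have h0: "hu S (rev (act_params A)) (act_comp A) 0" unfolding c by (rule H_F[OF D t wp repr_ty[OF D t wp]])
  have "wfc (rev (take (length es) (act_params A))) \<and> scv \<Gamma> (rev (take (length es) (act_params A))) (args (take (length es) es)) (args (take (length es) es))"
    by (rule args_scv[OF len len P]) (use es len cv_refl in auto)
  then have tsb: "tsb \<Gamma> (args es) (rev (act_params A))" using len by (simp add: scv_def)
  have h: "hu S \<Gamma> (Comp (Usr F) (sub (args es) t) (sub (args es) wp)) 0" using ty_sub(2)[OF tsb h0] by (simp add: c)
  have d: "tyt \<Gamma> (apps (act_impl A) es) (repr D \<cdot> sub (args es) t \<cdot> sub (args es) wp)"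
    using wt_pis(1)[OF impl len, of \<Gamma>] es len csD(2)[OF D] by (simp add: args_asub closed_sub)
  show ?thesis using Y_Act[OF A D len es _ c h0 h d] h P len by (auto simp: c)
qed

text \<open>Well-formedness of the assigned types is proved together with the translation, and the
  typed fields supply the unfoldings. Subtyping is translated only between well-formed types; the
  intermediate types of transitivity are well formed by its rule.\<close>

lemma ty_of_orig:
  "typing S \<Gamma> e c \<Longrightarrow> wfc \<Gamma> \<longrightarrow> ty S \<Gamma> e c \<and> (\<exists>j. hu S \<Gamma> c j)"
  "has_univ S \<Gamma> c i \<Longrightarrow> wfc \<Gamma> \<longrightarrow> hu S \<Gamma> c i"
  "subtype S \<Gamma> X Y \<Longrightarrow> wfc \<Gamma> \<longrightarrow> (\<exists>i. isty \<Gamma> X i) \<longrightarrow> (\<exists>i. isty \<Gamma> Y i) \<longrightarrow> st S \<Gamma> X Y"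
  "subcomp S \<Gamma> c1 c2 \<Longrightarrow> wfc \<Gamma> \<longrightarrow> (\<exists>i. hu S \<Gamma> c1 i) \<longrightarrow> (\<exists>i. hu S \<Gamma> c2 i) \<longrightarrow> sc S \<Gamma> c1 c2"
  "valid S \<Gamma> \<phi> \<Longrightarrow> True"
proof (induct rule: typing_has_univ_subtype_subcomp_valid.inducts)
  case (T_Var n \<Gamma>)
  show ?case
  proof
    assume "wfc \<Gamma>"
    from wfc_nth[OF this T_Var] obtain i where "isty \<Gamma> (lk \<Gamma> n) i" by blast
    from Y_Var[OF T_Var] H_Tot[OF this]
    show "tyt \<Gamma> (Var n) (lk \<Gamma> n) \<and> (\<exists>j. hu S \<Gamma> (Tot (lk \<Gamma> n)) j)" by blast
  qed
next
  case (T_Con k t \<Gamma>)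
  obtain i where i: "isty \<Gamma> t i" using const_type_ty[OF T_Con] by blast
  have "tyt \<Gamma> (Con k) t"
  proof (cases "\<forall>i. k \<noteq> Univ i")
    case True
    then show ?thesis using Y_Con[OF T_Con True i] by blast
  next
    case False
    then show ?thesis using T_Con by (auto elim: const_type.cases intro: Y_Univ)
  qed
  then show ?case using H_Tot[OF i] by blast
next
  case (T_Pi \<Gamma> t i c j)
  then show ?case using Y_Pi[of S \<Gamma> t i c j] hu_Ty by auto
next
  case (T_Refine \<Gamma> t i \<phi> j)
  then show ?case using Y_Refine[of S \<Gamma> t i \<phi> j] hu_Ty by auto
next
  case (T_Lam \<Gamma> t i e c)
  then show ?case using Y_Lam[of S \<Gamma> t i c _ e] H_Tot Y_Pi by (metis wfc.simps(2))
next
  case (T_App \<Gamma> e1 t c e2)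
  show ?case
  proof
    assume "wfc \<Gamma>"
    then obtain i j where 1: "tyt \<Gamma> e1 (Pi t c)" "tyt \<Gamma> e2 t" and 2: "isty \<Gamma> t i" "hu S (t # \<Gamma>) c j"
      using T_App pi_inv hu_inv(1) by meson
    show "ty S \<Gamma> (e1 \<cdot> e2) (instc c e2) \<and> (\<exists>k. hu S \<Gamma> (instc c e2) k)" using Y_App[OF 1 2] hu_inst[OF 2(2) 1(2)] by blast
  qed
next
  case (T_CaseTot \<Gamma> e t1 t2 t k e1 e2)
  show ?case
  proof
    assume w: "wfc \<Gamma>"
    then obtain l where e: "tyt \<Gamma> e (tsum t1 t2)" "isty \<Gamma> (tsum t1 t2) l" using T_CaseTot(2) hu_inv(1) by blast
    \<comment> \<open>The branches live in contexts extended by the components of the sum, whose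
      well-formedness is obtained from the semantic inversion.\<close>
    obtain i j where t: "isty \<Gamma> t1 i" "isty \<Gamma> t2 j" using tsum_inv[OF w e(2)] by blast
    have w': "wfc (tsum t1 t2 # \<Gamma>)" "wfc (t1 # \<Gamma>)" "wfc (t2 # \<Gamma>)" using w e t by auto
    have m: "isty (tsum t1 t2 # \<Gamma>) t k" using T_CaseTot(4) w'(1) by blast
    have "tyt \<Gamma> (Case t e e1 e2) (inst t e)"
      by (rule Y_CaseTot[OF e(1) t e(2) m]) (use T_CaseTot(6,8) w' in blast)+
    then show "tyt \<Gamma> (Case t e e1 e2) (inst t e) \<and> (\<exists>k. hu S \<Gamma> (Tot (inst t e)) k)" using hu_inst[OF H_Tot[OF m] e(1)] by auto
  qed
next
  case (T_CaseComp \<Gamma> e t1 t2 t M W e1 wp1 e2 wp2)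
  note H = T_CaseComp
  show ?case
  proof
    assume w: "wfc \<Gamma>"
    then obtain l where e: "tyt \<Gamma> e (tsum t1 t2)" "isty \<Gamma> (tsum t1 t2) l" using H(2) hu_inv(1) by blast
    obtain i j where t: "isty \<Gamma> t1 i" "isty \<Gamma> t2 j" using tsum_inv[OF w e(2)] by blast
    have w': "wfc (t1 # \<Gamma>)" "wfc (t2 # \<Gamma>)" using w e t by auto
    have tt: "isty \<Gamma> t 0" using H(4) w by blast
    obtain k where Wt: "isty \<Gamma> (W \<cdot> t) k" using ty_W[OF H(5) tt] by blast
    have b: "ty S (t1 # \<Gamma>) e1 (Comp M (sh t) wp1)" "hu S (t1 # \<Gamma>) (Comp M (sh t) wp1) 0" "ty S (t2 # \<Gamma>) e2 (Comp M (sh t) wp2)" "hu S (t2 # \<Gamma>) (Comp M (sh t) wp2) 0"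
      using H(7,9) w' hu_t(2) by blast+
    have sW: "sh (W \<cdot> t) = W \<cdot> sh t" using csD(12)[OF H(5)] by (simp add: closed_ren)
    have wp: "tyt (t1 # \<Gamma>) wp1 (sh (W \<cdot> t))" "tyt (t2 # \<Gamma>) wp2 (sh (W \<cdot> t))"
      unfolding sW by (rule hu_comp_wp[OF H(5) b(2)], rule hu_comp_wp[OF H(5) b(4)])
    have "isty (tsum t1 t2 # \<Gamma>) (sh (W \<cdot> t)) k" using ty_ren(1)[OF wk_Suc Wt] by simp
    \<comment> \<open>The specification is typed as a dependent case analysis whose motive is
      constant.\<close>
    from Y_CaseTot[OF e(1) t e(2) this, of wp1 wp2] wp have "tyt \<Gamma> (Case (sh (W \<cdot> t)) e wp1 wp2) (W \<cdot> t)"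
      by (simp add: sub_ren del: ren.simps) 
    from hu_comp[OF H(5) tt this] have h: "hu S \<Gamma> (Comp M t (Case (sh (W \<cdot> t)) e wp1 wp2)) 0" .
    show "ty S \<Gamma> (Case (sh t) e e1 e2) (Comp M t (Case (sh (W \<cdot> t)) e wp1 wp2)) \<and> (\<exists>k. hu S \<Gamma> (Comp M t (Case (sh (W \<cdot> t)) e wp1 wp2)) k)"
      using Y_CaseComp[OF e(1) t e(2) tt H(5) Wt b(1,3) wp b(2,4) h] h by blast
  qed
next
  case (T_Return M r \<Gamma> t e)
  show ?case
  proof
    assume w: "wfc \<Gamma>"
    then have t: "isty \<Gamma> t 0" and e: "tyt \<Gamma> e t" using T_Return by blast+
    obtain W where W: "wp_type_of S M = Some W" using T_Return(1) by (cases M) auto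
    note h = hu_comp[OF W t ret_star_ty[OF T_Return(1) W t e]]
    have "ty S \<Gamma> (Return M t e) (Comp M t (r \<cdot> t \<cdot> e))"
    proof (cases M)
      case Pure
      then show ?thesis using Y_ReturnP[OF t e] h T_Return(1) by simp
    next
      case (Usr F)
      then obtain D where D: "eff_of S F = Some D" "r = ret_star D" using T_Return(1) by auto
      show ?thesis using Y_ReturnF[OF D(1) t e _ ret_ty[OF D(1) t e]] h Usr D by simp
    qed
    then show "ty S \<Gamma> (Return M t e) (Comp M t (r \<cdot> t \<cdot> e)) \<and> (\<exists>k. hu S \<Gamma> (Comp M t (r \<cdot> t \<cdot> e)) k)" using h by blast
  qed
next
  case (T_Bind M W b \<Gamma> t2 wp2 t1 e1 wp1 e2)
  note H = T_Bind
  show ?case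
  proof
    assume w: "wfc \<Gamma>"
    then have t2: "isty \<Gamma> t2 0" and wp2: "tyt \<Gamma> wp2 (arr t1 (W \<cdot> t2))" and e1: "ty S \<Gamma> e1 (Comp M t1 wp1)" "hu S \<Gamma> (Comp M t1 wp1) 0"
      using H(4,6,8) hu_t(2) by blast+
    note t1 = hu_t(1)[OF e1(2)]
    have e2: "ty S (t1 # \<Gamma>) e2 (Comp M (sh t2) (sh wp2 \<cdot> Var 0))" "hu S (t1 # \<Gamma>) (Comp M (sh t2) (sh wp2 \<cdot> Var 0)) 0"
      using H(10) w t1 hu_t(2) by auto blast+
    note h = hu_comp[OF H(1) t2 bnd_star_ty[OF H(2,1) t1 t2 hu_comp_wp[OF H(1) e1(2)] wp2]]
    have "ty S \<Gamma> (Bind M t1 t2 wp1 e1 wp2 e2) (Comp M t2 (apps b [t1, t2, wp1, wp2]))"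
    proof (cases M)
      case Pure
      then have "W = pure_wp_type" "b = pure_bnd_star" using H(1,2) by auto
      then show ?thesis using Y_BindP[OF t1 t2] wp2 e1 e2 h Pure by simp
    next
      case (Usr F)
      then obtain D where D: "eff_of S F = Some D" "b = bnd_star D" "W = wp_type D" using H(1,2) by auto
      note X = wp2[unfolded D] e1[unfolded Usr] e2[unfolded Usr]
      show ?thesis unfolding Usr D by (rule Y_BindF[OF D(1) t1 t2 X(1,2,4,3,5) h[unfolded Usr D] bnd_ty[OF D(1) t1 t2 X]])
    qed
    then show "ty S \<Gamma> (Bind M t1 t2 wp1 e1 wp2 e2) (Comp M t2 (apps b [t1, t2, wp1, wp2])) \<and> (\<exists>k. hu S \<Gamma> (Comp M t2 (apps b [t1, t2, wp1, wp2])) k)" using h by blast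
  qed
next
  case (T_Lift M M' l l_star \<Gamma> e t wp)
  show ?case
  proof
    assume w: "wfc \<Gamma>"
    then have e: "ty S \<Gamma> e (Comp M t wp)" "hu S \<Gamma> (Comp M t wp) 0" using T_Lift(3) hu_t(2) by blast+
    from lift_ty[OF T_Lift(1) e] obtain F D where F: "M' = Usr F" "eff_of S F = Some D" "hu S \<Gamma> (Comp (Usr F) t (l_star \<cdot> t \<cdot> wp)) 0"
      "tyt \<Gamma> (apps l [t, wp, rep M e]) (repr D \<cdot> t \<cdot> (l_star \<cdot> t \<cdot> wp))" by blast
    show "ty S \<Gamma> (Lift M M' t wp e) (Comp M' t (l_star \<cdot> t \<cdot> wp)) \<and> (\<exists>k. hu S \<Gamma> (Comp M' t (l_star \<cdot> t \<cdot> wp)) k)"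
      unfolding F(1) using Y_Lift[OF T_Lift(1)[unfolded F(1)] F(2) e F(3,4)] F(3) by blast
  qed
next
  case (T_Act F a A es \<Gamma>)
  then show ?case using act_ty[OF T_Act(1,2)] by blast
next
  case (T_Reify F D \<Gamma> e t wp)
  then show ?case using Y_Reify[OF T_Reify(1)] H_Tot hu_inv(3) hu_t(2) by (metis option.inject)
next
  case (T_Reflect F D \<Gamma> e t wp i)
  then show ?case using Y_Reflect hu_t(2) by blast
next
  case (T_Run \<Gamma> e t wp)
  then show ?case using Y_Run hu_t(1) H_Tot by blast
next
  case (S_Pi \<Gamma> t t' c' c)
  show ?case
  proof (intro impI)
    assume w: "wfc \<Gamma>" and "\<exists>i. isty \<Gamma> (Pi t' c') i" "\<exists>i. isty \<Gamma> (Pi t c) i"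
    then obtain i j i' j' where 1: "isty \<Gamma> t i" "hu S (t # \<Gamma>) c j" "isty \<Gamma> t' i'" "hu S (t' # \<Gamma>) c' j'" using pi_inv by metis
    have s: "st S \<Gamma> t t'" using S_Pi(2) w 1 by blast
    \<comment> \<open>Well-formedness of \<open>c'\<close> is known over the larger domain and is
      moved to the smaller one by narrowing.\<close>
    have "sc S (t # \<Gamma>) c' c" using S_Pi(4) w 1 narrow[OF s 1(1,3,4)] by auto
    then show "st S \<Gamma> (Pi t' c') (Pi t c)" by (rule ST_Pi[OF 1(1) s])
  qed
next
  case (SC_F F D \<Gamma> t' wp' t wp)
  show ?case
  proof (intro impI)
    assume w: "wfc \<Gamma>" and h: "\<exists>i. hu S \<Gamma> (Comp (Usr F) t' wp') i" "\<exists>i. hu S \<Gamma> (Comp (Usr F) t wp) i"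
    then have "isty \<Gamma> (repr D \<cdot> t' \<cdot> wp') 0" "isty \<Gamma> (repr D \<cdot> t \<cdot> wp) 0" using hu_inv(3) SC_F(1) by fastforce+
    then show "sc S \<Gamma> (Comp (Usr F) t' wp') (Comp (Usr F) t wp)" using SB_F[OF SC_F(1)] SC_F(3) w by blast
  qed
next
  case S_Trans then show ?case using ST_Trans by blast
next
  case SC_Trans then show ?case using SB_Trans by blast
next
  case SC_Tot then show ?case using SB_Tot hu_inv(1) by blast
next
  case SC_Pure then show ?case using SB_Pure hu_t(1) by blast
next
  case T_Sub then show ?case using Y_Sub by blast
qed (simp_all add: ty_hu_st_sc.intros)

end

section \<open>Extension of signatures\<close>

definition ext :: "signature \<Rightarrow> signature \<Rightarrow> bool" where
  "ext S S' \<longleftrightarrow> (\<forall>F D. eff_of S F = Some D \<longrightarrow> eff_of S' F = Some D) \<and>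
     (\<forall>M M' x. lift_of S M M' = Some x \<longrightarrow> lift_of S' M M' = Some x)"

lemma extD:
  assumes "ext S S'"
  shows "eff_of S F = Some D \<Longrightarrow> eff_of S' F = Some D" "lift_of S M M' = Some x \<Longrightarrow> lift_of S' M M' = Some x"
    "act_of S F a = Some A \<Longrightarrow> act_of S' F a = Some A" "wp_type_of S M = Some W \<Longrightarrow> wp_type_of S' M = Some W"
    "ret_star_of S M = Some r \<Longrightarrow> ret_star_of S' M = Some r" "bnd_star_of S M = Some b \<Longrightarrow> bnd_star_of S' M = Some b"
    "rep_type S M t wp = Some R \<Longrightarrow> rep_type S' M t wp = Some R"
proof -
  have E: "\<And>F D. eff_of S F = Some D \<Longrightarrow> eff_of S' F = Some D" and L: "\<And>M M' x. lift_of S M M' = Some x \<Longrightarrow> lift_of S' M M' = Some x"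
    using assms unfolding ext_def by blast+
  show "eff_of S F = Some D \<Longrightarrow> eff_of S' F = Some D" "lift_of S M M' = Some x \<Longrightarrow> lift_of S' M M' = Some x"
    by (fact E, fact L)
  show "act_of S F a = Some A \<Longrightarrow> act_of S' F a = Some A" using E by (auto simp: act_of_def split: option.splits)
  show "wp_type_of S M = Some W \<Longrightarrow> wp_type_of S' M = Some W" "ret_star_of S M = Some r \<Longrightarrow> ret_star_of S' M = Some r"
    "bnd_star_of S M = Some b \<Longrightarrow> bnd_star_of S' M = Some b" "rep_type S M t wp = Some R \<Longrightarrow> rep_type S' M t wp = Some R"
    using E by (cases M; auto)+
qed

lemma ext_red: "red S e e' \<Longrightarrow> ext S S' \<Longrightarrow> red S' e e'"
  by (induct rule: red.induct) (blast intro: red.intros dest: extD)+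

lemma ext_reds: "reds S e e' \<Longrightarrow> ext S S' \<Longrightarrow> reds S' e e'"
  by (induct rule: rtranclp_induct) (auto dest: ext_red intro: rtranclp.rtrancl_into_rtrancl)

lemma ext_typing:
  assumes E: "ext S S'"
  shows "typing S \<Gamma> e c \<Longrightarrow> typing S' \<Gamma> e c"
    "has_univ S \<Gamma> c i \<Longrightarrow> has_univ S' \<Gamma> c i"
    "subtype S \<Gamma> X Y \<Longrightarrow> subtype S' \<Gamma> X Y"
    "subcomp S \<Gamma> c1 c2 \<Longrightarrow> subcomp S' \<Gamma> c1 c2"
    "valid S \<Gamma> \<phi> \<Longrightarrow> valid S' \<Gamma> \<phi>"
  by (induct rule: typing_has_univ_subtype_subcomp_valid.inducts)
    (rule typing_has_univ_subtype_subcomp_valid.intros; (assumption | erule extD[OF E] | erule ext_reds[OF _ E] | (simp; fail)))+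

lemma ext_ty:
  assumes E: "ext S S'"
  shows "ty S \<Gamma> e c \<Longrightarrow> ty S' \<Gamma> e c"
    "hu S \<Gamma> c i \<Longrightarrow> hu S' \<Gamma> c i"
    "st S \<Gamma> X Y \<Longrightarrow> st S' \<Gamma> X Y"
    "sc S \<Gamma> c1 c2 \<Longrightarrow> sc S' \<Gamma> c1 c2"
  by (induct rule: ty_hu_st_sc.inducts)
    (rule ty_hu_st_sc.intros; (assumption | erule extD[OF E] | erule ext_reds[OF _ E] | erule ext_typing(5)[OF E] | (auto; fail)))+

lemma ext_wt: "ext S S' \<Longrightarrow> wt S x T \<Longrightarrow> wt S' x T"
  unfolding wt_def using ext_ty(1) by blast

lemma ext_eff_typed: "ext S S' \<Longrightarrow> eff_typed S D \<Longrightarrow> eff_typed S' D"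
  unfolding eff_typed_def using ext_wt by blast

lemma ext_act_typed: assumes "ext S S'" shows "act_typed S F D A \<Longrightarrow> act_typed S' F D A"
  unfolding act_typed_def using ext_ty(1)[OF assms] ext_wt[OF assms] by meson

lemma ext_lift_typed: assumes "ext S S'" shows "lift_typed S M M' l ls \<Longrightarrow> lift_typed S' M M' l ls"
  unfolding lift_typed_def using extD(4,7)[OF assms] ext_wt[OF assms] by meson

lemma wt_closed: "wt S x T \<Longrightarrow> closed x"
  unfolding wt_def using ty_scoped(1)[of S "[]" x "Tot T"] by simp

lemma sig_typed_closed: assumes "sig_typed S" shows "closed_sig S"
  unfolding closed_sig_def
proof (intro conjI allI impI)
  fix F D assume "eff_of S F = Some D"
  then have "eff_typed S D" using assms unfolding sig_typed_def by blast
  then show "closed (wp_type D)" "closed (repr D)" "closed (ret D)" "closed (ret_star D)" "closed (bnd D)" "closed (bnd_star D)"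
    unfolding eff_typed_def using wt_closed by blast+
next
  fix M M' l l' assume "lift_of S M M' = Some (l, l')"
  then have "lift_typed S M M' l l'" using assms unfolding sig_typed_def by blast
  then show "closed l" "closed l'" unfolding lift_typed_def using wt_closed by blast+
next
  fix F a A assume A: "act_of S F a = Some A"
  then obtain D where "eff_of S F = Some D" by (auto simp: act_of_def split: option.splits)
  then have T: "act_typed S F D A" using assms A unfolding sig_typed_def by blast
  then show "closed (act_impl A)" unfolding act_typed_def using wt_closed by blast
  fix i assume i: "i < length (act_params A)"
  then obtain j where "ty S (rev (take i (act_params A))) (act_params A ! i) (Tot (Ty j))" using T unfolding act_typed_def by blast
  from ty_scoped(1)[OF this] show "scoped i (act_params A ! i)" using i by simp
next
  fix F a A assume A: "act_of S F a = Some A"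
  then obtain D where "eff_of S F = Some D" by (auto simp: act_of_def split: option.splits)
  then have "act_typed S F D A" using assms A unfolding sig_typed_def by blast
  then obtain t wp where c: "act_comp A = Comp (Usr F) t wp" "ty S (rev (act_params A)) t (Tot (Ty 0))" "ty S (rev (act_params A)) wp (Tot (wp_type D \<cdot> t))"
    unfolding act_typed_def by blast
  from ty_scoped(1)[OF c(2)] ty_scoped(1)[OF c(3)] show "scopedc (length (act_params A)) (act_comp A)"
    by (simp add: c(1) scoped_binders)
qed

context sigt begin

lemma wt_orig: assumes "typing S [] x (Tot T)" shows "wt S x T"
  using ty_of_orig(1)[OF assms] hu_inv(1) unfolding wt_def by auto

lemma eff_typed_orig: "wf_effdef S F D \<Longrightarrow> eff_typed S D"
  unfolding wf_effdef_def eff_typed_def using wt_orig by blast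

lemma act_typed_orig: assumes "wf_action S F D A" shows "act_typed S F D A"
proof -
  let ?P = "act_params A"
  from assms obtain t wp where P: "\<forall>i<length ?P. \<exists>j. typing S (rev (take i ?P)) (?P ! i) (Tot (Ty j))"
    and c: "act_comp A = Comp (Usr F) t wp" and t: "typing S (rev ?P) t (Tot (Ty 0))" and wp: "typing S (rev ?P) wp (Tot (wp_type D \<cdot> t))"
    and impl: "typing S [] (act_impl A) (Tot (pis ?P (repr D \<cdot> t \<cdot> wp)))" unfolding wf_action_def by blast
  have w: "i \<le> length ?P \<Longrightarrow> wfc (rev (take i ?P))" for i
  proof (induct i)
    case (Suc i)
    then obtain j where "typing S (rev (take i ?P)) (?P ! i) (Tot (Ty j))" using P Suc_le_eq by blast
    then show ?case using ty_of_orig(1) Suc by (auto simp: take_Suc_conv_app_nth)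
  qed simp
  have "isty (rev ?P) t 0" "tyt (rev ?P) wp (wp_type D \<cdot> t)" using ty_of_orig(1)[OF t] ty_of_orig(1)[OF wp] w[of "length ?P"] by simp_all
  moreover have "\<forall>i<length ?P. \<exists>j. isty (rev (take i ?P)) (?P ! i) j" using P w ty_of_orig(1) by (meson less_imp_le)
  ultimately show ?thesis unfolding act_typed_def using c wt_orig[OF impl] by blast
qed

lemma lift_typed_orig: "wf_lift S M M' l ls \<Longrightarrow> lift_typed S M M' l ls"
  unfolding wf_lift_def lift_typed_def using wt_orig by blast

end

text \<open>A new item is typed in the preceding signature, where the induction hypothesis makes the
  translation to \<open>ty\<close> available. The result and the typing of the older fields are then
  carried over to the extended signature.\<close>

lemma sigt_wf: "wf_sig S \<Longrightarrow> sigt S"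
proof (induct rule: wf_sig.induct)
  case wf_Nil
  have "sig_typed []" by (simp add: sig_typed_def)
  then show ?case by (simp add: sigt_def sigc_def sigt_axioms_def sig_typed_closed)
next
  case (wf_EffDef S F D)
  let ?S = "EffDef F D # S"
  interpret sigt S by fact
  have E: "ext S ?S" using wf_EffDef(3) by (auto simp: ext_def)
  have "eff_typed ?S D'" if "eff_of ?S G = Some D'" for G D'
    using that ext_eff_typed[OF E] eff_typed_orig[OF wf_EffDef(4)] sty by (auto simp: sig_typed_def split: if_splits)
  moreover have "act_typed ?S G D' A" if "eff_of ?S G = Some D'" "act_of ?S G a = Some A" for G D' a A
  proof (cases "G = F")
    case True
    then have "(a, A) \<in> set (acts D)" "D' = D" using that by (auto simp: act_of_def dest: map_of_SomeD)
    then have "wf_action S F D A" using wf_EffDef(4) unfolding wf_effdef_def by blast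
    then show ?thesis using ext_act_typed[OF E] act_typed_orig True \<open>D' = D\<close> by blast
  next
    case False
    then have "eff_of S G = Some D'" "act_of S G a = Some A" using that by (auto simp: act_of_def)
    then show ?thesis using ext_act_typed[OF E] sty unfolding sig_typed_def by blast
  qed
  moreover have "lift_typed ?S M M' l ls" if "lift_of ?S M M' = Some (l, ls)" for M M' l ls
    using that ext_lift_typed[OF E] sty by (auto simp: sig_typed_def)
  ultimately have "sig_typed ?S" unfolding sig_typed_def by blast
  then show ?case by (simp add: sigt_def sigc_def sigt_axioms_def sig_typed_closed)
next
  case (wf_LiftDef S M M' l l_star)
  let ?S = "LiftDef M M' l l_star # S"
  interpret sigt S by fact
  have E: "ext S ?S" using wf_LiftDef(3) by (auto simp: ext_def)
  have "eff_typed ?S D'" if "eff_of ?S G = Some D'" for G D'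
    using that ext_eff_typed[OF E] sty by (auto simp: sig_typed_def)
  moreover have "act_typed ?S G D' A" if "eff_of ?S G = Some D'" "act_of ?S G a = Some A" for G D' a A
    using that ext_act_typed[OF E] sty by (auto simp: sig_typed_def act_of_def)
  moreover have "lift_typed ?S N N' k ks" if "lift_of ?S N N' = Some (k, ks)" for N N' k ks
    using that ext_lift_typed[OF E] lift_typed_orig[OF wf_LiftDef(4)] sty by (auto simp: sig_typed_def split: if_splits)
  ultimately have "sig_typed ?S" unfolding sig_typed_def by blast
  then show ?case by (simp add: sigt_def sigc_def sigt_axioms_def sig_typed_closed)
qed

section \<open>Total correctness\<close>

context sigt begin

lemma pure_normalizes:
  assumes x: "ty S [] x (Comp Pure t w)"
  shows "\<exists>t' v. reds S x (Return Pure t' v) \<and> is_value S v \<and> ty S [] (Return Pure t' v) (Comp Pure t w)"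
proof -
  have w: "wfc []" by simp
  obtain y where y: "reds S x y" "is_value S y" using SN_nf[OF ty_SN[OF w x]] by blast
  note ty = ty_reds[OF w x y(1)]
  obtain n R where "LC n [] (Comp Pure t w) R" "(x, x) \<in> R" using sem_ex[OF fundamental(1)[OF w x] G_id[OF w]] by auto
  with LR_inv(6) obtain R0 where "(x, x) \<in> posR (Qpure R0) [] (Comp Pure t w)" by blast
  then have "stuck y \<or> Qpure R0 y y" using y unfolding posR_def fin_def by blast
  moreover have "\<not> stuck y" using stuck_not_closed ty_scoped(1)[OF ty] by auto
  ultimately obtain t' v where v: "y = Return Pure t' v" using Qpure_ex by blast
  \<comment> \<open>Reduction takes place below \<open>Return\<close>, so a step of \<open>v\<close>
    would be one of the normal form \<open>y\<close>.\<close>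
  then have "is_value S v" using y(2) E_Return[of S v _ Pure t'] unfolding is_value_def by blast
  then show ?thesis using y(1) ty v by blast
qed

text \<open>The representation type is headed by the redex \<open>st_repr s\<close> at
  \<open>t\<close>. As typing is preserved by reduction, the function type from states to which it
  unfolds is well formed, and the application can be typed at it.\<close>

lemma reify_state_ty:
  assumes st: "eff_of S F = Some (state_effect F s)" and e: "ty S [] e (Comp (Usr F) t wp)" "hu S [] (Comp (Usr F) t wp) 0"
    and s: "isty [] s i" and s0: "tyt [] s0 s"
  shows "ty S [] (Reify e \<cdot> s0) (Comp Pure (tprod t s) (wp \<cdot> s0))"
proof -
  let ?P = "Pi s (Comp Pure (tprod (sh t) s) (sh wp \<cdot> Var 0))"
  have cs: "closed s" using ty_scoped(1)[OF s] by simp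
  note cl = closed_sub[OF cs] closed_ren[OF cs]
  have r: "isty [] (st_repr s \<cdot> t \<cdot> wp) 0" using hu_inv(3)[OF e(2)] st by (simp add: state_effect_def)
  have "reds S (st_repr s) (sub Var (st_repr s))" by simp
  from reds_beta_sub[OF reds_beta_sub[OF this[unfolded st_repr_def]], of t wp]
  have red: "reds S (st_repr s \<cdot> t \<cdot> wp) ?P" by (simp add: st_repr_def cl numeral_eq_Suc)
  have P: "isty [] ?P 0" by (rule ty_reds[OF _ r red]) simp
  from Y_Reify[OF st e] have "tyt [] (Reify e) (st_repr s \<cdot> t \<cdot> wp)" by (simp add: state_effect_def)
  from ty_conv[OF this cv_red[OF r P red]] have f: "tyt [] (Reify e) ?P" .
  from pi_inv[OF P] obtain i j where "isty [] s i" "hu S [s] (Comp Pure (tprod (sh t) s) (sh wp \<cdot> Var 0)) j" by blast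
  from Y_App[OF f s0 this] show ?thesis by (simp add: instc_def cl sub_ren)
qed

end

theorem corollary4:
  fixes S :: signature and ST :: ename and s e t wp :: tm
  assumes cic_sn: cic_strongly_normalizing
    and wf: "wf_sig S"
    and st: "eff_of S ST = Some (state_effect ST s)"
    and e: "typing S [] e (Comp (Usr ST) t wp)"
  shows "\<forall>p s0. typing S [] s0 (Tot s) \<longrightarrow>
           typing S [] p (Tot (arr (tprod t s) (Ty 0))) \<longrightarrow>
           valid S [] (wp \<cdot> s0 \<cdot> p) \<longrightarrow>
           (\<exists>v. is_value S v \<and> reds S (Run (Reify e \<cdot> s0)) v \<and> valid S [] (p \<cdot> v))"
proof (intro allI impI)
  fix p s0
  assume s0: "typing S [] s0 (Tot s)" and p: "typing S [] p (Tot (arr (tprod t s) (Ty 0)))" and wp: "valid S [] (wp \<cdot> s0 \<cdot> p)"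
  interpret sigt S by (rule sigt_wf[OF wf])
  have e': "ty S [] e (Comp (Usr ST) t wp)" "hu S [] (Comp (Usr ST) t wp) 0" using ty_of_orig(1)[OF e] hu_t(2) wfc.simps(1) by blast+
  obtain i where s: "ty S [] s0 (Tot s)" "ty S [] s (Tot (Ty i))" using ty_of_orig(1)[OF s0] hu_inv(1) by auto
  have p': "ty S [] p (Tot (arr (tprod t s) (Ty 0)))" using ty_of_orig(1)[OF p] by simp
  from pure_normalizes[OF reify_state_ty[OF st e' s(2,1)]] obtain t' v
    where v: "reds S (Reify e \<cdot> s0) (Return Pure t' v)" "is_value S v" "ty S [] (Return Pure t' v) (Comp Pure (tprod t s) (wp \<cdot> s0))" by blast
  have "reds S (Run (Reify e \<cdot> s0)) v" using reds_snoc[OF reds_Run[OF v(1)] R_RunReturn] .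
  then show "\<exists>v. is_value S v \<and> reds S (Run (Reify e \<cdot> s0)) v \<and> valid S [] (p \<cdot> v)" using v(2) ret_inv[OF v(3) p' wp] by blast
qed

end
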